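(* Let $k$ be an algebraically closed field of characteristic $p>0$, let $S=k[[x_1,\dots,x_n]]$, let $G$ be a finite group scheme over $k$ acting on $\operatorname{Spec} S$ such that the action is free in codimension one, and let $R:=S^G\subseteq S$ be the invariant subring. Let $H:=H^0(G,\mathcal{O}_G)^*$ be the dual Hopf algebra of $H^0(G,\mathcal{O}_G)$. Then there exists a skew group scheme ring $S*G=S\#H$, and the natural homomorphism $S*G\to \operatorname{End}_R(S)$ is an isomorphism of (usually non-commutative) $R$-algebras.
   Context: Free in codimension one: there is a Zariski-closed subset $Z\subset \operatorname{Spec} S$ of codimension at least two such that, with $V:=\operatorname{Spec} S\setminus Z$, $\pi:\operatorname{Spec} S\to\operatorname{Spec} R$ the quotient morphism and $U:=\operatorname{Spec} R\setminus \pi(Z)$, the action restricts to an action of $G$ on $V$ and the morphism $V\times_{\operatorname{Spec} k} G\to V\times_U V$, $(v,g)\mapsto (v,gv)$, is an isomorphism. Skew group scheme ring: the $G$-action corresponds to a coaction of the Hopf algebra $H^0(G,\mathcal{O}_G)$ on $S$, i.e. $S$ is a right $H^*$-comodule algebra, equivalently a left $H$-module algebra for $H=H^0(G,\mathcal{O}_G)^*$. Then $S*G:=S\#H$ is the associated smash product algebra: the $k$-vector space $S\otimes_k H$ with multiplication $(s\#h)(t\#g)=\sum s\,(h_{(1)}\cdot t)\#h_{(2)}g$ (Sweedler notation). The natural homomorphism $S*G\to\operatorname{End}_R(S)$ is obtained by combining the multiplication map $S\to\operatorname{End}_R(S)$ with the action map $H\to\operatorname{End}_R(S)$, i.e. $s\#h\mapsto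 (t\mapsto s\,(h\cdot t))$. *)

theory Defs
  imports
    "HOL-Algebra.Algebra"
    "HOL-Algebra.Free_Abelian_Groups"
    "HOL-Algebra.Algebraic_Closure"
    "HOL-Analysis.Abstract_Topology"
    "HOL-Library.Extended_Nat"
begin

section \<open>Modules and algebras\<close>

text \<open>The library locale \<^locale>\<open>algebra\<close> is about commutative algebras; the smash product and the
  endomorphism ring are not commutative.\<close>

locale assoc_algebra = module + ring M +
  assumes smult_mult_left:
      "\<lbrakk>a \<in> carrier R; x \<in> carrier M; y \<in> carrier M\<rbrakk> \<Longrightarrow>
       (a \<odot>\<^bsub>M\<^esub> x) \<otimes>\<^bsub>M\<^esub> y = a \<odot>\<^bsub>M\<^esub> (x \<otimes>\<^bsub>M\<^esub> y)"
    and smult_mult_right: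
      "\<lbrakk>a \<in> carrier R; x \<in> carrier M; y \<in> carrier M\<rbrakk> \<Longrightarrow>
       x \<otimes>\<^bsub>M\<^esub> (a \<odot>\<^bsub>M\<^esub> y) = a \<odot>\<^bsub>M\<^esub> (x \<otimes>\<^bsub>M\<^esub> y)"

definition linear_maps ::
    "('r, 'c) ring_scheme \<Rightarrow> ('r, 'm, 'd) module_scheme \<Rightarrow> ('r, 'n, 'e) module_scheme \<Rightarrow> ('m \<Rightarrow> 'n) set" where
  "linear_maps R M N =
     {f \<in> carrier M \<rightarrow> carrier N.
        (\<forall>x\<in>carrier M. \<forall>y\<in>carrier M. f (x \<oplus>\<^bsub>M\<^esub> y) = f x \<oplus>\<^bsub>N\<^esub> f y) \<and>
        (\<forall>r\<in>carrier R. \<forall>x\<in>carrier M. f (r \<odot>\<^bsub>M\<^esub> x) = r \<odot>\<^bsub>N\<^esub> f x)}"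

definition algebra_homs ::
    "('r, 'c) ring_scheme \<Rightarrow> ('r, 'm, 'd) module_scheme \<Rightarrow> ('r, 'n, 'e) module_scheme \<Rightarrow> ('m \<Rightarrow> 'n) set" where
  "algebra_homs R M N = linear_maps R M N \<inter> ring_hom M N"

definition algebra_isos ::
    "('r, 'c) ring_scheme \<Rightarrow> ('r, 'm, 'd) module_scheme \<Rightarrow> ('r, 'n, 'e) module_scheme \<Rightarrow> ('m \<Rightarrow> 'n) set" where
  "algebra_isos R M N = linear_maps R M N \<inter> ring_iso M N"

text \<open>A ring as a module over itself or over one of its subrings.\<close>

definition regular :: "('a, 'c) ring_scheme \<Rightarrow> ('a, 'a) module" where
  "regular R = \<lparr>carrier = carrier R, monoid.mult = monoid.mult R, one = \<one>\<^bsub>R\<^esub>,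
                ring.zero = \<zero>\<^bsub>R\<^esub>, ring.add = add R, smult = monoid.mult R\<rparr>"

definition End_algebra :: "('r, 'c) ring_scheme \<Rightarrow> ('r, 'm, 'd) module_scheme \<Rightarrow> ('r, 'm \<Rightarrow> 'm) module" where
  "End_algebra R M =
     \<lparr>carrier = linear_maps R M M \<inter> extensional (carrier M),
      monoid.mult = (\<lambda>f g. compose (carrier M) f g),
      one = (\<lambda>x\<in>carrier M. x),
      ring.zero = (\<lambda>x\<in>carrier M. \<zero>\<^bsub>M\<^esub>),
      ring.add = (\<lambda>f g. \<lambda>x\<in>carrier M. f x \<oplus>\<^bsub>M\<^esub> g x),
      smult = (\<lambda>r f. \<lambda>x\<in>carrier M. r \<odot>\<^bsub>M\<^esub> f x)\<rparr>"

definition finite_dimensional :: "('k, 'c) ring_scheme \<Rightarrow> ('k, 'm, 'd) module_scheme \<Rightarrow> bool" where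
  "finite_dimensional K M \<longleftrightarrow>
     (\<exists>B. finite B \<and> B \<subseteq> carrier M \<and>
        (\<forall>x\<in>carrier M. \<exists>c \<in> B \<rightarrow> carrier K. x = (\<Oplus>\<^bsub>M\<^esub>b\<in>B. c b \<odot>\<^bsub>M\<^esub> b)))"


section \<open>Tensor products\<close>

text \<open>The tensor product over a commutative ring is the free abelian group on the pairs, modulo the
  usual relations; its elements are cosets of formal sums.\<close>

definition tensor_rels ::
    "('r, 'c) ring_scheme \<Rightarrow> ('r, 'm, 'd) module_scheme \<Rightarrow> ('r, 'n, 'e) module_scheme \<Rightarrow> ('m \<times> 'n \<Rightarrow>\<^sub>0 int) set" where
  "tensor_rels R M N =
     {frag_of (x \<oplus>\<^bsub>M\<^esub> x', y) - frag_of (x, y) - frag_of (x', y) | x x' y.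
        x \<in> carrier M \<and> x' \<in> carrier M \<and> y \<in> carrier N} \<union>
     {frag_of (x, y \<oplus>\<^bsub>N\<^esub> y') - frag_of (x, y) - frag_of (x, y') | x y y'.
        x \<in> carrier M \<and> y \<in> carrier N \<and> y' \<in> carrier N} \<union>
     {frag_of (r \<odot>\<^bsub>M\<^esub> x, y) - frag_of (x, r \<odot>\<^bsub>N\<^esub> y) | r x y.
        r \<in> carrier R \<and> x \<in> carrier M \<and> y \<in> carrier N}"

definition tensor_kernel ::
    "('r, 'c) ring_scheme \<Rightarrow> ('r, 'm, 'd) module_scheme \<Rightarrow> ('r, 'n, 'e) module_scheme \<Rightarrow> ('m \<times> 'n \<Rightarrow>\<^sub>0 int) set" where
  "tensor_kernel R M N =
     generate (free_Abelian_group (carrier M \<times> carrier N)) (tensor_rels R M N)"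

definition tensor_group ::
    "('r, 'c) ring_scheme \<Rightarrow> ('r, 'm, 'd) module_scheme \<Rightarrow> ('r, 'n, 'e) module_scheme \<Rightarrow> ('m \<times> 'n \<Rightarrow>\<^sub>0 int) set monoid" where
  "tensor_group R M N = free_Abelian_group (carrier M \<times> carrier N) Mod tensor_kernel R M N"

definition pure_tensor ::
    "('r, 'c) ring_scheme \<Rightarrow> ('r, 'm, 'd) module_scheme \<Rightarrow> ('r, 'n, 'e) module_scheme \<Rightarrow> 'm \<Rightarrow> 'n \<Rightarrow> ('m \<times> 'n \<Rightarrow>\<^sub>0 int) set" where
  "pure_tensor R M N x y =
     tensor_kernel R M N #>\<^bsub>free_Abelian_group (carrier M \<times> carrier N)\<^esub> frag_of (x, y)"

text \<open>The homomorphism into the abelian group \<open>G\<close> (written multiplicatively) that sends the class of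
  \<open>\<Sum>\<^sub>i n\<^sub>i (x\<^sub>i, y\<^sub>i)\<close> to the combination of the \<open>b x\<^sub>i y\<^sub>i\<close> with multiplicities \<open>n\<^sub>i\<close>. It is independent of
  the chosen representative when \<open>b\<close> is biadditive and balanced; see \<open>tensor_lift_class\<close> below.\<close>

definition tensor_lift ::
    "('g, 'c) monoid_scheme \<Rightarrow> ('m \<Rightarrow> 'n \<Rightarrow> 'g) \<Rightarrow> ('m \<times> 'n \<Rightarrow>\<^sub>0 int) set \<Rightarrow> 'g" where
  "tensor_lift G b z =
     (let c = (SOME c. c \<in> z) in
      finprod G (\<lambda>(x, y). b x y [^]\<^bsub>G\<^esub> Poly_Mapping.lookup c (x, y)) (Poly_Mapping.keys c))"

lemma tensor_lift_class:
  assumes "comm_group G" and "abelian_group M" and "abelian_group N"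
    and smult: "\<And>r x. \<lbrakk>r \<in> carrier R; x \<in> carrier M\<rbrakk> \<Longrightarrow> r \<odot>\<^bsub>M\<^esub> x \<in> carrier M"
      "\<And>r y. \<lbrakk>r \<in> carrier R; y \<in> carrier N\<rbrakk> \<Longrightarrow> r \<odot>\<^bsub>N\<^esub> y \<in> carrier N"
    and closed: "\<And>x y. \<lbrakk>x \<in> carrier M; y \<in> carrier N\<rbrakk> \<Longrightarrow> b x y \<in> carrier G"
    and add_left: "\<And>x x' y. \<lbrakk>x \<in> carrier M; x' \<in> carrier M; y \<in> carrier N\<rbrakk> \<Longrightarrow>
          b (x \<oplus>\<^bsub>M\<^esub> x') y = b x y \<otimes>\<^bsub>G\<^esub> b x' y"
    and add_right: "\<And>x y y'. \<lbrakk>x \<in> carrier M; y \<in> carrier N; y' \<in> carrier N\<rbrakk> \<Longrightarrow>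
          b x (y \<oplus>\<^bsub>N\<^esub> y') = b x y \<otimes>\<^bsub>G\<^esub> b x y'"
    and balanced: "\<And>r x y. \<lbrakk>r \<in> carrier R; x \<in> carrier M; y \<in> carrier N\<rbrakk> \<Longrightarrow>
          b (r \<odot>\<^bsub>M\<^esub> x) y = b x (r \<odot>\<^bsub>N\<^esub> y)"
    and c: "c \<in> carrier (free_Abelian_group (carrier M \<times> carrier N))"
  shows "tensor_lift G b (tensor_kernel R M N #>\<^bsub>free_Abelian_group (carrier M \<times> carrier N)\<^esub> c)
         = finprod G (\<lambda>(x, y). b x y [^]\<^bsub>G\<^esub> Poly_Mapping.lookup c (x, y)) (Poly_Mapping.keys c)"
proof -
  interpret G: comm_group G by fact
  interpret M: abelian_group M by fact
  interpret N: abelian_group N by fact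
  let ?B = "carrier M \<times> carrier N"
  let ?F = "free_Abelian_group ?B"
  define f where "f = (\<lambda>(x, y). b x y)"
  define \<Phi> where "\<Phi> = (\<lambda>c :: _ \<Rightarrow>\<^sub>0 int. finprod G (\<lambda>p. f p [^]\<^bsub>G\<^esub> Poly_Mapping.lookup c p) (Poly_Mapping.keys c))"
  have f: "f p \<in> carrier G" if "p \<in> ?B" for p using that closed by (auto simp: f_def)
  have \<Phi>_ext: "\<Phi> u = finprod G (\<lambda>p. f p [^]\<^bsub>G\<^esub> Poly_Mapping.lookup u p) L"
    if "Poly_Mapping.keys u \<subseteq> L" "finite L" "L \<subseteq> ?B" for u L
    unfolding \<Phi>_def
    by (rule G.finprod_mono_neutral_cong_left)
       (use that f in \<open>auto simp: in_keys_iff simp del: mem_Times_iff split_paired_All\<close>)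
  have \<Phi>_closed: "\<Phi> u \<in> carrier G" if "Poly_Mapping.keys u \<subseteq> ?B" for u
    unfolding \<Phi>_def by (rule G.finprod_closed) (use that f in \<open>auto intro!: G.int_pow_closed simp del: mem_Times_iff\<close>)
  have \<Phi>_add: "\<Phi> (u + v) = \<Phi> u \<otimes>\<^bsub>G\<^esub> \<Phi> v"
    if "Poly_Mapping.keys u \<subseteq> ?B" "Poly_Mapping.keys v \<subseteq> ?B" for u v
  proof -
    let ?L = "Poly_Mapping.keys u \<union> Poly_Mapping.keys v"
    have L: "finite ?L" "?L \<subseteq> ?B" "Poly_Mapping.keys (u + v) \<subseteq> ?L"
      using that keys_add[of u v] by auto
    have "\<Phi> (u + v) = finprod G (\<lambda>p. f p [^]\<^bsub>G\<^esub> Poly_Mapping.lookup u p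
                         \<otimes>\<^bsub>G\<^esub> f p [^]\<^bsub>G\<^esub> Poly_Mapping.lookup v p) ?L"
      unfolding \<Phi>_ext[OF L(3,1,2)]
      by (rule G.finprod_cong')
         (use L(2) f in \<open>auto simp: lookup_add Pi_iff subset_iff G.int_pow_closed G.int_pow_mult\<close>)
    also have "\<dots> = \<Phi> u \<otimes>\<^bsub>G\<^esub> \<Phi> v"
      by (subst G.finprod_multf)
         (use L(2) f \<Phi>_ext[of u ?L] \<Phi>_ext[of v ?L] L in \<open>auto simp: Pi_iff subset_iff intro!: G.int_pow_closed\<close>)
    finally show ?thesis .
  qed
  have \<Phi>_frag: "\<Phi> (frag_of p) = f p" if "p \<in> ?B" for p
    using f[OF that] by (simp add: \<Phi>_def G.finprod_singleton[where i=p] G.int_pow_1)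
  have "\<Phi> \<in> hom ?F G" by (auto simp: hom_def \<Phi>_closed \<Phi>_add)
  then interpret \<Phi>: group_hom ?F G \<Phi>
    by (simp add: group_hom_def group_hom_axioms_def)
  have \<Phi>_diff: "\<Phi> (u - v) = \<Phi> u \<otimes>\<^bsub>G\<^esub> inv\<^bsub>G\<^esub> \<Phi> v"
    if "Poly_Mapping.keys u \<subseteq> ?B" "Poly_Mapping.keys v \<subseteq> ?B" for u v
    using \<Phi>_add[of u "- v"] \<Phi>.hom_inv[of v] that by simp
  have rels: "u \<in> carrier ?F \<and> \<Phi> u = \<one>\<^bsub>G\<^esub>" if "u \<in> tensor_rels R M N" for u
  proof -
    have *: "Poly_Mapping.keys (frag_of p - frag_of q) \<subseteq> ?B" if "p \<in> ?B" "q \<in> ?B" for p q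
      using that keys_diff[of "frag_of p" "frag_of q"] by auto
    have **: "Poly_Mapping.keys (frag_of p - frag_of q - frag_of r) \<subseteq> ?B"
      if "p \<in> ?B" "q \<in> ?B" "r \<in> ?B" for p q r
      using that *[of p q] keys_diff[of "frag_of p - frag_of q" "frag_of r"] by auto
    have 3: "\<Phi> (frag_of p - frag_of q - frag_of r) = \<one>\<^bsub>G\<^esub>"
      if "p \<in> ?B" "q \<in> ?B" "r \<in> ?B" "f p = f q \<otimes>\<^bsub>G\<^esub> f r" for p q r
    proof -
      have "\<Phi> (frag_of p - frag_of q - frag_of r)
            = (f q \<otimes>\<^bsub>G\<^esub> f r) \<otimes>\<^bsub>G\<^esub> inv\<^bsub>G\<^esub> f q \<otimes>\<^bsub>G\<^esub> inv\<^bsub>G\<^esub> f r"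
        using that *[of p q] by (simp add: \<Phi>_diff \<Phi>_frag)
      also have "\<dots> = \<one>\<^bsub>G\<^esub>"
        using f[OF that(2)] f[OF that(3)] by (simp add: G.m_comm[of "f q" "f r"] G.m_assoc)
      finally show ?thesis .
    qed
    have 2: "\<Phi> (frag_of p - frag_of q) = \<one>\<^bsub>G\<^esub>" if "p \<in> ?B" "q \<in> ?B" "f p = f q" for p q
      using that f[OF that(2)] by (simp add: \<Phi>_diff \<Phi>_frag)
    show ?thesis
      using that unfolding tensor_rels_def
      by (elim UnE CollectE exE conjE)
         ((hypsubst, ((rule conjI[OF _ 3] | rule conjI[OF _ 2]);
            simp add: f_def add_left add_right balanced smult * **))+)
  qed
  have kernel: "u \<in> carrier ?F \<and> \<Phi> u = \<one>\<^bsub>G\<^esub>" if "u \<in> tensor_kernel R M N" for u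
    using that unfolding tensor_kernel_def
  proof induction
    case one then show ?case using \<Phi>.hom_one by simp
  next
    case (incl h) then show ?case by (rule rels)
  next
    case (inv h)
    then have "h \<in> carrier ?F" "\<Phi> h = \<one>\<^bsub>G\<^esub>" using rels by auto
    then show ?case using \<Phi>.hom_inv[of h] by (simp del: carrier_free_Abelian_group_iff inv_free_Abelian_group)
  next
    case (eng h1 h2) then show ?case
      using \<Phi>.hom_mult[of h1 h2] \<Phi>.m_closed by (metis G.r_one G.one_closed)
  qed
  let ?z = "tensor_kernel R M N #>\<^bsub>?F\<^esub> c"
  have const: "\<Phi> d = \<Phi> c" if d: "d \<in> ?z" for d
  proof -
    obtain u where u: "u \<in> tensor_kernel R M N" "d = u + c" using d by (auto simp: r_coset_def)
    then show ?thesis using kernel[OF u(1)] \<Phi>_add[of u c] c \<Phi>_closed[of c] by simp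
  qed
  have "c \<in> ?z"
    using generate.one[of ?F "tensor_rels R M N"] by (force simp: r_coset_def tensor_kernel_def)
  then have "(SOME d. d \<in> ?z) \<in> ?z" by (rule someI)
  from const[OF this] show ?thesis
    by (simp add: tensor_lift_def \<Phi>_def f_def Let_def split_def)
qed

lemma tensor_lift_pure:
  assumes "comm_group G" and "abelian_group M" and "abelian_group N"
    and "\<And>r x. \<lbrakk>r \<in> carrier R; x \<in> carrier M\<rbrakk> \<Longrightarrow> r \<odot>\<^bsub>M\<^esub> x \<in> carrier M"
      "\<And>r y. \<lbrakk>r \<in> carrier R; y \<in> carrier N\<rbrakk> \<Longrightarrow> r \<odot>\<^bsub>N\<^esub> y \<in> carrier N"
    and closed: "\<And>x y. \<lbrakk>x \<in> carrier M; y \<in> carrier N\<rbrakk> \<Longrightarrow> b x y \<in> carrier G"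
    and "\<And>x x' y. \<lbrakk>x \<in> carrier M; x' \<in> carrier M; y \<in> carrier N\<rbrakk> \<Longrightarrow>
          b (x \<oplus>\<^bsub>M\<^esub> x') y = b x y \<otimes>\<^bsub>G\<^esub> b x' y"
    and "\<And>x y y'. \<lbrakk>x \<in> carrier M; y \<in> carrier N; y' \<in> carrier N\<rbrakk> \<Longrightarrow>
          b x (y \<oplus>\<^bsub>N\<^esub> y') = b x y \<otimes>\<^bsub>G\<^esub> b x y'"
    and "\<And>r x y. \<lbrakk>r \<in> carrier R; x \<in> carrier M; y \<in> carrier N\<rbrakk> \<Longrightarrow>
          b (r \<odot>\<^bsub>M\<^esub> x) y = b x (r \<odot>\<^bsub>N\<^esub> y)"
    and xy: "x \<in> carrier M" "y \<in> carrier N"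
  shows "tensor_lift G b (pure_tensor R M N x y) = b x y"
proof -
  interpret G: comm_group G by fact
  have "tensor_lift G b (pure_tensor R M N x y)
        = finprod G (\<lambda>(u, v). b u v [^]\<^bsub>G\<^esub> Poly_Mapping.lookup (frag_of (x, y)) (u, v))
            (Poly_Mapping.keys (frag_of (x, y)))"
    unfolding pure_tensor_def by (rule tensor_lift_class) (use assms in auto)
  then show ?thesis
    using closed[OF xy] by (simp add: G.finprod_singleton G.int_pow_1)
qed

text \<open>The multiplication is the one of the tensor product of two algebras,
  \<open>(x \<otimes> y)(x' \<otimes> y') = xx' \<otimes> yy'\<close>.\<close>

definition tensor ::
    "('r, 'c) ring_scheme \<Rightarrow> ('r, 'm, 'd) module_scheme \<Rightarrow> ('r, 'n, 'e) module_scheme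
     \<Rightarrow> ('r, ('m \<times> 'n \<Rightarrow>\<^sub>0 int) set) module" where
  "tensor R M N =
     (let T = tensor_group R M N in
      \<lparr>carrier = carrier T,
       monoid.mult = (\<lambda>z w. tensor_lift T (\<lambda>x y. tensor_lift T (\<lambda>x' y'.
                        pure_tensor R M N (x \<otimes>\<^bsub>M\<^esub> x') (y \<otimes>\<^bsub>N\<^esub> y')) w) z),
       one = pure_tensor R M N \<one>\<^bsub>M\<^esub> \<one>\<^bsub>N\<^esub>,
       ring.zero = \<one>\<^bsub>T\<^esub>,
       ring.add = monoid.mult T,
       smult = (\<lambda>r. tensor_lift T (\<lambda>x y. pure_tensor R M N (r \<odot>\<^bsub>M\<^esub> x) y))\<rparr>)"

text \<open>The linear map \<open>f \<otimes> g\<close> from \<open>M \<otimes> N\<close> to \<open>M' \<otimes> N'\<close>.\<close>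

definition tensor_map ::
    "('r, 'c) ring_scheme \<Rightarrow> ('r, 'm, 'd) module_scheme \<Rightarrow> ('r, 'n, 'e) module_scheme
     \<Rightarrow> ('x \<Rightarrow> 'm) \<Rightarrow> ('y \<Rightarrow> 'n) \<Rightarrow> ('x \<times> 'y \<Rightarrow>\<^sub>0 int) set \<Rightarrow> ('m \<times> 'n \<Rightarrow>\<^sub>0 int) set" where
  "tensor_map R M' N' f g =
     tensor_lift (tensor_group R M' N') (\<lambda>x y. pure_tensor R M' N' (f x) (g y))"

text \<open>The associativity isomorphism from \<open>(L \<otimes> M) \<otimes> N\<close> to \<open>L \<otimes> (M \<otimes> N)\<close>.\<close>

definition tensor_assoc ::
    "('r, 'c) ring_scheme \<Rightarrow> ('r, 'l, 'd) module_scheme \<Rightarrow> ('r, 'm, 'e) module_scheme \<Rightarrow> ('r, 'n, 'f) module_scheme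
     \<Rightarrow> (('l \<times> 'm \<Rightarrow>\<^sub>0 int) set \<times> 'n \<Rightarrow>\<^sub>0 int) set
     \<Rightarrow> ('l \<times> ('m \<times> 'n \<Rightarrow>\<^sub>0 int) set \<Rightarrow>\<^sub>0 int) set" where
  "tensor_assoc R L M N =
     (let T = tensor_group R L (tensor R M N) in
      tensor_lift T (\<lambda>z y. tensor_lift T (\<lambda>w x.
        pure_tensor R L (tensor R M N) w (pure_tensor R M N x y)) z))"


section \<open>Finite group schemes and their actions\<close>

record ('k, 'a) hopf = "('k, 'a) module" +
  comult :: "'a \<Rightarrow> ('a \<times> 'a \<Rightarrow>\<^sub>0 int) set"
  counit :: "'a \<Rightarrow> 'k"
  antipode :: "'a \<Rightarrow> 'a"

text \<open>A finite group scheme \<open>G\<close> over \<open>K\<close> is the spectrum of a finite-dimensional commutative Hopf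
  algebra \<open>A = H\<^sup>0(G, O\<^sub>G)\<close>.\<close>

locale finite_group_scheme = algebra K A
  for K :: "('k, 'c) ring_scheme" and A :: "('k, 'a) hopf" +
  assumes finite_dim: "finite_dimensional K A"
    and comult_hom: "comult A \<in> algebra_homs K A (tensor K A A)"
    and counit_hom: "counit A \<in> algebra_homs K A (regular K)"
    and antipode_linear: "antipode A \<in> linear_maps K A A"
    and coassoc: "\<And>a. a \<in> carrier A \<Longrightarrow>
      tensor_assoc K A A A (tensor_map K (tensor K A A) A (comult A) (\<lambda>b. b) (comult A a))
      = tensor_map K A (tensor K A A) (\<lambda>b. b) (comult A) (comult A a)"
    and counit_left: "\<And>a. a \<in> carrier A \<Longrightarrow>
      tensor_lift (add_monoid A) (\<lambda>b c. counit A b \<odot>\<^bsub>A\<^esub> c) (comult A a) = a"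
    and counit_right: "\<And>a. a \<in> carrier A \<Longrightarrow>
      tensor_lift (add_monoid A) (\<lambda>b c. counit A c \<odot>\<^bsub>A\<^esub> b) (comult A a) = a"
    and antipode_left: "\<And>a. a \<in> carrier A \<Longrightarrow>
      tensor_lift (add_monoid A) (\<lambda>b c. antipode A b \<otimes>\<^bsub>A\<^esub> c) (comult A a) = counit A a \<odot>\<^bsub>A\<^esub> \<one>\<^bsub>A\<^esub>"
    and antipode_right: "\<And>a. a \<in> carrier A \<Longrightarrow>
      tensor_lift (add_monoid A) (\<lambda>b c. b \<otimes>\<^bsub>A\<^esub> antipode A c) (comult A a) = counit A a \<odot>\<^bsub>A\<^esub> \<one>\<^bsub>A\<^esub>"

text \<open>An action of \<open>G\<close> on \<open>Spec S\<close>, given by its comorphism: a coaction making \<open>S\<close> a right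
  \<open>A\<close>-comodule algebra.\<close>

locale group_scheme_action = finite_group_scheme K A + S: algebra K S
  for K :: "('k, 'c) ring_scheme" and A :: "('k, 'a) hopf"
    and S :: "('k, 's, 'd) module_scheme"
    and \<rho> :: "'s \<Rightarrow> ('s \<times> 'a \<Rightarrow>\<^sub>0 int) set" +
  assumes coaction_hom: "\<rho> \<in> algebra_homs K S (tensor K S A)"
    and coaction_coassoc: "\<And>s. s \<in> carrier S \<Longrightarrow>
      tensor_assoc K S A A (tensor_map K (tensor K S A) A \<rho> (\<lambda>a. a) (\<rho> s))
      = tensor_map K S (tensor K A A) (\<lambda>t. t) (comult A) (\<rho> s)"
    and coaction_counit: "\<And>s. s \<in> carrier S \<Longrightarrow>
      tensor_lift (add_monoid S) (\<lambda>t a. counit A a \<odot>\<^bsub>S\<^esub> t) (\<rho> s) = s"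

definition invariants ::
    "('k, 'c) ring_scheme \<Rightarrow> ('k, 'a) hopf \<Rightarrow> ('k, 's) module
     \<Rightarrow> ('s \<Rightarrow> ('s \<times> 'a \<Rightarrow>\<^sub>0 int) set) \<Rightarrow> 's ring" where
  "invariants K A S \<rho> =
     \<lparr>carrier = {s \<in> carrier S. \<rho> s = pure_tensor K S A s \<one>\<^bsub>A\<^esub>},
      monoid.mult = monoid.mult S, one = \<one>\<^bsub>S\<^esub>, ring.zero = \<zero>\<^bsub>S\<^esub>, ring.add = add S\<rparr>"


section \<open>Affine schemes and their open subschemes\<close>

definition Spec :: "('a, 'c) ring_scheme \<Rightarrow> 'a set set" where
  "Spec R = {P. primeideal P R}"

definition zariski :: "('a, 'c) ring_scheme \<Rightarrow> 'a set topology" where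
  "zariski R = topology (\<lambda>U. \<exists>E \<subseteq> carrier R. U = {P \<in> Spec R. \<not> E \<subseteq> P})"

lemma openin_zariski:
  "openin (zariski R) U \<longleftrightarrow> (\<exists>E \<subseteq> carrier R. U = {P \<in> Spec R. \<not> E \<subseteq> P})"
proof -
  let ?op = "\<lambda>U. \<exists>E \<subseteq> carrier R. U = {P \<in> Spec R. \<not> E \<subseteq> P}"
  have inter: "?op (U \<inter> U')" if U: "?op U" "?op U'" for U U'
  proof -
    from U(1) obtain E where E: "E \<subseteq> carrier R" "U = {P \<in> Spec R. \<not> E \<subseteq> P}"
      by (elim exE conjE)
    from U(2) obtain E' where E': "E' \<subseteq> carrier R" "U' = {P \<in> Spec R. \<not> E' \<subseteq> P}"
      by (elim exE conjE)
    let ?F = "{a \<otimes>\<^bsub>R\<^esub> b | a b. a \<in> E \<and> b \<in> E'} \<inter> carrier R"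
    have "(\<not> E \<subseteq> P \<and> \<not> E' \<subseteq> P) \<longleftrightarrow> \<not> ?F \<subseteq> P" if "P \<in> Spec R" for P
    proof -
      interpret primeideal P R using that by (simp add: Spec_def)
      show ?thesis
      proof
        assume "\<not> E \<subseteq> P \<and> \<not> E' \<subseteq> P"
        then obtain a b where ab: "a \<in> E" "a \<notin> P" "b \<in> E'" "b \<notin> P" by blast
        then have "a \<in> carrier R" "b \<in> carrier R" using E(1) E'(1) by auto
        then have "a \<otimes>\<^bsub>R\<^esub> b \<in> ?F" "a \<otimes>\<^bsub>R\<^esub> b \<notin> P" using ab I_prime by blast+
        then show "\<not> ?F \<subseteq> P" by blast
      next
        assume "\<not> ?F \<subseteq> P"
        then obtain a b where ab: "a \<in> E" "b \<in> E'" "a \<otimes>\<^bsub>R\<^esub> b \<notin> P" by blast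
        then have "a \<in> carrier R" "b \<in> carrier R" using E(1) E'(1) by auto
        then show "\<not> E \<subseteq> P \<and> \<not> E' \<subseteq> P" using ab I_l_closed I_r_closed by blast
      qed
    qed
    then have "U \<inter> U' = {P \<in> Spec R. \<not> ?F \<subseteq> P}" unfolding E(2) E'(2) by blast
    then show ?thesis by blast
  qed
  have union: "?op (\<Union>\<U>)" if "\<forall>U\<in>\<U>. ?op U" for \<U>
  proof -
    from bchoice[OF that] obtain E
      where E: "\<forall>U\<in>\<U>. E U \<subseteq> carrier R \<and> U = {P \<in> Spec R. \<not> E U \<subseteq> P}"
      by (elim exE)
    have mem: "P \<in> U \<longleftrightarrow> P \<in> Spec R \<and> \<not> E U \<subseteq> P" if "U \<in> \<U>" for U P
      using bspec[OF E that] by blast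
    have "\<Union>\<U> = {P \<in> Spec R. \<not> (\<Union>U\<in>\<U>. E U) \<subseteq> P}"
      unfolding set_eq_iff Union_iff mem_Collect_eq UN_subset_iff using mem by blast
    moreover have "(\<Union>U\<in>\<U>. E U) \<subseteq> carrier R" using E by blast
    ultimately show ?thesis by blast
  qed
  have "istopology ?op"
    unfolding istopology_def by (intro conjI allI impI inter union)
  then show ?thesis by (simp add: zariski_def topology_inverse')
qed

definition height :: "('a, 'c) ring_scheme \<Rightarrow> 'a set \<Rightarrow> enat" where
  "height R P = Sup {enat m | m. \<exists>c :: nat \<Rightarrow> 'a set.
     (\<forall>i\<le>m. c i \<in> Spec R) \<and> (\<forall>i<m. c i \<subset> c (Suc i)) \<and> c m = P}"

definition codimension :: "('a, 'c) ring_scheme \<Rightarrow> 'a set set \<Rightarrow> enat" where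
  "codimension R Z = (INF P\<in>Z. height R P)"

text \<open>The element \<open>a/b\<close> of the localisation of \<open>R\<close> at \<open>P\<close>, as an equivalence class of pairs.\<close>

definition local_frac :: "('a, 'c) ring_scheme \<Rightarrow> 'a set \<Rightarrow> 'a \<Rightarrow> 'a \<Rightarrow> ('a \<times> 'a) set" where
  "local_frac R P a b =
     {(c, d). c \<in> carrier R \<and> d \<in> carrier R - P \<and>
        (\<exists>u \<in> carrier R - P. u \<otimes>\<^bsub>R\<^esub> (a \<otimes>\<^bsub>R\<^esub> d) = u \<otimes>\<^bsub>R\<^esub> (c \<otimes>\<^bsub>R\<^esub> b))}"

text \<open>The ring of sections of the structure sheaf over an open \<open>W\<close>: functions that are locally
  fractions. In the ring operations, the unions are over representatives of the two classes; all
  members of such a union coincide.\<close>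

definition sections :: "('a, 'c) ring_scheme \<Rightarrow> 'a set set \<Rightarrow> ('a set \<Rightarrow> ('a \<times> 'a) set) ring" where
  "sections R W =
     \<lparr>carrier = {s \<in> extensional W. \<forall>P\<in>W. \<exists>W'. openin (zariski R) W' \<and> P \<in> W' \<and> W' \<subseteq> W \<and>
        (\<exists>a\<in>carrier R. \<exists>b\<in>carrier R. \<forall>Q\<in>W'. b \<notin> Q \<and> s Q = local_frac R Q a b)},
      monoid.mult = (\<lambda>s t. \<lambda>P\<in>W.
        \<Union>(a, b)\<in>s P. \<Union>(c, d)\<in>t P. local_frac R P (a \<otimes>\<^bsub>R\<^esub> c) (b \<otimes>\<^bsub>R\<^esub> d)),
      one = (\<lambda>P\<in>W. local_frac R P \<one>\<^bsub>R\<^esub> \<one>\<^bsub>R\<^esub>),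
      ring.zero = (\<lambda>P\<in>W. local_frac R P \<zero>\<^bsub>R\<^esub> \<one>\<^bsub>R\<^esub>),
      ring.add = (\<lambda>s t. \<lambda>P\<in>W.
        \<Union>(a, b)\<in>s P. \<Union>(c, d)\<in>t P.
          local_frac R P ((a \<otimes>\<^bsub>R\<^esub> d) \<oplus>\<^bsub>R\<^esub> (c \<otimes>\<^bsub>R\<^esub> b)) (b \<otimes>\<^bsub>R\<^esub> d))\<rparr>"

text \<open>For a ring homomorphism \<open>\<phi>\<close> from \<open>C\<close> to \<open>B\<close>: the underlying map of the morphism
  \<open>Spec B \<rightarrow> Spec C\<close>, and the map on sections from an open \<open>W\<close> in \<open>Spec C\<close> to an open \<open>W'\<close> in
  \<open>Spec B\<close> lying over \<open>W\<close>, obtained from the local homomorphisms \<open>a/b \<mapsto> \<phi> a/\<phi> b\<close>.\<close>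

definition Spec_map :: "('c, 'd) ring_scheme \<Rightarrow> ('c \<Rightarrow> 'b) \<Rightarrow> 'b set \<Rightarrow> 'c set" where
  "Spec_map C \<phi> Q = {c \<in> carrier C. \<phi> c \<in> Q}"

definition sections_map ::
    "('c, 'd) ring_scheme \<Rightarrow> ('b, 'e) ring_scheme \<Rightarrow> ('c \<Rightarrow> 'b) \<Rightarrow> 'b set set
     \<Rightarrow> ('c set \<Rightarrow> ('c \<times> 'c) set) \<Rightarrow> 'b set \<Rightarrow> ('b \<times> 'b) set" where
  "sections_map C B \<phi> W' s =
     (\<lambda>Q\<in>W'. \<Union>(a, b)\<in>s (Spec_map C \<phi> Q). local_frac B Q (\<phi> a) (\<phi> b))"

text \<open>The morphism \<open>Spec B \<rightarrow> Spec C\<close> given by \<open>\<phi>\<close> restricts to an isomorphism of schemes from the open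
  subscheme \<open>W'\<close> of \<open>Spec B\<close> to the open subscheme \<open>W\<close> of \<open>Spec C\<close>: a homeomorphism inducing
  isomorphisms on the rings of sections. (Being a homeomorphism onto \<open>W\<close> includes mapping \<open>W'\<close> to \<open>W\<close>.)\<close>

definition restricts_to_iso ::
    "('c, 'd) ring_scheme \<Rightarrow> ('b, 'e) ring_scheme \<Rightarrow> ('c \<Rightarrow> 'b) \<Rightarrow> 'b set set \<Rightarrow> 'c set set \<Rightarrow> bool" where
  "restricts_to_iso C B \<phi> W' W \<longleftrightarrow>
     homeomorphic_map (subtopology (zariski B) W') (subtopology (zariski C) W) (Spec_map C \<phi>) \<and>
     (\<forall>Y. openin (subtopology (zariski C) W) Y \<longrightarrow>
        (let Y' = {Q \<in> W'. Spec_map C \<phi> Q \<in> Y} in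
         sections_map C B \<phi> Y' \<in> ring_iso (sections C Y) (sections B Y')))"


section \<open>Actions that are free in codimension one\<close>

text \<open>Here \<open>Spec S \<times>\<^sub>k G = Spec (S \<otimes>\<^sub>k A)\<close>, where the projection to \<open>Spec S\<close> has comorphism
  \<open>s \<mapsto> s \<otimes> 1\<close> and the action map has comorphism \<open>\<rho>\<close>; \<open>V \<times>\<^sub>k G\<close> is the preimage of \<open>V\<close> under the
  projection. Likewise \<open>V \<times>\<^sub>U V\<close> is the open subscheme of \<open>Spec (S \<otimes>\<^sub>R S)\<close> consisting of the points
  whose two projections lie in \<open>V\<close> and whose image in \<open>Spec R\<close> lies in \<open>U\<close>. The morphism
  \<open>(v, g) \<mapsto> (v, gv)\<close> has comorphism \<open>s \<otimes> t \<mapsto> (s \<otimes> 1) \<rho>(t)\<close>.\<close>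

definition orbit_comorphism ::
    "('k, 'c) ring_scheme \<Rightarrow> ('k, 'a) hopf \<Rightarrow> ('k, 's) module \<Rightarrow> ('s \<Rightarrow> ('s \<times> 'a \<Rightarrow>\<^sub>0 int) set)
     \<Rightarrow> ('s \<times> 's \<Rightarrow>\<^sub>0 int) set \<Rightarrow> ('s \<times> 'a \<Rightarrow>\<^sub>0 int) set" where
  "orbit_comorphism K A S \<rho> =
     tensor_lift (tensor_group K S A)
       (\<lambda>s t. pure_tensor K S A s \<one>\<^bsub>A\<^esub> \<otimes>\<^bsub>tensor K S A\<^esub> \<rho> t)"

definition free_in_codimension_one ::
    "('k, 'c) ring_scheme \<Rightarrow> ('k, 'a) hopf \<Rightarrow> ('k, 's) module \<Rightarrow> ('s \<Rightarrow> ('s \<times> 'a \<Rightarrow>\<^sub>0 int) set) \<Rightarrow> bool" where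
  "free_in_codimension_one K A S \<rho> \<longleftrightarrow>
     (\<exists>Z. closedin (zariski S) Z \<and> 2 \<le> codimension S Z \<and>
       (let R = invariants K A S \<rho>;
            \<pi> = Spec_map R (\<lambda>r. r);
            V = Spec S - Z;
            U = Spec R - \<pi> ` Z;
            SA = tensor K S A;
            SS = tensor R (regular S) (regular S);
            VG = {Q \<in> Spec SA. Spec_map S (\<lambda>s. pure_tensor K S A s \<one>\<^bsub>A\<^esub>) Q \<in> V};
            VV = {Q \<in> Spec SS.
                    Spec_map S (\<lambda>s. pure_tensor R (regular S) (regular S) s \<one>\<^bsub>S\<^esub>) Q \<in> V \<and>
                    Spec_map S (\<lambda>s. pure_tensor R (regular S) (regular S) \<one>\<^bsub>S\<^esub> s) Q \<in> V \<and>
                    Spec_map R (\<lambda>r. pure_tensor R (regular S) (regular S) r \<one>\<^bsub>S\<^esub>) Q \<in> U}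
        in (\<forall>Q\<in>VG. Spec_map S \<rho> Q \<in> V) \<and>
           restricts_to_iso SS SA (orbit_comorphism K A S \<rho>) VG VV))"


section \<open>The dual Hopf algebra and the smash product\<close>

text \<open>Convolution product: \<open>(h g)(a) = \<Sum> h(a\<^sub>1) g(a\<^sub>2)\<close>.\<close>

definition dual_algebra :: "('k, 'c) ring_scheme \<Rightarrow> ('k, 'a) hopf \<Rightarrow> ('k, 'a \<Rightarrow> 'k) module" where
  "dual_algebra K A =
     \<lparr>carrier = linear_maps K A (regular K) \<inter> extensional (carrier A),
      monoid.mult = (\<lambda>h g. \<lambda>a\<in>carrier A.
        tensor_lift (add_monoid K) (\<lambda>b c. h b \<otimes>\<^bsub>K\<^esub> g c) (comult A a)),
      one = (\<lambda>a\<in>carrier A. counit A a),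
      ring.zero = (\<lambda>a\<in>carrier A. \<zero>\<^bsub>K\<^esub>),
      ring.add = (\<lambda>h g. \<lambda>a\<in>carrier A. h a \<oplus>\<^bsub>K\<^esub> g a),
      smult = (\<lambda>r h. \<lambda>a\<in>carrier A. r \<otimes>\<^bsub>K\<^esub> h a)\<rparr>"

text \<open>The comultiplication is dual to the multiplication of \<open>A\<close>: \<open>\<Sum> h\<^sub>1(a) h\<^sub>2(b) = h(ab)\<close>. This
  determines \<open>\<Sum> h\<^sub>1 \<otimes> h\<^sub>2\<close> uniquely because \<open>A\<close> is finite-dimensional.\<close>

definition dual_hopf :: "('k, 'c) ring_scheme \<Rightarrow> ('k, 'a) hopf \<Rightarrow> ('k, 'a \<Rightarrow> 'k) hopf" where
  "dual_hopf K A =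
     module.extend (dual_algebra K A)
       (hopf.fields
         (\<lambda>h. THE z. z \<in> carrier (tensor K (dual_algebra K A) (dual_algebra K A)) \<and>
            (\<forall>a\<in>carrier A. \<forall>b\<in>carrier A.
               tensor_lift (add_monoid K) (\<lambda>f g. f a \<otimes>\<^bsub>K\<^esub> g b) z = h (a \<otimes>\<^bsub>A\<^esub> b)))
         (\<lambda>h. h \<one>\<^bsub>A\<^esub>)
         (\<lambda>h. \<lambda>a\<in>carrier A. h (antipode A a)))"

text \<open>The left action of \<open>H\<close> on \<open>S\<close>: if \<open>\<rho>(s) = \<Sum> s\<^sub>0 \<otimes> s\<^sub>1\<close> then \<open>h \<cdot> s = \<Sum> h(s\<^sub>1) s\<^sub>0\<close>.\<close>

definition dual_act ::
    "('k, 's) module \<Rightarrow> ('s \<Rightarrow> ('s \<times> 'a \<Rightarrow>\<^sub>0 int) set) \<Rightarrow> ('a \<Rightarrow> 'k) \<Rightarrow> 's \<Rightarrow> 's" where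
  "dual_act S \<rho> h s = tensor_lift (add_monoid S) (\<lambda>t a. h a \<odot>\<^bsub>S\<^esub> t) (\<rho> s)"

text \<open>\<open>S * G = S # H\<close> on the space \<open>S \<otimes>\<^sub>k H\<close>, with \<open>(s # h)(t # g) = \<Sum> s(h\<^sub>1 \<cdot> t) # h\<^sub>2 g\<close>. It is
  considered over the ring of invariants, \<open>r\<close> acting as multiplication by \<open>r # 1\<close>.\<close>

definition skew_group_scheme_ring ::
    "('k, 'c) ring_scheme \<Rightarrow> ('k, 'a) hopf \<Rightarrow> ('k, 's) module \<Rightarrow> ('s \<Rightarrow> ('s \<times> 'a \<Rightarrow>\<^sub>0 int) set)
     \<Rightarrow> ('s, ('s \<times> ('a \<Rightarrow> 'k) \<Rightarrow>\<^sub>0 int) set) module" where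
  "skew_group_scheme_ring K A S \<rho> =
     (let H = dual_hopf K A;
          T = tensor_group K S H;
          smash = (\<lambda>x y.
            tensor_lift T (\<lambda>s h. tensor_lift T (\<lambda>t g. tensor_lift T (\<lambda>h1 h2.
              pure_tensor K S H (s \<otimes>\<^bsub>S\<^esub> dual_act S \<rho> h1 t) (h2 \<otimes>\<^bsub>H\<^esub> g)) (comult H h)) y) x)
      in \<lparr>carrier = carrier T,
          monoid.mult = smash,
          one = pure_tensor K S H \<one>\<^bsub>S\<^esub> \<one>\<^bsub>H\<^esub>,
          ring.zero = \<one>\<^bsub>T\<^esub>,
          ring.add = monoid.mult T,
          smult = (\<lambda>r. smash (pure_tensor K S H r \<one>\<^bsub>H\<^esub>))\<rparr>)"

definition natural_hom ::
    "('k, 'c) ring_scheme \<Rightarrow> ('k, 'a) hopf \<Rightarrow> ('k, 's) module \<Rightarrow> ('s \<Rightarrow> ('s \<times> 'a \<Rightarrow>\<^sub>0 int) set)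
     \<Rightarrow> ('s \<times> ('a \<Rightarrow> 'k) \<Rightarrow>\<^sub>0 int) set \<Rightarrow> 's \<Rightarrow> 's" where
  "natural_hom K A S \<rho> =
     tensor_lift (add_monoid (End_algebra (invariants K A S \<rho>) (regular S)))
       (\<lambda>s h. \<lambda>t\<in>carrier S. s \<otimes>\<^bsub>S\<^esub> dual_act S \<rho> h t)"


section \<open>Formal power series\<close>

definition exponents :: "nat \<Rightarrow> (nat \<Rightarrow> nat) set" where
  "exponents n = {\<alpha>. \<forall>i\<ge>n. \<alpha> i = 0}"

text \<open>\<open>K[[x\<^sub>1, \<dots>, x\<^sub>n]]\<close>: a series is its family of coefficients, indexed by exponents.\<close>

definition power_series :: "('k, 'c) ring_scheme \<Rightarrow> nat \<Rightarrow> ('k, (nat \<Rightarrow> nat) \<Rightarrow> 'k) module" where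
  "power_series K n =
     \<lparr>carrier = exponents n \<rightarrow>\<^sub>E carrier K,
      monoid.mult = (\<lambda>f g. \<lambda>\<gamma>\<in>exponents n.
        finsum K (\<lambda>(\<alpha>, \<beta>). f \<alpha> \<otimes>\<^bsub>K\<^esub> g \<beta>)
          {(\<alpha>, \<beta>) \<in> exponents n \<times> exponents n. (\<lambda>i. \<alpha> i + \<beta> i) = \<gamma>}),
      one = (\<lambda>\<gamma>\<in>exponents n. if \<gamma> = (\<lambda>i. 0) then \<one>\<^bsub>K\<^esub> else \<zero>\<^bsub>K\<^esub>),
      ring.zero = (\<lambda>\<gamma>\<in>exponents n. \<zero>\<^bsub>K\<^esub>),
      ring.add = (\<lambda>f g. \<lambda>\<gamma>\<in>exponents n. f \<gamma> \<oplus>\<^bsub>K\<^esub> g \<gamma>),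
      smult = (\<lambda>c f. \<lambda>\<gamma>\<in>exponents n. c \<otimes>\<^bsub>K\<^esub> f \<gamma>)\<rparr>"

end

theory Submission
  imports Defs
begin

text \<open>
  Put \<open>B = S \<otimes>\<^sub>k A\<close> with \<open>A = H\<^sup>0(G, O\<^sub>G)\<close>, put \<open>C = S \<otimes>\<^sub>R S\<close>, and let \<open>\<psi>\<close> from \<open>C\<close> to \<open>B\<close> be the comorphism of
  \<open>(v, g) \<mapsto> (v, gv)\<close>. Given a prime \<open>P\<close> outside the bad locus \<open>Z\<close>, prime avoidance, the product over
  the finitely many \<open>k\<close>-points of \<open>G\<close> and a power of \<open>p\<close> yield an invariant \<open>r\<close> that vanishes on \<open>Z\<close>
  but not at \<open>P\<close>; freeness then says that \<open>\<psi>\<close> becomes an isomorphism when \<open>r\<close> is inverted.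

  An element \<open>x\<close> of \<open>S # H\<close> is an \<open>S\<close>-linear map from \<open>B\<close> to \<open>S\<close>, an \<open>R\<close>-linear endomorphism of \<open>S\<close> is
  an \<open>S\<close>-linear map from \<open>C\<close> to \<open>S\<close>, and the natural homomorphism \<open>N\<close> is the composition with \<open>\<psi>\<close>. Since \<open>S\<close> is
  a domain and \<open>\<psi>\<close> is generically an isomorphism, \<open>N\<close> is injective and every endomorphism \<open>\<phi>\<close> kills the
  kernel of \<open>\<psi>\<close>. For \<open>b \<in> A\<close>, the \<open>f\<close> with \<open>f \<otimes> b\<close> in the image of \<open>\<psi>\<close> form an ideal that lies only in primes of \<open>Z\<close>,
  hence of height at least two, and \<open>\<phi>\<close> induces an \<open>S\<close>-linear map from this ideal to \<open>S\<close>. As \<open>S\<close> is noetherian and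
  completely integrally closed, that map is the multiplication by some \<open>s\<^sub>b\<close>; letting \<open>b\<close> run through
  a basis of \<open>A\<close> with dual basis \<open>e\<^sub>b\<close>, one gets \<open>\<phi> = N (\<Sum> s\<^sub>b # e\<^sub>b)\<close>. The ring axioms
  for \<open>S # H\<close> are pulled back along \<open>N\<close>.\<close>

section \<open>Prime ideals\<close>

text \<open>The familiar route compares two reflexive \<open>R\<close>-modules that agree in
  codimension one. It rests on \<open>S\<close> being finite over \<open>R\<close> and on duality
  over \<open>R\<close>; here everything happens over \<open>S\<close>. By the dual basis of
  \<open>A\<close>, an element of \<open>S # H\<close> is a family of elements of \<open>S\<close>,
  so surjectivity becomes a question about single fractions: each comes with a whole ideal of
  denominators, and one has to see that it needs none. This is done with divisibility and colon
  ideals, so that neither a field of fractions nor a localisation of \<open>S\<close> is formed.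

  Freeness, too, enters as a pair of statements on denominators: a power of \<open>r\<close> moves a
  given element of \<open>B\<close> into the image of \<open>\<psi>\<close>, and a power of
  \<open>r\<close> kills a given element of the kernel. The obstacle in finding \<open>r\<close> is
  that \<open>G\<close> may be non-reduced. An element fixed by all \<open>k\<close>-points is then
  not yet invariant, but its defect is nilpotent because \<open>k\<close> is algebraically closed,
  and this is what the power of \<open>p\<close> removes.\<close>

lemma (in cring) cring_idealI:
  assumes "I \<subseteq> carrier R" "\<zero> \<in> I" and add: "\<And>a b. a \<in> I \<Longrightarrow> b \<in> I \<Longrightarrow> a \<oplus> b \<in> I"
    and mult: "\<And>a x. a \<in> I \<Longrightarrow> x \<in> carrier R \<Longrightarrow> x \<otimes> a \<in> I"
  shows "ideal I R"
proof (rule idealI)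
  have "\<ominus> a \<in> I" if "a \<in> I" for a
    using mult[OF that, of "\<ominus> \<one>"] that assms(1) by (auto simp: l_minus)
  then show "subgroup I (add_monoid R)"
    using assms(1-3) by (intro add.subgroupI) (auto simp: a_inv_def)
  show "a \<otimes> x \<in> I" if "a \<in> I" "x \<in> carrier R" for a x
    using mult[OF that] that assms(1) by (auto simp: m_comm)
qed (use mult ring_axioms in auto)

text \<open>An ideal maximal among those containing \<open>I\<close> and no power of
  \<open>r\<close> is prime: adjoining an element outside it must catch a power of \<open>r\<close>,
  and if the product of two such elements were inside, the product of the two powers would be inside
  as well. The lemma turns statements about all primes into statements about powers of one
  element.\<close>

lemma (in cring) prime_avoiding_powers:
  assumes I: "ideal I R" and r: "r \<in> carrier R" and pow: "\<And>k::nat. r [^] k \<notin> I"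
  obtains Q where "primeideal Q R" "I \<subseteq> Q" "r \<notin> Q"
proof -
  define F where "F = {J. ideal J R \<and> I \<subseteq> J \<and> (\<forall>k::nat. r [^] k \<notin> J)}"
  have "\<exists>Q\<in>F. \<forall>J\<in>F. Q \<subseteq> J \<longrightarrow> J = Q"
  proof (rule subset_Zorn_nonempty)
    show "F \<noteq> {}" using I pow by (auto simp: F_def)
    fix C assume C: "C \<noteq> {}" "subset.chain F C"
    then have sub: "C \<subseteq> F" by (auto simp: pred_on.chain_def)
    have "subset.chain {J. ideal J R} C"
      using C sub by (auto simp: pred_on.chain_def F_def)
    from chain_Union_is_ideal[OF this] C(1) have "ideal (\<Union>C) R" by simp
    then show "\<Union>C \<in> F" using sub C(1) by (auto simp: F_def)
  qed
  then obtain Q where Q: "Q \<in> F" and max: "\<And>J. J \<in> F \<Longrightarrow> Q \<subseteq> J \<Longrightarrow> J = Q" by blast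
  interpret Q: ideal Q R using Q by (simp add: F_def)
  have power_in: "\<exists>k::nat. \<exists>q\<in>Q. \<exists>c\<in>carrier R. r [^] k = q \<oplus> c \<otimes> x" if x: "x \<in> carrier R" "x \<notin> Q" for x
  proof (rule ccontr)
    let ?J = "{q \<oplus> c \<otimes> x | q c. q \<in> Q \<and> c \<in> carrier R}"
    assume no: "\<not> ?thesis"
    have J: "ideal ?J R"
    proof (rule cring_idealI)
      show "?J \<subseteq> carrier R" using x Q.Icarr by auto
      show "\<zero> \<in> ?J" using x(1)
        by (intro CollectI exI[of _ \<zero>] conjI) simp_all
      show "a \<oplus> b \<in> ?J" if "a \<in> ?J" "b \<in> ?J" for a b
      proof -
        obtain q c q' c' where h: "a = q \<oplus> c \<otimes> x" "b = q' \<oplus> c' \<otimes> x" "q \<in> Q" "c \<in> carrier R" "q' \<in> Q" "c' \<in> carrier R"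
          using \<open>a \<in> ?J\<close> \<open>b \<in> ?J\<close> by blast
        have "a \<oplus> b = (q \<oplus> q') \<oplus> (c \<oplus> c') \<otimes> x"
          using h x Q.Icarr by (simp add: l_distr a_ac)
        then show ?thesis using h
          by (intro CollectI exI[of _ "q \<oplus> q'"] exI[of _ "c \<oplus> c'"] conjI) simp_all
      qed
      show "y \<otimes> a \<in> ?J" if "a \<in> ?J" "y \<in> carrier R" for a y
      proof -
        obtain q c where h: "a = q \<oplus> c \<otimes> x" "q \<in> Q" "c \<in> carrier R"
          using \<open>a \<in> ?J\<close> by blast
        have "y \<otimes> a = (y \<otimes> q) \<oplus> (y \<otimes> c) \<otimes> x"
          using h x Q.Icarr that(2) by (simp add: r_distr m_assoc)
        then show ?thesis using h that(2)
          by (intro CollectI exI[of _ "y \<otimes> q"] exI[of _ "y \<otimes> c"] conjI Q.I_l_closed) simp_all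
      qed
    qed
    have "Q \<subseteq> ?J"
    proof
      fix q assume "q \<in> Q"
      then have "q = q \<oplus> \<zero> \<otimes> x" using x Q.Icarr by simp
      then show "q \<in> ?J" using \<open>q \<in> Q\<close>
        by (intro CollectI exI[of _ q] exI[of _ \<zero>] conjI) simp_all
    qed
    moreover have "\<not> (\<exists>k::nat. r [^] k \<in> ?J)" using no by auto
    ultimately have "?J \<in> F" using J Q by (auto simp: F_def)
    then have "?J = Q" using max \<open>Q \<subseteq> ?J\<close> by blast
    moreover have "x = \<zero> \<oplus> \<one> \<otimes> x" using x by simp
    then have "x \<in> ?J"
      by (intro CollectI exI[of _ \<zero>] exI[of _ \<one>] conjI) simp_all
    ultimately show False using x by blast
  qed
  have "primeideal Q R"
  proof (rule primeidealI[OF Q.is_ideal is_cring])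
    have "\<one> \<notin> Q" using Q by (auto simp: F_def dest: spec[of _ "0::nat"])
    then show "carrier R \<noteq> Q" by blast
    fix a b assume ab: "a \<in> carrier R" "b \<in> carrier R" "a \<otimes> b \<in> Q"
    show "a \<in> Q \<or> b \<in> Q"
    proof (rule ccontr)
      assume "\<not> ?thesis"
      then obtain k q c l q' c' where h: "r [^] (k::nat) = q \<oplus> c \<otimes> a" "q \<in> Q" "c \<in> carrier R"
        "r [^] (l::nat) = q' \<oplus> c' \<otimes> b" "q' \<in> Q" "c' \<in> carrier R"
        using power_in[of a] power_in[of b] ab by metis
      note c = h(2,5)[THEN Q.Icarr]
      have "r [^] (k + l) = (q \<oplus> c \<otimes> a) \<otimes> (q' \<oplus> c' \<otimes> b)"
        using r h by (simp add: nat_pow_mult[symmetric])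
      also have "\<dots> = (q' \<oplus> c' \<otimes> b) \<otimes> q \<oplus> ((c \<otimes> a) \<otimes> q' \<oplus> (c \<otimes> c') \<otimes> (a \<otimes> b))"
        using h ab c by (simp add: l_distr r_distr m_ac a_ac)
      also have "\<dots> \<in> Q"
        using Q.I_l_closed[OF h(2), of "q' \<oplus> c' \<otimes> b"] Q.I_l_closed[OF h(5), of "c \<otimes> a"]
          Q.I_l_closed[OF ab(3), of "c \<otimes> c'"] h ab c by (intro Q.a_closed) simp_all
      finally have "r [^] (k + l) \<in> Q" .
      then show False using Q unfolding F_def by blast
    qed
  qed
  then show ?thesis
    using that[of Q] Q r by (auto simp: F_def dest: spec[of _ "1::nat"])
qed

lemma (in primeideal) prod_notin:
  assumes "finite F" "\<And>i. i \<in> F \<Longrightarrow> f i \<in> carrier R - I"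
  shows "finprod R f F \<in> carrier R - I"
  using assms
proof (induction F)
  case empty
  have "\<one> \<notin> I"
    using I_notcarr one_imp_carrier by blast
  then show ?case by simp
next
  case (insert i F)
  then have "finprod R f F \<in> carrier R - I" "f i \<in> carrier R - I" by auto
  moreover have "finprod R f (insert i F) = f i \<otimes> finprod R f F"
    using insert by (intro finprod_insert) auto
  ultimately show ?case using I_prime[of "f i" "finprod R f F"] by auto
qed

lemma (in primeideal) pow_notin:
  assumes "x \<in> carrier R - I"
  shows "x [^] (k::nat) \<in> carrier R - I"
proof (induction k)
  case 0
  have "\<one> \<notin> I"
    using I_notcarr one_imp_carrier by blast
  then show ?case by simp
next
  case (Suc i)
  then show ?case using I_prime[of "x [^] i" x] assms by auto
qed

lemma (in ideal) prod_in:
  assumes "cring R" "finite F" "\<And>i. i \<in> F \<Longrightarrow> f i \<in> carrier R" "j \<in> F" "f j \<in> I"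
  shows "finprod R f F \<in> I"
proof -
  interpret cring R by fact
  have "finprod R f F = f j \<otimes> finprod R f (F - {j})"
    using assms by (subst finprod_insert[symmetric]) (auto simp: insert_absorb)
  then show ?thesis using assms by (auto intro!: I_r_closed finprod_closed)
qed

lemma (in cring) prime_avoidance:
  assumes "finite F" and I: "ideal I R" and "\<And>P. P \<in> F \<Longrightarrow> primeideal P R" "\<And>P. P \<in> F \<Longrightarrow> \<not> I \<subseteq> P"
  obtains s where "s \<in> I" "\<And>P. P \<in> F \<Longrightarrow> s \<notin> P"
proof -
  interpret I: ideal I R by fact
  have "\<exists>s\<in>I. \<forall>P\<in>F. s \<notin> P"
    using assms(1,3,4)
  proof (induction "card F" arbitrary: F rule: less_induct)
    case less
    show ?case
    proof (cases "F = {}")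
      case True then show ?thesis using I.zero_closed by blast
    next
      case False
      then obtain P0 where P0: "P0 \<in> F" by blast
      interpret P0: primeideal P0 R using less P0 by blast
      have smaller: "\<exists>s\<in>I. \<forall>P\<in>F - {Q}. s \<notin> P" if "Q \<in> F" for Q
        using less(1)[of "F - {Q}"] less(2-) that by (metis DiffD1 card_Diff1_less finite_Diff)
      show ?thesis
      proof (cases "\<exists>P\<in>F. P \<noteq> P0 \<and> P \<subseteq> P0")
        case True
        then show ?thesis using smaller P0 by (metis DiffI singletonD subsetD)
      next
        case False
        obtain s where s: "s \<in> I" "\<And>P. P \<in> F - {P0} \<Longrightarrow> s \<notin> P" using smaller[OF P0] by blast
        show ?thesis
        proof (cases "s \<in> P0")
          case False then show ?thesis using s by blast
        next
          case s0: True
          have "\<forall>P\<in>F - {P0}. \<exists>x. x \<in> P - P0" using False by blast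
          then obtain x where x: "\<And>P. P \<in> F - {P0} \<Longrightarrow> x P \<in> P - P0" by metis
          have xc: "x P \<in> carrier R" if "P \<in> F - {P0}" for P
            using x[OF that] less(3)[of P] that primeideal.axioms(1) ideal.Icarr by (metis DiffD1)
          obtain y where y: "y \<in> I" "y \<notin> P0" using less(4)[OF P0] by blast
          \<comment> \<open>\<open>t\<close> lies in \<open>I\<close> and in every prime of
            \<open>F\<close> except \<open>P0\<close>. Adding it to \<open>s\<close> repairs the
            membership in \<open>P0\<close> and leaves the other primes alone.\<close>
          define t where "t = y \<otimes> finprod R x (F - {P0})"
          have fp: "finprod R x (F - {P0}) \<in> carrier R - P0"
            by (rule P0.prod_notin) (use less(2) x xc in auto)
          then have tI: "t \<in> I" unfolding t_def using y by (intro I.I_r_closed) auto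
          have t0: "t \<notin> P0" unfolding t_def using y fp I.Icarr P0.I_prime by blast
          have tP: "t \<in> P" if "P \<in> F - {P0}" for P
          proof -
            interpret P: primeideal P R using less(3) that by blast
            show ?thesis unfolding t_def
              by (rule P.I_l_closed[OF P.prod_in[OF is_cring _ xc that]]) (use x that less(2) y I.Icarr in auto)
          qed
          have "s \<oplus> t \<notin> P" if "P \<in> F" for P
          proof (cases "P = P0")
            case True
            have "s \<oplus> t \<in> P0 \<Longrightarrow> t \<in> P0"
              using s0 s(1) tI I.Icarr P0.a_closed[OF P0.a_inv_closed[OF s0], of "s \<oplus> t"]
              by (simp add: r_neg1 a_assoc[symmetric] l_neg)
            then show ?thesis using True t0 by blast
          next
            case False
            then interpret P: primeideal P R using less(3) that by blast
            have tP': "t \<in> P" using tP that False by blast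
            have "s \<oplus> t \<in> P \<Longrightarrow> s \<in> P"
              using s(1) tI I.Icarr P.a_closed[OF _ P.a_inv_closed[OF tP'], of "s \<oplus> t"]
              by (simp add: a_assoc r_neg)
            then show ?thesis using s that False by blast
          qed
          then show ?thesis using s(1) tI by blast
        qed
      qed
    qed
  qed
  then show ?thesis using that by blast
qed

section \<open>Fractions whose denominators form an ideal of height at least two\<close>

lemma (in noetherian_ring) maximal_ideal_in_family:
  assumes "F \<noteq> {}" "\<And>J. J \<in> F \<Longrightarrow> ideal J R"
  shows "\<exists>P\<in>F. \<forall>J\<in>F. P \<subseteq> J \<longrightarrow> J = P"
proof (rule subset_Zorn_nonempty[OF assms(1)])
  fix C assume C: "C \<noteq> {}" "subset.chain F C"
  then have "subset.chain {J. ideal J R} C"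
    using assms(2) by (auto simp: pred_on.chain_def)
  from ideal_chain_is_trivial[OF C(1) this] C show "\<Union>C \<in> F"
    by (auto simp: pred_on.chain_def)
qed

text \<open>The inner hypothesis says that all powers of the fraction \<open>a / f\<close> have the
  common denominator \<open>g\<close>. Divisibility expresses this without a field of
  fractions.\<close>

definition completely_integrally_closed :: "('a, 'b) ring_scheme \<Rightarrow> bool" where
  "completely_integrally_closed R \<longleftrightarrow>
     (\<forall>f\<in>carrier R - {\<zero>\<^bsub>R\<^esub>}. \<forall>g\<in>carrier R - {\<zero>\<^bsub>R\<^esub>}. \<forall>a\<in>carrier R.
        (\<forall>m::nat. f [^]\<^bsub>R\<^esub> m divides\<^bsub>R\<^esub> g \<otimes>\<^bsub>R\<^esub> a [^]\<^bsub>R\<^esub> m) \<longrightarrow> f divides\<^bsub>R\<^esub> a)"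

text \<open>If multiplication by \<open>a / f\<close> maps \<open>J\<close> into itself, then so do
  all powers of the fraction, and any nonzero \<open>g\<close> in \<open>J\<close> is a common
  denominator for them.\<close>

lemma (in domain) divides_if_multiplies_ideal:
  assumes cic: "completely_integrally_closed R"
    and "f \<in> carrier R" "f \<noteq> \<zero>" "a \<in> carrier R" "J \<subseteq> carrier R" "g \<in> J" "g \<noteq> \<zero>"
    and J: "\<And>x. x \<in> J \<Longrightarrow> \<exists>y\<in>J. x \<otimes> a = f \<otimes> y"
  shows "f divides a"
proof -
  have "\<exists>y\<in>J. g \<otimes> a [^] m = f [^] m \<otimes> y" for m :: nat
  proof (induction m)
    case 0 then show ?case using assms by (intro bexI[of _ g]) auto
  next
    case (Suc m)
    then obtain y where y: "y \<in> J" "g \<otimes> a [^] m = f [^] m \<otimes> y" by blast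
    obtain z where z: "z \<in> J" "y \<otimes> a = f \<otimes> z" using J[OF y(1)] by blast
    have c: "g \<in> carrier R" "y \<in> carrier R" "z \<in> carrier R" using assms y z by auto
    have "g \<otimes> a [^] Suc m = (g \<otimes> a [^] m) \<otimes> a" using c assms by (simp add: m_assoc)
    also have "\<dots> = f [^] m \<otimes> (y \<otimes> a)" using c assms y by (simp add: m_assoc)
    also have "\<dots> = f [^] Suc m \<otimes> z" using c assms z by (simp add: m_assoc)
    finally show ?case using z by blast
  qed
  then have "\<forall>m::nat. f [^] m divides g \<otimes> a [^] m"
    using assms(5) unfolding factor_def by blast
  then show ?thesis using assms unfolding completely_integrally_closed_def by blast
qed

text \<open>The hypothesis \<open>f \<otimes> m g = g \<otimes> m f\<close> says that
  \<open>m f / f\<close> is one and the same fraction for all nonzero \<open>f\<close> in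
  \<open>I\<close>. If it were not in the ring, then among the fractions \<open>a / f0\<close>
  outside the ring whose denominators include \<open>I\<close> there would be one whose denominators
  form a prime \<open>P\<close>. Either this fraction maps \<open>P\<close> into itself, or
  \<open>P\<close> is locally principal and the fraction maps the smaller prime \<open>c\<close>
  into itself. Complete integral closedness excludes both.\<close>

lemma (in noetherian_domain) quotient_map_is_multiplication:
  assumes cic: "completely_integrally_closed R"
    and I: "ideal I R" "f0 \<in> I" "f0 \<noteq> \<zero>"
    and ht: "\<And>P. primeideal P R \<Longrightarrow> I \<subseteq> P \<Longrightarrow> \<exists>c. primeideal c R \<and> c \<noteq> {\<zero>} \<and> c \<subset> P"
    and m: "\<And>f. f \<in> I \<Longrightarrow> m f \<in> carrier R" "\<And>f g. f \<in> I \<Longrightarrow> g \<in> I \<Longrightarrow> f \<otimes> m g = g \<otimes> m f"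
  obtains s where "s \<in> carrier R" "\<And>f. f \<in> I \<Longrightarrow> m f = s \<otimes> f"
proof -
  interpret I: ideal I R by fact
  note f0 = I.Icarr[OF I(2)]
  \<comment> \<open>\<open>colon a\<close> collects the denominators of the fraction
    \<open>a / f0\<close>.\<close>
  define colon where "colon a = {x \<in> carrier R. f0 divides x \<otimes> a}" for a
  have colon_ideal: "ideal (colon a) R" if a: "a \<in> carrier R" for a
  proof (rule cring_idealI)
    have "f0 divides \<zero> \<otimes> a" unfolding factor_def using a f0 by (intro bexI[of _ \<zero>]) simp_all
    then show "\<zero> \<in> colon a" by (simp add: colon_def)
    show "x \<oplus> y \<in> colon a" if xy: "x \<in> colon a" "y \<in> colon a" for x y
    proof -
      obtain u v where "x \<in> carrier R" "y \<in> carrier R" "u \<in> carrier R" "v \<in> carrier R" "x \<otimes> a = f0 \<otimes> u" "y \<otimes> a = f0 \<otimes> v"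
        using xy unfolding colon_def factor_def by blast
      then show ?thesis using a f0 unfolding colon_def factor_def
        by (intro CollectI conjI bexI[of _ "u \<oplus> v"]) (simp_all add: l_distr r_distr)
    qed
    show "y \<otimes> x \<in> colon a" if xy: "x \<in> colon a" "y \<in> carrier R" for x y
    proof -
      obtain u where "x \<in> carrier R" "u \<in> carrier R" "x \<otimes> a = f0 \<otimes> u"
        using xy unfolding colon_def factor_def by blast
      then show ?thesis using a f0 xy(2) unfolding colon_def factor_def
        by (intro CollectI conjI bexI[of _ "y \<otimes> u"]) (simp_all add: m_assoc m_lcomm[of y f0 u])
    qed
  qed (auto simp: colon_def)
  have "f0 divides m f0"
  proof (rule ccontr)
    assume nd: "\<not> f0 divides m f0"
    define F where "F = {colon a | a. a \<in> carrier R \<and> \<not> f0 divides a \<and> I \<subseteq> colon a}"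
    have "I \<subseteq> colon (m f0)"
    proof
      fix f assume f: "f \<in> I"
      show "f \<in> colon (m f0)"
        unfolding colon_def factor_def using m(1)[OF f] m(2)[OF f I(2)] I.Icarr[OF f] by blast
    qed
    then have ne: "F \<noteq> {}" using nd m(1)[OF I(2)] unfolding F_def by blast
    have id: "ideal J R" if "J \<in> F" for J using that colon_ideal unfolding F_def by blast
    obtain P where P: "P \<in> F" and max: "\<And>J. J \<in> F \<Longrightarrow> P \<subseteq> J \<Longrightarrow> J = P"
      using maximal_ideal_in_family[OF ne id] by blast
    from P obtain a where a: "a \<in> carrier R" "\<not> f0 divides a" "I \<subseteq> P" "P = colon a"
      unfolding F_def by blast
    interpret P: ideal P R by (rule id[OF P])
    have memP: "x \<in> P \<longleftrightarrow> x \<in> carrier R \<and> f0 divides x \<otimes> a" for x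
      by (subst a(4), subst colon_def, rule mem_Collect_eq)
    \<comment> \<open>Maximality gives primality: for \<open>y\<close> outside \<open>P\<close> the
      fraction \<open>y a / f0\<close> is again outside the ring and its denominators include
      \<open>P\<close>, so they are exactly \<open>P\<close>.\<close>
    have prime: "primeideal P R"
    proof (rule primeidealI[OF P.is_ideal is_cring])
      have "\<one> \<notin> P" using memP[of \<one>] l_one[OF a(1)] a(2) by metis
      then show "carrier R \<noteq> P" by blast
      fix x y assume xy: "x \<in> carrier R" "y \<in> carrier R" "x \<otimes> y \<in> P"
      show "x \<in> P \<or> y \<in> P"
      proof (rule ccontr)
        assume no: "\<not> ?thesis"
        have nd': "\<not> f0 divides y \<otimes> a" using no xy memP by blast
        have sub: "P \<subseteq> colon (y \<otimes> a)"
        proof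
          fix z assume z: "z \<in> P"
          then have "y \<otimes> z \<in> colon a" using P.I_l_closed xy a(4) by blast
          moreover have "z \<otimes> (y \<otimes> a) = (y \<otimes> z) \<otimes> a" using P.Icarr[OF z] xy a(1) by (simp add: m_ac)
          ultimately show "z \<in> colon (y \<otimes> a)" using P.Icarr[OF z] by (simp add: colon_def)
        qed
        then have "colon (y \<otimes> a) \<in> F" using nd' a(3) m_closed[OF xy(2) a(1)] unfolding F_def by blast
        from max[OF this sub] have "colon (y \<otimes> a) = P" .
        moreover have "x \<in> colon (y \<otimes> a)" using xy(1,2) xy(3)[unfolded memP] m_assoc[OF xy(1,2) a(1)] unfolding colon_def by auto
        ultimately show False using no by blast
      qed
    qed
    interpret P: primeideal P R by fact
    have quot: "\<exists>y\<in>carrier R. x \<otimes> a = f0 \<otimes> y" if "x \<in> P" for x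
      using that unfolding memP factor_def by blast
    obtain c where c: "primeideal c R" "c \<noteq> {\<zero>}" "c \<subset> P" using ht[OF prime a(3)] by blast
    interpret c: primeideal c R by fact
    show False
    proof (cases "\<forall>x\<in>P. \<exists>y\<in>P. x \<otimes> a = f0 \<otimes> y")
      case True
      have "f0 divides a"
        by (rule divides_if_multiplies_ideal[OF cic f0 I(3) a(1) _ _ I(3), of P])
           (use True P.Icarr a(3) I(2) in auto)
      then show False using a by blast
    next
      case False
      \<comment> \<open>The fraction takes \<open>t\<close> to an element \<open>u\<close> outside
        \<open>P\<close>. Where \<open>u\<close> is invertible, \<open>t\<close> generates
        \<open>P\<close>; \<open>key\<close> is this statement without the localisation.\<close>
      then obtain t where t: "t \<in> P" "\<And>y. y \<in> P \<Longrightarrow> t \<otimes> a \<noteq> f0 \<otimes> y" by blast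
      obtain u where u: "u \<in> carrier R" "t \<otimes> a = f0 \<otimes> u" using quot[OF t(1)] by blast
      have uP: "u \<notin> P" using t u by blast
      have key: "u \<otimes> x = t \<otimes> y" if "x \<in> P" "y \<in> carrier R" "x \<otimes> a = f0 \<otimes> y" for x y
      proof -
        note cc = P.Icarr[OF that(1)] P.Icarr[OF t(1)] that(2) u(1) a(1) f0
        have "f0 \<otimes> (u \<otimes> x) = (t \<otimes> a) \<otimes> x" using u cc by (simp add: m_assoc)
        also have "\<dots> = t \<otimes> (x \<otimes> a)" using cc by (simp add: m_ac)
        also have "\<dots> = f0 \<otimes> (t \<otimes> y)" using that(3) cc by (simp add: m_lcomm)
        finally show ?thesis using cc I(3) by (simp add: m_lcancel)
      qed
      \<comment> \<open>If \<open>c\<close> contained \<open>t\<close>, it would contain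
        \<open>u x\<close> for every \<open>x\<close> in \<open>P\<close> and hence all of
        \<open>P\<close>.\<close>
      have tc: "t \<notin> c"
      proof
        assume "t \<in> c"
        have "P \<subseteq> c"
        proof
          fix x assume x: "x \<in> P"
          obtain y where y: "y \<in> carrier R" "x \<otimes> a = f0 \<otimes> y" using quot[OF x] by blast
          have "u \<otimes> x \<in> c" using key[OF x y] \<open>t \<in> c\<close> y by (simp add: c.I_r_closed)
          then show "x \<in> c" using c.I_prime[of u x] u x P.Icarr uP c(3) by blast
        qed
        then show False using c(3) by blast
      qed
      have "\<exists>g\<in>c. g \<noteq> \<zero>" using c(2) c.zero_closed by blast
      then obtain g where g: "g \<in> c" "g \<noteq> \<zero>" by blast
      \<comment> \<open>As \<open>t\<close> lies outside \<open>c\<close>, the relation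
        \<open>u x = t y\<close> shows that the fraction maps \<open>c\<close> into itself.\<close>
      have "f0 divides a"
      proof (rule divides_if_multiplies_ideal[OF cic f0 I(3) a(1) _ g])
        show "c \<subseteq> carrier R" using c.Icarr by blast
        fix x assume x: "x \<in> c"
        then have xP: "x \<in> P" using c(3) by blast
        obtain y where y: "y \<in> carrier R" "x \<otimes> a = f0 \<otimes> y" using quot[OF xP] by blast
        have "t \<otimes> y \<in> c" using key[OF xP y] x u c.I_l_closed by metis
        then have "y \<in> c" using c.I_prime[of t y] t(1) P.Icarr y tc by blast
        then show "\<exists>y\<in>c. x \<otimes> a = f0 \<otimes> y" using y by blast
      qed
      then show False using a by blast
    qed
  qed
  then obtain s where s: "s \<in> carrier R" "m f0 = f0 \<otimes> s" by (auto simp: factor_def)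
  have "m f = s \<otimes> f" if f: "f \<in> I" for f
  proof -
    have "f0 \<otimes> m f = f0 \<otimes> (s \<otimes> f)" using m(2)[OF I(2) f] s I.Icarr[OF f] f0 by (simp add: m_ac)
    then show ?thesis using m_lcancel[OF I(3) f0 m(1)[OF f], of "s \<otimes> f"] s I.Icarr[OF f] by simp
  qed
  then show ?thesis using s that by blast
qed

text \<open>In characteristic \<open>p\<close> the \<open>p\<close>-power map at least squares the difference \<open>v\<close>; this replaces the
  Frobenius endomorphism.\<close>

lemma (in cring) pow_add_expansion:
  assumes "b \<in> carrier R" "v \<in> carrier R"
  shows "\<exists>y\<in>carrier R. (b \<oplus> v) [^] Suc m = b [^] Suc m \<oplus> ([Suc m] \<cdot> (b [^] m) \<otimes> v \<oplus> v \<otimes> v \<otimes> y)"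
proof (induction m)
  case 0
  show ?case by (intro bexI[of _ \<zero>]) (use assms in auto)
next
  case (Suc m)
  then obtain y where y: "y \<in> carrier R" "(b \<oplus> v) [^] Suc m = b [^] Suc m \<oplus> ([Suc m] \<cdot> (b [^] m) \<otimes> v \<oplus> v \<otimes> v \<otimes> y)" by blast
  let ?n = "[Suc m] \<cdot> (b [^] m)"
  have n: "?n \<in> carrier R" "b [^] m \<in> carrier R" using assms by auto
  have nb: "?n \<otimes> b = [Suc m] \<cdot> (b [^] Suc m)" using assms add_pow_ldistr[of "b [^] m" b "Suc m"] by simp
  have "(b \<oplus> v) [^] Suc (Suc m) = (b [^] Suc m \<oplus> (?n \<otimes> v \<oplus> v \<otimes> v \<otimes> y)) \<otimes> (b \<oplus> v)"
    using y by (subst nat_pow_Suc) simp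
  also have "\<dots> = b [^] Suc m \<otimes> b \<oplus> ((?n \<otimes> b) \<otimes> v \<oplus> b [^] Suc m \<otimes> v) \<oplus> v \<otimes> v \<otimes> (?n \<oplus> y \<otimes> (b \<oplus> v))"
    using assms y n by (simp del: nat_pow_Suc add: l_distr r_distr m_ac a_ac)
  also have "\<dots> = b [^] Suc (Suc m) \<oplus> ([Suc (Suc m)] \<cdot> (b [^] Suc m) \<otimes> v \<oplus> v \<otimes> v \<otimes> (?n \<oplus> y \<otimes> (b \<oplus> v)))"
    unfolding nb using assms y n by (simp add: add.nat_pow_Suc l_distr a_assoc)
  finally show ?case using assms y n by blast
qed

section \<open>Tensor products\<close>

text \<open>Beyond the two additive groups only closure under scalars is assumed. The dual Hopf
  algebra can therefore be a tensor factor without first being shown to be a module.\<close>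

locale tensor_pair =
  fixes R :: "('r, 'c) ring_scheme" and M :: "('r, 'm, 'd) module_scheme" and N :: "('r, 'n, 'e) module_scheme"
  assumes left: "abelian_group M" and right: "abelian_group N"
    and smult_left: "\<And>r x. \<lbrakk>r \<in> carrier R; x \<in> carrier M\<rbrakk> \<Longrightarrow> r \<odot>\<^bsub>M\<^esub> x \<in> carrier M"
    and smult_right: "\<And>r y. \<lbrakk>r \<in> carrier R; y \<in> carrier N\<rbrakk> \<Longrightarrow> r \<odot>\<^bsub>N\<^esub> y \<in> carrier N"
begin

abbreviation "\<F> \<equiv> free_Abelian_group (carrier M \<times> carrier N)"
abbreviation "\<K> \<equiv> tensor_kernel R M N"
abbreviation "T \<equiv> tensor R M N"
abbreviation "\<tau> \<equiv> pure_tensor R M N"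

lemma rels_closed: "tensor_rels R M N \<subseteq> carrier \<F>"
proof -
  interpret M: abelian_group M by (rule left)
  interpret N: abelian_group N by (rule right)
  have 2: "Poly_Mapping.keys (frag_of p - frag_of q) \<subseteq> carrier M \<times> carrier N"
    if "p \<in> carrier M \<times> carrier N" "q \<in> carrier M \<times> carrier N" for p q
    using that keys_diff[of "frag_of p" "frag_of q"] by auto
  have 3: "Poly_Mapping.keys (frag_of p - frag_of q - frag_of r) \<subseteq> carrier M \<times> carrier N"
    if "p \<in> carrier M \<times> carrier N" "q \<in> carrier M \<times> carrier N" "r \<in> carrier M \<times> carrier N" for p q r
    using that 2[of p q] keys_diff[of "frag_of p - frag_of q" "frag_of r"] by auto
  show ?thesis
    unfolding tensor_rels_def
    by (intro Un_least subsetI; elim CollectE exE conjE; hypsubst)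
       (simp_all only: carrier_free_Abelian_group_iff, (rule 2 3; simp add: smult_left smult_right)+)
qed

lemma kernel_subgroup: "subgroup \<K> \<F>"
  unfolding tensor_kernel_def by (rule group.generate_is_subgroup) (use rels_closed in auto)

lemma kernel_normal: "\<K> \<lhd> \<F>"
  by (rule comm_group.subgroup_imp_normal[OF abelian_free_Abelian_group kernel_subgroup])

lemma comm_group_tensor: "comm_group (tensor_group R M N)"
  unfolding tensor_group_def
  by (rule comm_group.abelian_FactGroup[OF abelian_free_Abelian_group kernel_subgroup])

lemma tensor_group_simps:
  "carrier (tensor_group R M N) = carrier T"
  "monoid.mult (tensor_group R M N) = add T"
  "one (tensor_group R M N) = \<zero>\<^bsub>T\<^esub>"
  by (simp_all add: tensor_def Let_def)

lemma group_facts: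
  "comm_group (tensor_group R M N)" "carrier (tensor_group R M N) = carrier T"
  "monoid.mult (tensor_group R M N) = add T"
  by (simp_all add: comm_group_tensor tensor_group_simps)

lemma abelian_group_tensor: "abelian_group T"
proof -
  interpret G: comm_group "tensor_group R M N" by (rule comm_group_tensor)
  have inv: "\<exists>y\<in>carrier T. y \<oplus>\<^bsub>T\<^esub> x = \<zero>\<^bsub>T\<^esub>" if "x \<in> carrier T" for x
    using G.l_inv_ex that by (simp add: tensor_group_simps)
  show ?thesis
    by (rule abelian_groupI)
       (use G.m_closed G.one_closed G.m_assoc G.m_comm G.l_one inv in \<open>simp_all add: tensor_group_simps\<close>)
qed

sublocale T: abelian_group T by (rule abelian_group_tensor)

lemma carrier_tensor: "carrier T = (\<lambda>c. \<K> #>\<^bsub>\<F>\<^esub> c) ` carrier \<F>"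
  by (simp add: tensor_def Let_def tensor_group_def carrier_FactGroup)

lemma zero_tensor: "\<zero>\<^bsub>T\<^esub> = \<K>"
  by (simp add: tensor_def Let_def tensor_group_def)

lemma add_coset:
  assumes "c \<in> carrier \<F>" "d \<in> carrier \<F>"
  shows "(\<K> #>\<^bsub>\<F>\<^esub> c) \<oplus>\<^bsub>T\<^esub> (\<K> #>\<^bsub>\<F>\<^esub> d) = \<K> #>\<^bsub>\<F>\<^esub> (c + d)"
  using normal.rcos_sum[OF kernel_normal assms]
  by (simp add: tensor_def Let_def tensor_group_def)

lemma coset_eq:
  assumes "c \<in> carrier \<F>" "d \<in> carrier \<F>" "c - d \<in> \<K>"
  shows "\<K> #>\<^bsub>\<F>\<^esub> c = \<K> #>\<^bsub>\<F>\<^esub> d"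
proof -
  have "(c - d) + d \<in> \<K> #>\<^bsub>\<F>\<^esub> d"
    using assms(3) unfolding r_coset_def by force
  then have "c \<in> \<K> #>\<^bsub>\<F>\<^esub> d" by simp
  then show ?thesis
    using group.repr_independence[OF group_free_Abelian_group _ assms(2) kernel_subgroup] by metis
qed

lemma pure_closed [simp, intro]: "x \<in> carrier M \<Longrightarrow> y \<in> carrier N \<Longrightarrow> \<tau> x y \<in> carrier T"
  by (auto simp: carrier_tensor pure_tensor_def simp del: carrier_free_Abelian_group_iff)

lemma rel_in_kernel: "u \<in> tensor_rels R M N \<Longrightarrow> u \<in> \<K>"
  unfolding tensor_kernel_def by (rule generate.incl)

lemma pure_add_left:
  assumes "x \<in> carrier M" "x' \<in> carrier M" "y \<in> carrier N"
  shows "\<tau> (x \<oplus>\<^bsub>M\<^esub> x') y = \<tau> x y \<oplus>\<^bsub>T\<^esub> \<tau> x' y"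
proof -
  interpret M: abelian_group M by (rule left)
  have c: "frag_of (x, y) \<in> carrier \<F>" "frag_of (x', y) \<in> carrier \<F>" "frag_of (x \<oplus>\<^bsub>M\<^esub> x', y) \<in> carrier \<F>"
    using assms by auto
  have s: "frag_of (x, y) + frag_of (x', y) \<in> carrier \<F>"
    using subgroup.m_closed[OF group.subgroup_self[OF group_free_Abelian_group] c(1,2)] by simp
  have "frag_of (x \<oplus>\<^bsub>M\<^esub> x', y) - frag_of (x, y) - frag_of (x', y) \<in> \<K>"
    by (rule rel_in_kernel) (use assms in \<open>auto simp: tensor_rels_def\<close>)
  then show ?thesis
    unfolding pure_tensor_def add_coset[OF c(1,2)]
    by (intro coset_eq c s) (simp add: algebra_simps)
qed

lemma pure_add_right:
  assumes "x \<in> carrier M" "y \<in> carrier N" "y' \<in> carrier N"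
  shows "\<tau> x (y \<oplus>\<^bsub>N\<^esub> y') = \<tau> x y \<oplus>\<^bsub>T\<^esub> \<tau> x y'"
proof -
  interpret N: abelian_group N by (rule right)
  have c: "frag_of (x, y) \<in> carrier \<F>" "frag_of (x, y') \<in> carrier \<F>" "frag_of (x, y \<oplus>\<^bsub>N\<^esub> y') \<in> carrier \<F>"
    using assms by auto
  have s: "frag_of (x, y) + frag_of (x, y') \<in> carrier \<F>"
    using subgroup.m_closed[OF group.subgroup_self[OF group_free_Abelian_group] c(1,2)] by simp
  have "frag_of (x, y \<oplus>\<^bsub>N\<^esub> y') - frag_of (x, y) - frag_of (x, y') \<in> \<K>"
    by (rule rel_in_kernel) (use assms in \<open>auto simp: tensor_rels_def\<close>)
  then show ?thesis
    unfolding pure_tensor_def add_coset[OF c(1,2)]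
    by (intro coset_eq c s) (simp add: algebra_simps)
qed

lemma pure_smult:
  assumes "r \<in> carrier R" "x \<in> carrier M" "y \<in> carrier N"
  shows "\<tau> (r \<odot>\<^bsub>M\<^esub> x) y = \<tau> x (r \<odot>\<^bsub>N\<^esub> y)"
  unfolding pure_tensor_def
proof (rule coset_eq)
  show "frag_of (r \<odot>\<^bsub>M\<^esub> x, y) - frag_of (x, r \<odot>\<^bsub>N\<^esub> y) \<in> \<K>"
    by (rule rel_in_kernel) (use assms in \<open>auto simp: tensor_rels_def\<close>)
qed (use assms smult_left smult_right in auto)

lemma pure_zero_left: "y \<in> carrier N \<Longrightarrow> \<tau> \<zero>\<^bsub>M\<^esub> y = \<zero>\<^bsub>T\<^esub>"
proof -
  assume y: "y \<in> carrier N"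
  interpret M: abelian_group M by (rule left)
  have "\<tau> \<zero>\<^bsub>M\<^esub> y \<oplus>\<^bsub>T\<^esub> \<tau> \<zero>\<^bsub>M\<^esub> y = \<tau> \<zero>\<^bsub>M\<^esub> y"
    using pure_add_left[of "\<zero>\<^bsub>M\<^esub>" "\<zero>\<^bsub>M\<^esub>" y] y by simp
  then show ?thesis using y by (metis M.zero_closed T.add.r_cancel_one pure_closed)
qed

lemma pure_minus_left: "x \<in> carrier M \<Longrightarrow> y \<in> carrier N \<Longrightarrow> \<tau> (\<ominus>\<^bsub>M\<^esub> x) y = \<ominus>\<^bsub>T\<^esub> \<tau> x y"
proof -
  assume xy: "x \<in> carrier M" "y \<in> carrier N"
  interpret M: abelian_group M by (rule left)
  have "\<tau> (\<ominus>\<^bsub>M\<^esub> x) y \<oplus>\<^bsub>T\<^esub> \<tau> x y = \<zero>\<^bsub>T\<^esub>"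
    using pure_add_left[of "\<ominus>\<^bsub>M\<^esub> x" x y] xy by (simp add: M.l_neg pure_zero_left)
  then show ?thesis using xy by (simp add: T.minus_equality)
qed

text \<open>Sums of pure tensors exhaust the tensor product, without negatives, because
  \<open>- (x \<otimes> y)\<close> is the pure tensor of \<open>- x\<close> and
  \<open>y\<close>.\<close>

lemma tensor_induct [consumes 1, case_names pure add]:
  assumes z: "z \<in> carrier T"
    and pure: "\<And>x y. x \<in> carrier M \<Longrightarrow> y \<in> carrier N \<Longrightarrow> P (\<tau> x y)"
    and add: "\<And>z w. z \<in> carrier T \<Longrightarrow> w \<in> carrier T \<Longrightarrow> P z \<Longrightarrow> P w \<Longrightarrow> P (z \<oplus>\<^bsub>T\<^esub> w)"
  shows "P z"
proof -
  interpret M: abelian_group M by (rule left)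
  interpret N: abelian_group N by (rule right)
  obtain c where c: "Poly_Mapping.keys c \<subseteq> carrier M \<times> carrier N" "z = \<K> #>\<^bsub>\<F>\<^esub> c"
    using z by (auto simp: carrier_tensor)
  have cl: "\<K> #>\<^bsub>\<F>\<^esub> c \<in> carrier T" if "Poly_Mapping.keys c \<subseteq> carrier M \<times> carrier N" for c
    using that by (auto simp: carrier_tensor)
  have zero: "P \<zero>\<^bsub>T\<^esub>" "\<K> #>\<^bsub>\<F>\<^esub> 0 = \<zero>\<^bsub>T\<^esub>"
    using pure[of "\<zero>\<^bsub>M\<^esub>" "\<zero>\<^bsub>N\<^esub>"] pure_zero_left[of "\<zero>\<^bsub>N\<^esub>"]
      group.coset_join2[OF group_free_Abelian_group _ kernel_subgroup, of 0]
      subgroup.one_closed[OF kernel_subgroup]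
    by (auto simp: zero_tensor)
  \<comment> \<open>Both signs are carried along because the induction on the free abelian group
    passes from \<open>a\<close> and \<open>b\<close> to \<open>a - b\<close>.\<close>
  have minus: "P (\<ominus>\<^bsub>T\<^esub> w) \<and> P w"
    if "Poly_Mapping.keys c \<subseteq> carrier M \<times> carrier N" "w = \<K> #>\<^bsub>\<F>\<^esub> c" for c w
    using that
  proof (induction arbitrary: w rule: free_Abelian_group_induct [consumes 1, case_names 1 2 3])
    case 1
    have "\<ominus>\<^bsub>T\<^esub> \<zero>\<^bsub>T\<^esub> = \<zero>\<^bsub>T\<^esub>" by (rule T.minus_equality) simp_all
    then show ?case using zero 1 by metis
  next
    case (2 a b)
    let ?a = "\<K> #>\<^bsub>\<F>\<^esub> a" and ?b = "\<K> #>\<^bsub>\<F>\<^esub> b"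
    note cl' = cl[OF 2(1)] cl[OF 2(2)]
    have ab: "Poly_Mapping.keys (a - b) \<subseteq> carrier M \<times> carrier N"
      using 2(1,2) keys_diff[of a b] by blast
    have "w \<oplus>\<^bsub>T\<^esub> ?b = ?a" using add_coset[of "a - b" b] 2 ab by simp
    then have w: "w = ?a \<oplus>\<^bsub>T\<^esub> \<ominus>\<^bsub>T\<^esub> ?b"
      using cl' cl[OF ab] 2(5) by (metis T.add.m_assoc T.add.r_inv T.minus_closed T.r_zero T.a_inv_closed)
    then have "\<ominus>\<^bsub>T\<^esub> w = \<ominus>\<^bsub>T\<^esub> ?a \<oplus>\<^bsub>T\<^esub> ?b"
      using cl' by (simp add: T.minus_add)
    then show ?case using w 2(3,4) cl' add by simp
  next
    case (3 a)
    obtain x y where a: "a = (x, y)" "x \<in> carrier M" "y \<in> carrier N" using 3 by auto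
    then have "w = \<tau> x y" using 3 by (simp add: pure_tensor_def)
    then show ?case using pure[of "\<ominus>\<^bsub>M\<^esub> x" y] pure[of x y] a by (simp add: pure_minus_left)
  qed
  show ?thesis using minus[OF c] by simp
qed

end

section \<open>Balanced maps and the universal property of the tensor product\<close>

definition balanced ::
    "('r, 'c) ring_scheme \<Rightarrow> ('r, 'm, 'd) module_scheme \<Rightarrow> ('r, 'n, 'e) module_scheme \<Rightarrow>
     ('g, 'h) ring_scheme \<Rightarrow> ('m \<Rightarrow> 'n \<Rightarrow> 'g) \<Rightarrow> bool" where
  "balanced R M N V b \<longleftrightarrow>
     (\<forall>x\<in>carrier M. \<forall>y\<in>carrier N. b x y \<in> carrier V) \<and>
     (\<forall>x\<in>carrier M. \<forall>x'\<in>carrier M. \<forall>y\<in>carrier N. b (x \<oplus>\<^bsub>M\<^esub> x') y = b x y \<oplus>\<^bsub>V\<^esub> b x' y) \<and>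
     (\<forall>x\<in>carrier M. \<forall>y\<in>carrier N. \<forall>y'\<in>carrier N. b x (y \<oplus>\<^bsub>N\<^esub> y') = b x y \<oplus>\<^bsub>V\<^esub> b x y') \<and>
     (\<forall>r\<in>carrier R. \<forall>x\<in>carrier M. \<forall>y\<in>carrier N. b (r \<odot>\<^bsub>M\<^esub> x) y = b x (r \<odot>\<^bsub>N\<^esub> y))"

lemma balancedI:
  assumes "\<And>x y. x \<in> carrier M \<Longrightarrow> y \<in> carrier N \<Longrightarrow> b x y \<in> carrier V"
    and "\<And>x x' y. x \<in> carrier M \<Longrightarrow> x' \<in> carrier M \<Longrightarrow> y \<in> carrier N \<Longrightarrow> b (x \<oplus>\<^bsub>M\<^esub> x') y = b x y \<oplus>\<^bsub>V\<^esub> b x' y"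
    and "\<And>x y y'. x \<in> carrier M \<Longrightarrow> y \<in> carrier N \<Longrightarrow> y' \<in> carrier N \<Longrightarrow> b x (y \<oplus>\<^bsub>N\<^esub> y') = b x y \<oplus>\<^bsub>V\<^esub> b x y'"
    and "\<And>r x y. r \<in> carrier R \<Longrightarrow> x \<in> carrier M \<Longrightarrow> y \<in> carrier N \<Longrightarrow> b (r \<odot>\<^bsub>M\<^esub> x) y = b x (r \<odot>\<^bsub>N\<^esub> y)"
  shows "balanced R M N V b"
  using assms by (simp add: balanced_def)

definition additive :: "('a, 'b) ring_scheme \<Rightarrow> ('c, 'd) ring_scheme \<Rightarrow> ('a \<Rightarrow> 'c) \<Rightarrow> bool" where
  "additive V Y f \<longleftrightarrow> (\<forall>x\<in>carrier V. f x \<in> carrier Y) \<and>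
     (\<forall>x\<in>carrier V. \<forall>y\<in>carrier V. f (x \<oplus>\<^bsub>V\<^esub> y) = f x \<oplus>\<^bsub>Y\<^esub> f y)"

lemma additiveI:
  assumes "\<And>x. x \<in> carrier V \<Longrightarrow> f x \<in> carrier Y"
    and "\<And>x y. x \<in> carrier V \<Longrightarrow> y \<in> carrier V \<Longrightarrow> f (x \<oplus>\<^bsub>V\<^esub> y) = f x \<oplus>\<^bsub>Y\<^esub> f y"
  shows "additive V Y f"
  using assms by (simp add: additive_def)

lemma additive_closed: "additive V Y f \<Longrightarrow> x \<in> carrier V \<Longrightarrow> f x \<in> carrier Y"
  by (simp add: additive_def)

lemma additive_add:
  "additive V Y f \<Longrightarrow> x \<in> carrier V \<Longrightarrow> y \<in> carrier V \<Longrightarrow> f (x \<oplus>\<^bsub>V\<^esub> y) = f x \<oplus>\<^bsub>Y\<^esub> f y"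
  by (simp add: additive_def)

lemma additive_zero:
  assumes "abelian_group V" "abelian_group Y" "additive V Y f"
  shows "f \<zero>\<^bsub>V\<^esub> = \<zero>\<^bsub>Y\<^esub>"
proof -
  interpret V: abelian_group V by fact
  interpret Y: abelian_group Y by fact
  have "f \<zero>\<^bsub>V\<^esub> \<oplus>\<^bsub>Y\<^esub> f \<zero>\<^bsub>V\<^esub> = f \<zero>\<^bsub>V\<^esub>"
    using additive_add[OF assms(3), of "\<zero>\<^bsub>V\<^esub>" "\<zero>\<^bsub>V\<^esub>"] by simp
  then show ?thesis using additive_closed[OF assms(3), of "\<zero>\<^bsub>V\<^esub>"]
    by (metis V.zero_closed Y.add.r_cancel_one)
qed

lemma additive_minus:
  assumes "abelian_group V" "abelian_group Y" "additive V Y f" "x \<in> carrier V"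
  shows "f (\<ominus>\<^bsub>V\<^esub> x) = \<ominus>\<^bsub>Y\<^esub> f x"
proof -
  interpret V: abelian_group V by fact
  interpret Y: abelian_group Y by fact
  have "f (\<ominus>\<^bsub>V\<^esub> x) \<oplus>\<^bsub>Y\<^esub> f x = \<zero>\<^bsub>Y\<^esub>"
    using additive_add[OF assms(3), of "\<ominus>\<^bsub>V\<^esub> x" x] additive_zero[OF assms(1-3)] assms(4)
    by (simp add: V.l_neg)
  then show ?thesis using additive_closed[OF assms(3)] assms(4)
    by (metis V.a_inv_closed Y.minus_equality)
qed

lemma additive_diff:
  assumes "abelian_group V" "abelian_group Y" "additive V Y f" "x \<in> carrier V" "y \<in> carrier V"
  shows "f (x \<ominus>\<^bsub>V\<^esub> y) = f x \<ominus>\<^bsub>Y\<^esub> f y"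
  using assms by (simp add: a_minus_def additive_add additive_minus abelian_group.a_inv_closed)

lemma additive_finsum:
  assumes "abelian_group V" "abelian_group Y" "additive V Y f" "finite I" "\<And>i. i \<in> I \<Longrightarrow> g i \<in> carrier V"
  shows "f (finsum V g I) = finsum Y (\<lambda>i. f (g i)) I"
  using assms(4,5)
proof (induction I)
  case empty
  then show ?case using additive_zero[OF assms(1-3)] assms(1,2)
    by (simp add: abelian_monoid.finsum_empty abelian_group_def)
next
  case (insert i I)
  interpret V: abelian_group V by fact
  interpret Y: abelian_group Y by fact
  have "finsum V g (insert i I) = g i \<oplus>\<^bsub>V\<^esub> finsum V g I"
    by (rule V.finsum_insert) (use insert in auto)
  moreover have "finsum Y (\<lambda>i. f (g i)) (insert i I) = f (g i) \<oplus>\<^bsub>Y\<^esub> finsum Y (\<lambda>i. f (g i)) I"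
    by (rule Y.finsum_insert) (use insert additive_closed[OF assms(3)] in auto)
  moreover have "finsum V g I \<in> carrier V" by (rule V.finsum_closed) (use insert in auto)
  ultimately show ?case using insert by (simp add: additive_add[OF assms(3)])
qed

context tensor_pair
begin

text \<open>The target is a group \<open>G\<close> having the carrier and the sum of
  \<open>V\<close>, because some lifts end in an \<open>add_monoid\<close> and others in a
  \<open>tensor_group\<close>. One proof then serves both.\<close>

lemma
  assumes G: "comm_group G" "carrier G = carrier V" "monoid.mult G = add V" and b: "balanced R M N V b"
  shows lift_pure': "x \<in> carrier M \<Longrightarrow> y \<in> carrier N \<Longrightarrow> tensor_lift G b (\<tau> x y) = b x y"
    and lift_additive': "additive T V (tensor_lift G b)"
proof -
  interpret G: comm_group G by (rule G)
  note Gs [simp] = G(2,3)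
  interpret M: abelian_group M by (rule left)
  interpret N: abelian_group N by (rule right)
  let ?l = "tensor_lift (G) b"
  note bs = b[unfolded balanced_def]
  show pure: "?l (\<tau> x y) = b x y" if "x \<in> carrier M" "y \<in> carrier N" for x y
    by (rule tensor_lift_pure[OF G(1) left right smult_left smult_right]) (use bs that in auto)
  define \<Phi> where "\<Phi> = (\<lambda>c :: _ \<Rightarrow>\<^sub>0 int. finprod (G) (\<lambda>(x, y). b x y [^]\<^bsub>G\<^esub> Poly_Mapping.lookup c (x, y)) (Poly_Mapping.keys c))"
  have cls: "?l (\<K> #>\<^bsub>\<F>\<^esub> c) = \<Phi> c" if "c \<in> carrier \<F>" for c
    unfolding \<Phi>_def
    by (rule tensor_lift_class[OF G(1) left right smult_left smult_right]) (use bs that in auto)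
  define f where "f = (\<lambda>(x, y). b x y)"
  have f: "f p \<in> carrier V" if "p \<in> carrier M \<times> carrier N" for p using that bs by (auto simp: f_def)
  \<comment> \<open>The product may be taken over any larger finite set, which allows two
    combinations to be compared over the union of their supports.\<close>
  have \<Phi>_ext: "\<Phi> u = finprod (G) (\<lambda>p. f p [^]\<^bsub>G\<^esub> Poly_Mapping.lookup u p) L"
    if "Poly_Mapping.keys u \<subseteq> L" "finite L" "L \<subseteq> carrier M \<times> carrier N" for u L
    unfolding \<Phi>_def
    by (rule G.finprod_mono_neutral_cong_left)
       (use that f G.int_pow_closed[unfolded Gs] in
         \<open>auto simp: in_keys_iff f_def Pi_iff simp del: mem_Times_iff split_paired_All\<close>)
  have add: "\<Phi> (u + v) = \<Phi> u \<oplus>\<^bsub>V\<^esub> \<Phi> v"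
    if "Poly_Mapping.keys u \<subseteq> carrier M \<times> carrier N" "Poly_Mapping.keys v \<subseteq> carrier M \<times> carrier N" for u v
  proof -
    let ?L = "Poly_Mapping.keys u \<union> Poly_Mapping.keys v"
    have L: "finite ?L" "?L \<subseteq> carrier M \<times> carrier N" "Poly_Mapping.keys (u + v) \<subseteq> ?L"
      using that keys_add[of u v] by auto
    have "\<Phi> (u + v) = finprod (G) (\<lambda>p. f p [^]\<^bsub>G\<^esub> Poly_Mapping.lookup u p
                         \<otimes>\<^bsub>G\<^esub> f p [^]\<^bsub>G\<^esub> Poly_Mapping.lookup v p) ?L"
      unfolding \<Phi>_ext[OF L(3,1,2)]
      by (rule G.finprod_cong')
         (use L(2) f G.int_pow_closed in \<open>auto simp: lookup_add Pi_iff subset_iff G.int_pow_mult [symmetric, unfolded Gs]\<close>)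
    also have "\<dots> = finprod (G) (\<lambda>p. f p [^]\<^bsub>G\<^esub> Poly_Mapping.lookup u p) ?L
                      \<otimes>\<^bsub>G\<^esub> finprod (G) (\<lambda>p. f p [^]\<^bsub>G\<^esub> Poly_Mapping.lookup v p) ?L"
      by (rule G.finprod_multf)
         (use L(2) f G.int_pow_closed in \<open>auto simp: Pi_iff subset_iff\<close>)
    finally show ?thesis using \<Phi>_ext[of u ?L] \<Phi>_ext[of v ?L] L by simp
  qed
  have \<Phi>_closed: "\<Phi> u \<in> carrier V" if "Poly_Mapping.keys u \<subseteq> carrier M \<times> carrier N" for u
  proof -
    have "f p [^]\<^bsub>G\<^esub> Poly_Mapping.lookup u p \<in> carrier G" if "p \<in> Poly_Mapping.keys u" for p
    proof -
      have "p \<in> carrier M \<times> carrier N"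
        using that \<open>Poly_Mapping.keys u \<subseteq> carrier M \<times> carrier N\<close> by (rule rev_subsetD)
      then show ?thesis using f by (intro G.int_pow_closed) simp
    qed
    then have "finprod G (\<lambda>p. f p [^]\<^bsub>G\<^esub> Poly_Mapping.lookup u p) (Poly_Mapping.keys u) \<in> carrier G"
      by (intro G.finprod_closed) blast
    then show ?thesis using \<Phi>_ext[OF order_refl finite_keys that] by simp
  qed
  show "additive T V ?l"
  proof (rule additiveI)
    show "?l z \<in> carrier V" if "z \<in> carrier T" for z
      using that cls \<Phi>_closed by (auto simp: carrier_tensor)
    show "?l (z \<oplus>\<^bsub>T\<^esub> w) = ?l z \<oplus>\<^bsub>V\<^esub> ?l w" if zw: "z \<in> carrier T" "w \<in> carrier T" for z w
    proof -
      obtain c d where cd: "c \<in> carrier \<F>" "z = \<K> #>\<^bsub>\<F>\<^esub> c" "d \<in> carrier \<F>" "w = \<K> #>\<^bsub>\<F>\<^esub> d"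
        using zw[unfolded carrier_tensor] by (elim imageE) simp
      have "Poly_Mapping.keys (c + d) \<subseteq> carrier M \<times> carrier N"
        using cd(1,3) keys_add[of c d] by auto
      then show ?thesis using cd add_coset[of c d] cls[of c] cls[of d] cls[of "c + d"] add[of c d] by simp
    qed
  qed
qed

lemma
  assumes V: "abelian_group V" and b: "balanced R M N V b"
  shows lift_pure: "x \<in> carrier M \<Longrightarrow> y \<in> carrier N \<Longrightarrow> tensor_lift (add_monoid V) b (\<tau> x y) = b x y"
    and lift_additive: "additive T V (tensor_lift (add_monoid V) b)"
proof -
  interpret V: abelian_group V by fact
  show "x \<in> carrier M \<Longrightarrow> y \<in> carrier N \<Longrightarrow> tensor_lift (add_monoid V) b (\<tau> x y) = b x y"
    and "additive T V (tensor_lift (add_monoid V) b)"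
    using lift_pure'[OF V.a_comm_group _ _ b] lift_additive'[OF V.a_comm_group _ _ b] by auto
qed

lemmas lift_add' = additive_add[OF lift_additive']

text \<open>Most identities on tensor products below come from this rule: both sides are additive in
  one variable, so that variable may be taken to be a pure tensor. Several variables are treated one
  after the other.\<close>

lemma additive_eqI:
  assumes "additive T V f" "additive T V g" "\<And>x y. x \<in> carrier M \<Longrightarrow> y \<in> carrier N \<Longrightarrow> f (\<tau> x y) = g (\<tau> x y)"
    and "z \<in> carrier T"
  shows "f z = g z"
  using assms(4) by (induction rule: tensor_induct) (simp_all add: assms additive_add[OF assms(1)] additive_add[OF assms(2)])

end

lemma additive_plus:
  assumes "abelian_group V" "additive U V f" "additive U V g"
  shows "additive U V (\<lambda>z. f z \<oplus>\<^bsub>V\<^esub> g z)"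
proof -
  interpret V: abelian_group V by fact
  show ?thesis
    by (rule additiveI) (simp_all add: assms(2,3)[THEN additive_closed] assms(2,3)[THEN additive_add] V.a_ac)
qed

lemma additive_comp: "additive U V f \<Longrightarrow> additive V W g \<Longrightarrow> additive U W (\<lambda>z. g (f z))"
  by (simp add: additive_def)

lemma additive_id: "additive U U (\<lambda>z. z)"
  by (simp add: additive_def)

text \<open>This makes nested lifts legitimate. For fixed \<open>w\<close> each law required of the
  inner lift is an equation between additive functions of \<open>w\<close>, hence needs checking
  only for pure \<open>w\<close>, where it is the corresponding law of \<open>f\<close>. The
  products of tensor algebras and of the smash product have this nested shape.\<close>

lemma balanced_lift:
  assumes P: "tensor_pair R M N" and Q: "tensor_pair R' M' N'"
    and G: "comm_group G" "carrier G = carrier V" "monoid.mult G = add V" and V: "abelian_group V"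
    and 1: "\<And>x y. x \<in> carrier M \<Longrightarrow> y \<in> carrier N \<Longrightarrow> balanced R' M' N' V (f x y)"
    and 2: "\<And>x' y'. x' \<in> carrier M' \<Longrightarrow> y' \<in> carrier N' \<Longrightarrow> balanced R M N V (\<lambda>x y. f x y x' y')"
    and w: "w \<in> carrier (tensor R' M' N')"
  shows "balanced R M N V (\<lambda>x y. tensor_lift G (f x y) w)"
proof -
  interpret P: tensor_pair R M N by fact
  interpret Q: tensor_pair R' M' N' by fact
  interpret M: abelian_group M by (rule P.left)
  interpret N: abelian_group N by (rule P.right)
  note la = Q.lift_additive'[OF G 1] and lp = Q.lift_pure'[OF G 1]
  note b2 = 2[unfolded balanced_def]
  show ?thesis
  proof (rule balancedI)
    show "tensor_lift G (f x y) w \<in> carrier V" if "x \<in> carrier M" "y \<in> carrier N" for x y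
      using additive_closed[OF la[OF that] w] .
    show "tensor_lift G (f (x \<oplus>\<^bsub>M\<^esub> x') y) w = tensor_lift G (f x y) w \<oplus>\<^bsub>V\<^esub> tensor_lift G (f x' y) w"
      if "x \<in> carrier M" "x' \<in> carrier M" "y \<in> carrier N" for x x' y
      by (rule Q.additive_eqI[OF _ _ _ w]) (use that b2 in \<open>auto intro!: additive_plus la V simp: lp\<close>)
    show "tensor_lift G (f x (y \<oplus>\<^bsub>N\<^esub> y')) w = tensor_lift G (f x y) w \<oplus>\<^bsub>V\<^esub> tensor_lift G (f x y') w"
      if "x \<in> carrier M" "y \<in> carrier N" "y' \<in> carrier N" for x y y'
      by (rule Q.additive_eqI[OF _ _ _ w]) (use that b2 in \<open>auto intro!: additive_plus la V simp: lp\<close>)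
    show "tensor_lift G (f (r \<odot>\<^bsub>M\<^esub> x) y) w = tensor_lift G (f x (r \<odot>\<^bsub>N\<^esub> y)) w"
      if "r \<in> carrier R" "x \<in> carrier M" "y \<in> carrier N" for r x y
      by (rule Q.additive_eqI[OF _ _ _ w])
         (use that b2 P.smult_left P.smult_right in \<open>auto intro!: la V simp: lp\<close>)
  qed
qed

section \<open>The tensor product of two commutative algebras\<close>

locale tensor_algebra =
  fixes R :: "('r, 'c) ring_scheme" and M :: "('r, 'm, 'd) module_scheme" and N :: "('r, 'n, 'e) module_scheme"
  assumes left_algebra: "algebra R M" and right_algebra: "algebra R N"

sublocale tensor_algebra \<subseteq> tensor_pair R M N
proof -
  interpret M: algebra R M by (rule left_algebra)
  interpret N: algebra R N by (rule right_algebra)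
  show "tensor_pair R M N"
    by unfold_locales simp_all
qed

context tensor_algebra
begin

lemma mult_eq: "z \<otimes>\<^bsub>T\<^esub> w = tensor_lift (tensor_group R M N) (\<lambda>x y. tensor_lift (tensor_group R M N)
    (\<lambda>x' y'. \<tau> (x \<otimes>\<^bsub>M\<^esub> x') (y \<otimes>\<^bsub>N\<^esub> y')) w) z"
  by (simp add: tensor_def Let_def)

lemma mult_balanced:
  shows mult_balanced_left: "x' \<in> carrier M \<Longrightarrow> y' \<in> carrier N \<Longrightarrow> balanced R M N T (\<lambda>x y. \<tau> (x \<otimes>\<^bsub>M\<^esub> x') (y \<otimes>\<^bsub>N\<^esub> y'))"
    and mult_balanced_right: "x \<in> carrier M \<Longrightarrow> y \<in> carrier N \<Longrightarrow> balanced R M N T (\<lambda>x' y'. \<tau> (x \<otimes>\<^bsub>M\<^esub> x') (y \<otimes>\<^bsub>N\<^esub> y'))"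
proof -
  interpret M: algebra R M by (rule left_algebra)
  interpret N: algebra R N by (rule right_algebra)
  have r: "x \<otimes>\<^bsub>M\<^esub> (r \<odot>\<^bsub>M\<^esub> y) = r \<odot>\<^bsub>M\<^esub> (x \<otimes>\<^bsub>M\<^esub> y)" if "r \<in> carrier R" "x \<in> carrier M" "y \<in> carrier M" for r x y
    using that by (metis M.m_comm M.smult_assoc2 M.smult_closed)
  have r': "x \<otimes>\<^bsub>N\<^esub> (r \<odot>\<^bsub>N\<^esub> y) = r \<odot>\<^bsub>N\<^esub> (x \<otimes>\<^bsub>N\<^esub> y)" if "r \<in> carrier R" "x \<in> carrier N" "y \<in> carrier N" for r x y
    using that by (metis N.m_comm N.smult_assoc2 N.smult_closed)
  show "x' \<in> carrier M \<Longrightarrow> y' \<in> carrier N \<Longrightarrow> balanced R M N T (\<lambda>x y. \<tau> (x \<otimes>\<^bsub>M\<^esub> x') (y \<otimes>\<^bsub>N\<^esub> y'))"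
    by (rule balancedI) (simp_all add: M.l_distr N.l_distr pure_add_left pure_add_right M.smult_assoc2 N.smult_assoc2 pure_smult)
  show "x \<in> carrier M \<Longrightarrow> y \<in> carrier N \<Longrightarrow> balanced R M N T (\<lambda>x' y'. \<tau> (x \<otimes>\<^bsub>M\<^esub> x') (y \<otimes>\<^bsub>N\<^esub> y'))"
    by (rule balancedI) (simp_all add: M.r_distr N.r_distr pure_add_left pure_add_right r r' pure_smult)
qed

lemma mult_additive_left: "w \<in> carrier T \<Longrightarrow> additive T T (\<lambda>z. z \<otimes>\<^bsub>T\<^esub> w)"
  unfolding mult_eq
  by (rule lift_additive'[OF group_facts])
     (rule balanced_lift[OF tensor_pair_axioms tensor_pair_axioms group_facts T.abelian_group_axioms mult_balanced_right mult_balanced_left])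

lemma mult_pure_left:
  "w \<in> carrier T \<Longrightarrow> x \<in> carrier M \<Longrightarrow> y \<in> carrier N \<Longrightarrow>
   \<tau> x y \<otimes>\<^bsub>T\<^esub> w = tensor_lift (tensor_group R M N) (\<lambda>x' y'. \<tau> (x \<otimes>\<^bsub>M\<^esub> x') (y \<otimes>\<^bsub>N\<^esub> y')) w"
  unfolding mult_eq
  by (rule lift_pure'[OF group_facts])
     (rule balanced_lift[OF tensor_pair_axioms tensor_pair_axioms group_facts T.abelian_group_axioms mult_balanced_right mult_balanced_left])

lemma mult_pure:
  "x \<in> carrier M \<Longrightarrow> y \<in> carrier N \<Longrightarrow> x' \<in> carrier M \<Longrightarrow> y' \<in> carrier N \<Longrightarrow>
   \<tau> x y \<otimes>\<^bsub>T\<^esub> \<tau> x' y' = \<tau> (x \<otimes>\<^bsub>M\<^esub> x') (y \<otimes>\<^bsub>N\<^esub> y')"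
  by (simp add: mult_pure_left lift_pure'[OF group_facts mult_balanced_right])

lemma mult_closed: "z \<in> carrier T \<Longrightarrow> w \<in> carrier T \<Longrightarrow> z \<otimes>\<^bsub>T\<^esub> w \<in> carrier T"
  using additive_closed[OF mult_additive_left] .

lemma mult_additive_right:
  assumes z: "z \<in> carrier T"
  shows "additive T T (\<lambda>w. z \<otimes>\<^bsub>T\<^esub> w)"
proof (rule additiveI)
  show "z \<otimes>\<^bsub>T\<^esub> w \<in> carrier T" if "w \<in> carrier T" for w using mult_closed that z by simp
  show "z \<otimes>\<^bsub>T\<^esub> (w \<oplus>\<^bsub>T\<^esub> w') = z \<otimes>\<^bsub>T\<^esub> w \<oplus>\<^bsub>T\<^esub> z \<otimes>\<^bsub>T\<^esub> w'" if w: "w \<in> carrier T" "w' \<in> carrier T" for w w'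
    by (rule additive_eqI[OF _ _ _ z])
       (use w in \<open>auto intro!: additive_plus mult_additive_left T.abelian_group_axioms
          simp: mult_pure_left lift_add'[OF group_facts mult_balanced_right]\<close>)
qed

lemma one_tensor: "\<one>\<^bsub>T\<^esub> = \<tau> \<one>\<^bsub>M\<^esub> \<one>\<^bsub>N\<^esub>"
  by (simp add: tensor_def Let_def)

lemma mult_comm: "z \<in> carrier T \<Longrightarrow> w \<in> carrier T \<Longrightarrow> z \<otimes>\<^bsub>T\<^esub> w = w \<otimes>\<^bsub>T\<^esub> z"
proof -
  interpret M: algebra R M by (rule left_algebra)
  interpret N: algebra R N by (rule right_algebra)
  assume z: "z \<in> carrier T" and w: "w \<in> carrier T"
  have *: "\<tau> x y \<otimes>\<^bsub>T\<^esub> w = w \<otimes>\<^bsub>T\<^esub> \<tau> x y" if "x \<in> carrier M" "y \<in> carrier N" for x y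
    by (rule additive_eqI[OF _ _ _ w])
       (use that in \<open>auto intro!: mult_additive_left mult_additive_right simp: mult_pure M.m_comm N.m_comm\<close>)
  show ?thesis
    by (rule additive_eqI[OF _ _ _ z]) (use w * in \<open>auto intro!: mult_additive_left mult_additive_right\<close>)
qed

lemma cring_tensor: "cring T"
proof -
  interpret M: algebra R M by (rule left_algebra)
  interpret N: algebra R N by (rule right_algebra)
  have assoc: "z \<otimes>\<^bsub>T\<^esub> w \<otimes>\<^bsub>T\<^esub> v = z \<otimes>\<^bsub>T\<^esub> (w \<otimes>\<^bsub>T\<^esub> v)"
    if z: "z \<in> carrier T" and w: "w \<in> carrier T" and v: "v \<in> carrier T" for z w v
  proof -
    have 1: "\<tau> x y \<otimes>\<^bsub>T\<^esub> \<tau> x' y' \<otimes>\<^bsub>T\<^esub> v = \<tau> x y \<otimes>\<^bsub>T\<^esub> (\<tau> x' y' \<otimes>\<^bsub>T\<^esub> v)"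
      if "x \<in> carrier M" "y \<in> carrier N" "x' \<in> carrier M" "y' \<in> carrier N" for x y x' y'
      by (rule additive_eqI[OF _ _ _ v])
         (use that in \<open>auto intro!: mult_additive_right additive_comp[OF mult_additive_right mult_additive_right]
           simp: mult_pure M.m_assoc N.m_assoc\<close>)
    have 2: "\<tau> x y \<otimes>\<^bsub>T\<^esub> w \<otimes>\<^bsub>T\<^esub> v = \<tau> x y \<otimes>\<^bsub>T\<^esub> (w \<otimes>\<^bsub>T\<^esub> v)"
      if "x \<in> carrier M" "y \<in> carrier N" for x y
      by (rule additive_eqI[OF _ _ _ w])
         (use that v in \<open>auto intro!: additive_comp[OF mult_additive_left mult_additive_right]
           additive_comp[OF mult_additive_right mult_additive_left] simp: 1\<close>)
    show ?thesis
      by (rule additive_eqI[OF _ _ _ z])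
         (use v w in \<open>auto intro!: additive_comp[OF mult_additive_left mult_additive_left]
           mult_additive_left simp: 2 mult_closed\<close>)
  qed
  have one: "\<one>\<^bsub>T\<^esub> \<otimes>\<^bsub>T\<^esub> z = z" if z: "z \<in> carrier T" for z
    by (rule additive_eqI[OF _ _ _ z]) (auto intro!: mult_additive_right additive_id simp: one_tensor mult_pure)
  show ?thesis
  proof (intro cringI T.abelian_group_axioms comm_monoidI)
    show "(x \<oplus>\<^bsub>T\<^esub> y) \<otimes>\<^bsub>T\<^esub> z = x \<otimes>\<^bsub>T\<^esub> z \<oplus>\<^bsub>T\<^esub> y \<otimes>\<^bsub>T\<^esub> z"
      if "x \<in> carrier T" "y \<in> carrier T" "z \<in> carrier T" for x y z
      using additive_add[OF mult_additive_left] that by blast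
    show "\<one>\<^bsub>T\<^esub> \<in> carrier T" by (simp add: one_tensor)
  qed (simp_all add: assoc one mult_closed, rule mult_comm)
qed

sublocale T: cring T by (rule cring_tensor)

lemma smult_eq: "r \<odot>\<^bsub>T\<^esub> z = tensor_lift (tensor_group R M N) (\<lambda>x y. \<tau> (r \<odot>\<^bsub>M\<^esub> x) y) z"
  by (simp add: tensor_def Let_def)

lemma smult_balanced: "r \<in> carrier R \<Longrightarrow> balanced R M N T (\<lambda>x y. \<tau> (r \<odot>\<^bsub>M\<^esub> x) y)"
proof -
  interpret M: algebra R M by (rule left_algebra)
  interpret N: algebra R N by (rule right_algebra)
  show "r \<in> carrier R \<Longrightarrow> ?thesis"
    by (rule balancedI)
       (auto simp: M.smult_r_distr pure_add_left pure_add_right M.smult_assoc1[symmetric] N.smult_assoc1[symmetric]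
         M.m_comm pure_smult M.R.m_comm)
qed

lemma smult_additive: "r \<in> carrier R \<Longrightarrow> additive T T (\<lambda>z. r \<odot>\<^bsub>T\<^esub> z)"
  unfolding smult_eq by (rule lift_additive'[OF group_facts smult_balanced])

lemma smult_pure: "r \<in> carrier R \<Longrightarrow> x \<in> carrier M \<Longrightarrow> y \<in> carrier N \<Longrightarrow> r \<odot>\<^bsub>T\<^esub> \<tau> x y = \<tau> (r \<odot>\<^bsub>M\<^esub> x) y"
  unfolding smult_eq by (rule lift_pure'[OF group_facts smult_balanced])

lemma algebra_tensor: "algebra R T"
proof -
  interpret M: algebra R M by (rule left_algebra)
  interpret N: algebra R N by (rule right_algebra)
  note cl = additive_closed[OF smult_additive]
  have l: "(a \<oplus>\<^bsub>R\<^esub> b) \<odot>\<^bsub>T\<^esub> z = a \<odot>\<^bsub>T\<^esub> z \<oplus>\<^bsub>T\<^esub> b \<odot>\<^bsub>T\<^esub> z"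
    if "a \<in> carrier R" "b \<in> carrier R" "z \<in> carrier T" for a b z
    by (rule additive_eqI[OF _ _ _ that(3)])
       (use that in \<open>auto intro!: additive_plus smult_additive T.abelian_group_axioms simp: smult_pure M.smult_l_distr pure_add_left\<close>)
  have a: "(a \<otimes>\<^bsub>R\<^esub> b) \<odot>\<^bsub>T\<^esub> z = a \<odot>\<^bsub>T\<^esub> (b \<odot>\<^bsub>T\<^esub> z)"
    if "a \<in> carrier R" "b \<in> carrier R" "z \<in> carrier T" for a b z
    by (rule additive_eqI[OF _ _ _ that(3)])
       (use that in \<open>auto intro!: additive_comp[OF smult_additive smult_additive] smult_additive simp: smult_pure M.smult_assoc1\<close>)
  have o: "\<one>\<^bsub>R\<^esub> \<odot>\<^bsub>T\<^esub> z = z" if "z \<in> carrier T" for z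
    by (rule additive_eqI[OF _ _ _ that]) (auto intro!: smult_additive additive_id simp: smult_pure)
  have m: "(r \<odot>\<^bsub>T\<^esub> z) \<otimes>\<^bsub>T\<^esub> w = r \<odot>\<^bsub>T\<^esub> (z \<otimes>\<^bsub>T\<^esub> w)" if r: "r \<in> carrier R" and z: "z \<in> carrier T" and w: "w \<in> carrier T" for r z w
  proof -
    have 1: "(r \<odot>\<^bsub>T\<^esub> \<tau> x y) \<otimes>\<^bsub>T\<^esub> w = r \<odot>\<^bsub>T\<^esub> (\<tau> x y \<otimes>\<^bsub>T\<^esub> w)" if "x \<in> carrier M" "y \<in> carrier N" for x y
      by (rule additive_eqI[OF _ _ _ w])
         (use that r in \<open>auto intro!: additive_comp[OF mult_additive_right smult_additive] mult_additive_right
            simp: smult_pure mult_pure M.smult_assoc2\<close>)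
    show ?thesis
      by (rule additive_eqI[OF _ _ _ z])
         (use r w 1 in \<open>auto intro!: additive_comp[OF mult_additive_left smult_additive]
            additive_comp[OF smult_additive mult_additive_left]\<close>)
  qed
  show ?thesis
    by (rule algebraI[OF M.R_cring cring_tensor]) (auto simp: cl l a o m additive_add[OF smult_additive])
qed

end

section \<open>Formal power series\<close>

text \<open>Dickson's lemma, by forgetting the coordinate \<open>n\<close>. A finite set
  \<open>M0\<close> that suffices for the other coordinates also suffices for all exponents whose
  coordinate \<open>n\<close> is large. Only finitely many values of that coordinate remain, and
  each has a finite set of its own.\<close>

lemma dickson:
  assumes "L \<subseteq> exponents n"
  shows "\<exists>L0. finite L0 \<and> L0 \<subseteq> L \<and> (\<forall>\<alpha>\<in>L. \<exists>\<beta>\<in>L0. \<forall>i. \<beta> i \<le> \<alpha> i)"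
  using assms
proof (induction n arbitrary: L)
  case 0
  then have "L \<subseteq> {\<lambda>i. 0}" by (auto simp: exponents_def)
  then have "finite L" using finite_subset by blast
  then show ?case by (intro exI[of _ L]) auto
next
  case (Suc n)
  define pr where "pr \<alpha> = \<alpha>(n := 0)" for \<alpha> :: "nat \<Rightarrow> nat"
  have pr: "pr ` M \<subseteq> exponents n" if "M \<subseteq> L" for M
    using that Suc.prems by (auto simp: exponents_def pr_def subset_iff)
  have basis: "\<exists>M0. finite M0 \<and> M0 \<subseteq> M \<and> (\<forall>\<alpha>\<in>M. \<exists>\<beta>\<in>M0. \<forall>i. i \<noteq> n \<longrightarrow> \<beta> i \<le> \<alpha> i)" if M: "M \<subseteq> L" for M
  proof -
    obtain B where B: "finite B" "B \<subseteq> pr ` M" "\<forall>\<alpha>\<in>pr ` M. \<exists>\<beta>\<in>B. \<forall>i. \<beta> i \<le> \<alpha> i"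
      using Suc.IH[OF pr[OF M]] by blast
    obtain M0 where M0: "M0 \<subseteq> M" "finite M0" "B = pr ` M0"
      using finite_subset_image[OF B(1,2)] by blast
    have "\<exists>\<beta>\<in>M0. \<forall>i. i \<noteq> n \<longrightarrow> \<beta> i \<le> \<alpha> i" if "\<alpha> \<in> M" for \<alpha>
    proof -
      have "\<exists>\<beta>\<in>B. \<forall>i. \<beta> i \<le> pr \<alpha> i" using B(3) that by blast
      then obtain \<beta> where \<beta>: "\<beta> \<in> M0" "\<And>i. pr \<beta> i \<le> pr \<alpha> i" using M0(3) by blast
      have "\<beta> i \<le> \<alpha> i" if "i \<noteq> n" for i using \<beta>(2)[of i] that by (simp add: pr_def)
      then show ?thesis using \<beta>(1) by blast
    qed
    then show ?thesis using M0 by blast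
  qed
  obtain M0 where M0: "finite M0" "M0 \<subseteq> L" "\<And>\<alpha>. \<alpha> \<in> L \<Longrightarrow> \<exists>\<beta>\<in>M0. \<forall>i. i \<noteq> n \<longrightarrow> \<beta> i \<le> \<alpha> i"
    using basis[of L] by blast
  have "\<forall>k. \<exists>M. finite M \<and> M \<subseteq> {\<alpha>\<in>L. \<alpha> n = k} \<and> (\<forall>\<alpha>\<in>{\<alpha>\<in>L. \<alpha> n = k}. \<exists>\<beta>\<in>M. \<forall>i. i \<noteq> n \<longrightarrow> \<beta> i \<le> \<alpha> i)"
    by (intro allI basis) blast
  from choice[OF this] obtain M where "\<forall>k. finite (M k) \<and> M k \<subseteq> {\<alpha>\<in>L. \<alpha> n = k} \<and>
      (\<forall>\<alpha>\<in>{\<alpha>\<in>L. \<alpha> n = k}. \<exists>\<beta>\<in>M k. \<forall>i. i \<noteq> n \<longrightarrow> \<beta> i \<le> \<alpha> i)" ..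
  then have M: "\<And>k. finite (M k)" "\<And>k. M k \<subseteq> {\<alpha>\<in>L. \<alpha> n = k}"
    "\<And>k \<alpha>. \<alpha> \<in> L \<Longrightarrow> \<alpha> n = k \<Longrightarrow> \<exists>\<beta>\<in>M k. \<forall>i. i \<noteq> n \<longrightarrow> \<beta> i \<le> \<alpha> i"
    by blast+
  \<comment> \<open>Above the level \<open>N\<close> the comparison in the coordinate
    \<open>n\<close> with any member of \<open>M0\<close> is automatic.\<close>
  obtain N where N: "\<And>\<beta>. \<beta> \<in> M0 \<Longrightarrow> \<beta> n \<le> N"
    using finite_nat_set_iff_bounded_le[of "(\<lambda>\<beta>. \<beta> n) ` M0"] M0(1) by auto
  let ?L0 = "M0 \<union> (\<Union>k\<le>N. M k)"
  have "\<exists>\<beta>\<in>?L0. \<forall>i. \<beta> i \<le> \<alpha> i" if a: "\<alpha> \<in> L" for \<alpha>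
  proof (cases "\<alpha> n \<le> N")
    case True
    obtain \<beta> where \<beta>: "\<beta> \<in> M (\<alpha> n)" "\<And>i. i \<noteq> n \<Longrightarrow> \<beta> i \<le> \<alpha> i" using M(3)[OF a refl] by blast
    have "\<beta> n = \<alpha> n" using M(2) \<beta>(1) by blast
    then have "\<beta> i \<le> \<alpha> i" for i using \<beta>(2)[of i] by (cases "i = n") auto
    then show ?thesis using \<beta>(1) True by blast
  next
    case False
    obtain \<beta> where \<beta>: "\<beta> \<in> M0" "\<And>i. i \<noteq> n \<Longrightarrow> \<beta> i \<le> \<alpha> i" using M0(3)[OF a] by blast
    then have "\<beta> i \<le> \<alpha> i" for i using \<beta>(2)[of i] N[OF \<beta>(1)] False by (cases "i = n") auto
    then show ?thesis using \<beta>(1) by blast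
  qed
  moreover have "finite ?L0" using M0(1) M(1) by blast
  moreover have "?L0 \<subseteq> L" using M0(2) M(2) by blast
  ultimately show ?case by blast
qed

lemma exponents_add [intro]: "\<alpha> \<in> exponents n \<Longrightarrow> \<beta> \<in> exponents n \<Longrightarrow> (\<lambda>i. \<alpha> i + \<beta> i) \<in> exponents n"
  by (simp add: exponents_def)

text \<open>The ranking enumerates the exponents along the degree-lexicographic order.\<close>

lemma exponent_ranking:
  "\<exists>rk :: (nat \<Rightarrow> nat) \<Rightarrow> nat. inj_on rk (exponents n) \<and>
     (\<forall>\<alpha>\<in>exponents n. \<forall>\<beta>\<in>exponents n. \<forall>\<gamma>\<in>exponents n.
        rk \<alpha> < rk \<beta> \<longrightarrow> rk (\<lambda>i. \<alpha> i + \<gamma> i) < rk (\<lambda>i. \<beta> i + \<gamma> i))"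
proof -
  let ?E = "exponents n"
  \<comment> \<open>Comparing total degrees first leaves only finitely many exponents below a given
    one, so that the rank can be a cardinality. A purely lexicographic order would not do
    this.\<close>
  define deg where "deg \<alpha> = (\<Sum>i<n. \<alpha> i)" for \<alpha> :: "nat \<Rightarrow> nat"
  define lt where "lt \<alpha> \<beta> \<longleftrightarrow> deg \<alpha> < deg \<beta> \<or> deg \<alpha> = deg \<beta> \<and> (\<exists>i. (\<forall>j<i. \<alpha> j = \<beta> j) \<and> \<alpha> i < \<beta> i)"
    for \<alpha> \<beta> :: "nat \<Rightarrow> nat"
  define rk where "rk \<alpha> = card {\<beta>\<in>?E. lt \<beta> \<alpha>}" for \<alpha>
  have irrefl: "\<not> lt \<alpha> \<alpha>" for \<alpha> by (simp add: lt_def)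
  have trans: "lt \<alpha> \<gamma>" if ab: "lt \<alpha> \<beta>" and bc: "lt \<beta> \<gamma>" for \<alpha> \<beta> \<gamma>
  proof (cases "deg \<alpha> = deg \<beta> \<and> deg \<beta> = deg \<gamma>")
    case False then show ?thesis using ab bc by (auto simp: lt_def)
  next
    case True
    obtain i where i: "\<And>j. j < i \<Longrightarrow> \<alpha> j = \<beta> j" "\<alpha> i < \<beta> i" using ab True by (auto simp: lt_def)
    obtain k where k: "\<And>j. j < k \<Longrightarrow> \<beta> j = \<gamma> j" "\<beta> k < \<gamma> k" using bc True by (auto simp: lt_def)
    have "(\<forall>j<min i k. \<alpha> j = \<gamma> j) \<and> \<alpha> (min i k) < \<gamma> (min i k)"
      using i k by (cases i k rule: linorder_cases) (auto simp: min_def)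
    then have "\<exists>i. (\<forall>j<i. \<alpha> j = \<gamma> j) \<and> \<alpha> i < \<gamma> i" by blast
    then show ?thesis using True by (simp add: lt_def)
  qed
  have total: "lt \<alpha> \<beta> \<or> lt \<beta> \<alpha>" if ne: "\<alpha> \<noteq> \<beta>" for \<alpha> \<beta>
  proof -
    obtain k where k: "\<alpha> k \<noteq> \<beta> k" using ne by blast
    define i where "i = (LEAST i. \<alpha> i \<noteq> \<beta> i)"
    have "\<alpha> i \<noteq> \<beta> i" unfolding i_def by (rule LeastI[of "\<lambda>i. \<alpha> i \<noteq> \<beta> i", OF k])
    moreover have "\<alpha> j = \<beta> j" if "j < i" for j using not_less_Least[of j "\<lambda>i. \<alpha> i \<noteq> \<beta> i"] that by (auto simp: i_def)
    ultimately show ?thesis unfolding lt_def by (metis linorder_neqE_nat)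
  qed
  have add: "lt (\<lambda>i. \<alpha> i + \<gamma> i) (\<lambda>i. \<beta> i + \<gamma> i)" if "lt \<alpha> \<beta>" for \<alpha> \<beta> \<gamma>
    using that by (auto simp: lt_def deg_def sum.distrib)
  have fin: "finite {\<beta>\<in>?E. lt \<beta> \<alpha>}" for \<alpha>
  proof (rule finite_subset)
    have "\<beta> i \<le> deg \<beta>" if "i < n" for \<beta> i
      unfolding deg_def using that by (intro member_le_sum) auto
    then show "{\<beta>\<in>?E. lt \<beta> \<alpha>} \<subseteq> {f. \<forall>x. (x \<in> {..<n} \<longrightarrow> f x \<in> {..deg \<alpha>}) \<and> (x \<notin> {..<n} \<longrightarrow> f x = 0)}"
      by (auto simp: exponents_def lt_def) (metis less_or_eq_imp_le order.trans)+
    show "finite {f. \<forall>x. (x \<in> {..<n} \<longrightarrow> f x \<in> {..deg \<alpha>}) \<and> (x \<notin> {..<n} \<longrightarrow> f x = (0::nat))}"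
      by (rule finite_set_of_finite_funs) auto
  qed
  have mono: "rk \<alpha> < rk \<beta>" if "\<alpha> \<in> ?E" "lt \<alpha> \<beta>" for \<alpha> \<beta>
    unfolding rk_def
    by (rule psubset_card_mono[OF fin]) (use that irrefl trans in blast)
  have iff: "rk \<alpha> < rk \<beta> \<longleftrightarrow> lt \<alpha> \<beta>" if "\<alpha> \<in> ?E" "\<beta> \<in> ?E" for \<alpha> \<beta>
    using mono[of \<alpha> \<beta>] mono[of \<beta> \<alpha>] total[of \<alpha> \<beta>] that by fastforce
  have "inj_on rk ?E"
    using mono total by (intro inj_onI) (metis less_irrefl)
  then show ?thesis using iff add exponents_add by (intro exI[of _ rk] conjI) auto
qed

locale power_series_ring = K: field K + S: cring "power_series K n"
  for K :: "('k, 'c) ring_scheme" and n :: nat +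
  fixes rk :: "(nat \<Rightarrow> nat) \<Rightarrow> nat"
  assumes rk_inj: "inj_on rk (exponents n)"
    and rk_add: "\<And>\<alpha> \<beta> \<gamma>. \<alpha> \<in> exponents n \<Longrightarrow> \<beta> \<in> exponents n \<Longrightarrow> \<gamma> \<in> exponents n \<Longrightarrow>
      rk \<alpha> < rk \<beta> \<Longrightarrow> rk (\<lambda>i. \<alpha> i + \<gamma> i) < rk (\<lambda>i. \<beta> i + \<gamma> i)"
begin

abbreviation "S \<equiv> power_series K n"
abbreviation "E \<equiv> exponents n"

text \<open>The leading exponent is the one of least rank, since a power series has a lowest term
  but in general no highest one.\<close>

definition is_lead :: "((nat \<Rightarrow> nat) \<Rightarrow> 'k) \<Rightarrow> (nat \<Rightarrow> nat) \<Rightarrow> bool" where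
  "is_lead f \<alpha> \<longleftrightarrow> \<alpha> \<in> E \<and> f \<alpha> \<noteq> \<zero>\<^bsub>K\<^esub> \<and> (\<forall>\<beta>\<in>E. f \<beta> \<noteq> \<zero>\<^bsub>K\<^esub> \<longrightarrow> rk \<alpha> \<le> rk \<beta>)"

lemma rk_add_le:
  assumes "\<alpha> \<in> E" "\<beta> \<in> E" "\<gamma> \<in> E" "rk \<alpha> \<le> rk \<beta>"
  shows "rk (\<lambda>i. \<alpha> i + \<gamma> i) \<le> rk (\<lambda>i. \<beta> i + \<gamma> i)"
proof (cases "\<alpha> = \<beta>")
  case False
  then have "rk \<alpha> < rk \<beta>" using assms rk_inj by (auto simp: inj_on_def le_less)
  then show ?thesis using rk_add assms by (simp add: less_imp_le)
qed simp

lemma carrier_S: "carrier S = E \<rightarrow>\<^sub>E carrier K"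
  by (simp add: power_series_def)

lemma coeff_closed [simp]: "f \<in> carrier S \<Longrightarrow> \<alpha> \<in> E \<Longrightarrow> f \<alpha> \<in> carrier K"
  by (auto simp: carrier_S)

lemma series_eqI: "f \<in> carrier S \<Longrightarrow> g \<in> carrier S \<Longrightarrow> (\<And>\<alpha>. \<alpha> \<in> E \<Longrightarrow> f \<alpha> = g \<alpha>) \<Longrightarrow> f = g"
  unfolding carrier_S by (rule PiE_ext)

lemma coeff_zero [simp]: "\<alpha> \<in> E \<Longrightarrow> \<zero>\<^bsub>S\<^esub> \<alpha> = \<zero>\<^bsub>K\<^esub>"
  by (simp add: power_series_def)

lemma coeff_add [simp]: "\<alpha> \<in> E \<Longrightarrow> (f \<oplus>\<^bsub>S\<^esub> g) \<alpha> = f \<alpha> \<oplus>\<^bsub>K\<^esub> g \<alpha>"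
  by (simp add: power_series_def)

lemma coeff_additive: "\<alpha> \<in> E \<Longrightarrow> additive S K (\<lambda>f. f \<alpha>)"
  by (rule additiveI) auto

lemma coeff_diff: "f \<in> carrier S \<Longrightarrow> g \<in> carrier S \<Longrightarrow> \<alpha> \<in> E \<Longrightarrow> (f \<ominus>\<^bsub>S\<^esub> g) \<alpha> = f \<alpha> \<ominus>\<^bsub>K\<^esub> g \<alpha>"
  by (rule additive_diff[OF S.is_abelian_group K.is_abelian_group coeff_additive])

lemma coeff_mult: "\<gamma> \<in> E \<Longrightarrow> (f \<otimes>\<^bsub>S\<^esub> g) \<gamma> =
    finsum K (\<lambda>(\<alpha>, \<beta>). f \<alpha> \<otimes>\<^bsub>K\<^esub> g \<beta>) {(\<alpha>, \<beta>) \<in> E \<times> E. (\<lambda>i. \<alpha> i + \<beta> i) = \<gamma>}"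
  by (simp add: power_series_def)

lemma lead_exists:
  assumes "f \<in> carrier S" "f \<noteq> \<zero>\<^bsub>S\<^esub>"
  obtains \<alpha> where "is_lead f \<alpha>"
proof -
  have "\<exists>\<alpha>\<in>E. f \<alpha> \<noteq> \<zero>\<^bsub>K\<^esub>"
    using series_eqI[OF assms(1) S.zero_closed] assms(2) by auto
  then obtain \<alpha> where "\<alpha> \<in> E \<and> f \<alpha> \<noteq> \<zero>\<^bsub>K\<^esub>" "\<forall>\<beta>. \<beta> \<in> E \<and> f \<beta> \<noteq> \<zero>\<^bsub>K\<^esub> \<longrightarrow> rk \<alpha> \<le> rk \<beta>"
    using ex_has_least_nat[of "\<lambda>\<alpha>. \<alpha> \<in> E \<and> f \<alpha> \<noteq> \<zero>\<^bsub>K\<^esub>" _ rk] by blast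
  then show ?thesis using that by (auto simp: is_lead_def)
qed

lemma lead_nonzero: "is_lead f \<alpha> \<Longrightarrow> f \<noteq> \<zero>\<^bsub>S\<^esub>"
  by (auto simp: is_lead_def)

text \<open>It serves two purposes: it shows that no term of a product precedes the product of the
  leading terms, and it allows the tail of a quotient to be discarded when a single coefficient is
  computed in \<open>division\<close>.\<close>

lemma coeff_mult_low:
  assumes f: "f \<in> carrier S" and g: "g \<in> carrier S" and l: "l \<in> E" "\<And>\<beta>. \<beta> \<in> E \<Longrightarrow> g \<beta> \<noteq> \<zero>\<^bsub>K\<^esub> \<Longrightarrow> rk l \<le> rk \<beta>"
    and N: "\<And>\<alpha>. \<alpha> \<in> E \<Longrightarrow> f \<alpha> \<noteq> \<zero>\<^bsub>K\<^esub> \<Longrightarrow> N \<le> rk (\<lambda>i. \<alpha> i + l i)"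
    and \<delta>: "\<delta> \<in> E" "rk \<delta> < N"
  shows "(f \<otimes>\<^bsub>S\<^esub> g) \<delta> = \<zero>\<^bsub>K\<^esub>"
proof -
  have "f \<alpha> \<otimes>\<^bsub>K\<^esub> g \<beta> = \<zero>\<^bsub>K\<^esub>" if ab: "\<alpha> \<in> E" "\<beta> \<in> E" "(\<lambda>i. \<alpha> i + \<beta> i) = \<delta>" for \<alpha> \<beta>
  proof (rule ccontr)
    assume "f \<alpha> \<otimes>\<^bsub>K\<^esub> g \<beta> \<noteq> \<zero>\<^bsub>K\<^esub>"
    then have nz: "f \<alpha> \<noteq> \<zero>\<^bsub>K\<^esub>" "g \<beta> \<noteq> \<zero>\<^bsub>K\<^esub>" using f g ab by auto
    have "N \<le> rk (\<lambda>i. l i + \<alpha> i)" using N[OF ab(1) nz(1)] by (simp add: add.commute)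
    also have "\<dots> \<le> rk (\<lambda>i. \<beta> i + \<alpha> i)" by (rule rk_add_le) (use l ab nz in auto)
    also have "\<dots> = rk \<delta>" using ab(3) by (simp add: add.commute)
    finally show False using \<delta> by simp
  qed
  then show ?thesis
    unfolding coeff_mult[OF \<delta>(1)] by (intro K.add.finprod_one_eqI) auto
qed

text \<open>Leading exponents add and leading coefficients multiply: for any other pair of exponents
  in the two supports the sum has strictly greater rank, because the ranking is strictly compatible
  with addition.\<close>

lemma lead_mult:
  assumes f: "f \<in> carrier S" and g: "g \<in> carrier S" and lf: "is_lead f \<alpha>" and lg: "is_lead g \<beta>"
  shows coeff_lead_mult: "(f \<otimes>\<^bsub>S\<^esub> g) (\<lambda>i. \<alpha> i + \<beta> i) = f \<alpha> \<otimes>\<^bsub>K\<^esub> g \<beta>"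
    and is_lead_mult: "is_lead (f \<otimes>\<^bsub>S\<^esub> g) (\<lambda>i. \<alpha> i + \<beta> i)"
proof -
  note lfd = lf[unfolded is_lead_def] and lgd = lg[unfolded is_lead_def]
  let ?\<delta> = "\<lambda>i. \<alpha> i + \<beta> i"
  have E: "\<alpha> \<in> E" "\<beta> \<in> E" "?\<delta> \<in> E" using lfd lgd by auto
  let ?A = "{(\<alpha>', \<beta>') \<in> E \<times> E. (\<lambda>i. \<alpha>' i + \<beta>' i) = ?\<delta>}"
  have finA: "finite ?A"
  proof (rule finite_subset)
    let ?F = "{f. \<forall>x. (x \<in> {..<n} \<longrightarrow> f x \<in> {..Max (?\<delta> ` {..<n})}) \<and> (x \<notin> {..<n} \<longrightarrow> f x = (0::nat))}"
    have "p \<in> ?F" if "p \<in> E" "\<And>i. p i \<le> ?\<delta> i" for p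
      using that by (auto simp: exponents_def intro!: order.trans[OF that(2) Max_ge])
    then show "?A \<subseteq> ?F \<times> ?F"
      by (auto simp: fun_eq_iff) (metis le_add1 le_add2)+
    have "finite ?F" by (rule finite_set_of_finite_funs) auto
    then show "finite (?F \<times> ?F)" by blast
  qed
  have z: "f \<alpha>' \<otimes>\<^bsub>K\<^esub> g \<beta>' = \<zero>\<^bsub>K\<^esub>" if ab: "\<alpha>' \<in> E" "\<beta>' \<in> E" "(\<lambda>i. \<alpha>' i + \<beta>' i) = ?\<delta>" "(\<alpha>', \<beta>') \<noteq> (\<alpha>, \<beta>)" for \<alpha>' \<beta>'
  proof (rule ccontr)
    assume "f \<alpha>' \<otimes>\<^bsub>K\<^esub> g \<beta>' \<noteq> \<zero>\<^bsub>K\<^esub>"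
    then have nz: "f \<alpha>' \<noteq> \<zero>\<^bsub>K\<^esub>" "g \<beta>' \<noteq> \<zero>\<^bsub>K\<^esub>" using f g ab by auto
    have le: "rk \<alpha> \<le> rk \<alpha>'" "rk \<beta> \<le> rk \<beta>'" using lfd lgd nz ab by auto
    have "\<alpha> \<noteq> \<alpha>'"
    proof
      assume eq: "\<alpha> = \<alpha>'"
      have "\<beta>' i = \<beta> i" for i using fun_cong[OF ab(3), of i] eq by simp
      then show False using eq ab(4) by auto
    qed
    then have "rk \<alpha> < rk \<alpha>'" using le rk_inj E ab by (auto simp: inj_on_def le_less)
    then have "rk (\<lambda>i. \<alpha> i + \<beta> i) < rk (\<lambda>i. \<alpha>' i + \<beta> i)" using rk_add E ab by blast
    also have "\<dots> = rk (\<lambda>i. \<beta> i + \<alpha>' i)" by (simp add: add.commute)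
    also have "\<dots> \<le> rk (\<lambda>i. \<beta>' i + \<alpha>' i)" by (rule rk_add_le) (use E ab le in auto)
    also have "\<dots> = rk ?\<delta>" using ab(3) by (simp add: add.commute)
    finally show False by simp
  qed
  have "(f \<otimes>\<^bsub>S\<^esub> g) ?\<delta> = finsum K (\<lambda>p. if (\<alpha>, \<beta>) = p then f \<alpha> \<otimes>\<^bsub>K\<^esub> g \<beta> else \<zero>\<^bsub>K\<^esub>) ?A"
    unfolding coeff_mult[OF E(3)]
    by (rule K.finsum_cong') (use z f g E in auto)
  also have "\<dots> = f \<alpha> \<otimes>\<^bsub>K\<^esub> g \<beta>"
    using K.add.finprod_singleton[of "(\<alpha>, \<beta>)" ?A "\<lambda>p. f \<alpha> \<otimes>\<^bsub>K\<^esub> g \<beta>"] finA f g E by simp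
  finally show 1: "(f \<otimes>\<^bsub>S\<^esub> g) ?\<delta> = f \<alpha> \<otimes>\<^bsub>K\<^esub> g \<beta>" .
  have "rk ?\<delta> \<le> rk \<gamma>" if "\<gamma> \<in> E" "(f \<otimes>\<^bsub>S\<^esub> g) \<gamma> \<noteq> \<zero>\<^bsub>K\<^esub>" for \<gamma>
  proof (rule ccontr)
    assume "\<not> ?thesis"
    then have "(f \<otimes>\<^bsub>S\<^esub> g) \<gamma> = \<zero>\<^bsub>K\<^esub>"
      by (intro coeff_mult_low[OF f g, of \<beta> "rk ?\<delta>"] rk_add_le) (use lfd lgd E that in auto)
    then show False using that by simp
  qed
  then show "is_lead (f \<otimes>\<^bsub>S\<^esub> g) ?\<delta>"
    unfolding is_lead_def using 1 E lfd lgd f g by (auto simp: K.integral_iff)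
qed

lemma one_not_zero_S: "\<one>\<^bsub>S\<^esub> \<noteq> \<zero>\<^bsub>S\<^esub>"
proof
  assume "\<one>\<^bsub>S\<^esub> = \<zero>\<^bsub>S\<^esub>"
  then have "\<one>\<^bsub>S\<^esub> (\<lambda>i. 0) = \<zero>\<^bsub>S\<^esub> (\<lambda>i. 0)" by simp
  then show False by (simp add: power_series_def exponents_def)
qed

lemma domain_S: "domain S"
proof
  show "\<one>\<^bsub>S\<^esub> \<noteq> \<zero>\<^bsub>S\<^esub>" by (rule one_not_zero_S)
  fix a b assume ab: "a \<otimes>\<^bsub>S\<^esub> b = \<zero>\<^bsub>S\<^esub>" "a \<in> carrier S" "b \<in> carrier S"
  show "a = \<zero>\<^bsub>S\<^esub> \<or> b = \<zero>\<^bsub>S\<^esub>"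
  proof (rule ccontr)
    assume "\<not> ?thesis"
    then have nz: "a \<noteq> \<zero>\<^bsub>S\<^esub>" "b \<noteq> \<zero>\<^bsub>S\<^esub>" by auto
    obtain \<alpha> where \<alpha>: "is_lead a \<alpha>" by (rule lead_exists[OF ab(2) nz(1)])
    obtain \<beta> where \<beta>: "is_lead b \<beta>" by (rule lead_exists[OF ab(3) nz(2)])
    show False using lead_nonzero[OF is_lead_mult[OF ab(2,3) \<alpha> \<beta>]] ab(1) by simp
  qed
qed

sublocale S: domain S by (rule domain_S)

section \<open>Division of power series by leading exponents\<close>

definition monomial :: "'k \<Rightarrow> (nat \<Rightarrow> nat) \<Rightarrow> (nat \<Rightarrow> nat) \<Rightarrow> 'k" where
  "monomial c \<gamma> = (\<lambda>\<beta>\<in>E. if \<beta> = \<gamma> then c else \<zero>\<^bsub>K\<^esub>)"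

lemma monomial_closed: "c \<in> carrier K \<Longrightarrow> monomial c \<gamma> \<in> carrier S"
  by (auto simp: monomial_def carrier_S)

lemma lead_monomial: "c \<noteq> \<zero>\<^bsub>K\<^esub> \<Longrightarrow> \<gamma> \<in> E \<Longrightarrow> is_lead (monomial c \<gamma>) \<gamma>"
  by (auto simp: monomial_def is_lead_def)

text \<open>As ranks are injective, at most one coefficient has rank \<open>N\<close>. If it is
  nonzero, its exponent is the leading one, \<open>cover\<close> provides a divisor whose leading
  exponent divides it, and a monomial multiple removes it. The clause on the support of
  \<open>y\<close> records that quotient terms from different steps never meet, which is what allows
  infinitely many steps to be collected. \<open>Y\<close> is the set in which the remainders
  stay.\<close>

lemma division_step:
  assumes I: "I \<noteq> {}" and g: "\<And>i. i \<in> I \<Longrightarrow> g i \<in> carrier S" "\<And>i. i \<in> I \<Longrightarrow> is_lead (g i) (l i)"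
    and sub: "Y \<subseteq> carrier S" and closed: "\<And>a y i. a \<in> Y \<Longrightarrow> y \<in> carrier S \<Longrightarrow> i \<in> I \<Longrightarrow> a \<ominus>\<^bsub>S\<^esub> y \<otimes>\<^bsub>S\<^esub> g i \<in> Y"
    and cover: "\<And>a \<alpha>. a \<in> Y \<Longrightarrow> is_lead a \<alpha> \<Longrightarrow> \<exists>i\<in>I. \<exists>\<gamma>\<in>E. \<alpha> = (\<lambda>j. \<gamma> j + l i j)"
    and a: "a \<in> Y" "\<And>\<beta>. \<beta> \<in> E \<Longrightarrow> rk \<beta> < N \<Longrightarrow> a \<beta> = \<zero>\<^bsub>K\<^esub>"
  shows "\<exists>i\<in>I. \<exists>y\<in>carrier S. (\<forall>\<beta>\<in>E. y \<beta> \<noteq> \<zero>\<^bsub>K\<^esub> \<longrightarrow> rk (\<lambda>j. \<beta> j + l i j) = N) \<and>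
    a \<ominus>\<^bsub>S\<^esub> y \<otimes>\<^bsub>S\<^esub> g i \<in> Y \<and> (\<forall>\<beta>\<in>E. rk \<beta> < Suc N \<longrightarrow> (a \<ominus>\<^bsub>S\<^esub> y \<otimes>\<^bsub>S\<^esub> g i) \<beta> = \<zero>\<^bsub>K\<^esub>)"
proof (cases "\<exists>\<alpha>\<in>E. rk \<alpha> = N \<and> a \<alpha> \<noteq> \<zero>\<^bsub>K\<^esub>")
  case False
  obtain i where i: "i \<in> I" using I by blast
  have "a \<ominus>\<^bsub>S\<^esub> \<zero>\<^bsub>S\<^esub> \<otimes>\<^bsub>S\<^esub> g i = a" using a(1) sub g(1)[OF i] by (auto simp: S.minus_eq)
  then show ?thesis using i a False
    by (intro bexI[of _ i] bexI[of _ "\<zero>\<^bsub>S\<^esub>"]) (auto simp: less_Suc_eq)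
next
  case True
  then obtain \<alpha> where \<alpha>: "\<alpha> \<in> E" "rk \<alpha> = N" "a \<alpha> \<noteq> \<zero>\<^bsub>K\<^esub>" by blast
  have aS: "a \<in> carrier S" using a sub by blast
  have "is_lead a \<alpha>" unfolding is_lead_def using \<alpha> a(2) by (auto simp: not_less[symmetric])
  then obtain i \<gamma> where i: "i \<in> I" "\<gamma> \<in> E" "\<alpha> = (\<lambda>j. \<gamma> j + l i j)" using cover[OF a(1)] by blast
  note gi = g(1)[OF i(1)] and li = g(2)[OF i(1)]
  have lE: "l i \<in> E" and gl: "g i (l i) \<noteq> \<zero>\<^bsub>K\<^esub>" using li by (auto simp: is_lead_def)
  define c where "c = a \<alpha> \<otimes>\<^bsub>K\<^esub> inv\<^bsub>K\<^esub> (g i (l i))"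
  have u: "g i (l i) \<in> Units K" using gl gi lE K.field_Units by auto
  have c: "c \<in> carrier K" using u aS \<alpha> by (simp add: c_def)
  have cg: "c \<otimes>\<^bsub>K\<^esub> g i (l i) = a \<alpha>" using u aS \<alpha> gi lE by (simp add: c_def K.m_assoc K.Units_inv_closed K.Units_l_inv)
  then have c0: "c \<noteq> \<zero>\<^bsub>K\<^esub>" using \<alpha> gi lE by auto
  let ?y = "monomial c \<gamma>"
  note y = monomial_closed[OF c, of \<gamma>] and ly = lead_monomial[OF c0 i(2)]
  have yg: "(?y \<otimes>\<^bsub>S\<^esub> g i) \<alpha> = a \<alpha>"
    using coeff_lead_mult[OF y gi ly li] i(2,3) cg by (simp add: monomial_def)
  have lyg: "is_lead (?y \<otimes>\<^bsub>S\<^esub> g i) \<alpha>" using is_lead_mult[OF y gi ly li] i(3) by simp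
  have "(a \<ominus>\<^bsub>S\<^esub> ?y \<otimes>\<^bsub>S\<^esub> g i) \<beta> = \<zero>\<^bsub>K\<^esub>" if b: "\<beta> \<in> E" "rk \<beta> < Suc N" for \<beta>
  proof (cases "rk \<beta> < N")
    case True
    then have "a \<beta> = \<zero>\<^bsub>K\<^esub>" "(?y \<otimes>\<^bsub>S\<^esub> g i) \<beta> = \<zero>\<^bsub>K\<^esub>"
      using a(2)[OF b(1)] lyg \<alpha> b by (auto simp: is_lead_def not_le[symmetric])
    then show ?thesis using coeff_diff[OF aS _ b(1)] y gi by (simp add: K.minus_eq)
  next
    case False
    then have "\<beta> = \<alpha>" using b \<alpha> rk_inj by (auto simp: inj_on_def less_Suc_eq)
    then show ?thesis using coeff_diff[OF aS _ b(1), of "?y \<otimes>\<^bsub>S\<^esub> g i"] y gi yg aS b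
      by (simp add: K.minus_eq K.r_neg)
  qed
  moreover have "\<forall>\<beta>\<in>E. ?y \<beta> \<noteq> \<zero>\<^bsub>K\<^esub> \<longrightarrow> rk (\<lambda>j. \<beta> j + l i j) = N"
    using i \<alpha> by (auto simp: monomial_def)
  ultimately show ?thesis using i(1) y closed[OF a(1) y i(1)] by blast
qed

text \<open>Infinitely many division steps without any notion of convergence: step \<open>N\<close>
  changes the quotient of \<open>g i\<close> only at the exponent whose sum with \<open>l i\<close>
  has rank \<open>N\<close>, so every coefficient of the quotient is settled by one step. The
  resulting identity is verified coefficient by coefficient, where finitely many steps
  suffice.\<close>

lemma division:
  assumes I: "finite I" "I \<noteq> {}" and g: "\<And>i. i \<in> I \<Longrightarrow> g i \<in> carrier S" "\<And>i. i \<in> I \<Longrightarrow> is_lead (g i) (l i)"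
    and sub: "Y \<subseteq> carrier S" and closed: "\<And>a y i. a \<in> Y \<Longrightarrow> y \<in> carrier S \<Longrightarrow> i \<in> I \<Longrightarrow> a \<ominus>\<^bsub>S\<^esub> y \<otimes>\<^bsub>S\<^esub> g i \<in> Y"
    and cover: "\<And>a \<alpha>. a \<in> Y \<Longrightarrow> is_lead a \<alpha> \<Longrightarrow> \<exists>i\<in>I. \<exists>\<gamma>\<in>E. \<alpha> = (\<lambda>j. \<gamma> j + l i j)"
    and a: "a \<in> Y"
  shows "\<exists>h\<in>I \<rightarrow> carrier S. a = finsum S (\<lambda>i. h i \<otimes>\<^bsub>S\<^esub> g i) I"
proof -
  define low where "low N b \<longleftrightarrow> (\<forall>\<beta>\<in>E. rk \<beta> < N \<longrightarrow> b \<beta> = \<zero>\<^bsub>K\<^esub>)" for N b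
  define good where "good N b i y \<longleftrightarrow> i \<in> I \<and> y \<in> carrier S \<and>
    (\<forall>\<beta>\<in>E. y \<beta> \<noteq> \<zero>\<^bsub>K\<^esub> \<longrightarrow> rk (\<lambda>j. \<beta> j + l i j) = N) \<and> b \<ominus>\<^bsub>S\<^esub> y \<otimes>\<^bsub>S\<^esub> g i \<in> Y \<and> low (Suc N) (b \<ominus>\<^bsub>S\<^esub> y \<otimes>\<^bsub>S\<^esub> g i)"
    for N b i y
  have ex: "\<exists>i y. good N b i y" if b: "b \<in> Y" "low N b" for N b
  proof -
    have "\<exists>i\<in>I. \<exists>y\<in>carrier S. (\<forall>\<beta>\<in>E. y \<beta> \<noteq> \<zero>\<^bsub>K\<^esub> \<longrightarrow> rk (\<lambda>j. \<beta> j + l i j) = N) \<and>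
        b \<ominus>\<^bsub>S\<^esub> y \<otimes>\<^bsub>S\<^esub> g i \<in> Y \<and> (\<forall>\<beta>\<in>E. rk \<beta> < Suc N \<longrightarrow> (b \<ominus>\<^bsub>S\<^esub> y \<otimes>\<^bsub>S\<^esub> g i) \<beta> = \<zero>\<^bsub>K\<^esub>)"
      by (rule division_step[OF I(2) g sub closed cover b(1)]) (use b(2) in \<open>simp_all add: low_def\<close>)
    then show ?thesis unfolding good_def low_def by blast
  qed
  define ii where "ii N b = (SOME i. \<exists>y. good N b i y)" for N b
  define yy where "yy N b = (SOME y. good N b (ii N b) y)" for N b
  have step: "good N b (ii N b) (yy N b)" if "b \<in> Y" "low N b" for N b
    unfolding yy_def ii_def using someI_ex[OF ex[OF that]] by (rule someI_ex)
  \<comment> \<open>\<open>F N\<close> is the remainder after \<open>N\<close> steps;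
    \<open>J N\<close> and \<open>y N\<close> are the divisor chosen in step \<open>N\<close> and
    its monomial factor.\<close>
  define F where "F = rec_nat a (\<lambda>N b. b \<ominus>\<^bsub>S\<^esub> yy N b \<otimes>\<^bsub>S\<^esub> g (ii N b))"
  define y where "y N = yy N (F N)" for N
  define J where "J N = ii N (F N)" for N
  have F0: "F 0 = a" and FS: "F (Suc N) = F N \<ominus>\<^bsub>S\<^esub> y N \<otimes>\<^bsub>S\<^esub> g (J N)" for N
    by (simp_all add: F_def y_def J_def)
  have FY: "F N \<in> Y \<and> low N (F N)" for N
  proof (induction N)
    case 0 show ?case using a by (simp add: F0 low_def)
  next
    case (Suc N) then show ?case using step[of "F N" N] unfolding FS y_def J_def good_def by blast
  qed
  have FC: "F N \<in> carrier S" for N using FY sub by blast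
  have J: "J N \<in> I" and y: "y N \<in> carrier S" and
    ysupp: "\<And>\<beta>. \<beta> \<in> E \<Longrightarrow> rk (\<lambda>j. \<beta> j + l (J N) j) \<noteq> N \<Longrightarrow> y N \<beta> = \<zero>\<^bsub>K\<^esub>" for N
    using step[of "F N" N] FY[of N] unfolding y_def J_def good_def by blast+
  \<comment> \<open>The coefficient of the quotient at \<open>\<beta>\<close> can come only from the
    step whose number is the rank of \<open>\<beta>\<close> plus \<open>l i\<close>. The partial
    quotient \<open>p N i\<close> keeps the coefficients contributed by the first \<open>N\<close>
    steps.\<close>
  define h where "h i = (\<lambda>\<beta>\<in>E. let N = rk (\<lambda>j. \<beta> j + l i j) in if J N = i then y N \<beta> else \<zero>\<^bsub>K\<^esub>)" for i
  define p where "p N i = (\<lambda>\<beta>\<in>E. if rk (\<lambda>j. \<beta> j + l i j) < N then h i \<beta> else \<zero>\<^bsub>K\<^esub>)" for N i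
  have h: "h i \<in> carrier S" for i using y by (auto simp: h_def carrier_S Let_def PiE_iff)
  have p: "p N i \<in> carrier S" for N i using h by (auto simp: p_def carrier_S PiE_iff)
  have pS: "p (Suc N) i = p N i \<oplus>\<^bsub>S\<^esub> (if J N = i then y N else \<zero>\<^bsub>S\<^esub>)" for N i
  proof (rule series_eqI)
    fix \<beta> assume b: "\<beta> \<in> E"
    let ?r = "rk (\<lambda>j. \<beta> j + l i j)"
    have hb: "h i \<beta> = (if J ?r = i then y ?r \<beta> else \<zero>\<^bsub>K\<^esub>)" using b by (simp add: h_def Let_def)
    show "p (Suc N) i \<beta> = (p N i \<oplus>\<^bsub>S\<^esub> (if J N = i then y N else \<zero>\<^bsub>S\<^esub>)) \<beta>"
    proof (cases "?r = N")
      case True then show ?thesis using b hb y[of N] by (auto simp: p_def)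
    next
      case False
      then have "J N = i \<Longrightarrow> y N \<beta> = \<zero>\<^bsub>K\<^esub>" using ysupp[OF b, of N] by blast
      moreover have "?r < Suc N \<longleftrightarrow> ?r < N" using False by auto
      moreover have "h i \<beta> \<in> carrier K" using h b by simp
      ultimately show ?thesis using b by (simp add: p_def)
    qed
  qed (use p y in auto)
  have partial: "a = F N \<oplus>\<^bsub>S\<^esub> finsum S (\<lambda>i. p N i \<otimes>\<^bsub>S\<^esub> g i) I" for N
  proof (induction N)
    case 0
    have "p 0 i = \<zero>\<^bsub>S\<^esub>" for i by (rule series_eqI[OF p S.zero_closed]) (simp add: p_def)
    then have "finsum S (\<lambda>i. p 0 i \<otimes>\<^bsub>S\<^esub> g i) I = \<zero>\<^bsub>S\<^esub>" using g by (intro S.add.finprod_one_eqI) auto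
    then show ?case using FC[of 0] by (simp add: F0)
  next
    case (Suc N)
    have "finsum S (\<lambda>i. p (Suc N) i \<otimes>\<^bsub>S\<^esub> g i) I
        = finsum S (\<lambda>i. p N i \<otimes>\<^bsub>S\<^esub> g i \<oplus>\<^bsub>S\<^esub> (if J N = i then y N \<otimes>\<^bsub>S\<^esub> g i else \<zero>\<^bsub>S\<^esub>)) I"
      by (rule S.finsum_cong') (use g p y in \<open>auto simp: pS S.l_distr\<close>)
    also have "\<dots> = finsum S (\<lambda>i. p N i \<otimes>\<^bsub>S\<^esub> g i) I \<oplus>\<^bsub>S\<^esub> finsum S (\<lambda>i. if J N = i then y N \<otimes>\<^bsub>S\<^esub> g i else \<zero>\<^bsub>S\<^esub>) I"
      by (rule S.finsum_addf) (use g p y in auto)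
    also have "finsum S (\<lambda>i. if J N = i then y N \<otimes>\<^bsub>S\<^esub> g i else \<zero>\<^bsub>S\<^esub>) I = y N \<otimes>\<^bsub>S\<^esub> g (J N)"
      by (rule S.add.finprod_singleton) (use J I g y in auto)
    finally have eq: "finsum S (\<lambda>i. p (Suc N) i \<otimes>\<^bsub>S\<^esub> g i) I = finsum S (\<lambda>i. p N i \<otimes>\<^bsub>S\<^esub> g i) I \<oplus>\<^bsub>S\<^esub> y N \<otimes>\<^bsub>S\<^esub> g (J N)" .
    have c: "finsum S (\<lambda>i. p N i \<otimes>\<^bsub>S\<^esub> g i) I \<in> carrier S" "y N \<otimes>\<^bsub>S\<^esub> g (J N) \<in> carrier S"
      using g p y J by (auto intro!: S.finsum_closed)
    have fs: "F (Suc N) \<oplus>\<^bsub>S\<^esub> y N \<otimes>\<^bsub>S\<^esub> g (J N) = F N"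
      unfolding FS using FC[of N] c by (simp add: S.minus_eq S.a_assoc S.l_neg)
    have "F (Suc N) \<oplus>\<^bsub>S\<^esub> (finsum S (\<lambda>i. p N i \<otimes>\<^bsub>S\<^esub> g i) I \<oplus>\<^bsub>S\<^esub> y N \<otimes>\<^bsub>S\<^esub> g (J N))
        = (F (Suc N) \<oplus>\<^bsub>S\<^esub> y N \<otimes>\<^bsub>S\<^esub> g (J N)) \<oplus>\<^bsub>S\<^esub> finsum S (\<lambda>i. p N i \<otimes>\<^bsub>S\<^esub> g i) I"
      using c FC[of "Suc N"] by (simp only: S.a_ac)
    then show ?case unfolding eq using Suc.IH fs by simp
  qed
  have "a = finsum S (\<lambda>i. h i \<otimes>\<^bsub>S\<^esub> g i) I"
  proof (rule series_eqI)
    show "a \<in> carrier S" using a sub by blast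
    show "finsum S (\<lambda>i. h i \<otimes>\<^bsub>S\<^esub> g i) I \<in> carrier S" using h g by (intro S.finsum_closed) auto
    fix \<delta> assume d: "\<delta> \<in> E"
    \<comment> \<open>After this many steps the remainder has no coefficient at
      \<open>\<delta>\<close>, and the missing tail of the quotients contributes only at greater
      rank.\<close>
    let ?N = "Suc (rk \<delta>)"
    have same: "(h i \<otimes>\<^bsub>S\<^esub> g i) \<delta> = (p ?N i \<otimes>\<^bsub>S\<^esub> g i) \<delta>" if i: "i \<in> I" for i
    proof -
      note gi = g(1)[OF i] and li = g(2)[OF i, unfolded is_lead_def]
      have "((h i \<ominus>\<^bsub>S\<^esub> p ?N i) \<otimes>\<^bsub>S\<^esub> g i) \<delta> = \<zero>\<^bsub>K\<^esub>"
      proof (rule coeff_mult_low[of _ _ "l i" ?N])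
        show "?N \<le> rk (\<lambda>j. \<alpha> j + l i j)" if "\<alpha> \<in> E" "(h i \<ominus>\<^bsub>S\<^esub> p ?N i) \<alpha> \<noteq> \<zero>\<^bsub>K\<^esub>" for \<alpha>
        proof (rule ccontr)
          assume "\<not> ?thesis"
          then have "p ?N i \<alpha> = h i \<alpha>" using that by (simp add: p_def)
          then show False using that coeff_diff[OF h[of i] p[of ?N i] that(1)] coeff_closed[OF h[of i] that(1)]
            by (simp add: K.minus_eq K.r_neg)
        qed
      qed (use h p gi li d in auto)
      moreover have "(h i \<ominus>\<^bsub>S\<^esub> p ?N i) \<otimes>\<^bsub>S\<^esub> g i = h i \<otimes>\<^bsub>S\<^esub> g i \<ominus>\<^bsub>S\<^esub> p ?N i \<otimes>\<^bsub>S\<^esub> g i"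
        using h[of i] p[of ?N i] gi by (simp add: S.minus_eq S.l_distr S.l_minus)
      ultimately have "(h i \<otimes>\<^bsub>S\<^esub> g i) \<delta> \<ominus>\<^bsub>K\<^esub> (p ?N i \<otimes>\<^bsub>S\<^esub> g i) \<delta> = \<zero>\<^bsub>K\<^esub>"
        using coeff_diff[of "h i \<otimes>\<^bsub>S\<^esub> g i" "p ?N i \<otimes>\<^bsub>S\<^esub> g i" \<delta>] h[of i] p[of ?N i] gi d by simp
      then show ?thesis using h[of i] p[of ?N i] gi d by simp
    qed
    have "F ?N \<delta> = \<zero>\<^bsub>K\<^esub>" using FY[of ?N] d by (simp add: low_def)
    moreover have "a \<delta> = F ?N \<delta> \<oplus>\<^bsub>K\<^esub> (finsum S (\<lambda>i. p ?N i \<otimes>\<^bsub>S\<^esub> g i) I) \<delta>"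
      using partial[of ?N] coeff_add[OF d, of "F ?N" "finsum S (\<lambda>i. p ?N i \<otimes>\<^bsub>S\<^esub> g i) I"] by metis
    moreover have "(finsum S (\<lambda>i. p ?N i \<otimes>\<^bsub>S\<^esub> g i) I) \<delta> = finsum K (\<lambda>i. (p ?N i \<otimes>\<^bsub>S\<^esub> g i) \<delta>) I"
      by (rule additive_finsum[OF S.is_abelian_group K.is_abelian_group coeff_additive[OF d] I(1)]) (use p g in auto)
    moreover have "(finsum S (\<lambda>i. h i \<otimes>\<^bsub>S\<^esub> g i) I) \<delta> = finsum K (\<lambda>i. (h i \<otimes>\<^bsub>S\<^esub> g i) \<delta>) I"
      by (rule additive_finsum[OF S.is_abelian_group K.is_abelian_group coeff_additive[OF d] I(1)]) (use h g in auto)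
    moreover have "finsum K (\<lambda>i. (h i \<otimes>\<^bsub>S\<^esub> g i) \<delta>) I = finsum K (\<lambda>i. (p ?N i \<otimes>\<^bsub>S\<^esub> g i) \<delta>) I"
      by (rule K.finsum_cong') (use same p g d in auto)
    moreover have "finsum K (\<lambda>i. (p ?N i \<otimes>\<^bsub>S\<^esub> g i) \<delta>) I \<in> carrier K"
      by (rule K.finsum_closed) (use p g d in auto)
    ultimately show "a \<delta> = (finsum S (\<lambda>i. h i \<otimes>\<^bsub>S\<^esub> g i) I) \<delta>" by simp
  qed
  then show ?thesis using h by blast
qed

text \<open>The standard basis argument: Dickson's lemma yields finitely many elements of the ideal
  whose leading exponents divide all the others, and division by them never leaves the ideal, so it
  ends with remainder zero.\<close>

lemma noetherian_S: "noetherian_ring S"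
proof (rule S.noetherian_ringI)
  fix I assume I: "ideal I S"
  interpret I: ideal I S by fact
  define L where "L = {\<alpha>. \<exists>f\<in>I. is_lead f \<alpha>}"
  have "L \<subseteq> E" by (auto simp: L_def is_lead_def)
  then obtain L0 where L0: "finite L0" "L0 \<subseteq> L" "\<And>\<alpha>. \<alpha> \<in> L \<Longrightarrow> \<exists>\<beta>\<in>L0. \<forall>i. \<beta> i \<le> \<alpha> i"
    using dickson by metis
  have "\<forall>\<beta>\<in>L0. \<exists>f\<in>I. is_lead f \<beta>" using L0(2) by (auto simp: L_def)
  then obtain g where g: "\<And>\<beta>. \<beta> \<in> L0 \<Longrightarrow> g \<beta> \<in> I" "\<And>\<beta>. \<beta> \<in> L0 \<Longrightarrow> is_lead (g \<beta>) \<beta>" by metis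
  show "\<exists>A\<subseteq>carrier S. finite A \<and> I = genideal S A"
  \<comment> \<open>The zero ideal has no leading exponents, and \<open>division\<close> requires at
    least one divisor.\<close>
  proof (cases "I = {\<zero>\<^bsub>S\<^esub>}")
    case True
    then show ?thesis using S.genideal_zero by (intro exI[of _ "{\<zero>\<^bsub>S\<^esub>}"]) auto
  next
    case False
    then obtain f where f: "f \<in> I" "f \<noteq> \<zero>\<^bsub>S\<^esub>" using I.zero_closed by blast
    then obtain \<alpha> where "is_lead f \<alpha>" using lead_exists[OF I.Icarr[OF f(1)]] by blast
    then have "\<alpha> \<in> L" using f(1) by (auto simp: L_def)
    then have ne: "L0 \<noteq> {}" using L0(3) by blast
    let ?A = "g ` L0"
    have A: "?A \<subseteq> carrier S" using g(1) I.Icarr by blast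
    interpret A: ideal "genideal S ?A" S by (rule S.genideal_ideal[OF A])
    have "genideal S ?A \<subseteq> I" by (rule S.genideal_minimal[OF I]) (use g(1) in blast)
    moreover have "a \<in> genideal S ?A" if a: "a \<in> I" for a
    proof -
      have closed: "b \<ominus>\<^bsub>S\<^esub> y \<otimes>\<^bsub>S\<^esub> g i \<in> I" if "b \<in> I" "y \<in> carrier S" "i \<in> L0" for b y i
        unfolding S.minus_eq by (intro I.a_closed I.a_inv_closed I.I_l_closed that g(1))
      have cover: "\<exists>i\<in>L0. \<exists>\<gamma>\<in>E. \<alpha> = (\<lambda>j. \<gamma> j + i j)" if "b \<in> I" "is_lead b \<alpha>" for b \<alpha>
      proof -
        have "\<alpha> \<in> L" using that by (auto simp: L_def)
        then obtain \<beta> where b: "\<beta> \<in> L0" "\<And>i. \<beta> i \<le> \<alpha> i" using L0(3) by blast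
        have "\<alpha> \<in> E" using \<open>\<alpha> \<in> L\<close> \<open>L \<subseteq> E\<close> by blast
        then have "(\<lambda>j. \<alpha> j - \<beta> j) \<in> E" by (simp add: exponents_def)
        then show ?thesis using b by (intro bexI[of _ \<beta>] bexI[of _ "\<lambda>j. \<alpha> j - \<beta> j"]) auto
      qed
      have "\<exists>h\<in>L0 \<rightarrow> carrier S. a = finsum S (\<lambda>i. h i \<otimes>\<^bsub>S\<^esub> g i) L0"
        by (rule division[where l = "\<lambda>i. i", OF L0(1) ne I.Icarr[OF g(1)] g(2) I.a_subset closed cover a])
      then obtain h where h: "h \<in> L0 \<rightarrow> carrier S" "a = finsum S (\<lambda>i. h i \<otimes>\<^bsub>S\<^esub> g i) L0" ..
      have "finsum S (\<lambda>i. h i \<otimes>\<^bsub>S\<^esub> g i) L' \<in> genideal S ?A" if "finite L'" "L' \<subseteq> L0" for L'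
        using that
      proof (induction L')
        case empty show ?case using A.zero_closed by simp
      next
        case (insert i L')
        have "h i \<in> carrier S" "g i \<in> genideal S ?A" using insert h(1) S.genideal_self[OF A] by auto
        moreover have "finsum S (\<lambda>i. h i \<otimes>\<^bsub>S\<^esub> g i) (insert i L') = h i \<otimes>\<^bsub>S\<^esub> g i \<oplus>\<^bsub>S\<^esub> finsum S (\<lambda>i. h i \<otimes>\<^bsub>S\<^esub> g i) L'"
          by (rule S.finsum_insert) (use insert h(1) A in \<open>auto simp: Pi_iff subset_iff\<close>)
        ultimately show ?case using insert A.a_closed A.I_l_closed by simp
      qed
      then show ?thesis using h(2) L0(1) by blast
    qed
    ultimately show ?thesis using A L0(1) by (intro exI[of _ ?A]) auto
  qed
qed

section \<open>Complete integral closedness of the power series ring\<close>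

lemma lead_pow:
  assumes "f \<in> carrier S" "is_lead f \<alpha>"
  shows "is_lead (f [^]\<^bsub>S\<^esub> (m::nat)) (\<lambda>i. m * \<alpha> i)"
proof (induction m)
  case 0
  have "is_lead \<one>\<^bsub>S\<^esub> (\<lambda>i. 0)"
    by (auto simp: is_lead_def power_series_def exponents_def)
  then show ?case by simp
next
  case (Suc m)
  then show ?case using is_lead_mult[OF S.nat_pow_closed[OF assms(1)] assms(1) Suc assms(2)]
    by (simp add: add.commute)
qed

lemma lead_unique: "is_lead f \<alpha> \<Longrightarrow> is_lead f \<beta> \<Longrightarrow> \<alpha> = \<beta>"
  using rk_inj unfolding is_lead_def by (metis inj_onD order.antisym)

text \<open>Let \<open>Y\<close> consist of the numerators \<open>a\<close> for which all powers of
  \<open>a / f\<close> have the denominator \<open>g\<close>. It is stable under subtracting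
  multiples of \<open>f\<close>, and the leading exponent of \<open>f\<close> divides those of its
  members. Division by the single series \<open>f\<close> therefore runs inside \<open>Y\<close> and
  leaves no remainder, so \<open>f\<close> divides every member.\<close>

lemma cic_S: "completely_integrally_closed S"
  unfolding completely_integrally_closed_def
proof (intro ballI impI)
  fix f g a assume fga: "f \<in> carrier S - {\<zero>\<^bsub>S\<^esub>}" "g \<in> carrier S - {\<zero>\<^bsub>S\<^esub>}" "a \<in> carrier S"
    and dv: "\<forall>m::nat. f [^]\<^bsub>S\<^esub> m divides\<^bsub>S\<^esub> g \<otimes>\<^bsub>S\<^esub> a [^]\<^bsub>S\<^esub> m"
  obtain l where l: "is_lead f l" using lead_exists fga by blast
  obtain lg where lg: "is_lead g lg" using lead_exists fga by blast
  define Y where "Y = {a \<in> carrier S. \<forall>m::nat. f [^]\<^bsub>S\<^esub> m divides\<^bsub>S\<^esub> g \<otimes>\<^bsub>S\<^esub> a [^]\<^bsub>S\<^esub> m}"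
  have c: "f \<in> carrier S" "g \<in> carrier S" using fga by auto
  have closed: "b \<ominus>\<^bsub>S\<^esub> y \<otimes>\<^bsub>S\<^esub> f \<in> Y" if b: "b \<in> Y" and y: "y \<in> carrier S" for b y
  proof -
    have bS: "b \<in> carrier S" using b by (simp add: Y_def)
    let ?d = "b \<ominus>\<^bsub>S\<^esub> y \<otimes>\<^bsub>S\<^esub> f"
    have dS: "?d \<in> carrier S" using bS y c by simp
    \<comment> \<open>Mixed powers of \<open>b\<close> and of the new numerator make an induction on
      \<open>j\<close> possible: \<open>j = 0\<close> is the membership of \<open>b\<close>, and
      \<open>m = 0\<close> is the claim. The step rewrites one factor \<open>?d\<close> as
      \<open>b\<close> minus a multiple of \<open>f\<close>.\<close>
    have "\<exists>z\<in>carrier S. g \<otimes>\<^bsub>S\<^esub> b [^]\<^bsub>S\<^esub> m \<otimes>\<^bsub>S\<^esub> ?d [^]\<^bsub>S\<^esub> j = f [^]\<^bsub>S\<^esub> (m + j) \<otimes>\<^bsub>S\<^esub> z" for m j :: nat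
    proof (induction j arbitrary: m)
      case 0
      then show ?case using b bS c by (auto simp: Y_def factor_def)
    next
      case (Suc j)
      obtain z where z: "z \<in> carrier S" "g \<otimes>\<^bsub>S\<^esub> b [^]\<^bsub>S\<^esub> m \<otimes>\<^bsub>S\<^esub> ?d [^]\<^bsub>S\<^esub> j = f [^]\<^bsub>S\<^esub> (m + j) \<otimes>\<^bsub>S\<^esub> z"
        using Suc[of m] by blast
      obtain w where w: "w \<in> carrier S" "g \<otimes>\<^bsub>S\<^esub> b [^]\<^bsub>S\<^esub> Suc m \<otimes>\<^bsub>S\<^esub> ?d [^]\<^bsub>S\<^esub> j = f [^]\<^bsub>S\<^esub> (Suc m + j) \<otimes>\<^bsub>S\<^esub> w"
        using Suc[of "Suc m"] by blast
      let ?D = "?d [^]\<^bsub>S\<^esub> j" and ?B = "b [^]\<^bsub>S\<^esub> m"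
      have DB: "?D \<in> carrier S" "?B \<in> carrier S" using dS bS by auto
      have "g \<otimes>\<^bsub>S\<^esub> ?B \<otimes>\<^bsub>S\<^esub> ?d [^]\<^bsub>S\<^esub> Suc j = (g \<otimes>\<^bsub>S\<^esub> ?B \<otimes>\<^bsub>S\<^esub> ?D) \<otimes>\<^bsub>S\<^esub> ?d"
        using DB c dS by (simp add: S.m_assoc)
      also have "\<dots> = (g \<otimes>\<^bsub>S\<^esub> ?B \<otimes>\<^bsub>S\<^esub> ?D) \<otimes>\<^bsub>S\<^esub> b \<ominus>\<^bsub>S\<^esub> (g \<otimes>\<^bsub>S\<^esub> ?B \<otimes>\<^bsub>S\<^esub> ?D) \<otimes>\<^bsub>S\<^esub> (y \<otimes>\<^bsub>S\<^esub> f)"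
        using DB c bS y by (simp add: S.minus_eq S.r_distr S.r_minus)
      also have "(g \<otimes>\<^bsub>S\<^esub> ?B \<otimes>\<^bsub>S\<^esub> ?D) \<otimes>\<^bsub>S\<^esub> b = g \<otimes>\<^bsub>S\<^esub> b [^]\<^bsub>S\<^esub> Suc m \<otimes>\<^bsub>S\<^esub> ?D"
        using DB c bS by (simp add: S.m_assoc S.m_comm[of ?D b])
      also have "\<dots> = f [^]\<^bsub>S\<^esub> (Suc m + j) \<otimes>\<^bsub>S\<^esub> w" by (rule w(2))
      also have "f [^]\<^bsub>S\<^esub> (Suc m + j) = f [^]\<^bsub>S\<^esub> (m + j) \<otimes>\<^bsub>S\<^esub> f" by simp
      also have "(g \<otimes>\<^bsub>S\<^esub> ?B \<otimes>\<^bsub>S\<^esub> ?D) \<otimes>\<^bsub>S\<^esub> (y \<otimes>\<^bsub>S\<^esub> f) = (f [^]\<^bsub>S\<^esub> (m + j) \<otimes>\<^bsub>S\<^esub> f) \<otimes>\<^bsub>S\<^esub> (z \<otimes>\<^bsub>S\<^esub> y)"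
        unfolding z(2) using z(1) y c by (simp add: S.m_ac)
      also have "(f [^]\<^bsub>S\<^esub> (m + j) \<otimes>\<^bsub>S\<^esub> f) \<otimes>\<^bsub>S\<^esub> w \<ominus>\<^bsub>S\<^esub> (f [^]\<^bsub>S\<^esub> (m + j) \<otimes>\<^bsub>S\<^esub> f) \<otimes>\<^bsub>S\<^esub> (z \<otimes>\<^bsub>S\<^esub> y)
          = f [^]\<^bsub>S\<^esub> (m + Suc j) \<otimes>\<^bsub>S\<^esub> (w \<ominus>\<^bsub>S\<^esub> z \<otimes>\<^bsub>S\<^esub> y)"
        using z(1) w(1) y c by (simp add: S.minus_eq S.r_distr S.r_minus)
      finally show ?case using w(1) z(1) y by blast
    qed
    from this[of 0] have "f [^]\<^bsub>S\<^esub> j divides\<^bsub>S\<^esub> g \<otimes>\<^bsub>S\<^esub> ?d [^]\<^bsub>S\<^esub> j" for j :: nat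
      using c unfolding factor_def by simp
    then show ?thesis using dS by (simp add: Y_def)
  qed
  have cover: "\<exists>\<gamma>\<in>E. \<alpha> = (\<lambda>j. \<gamma> j + l j)" if b: "b \<in> Y" and \<alpha>: "is_lead b \<alpha>" for b \<alpha>
  proof -
    have bS: "b \<in> carrier S" using b by (simp add: Y_def)
    have le: "m * l i \<le> lg i + m * \<alpha> i" for m i
    proof -
      obtain z where z: "z \<in> carrier S" "g \<otimes>\<^bsub>S\<^esub> b [^]\<^bsub>S\<^esub> m = f [^]\<^bsub>S\<^esub> m \<otimes>\<^bsub>S\<^esub> z"
        using b by (auto simp: Y_def factor_def)
      have L: "is_lead (g \<otimes>\<^bsub>S\<^esub> b [^]\<^bsub>S\<^esub> m) (\<lambda>i. lg i + m * \<alpha> i)"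
        using is_lead_mult[OF c(2) _ lg lead_pow[OF bS \<alpha>]] bS by simp
      have "z \<noteq> \<zero>\<^bsub>S\<^esub>" using lead_nonzero[OF L] z c by auto
      then obtain lz where lz: "is_lead z lz" using lead_exists z by blast
      have "is_lead (f [^]\<^bsub>S\<^esub> m \<otimes>\<^bsub>S\<^esub> z) (\<lambda>i. m * l i + lz i)"
        using is_lead_mult[OF _ z(1) lead_pow[OF c(1) l] lz] c by simp
      then have "(\<lambda>i. lg i + m * \<alpha> i) = (\<lambda>i. m * l i + lz i)" using L z(2) lead_unique by metis
      then have "lg i + m * \<alpha> i = m * l i + lz i" by (rule fun_cong)
      then show ?thesis by simp
    qed
    have "l i \<le> \<alpha> i" for i
    proof (rule ccontr)
      assume "\<not> ?thesis"
      then have "Suc (\<alpha> i) \<le> l i" by simp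
      \<comment> \<open>In \<open>m l \<le> lg + m \<alpha>\<close> the constant \<open>lg\<close>
        becomes negligible for large \<open>m\<close>; taking \<open>m\<close> to be
        \<open>Suc (lg i)\<close> is enough.\<close>
      then have "Suc (lg i) * Suc (\<alpha> i) \<le> Suc (lg i) * l i" by (rule mult_le_mono2)
      then show False using le[of "Suc (lg i)" i] by simp
    qed
    moreover have "(\<lambda>j. \<alpha> j - l j) \<in> E" using \<alpha> by (simp add: is_lead_def exponents_def)
    ultimately show ?thesis by (intro bexI[of _ "\<lambda>j. \<alpha> j - l j"]) auto
  qed
  have "a \<in> Y" using dv fga by (simp add: Y_def)
  then obtain h where h: "h \<in> {()} \<rightarrow> carrier S" "a = finsum S (\<lambda>i. h i \<otimes>\<^bsub>S\<^esub> f) {()}"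
    \<comment> \<open>A single divisor, hence an index set with one element.\<close>
    using division[of "{()}" "\<lambda>_. f" "\<lambda>_. l" Y a] c l closed cover by (auto simp: Y_def)
  have "finsum S (\<lambda>i. h i \<otimes>\<^bsub>S\<^esub> f) {()} = h () \<otimes>\<^bsub>S\<^esub> f"
    using S.add.finprod_insert[of "{}" "()" "\<lambda>i. h i \<otimes>\<^bsub>S\<^esub> f"] h(1) c by (simp add: Pi_iff)
  then have "a = f \<otimes>\<^bsub>S\<^esub> h ()" using h c S.m_comm[of "h ()" f] by auto
  then show "f divides\<^bsub>S\<^esub> a" using h(1) by (auto simp: factor_def)
qed

end

section \<open>Localisation at an element\<close>

text \<open>Otherwise some prime would contain the annihilator of \<open>x\<close> but not
  \<open>g\<close>, although by assumption the annihilator has an element outside that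
  prime.\<close>

lemma (in cring) vanishing_on_basic_open:
  assumes g: "g \<in> carrier R" and x: "x \<in> carrier R"
    and van: "\<And>Q. Q \<in> Spec R \<Longrightarrow> g \<notin> Q \<Longrightarrow> \<exists>u\<in>carrier R - Q. u \<otimes> x = \<zero>"
  shows "\<exists>N::nat. g [^] N \<otimes> x = \<zero>"
proof (rule ccontr)
  let ?A = "{u \<in> carrier R. u \<otimes> x = \<zero>}"
  assume "\<not> ?thesis"
  then have no: "g [^] k \<notin> ?A" for k :: nat by blast
  have A: "ideal ?A R"
    by (rule cring_idealI) (use x in \<open>auto simp: l_distr m_assoc\<close>)
  obtain Q where Q: "primeideal Q R" "?A \<subseteq> Q" "g \<notin> Q"
    by (rule prime_avoiding_powers[OF A g no])
  then show False using van[of Q] by (auto simp: Spec_def)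
qed

lemma (in cring) openin_basic:
  "f \<in> carrier R \<Longrightarrow> openin (zariski R) {Q \<in> Spec R. f \<notin> Q}"
  unfolding openin_zariski by (intro exI[of _ "{f}"]) auto

lemma (in primeideal) one_notin: "\<one> \<notin> I"
  using I_notcarr one_imp_carrier by blast

lemma (in cring) local_frac_self:
  assumes "Q \<in> Spec R" "a \<in> carrier R" "b \<in> carrier R - Q"
  shows "(a, b) \<in> local_frac R Q a b"
proof -
  interpret primeideal Q R using assms by (simp add: Spec_def)
  show ?thesis unfolding local_frac_def using assms one_notin by auto
qed

lemma (in cring) fraction_section:
  assumes "f \<in> carrier R" "a \<in> carrier R"
  shows "(\<lambda>P\<in>{Q \<in> Spec R. f \<notin> Q}. local_frac R P a \<one>) \<in> carrier (sections R {Q \<in> Spec R. f \<notin> Q})"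
proof -
  have "\<one> \<notin> Q" if "Q \<in> Spec R" for Q
    using that primeideal.one_notin by (auto simp: Spec_def)
  then have "\<forall>Q\<in>{Q \<in> Spec R. f \<notin> Q}. \<one> \<notin> Q \<and>
      (\<lambda>P\<in>{Q \<in> Spec R. f \<notin> Q}. local_frac R P a \<one>) Q = local_frac R Q a \<one>"
    by simp
  then show ?thesis
    unfolding sections_def using openin_basic[OF assms(1)] assms(2) one_closed by (simp only: ring.simps partial_object.simps) blast
qed

lemma section_locally_fraction:
  assumes "s \<in> carrier (sections R W)" "P \<in> W"
  obtains E a b where "E \<subseteq> carrier R" "\<not> E \<subseteq> P" "{Q \<in> Spec R. \<not> E \<subseteq> Q} \<subseteq> W"
    "a \<in> carrier R" "b \<in> carrier R"
    "\<And>Q. Q \<in> Spec R \<Longrightarrow> \<not> E \<subseteq> Q \<Longrightarrow> b \<notin> Q \<and> s Q = local_frac R Q a b"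
proof -
  have "\<exists>W'. openin (zariski R) W' \<and> P \<in> W' \<and> W' \<subseteq> W \<and>
        (\<exists>a\<in>carrier R. \<exists>b\<in>carrier R. \<forall>Q\<in>W'. b \<notin> Q \<and> s Q = local_frac R Q a b)"
    using assms unfolding sections_def partial_object.simps by blast
  then obtain W' a b where W': "openin (zariski R) W'" "P \<in> W'" "W' \<subseteq> W"
    and ab: "a \<in> carrier R" "b \<in> carrier R" "\<forall>Q\<in>W'. b \<notin> Q \<and> s Q = local_frac R Q a b"
    by (elim exE conjE bexE)
  obtain E where E: "E \<subseteq> carrier R" "W' = {Q \<in> Spec R. \<not> E \<subseteq> Q}"
    using W'(1) unfolding openin_zariski by (elim exE conjE)
  show ?thesis
  proof (rule that[of E a b])
    show "\<not> E \<subseteq> P" using W'(2) unfolding E(2) by simp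
    show "{Q \<in> Spec R. \<not> E \<subseteq> Q} \<subseteq> W" using W'(3) unfolding E(2) .
    show "b \<notin> Q \<and> s Q = local_frac R Q a b" if "Q \<in> Spec R" "\<not> E \<subseteq> Q" for Q
    proof -
      have "Q \<in> W'" unfolding E(2) using that by simp
      then show ?thesis by (rule bspec[OF ab(3)])
    qed
  qed (fact E(1) ab(1) ab(2))+
qed

lemma Spec_map_Spec:
  assumes "cring C" "cring B" "\<phi> \<in> ring_hom C B" "Q \<in> Spec B"
  shows "Spec_map C \<phi> Q \<in> Spec C"
proof -
  interpret C: cring C by fact
  interpret B: cring B by fact
  interpret h: ring_hom_cring C B \<phi>
    by (simp add: ring_hom_cring_def ring_hom_cring_axioms_def assms)
  interpret Q: primeideal Q B using assms(4) by (simp add: Spec_def)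
  have "ideal (Spec_map C \<phi> Q) C"
    by (rule C.cring_idealI) (auto simp: Spec_map_def intro!: Q.I_l_closed)
  moreover have "\<one>\<^bsub>C\<^esub> \<notin> Spec_map C \<phi> Q" using Q.one_notin by (simp add: Spec_map_def)
  then have "carrier C \<noteq> Spec_map C \<phi> Q" by blast
  ultimately have "primeideal (Spec_map C \<phi> Q) C"
    by (intro primeidealI C.is_cring) (use Q.I_prime in \<open>simp_all add: Spec_map_def\<close>)
  then show ?thesis by (simp add: Spec_def)
qed

text \<open>The two inclusions make the basic open sets of \<open>f\<close> and of
  \<open>\<phi> f\<close> correspond under the isomorphism. The comparison of sections over them is
  unwound into elementary statements: \<open>denominator\<close> is surjectivity and
  \<open>kernel_torsion\<close> is injectivity of the map between the localisations at
  \<open>f\<close> and at \<open>\<phi> f\<close>.\<close>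

locale iso_on_basic_open =
  C: cring C + B: cring B + hom: ring_hom_cring C B \<phi> for C (structure) and B (structure) and \<phi> +
  fixes VG VV f
  assumes iso: "restricts_to_iso C B \<phi> VG VV"
    and VG: "VG \<subseteq> Spec B"
    and f: "f \<in> carrier C"
    and sub_VV: "{P \<in> Spec C. f \<notin> P} \<subseteq> VV"
    and sub_VG: "{Q \<in> Spec B. \<phi> f \<notin> Q} \<subseteq> VG"
begin

abbreviation "D \<equiv> {P \<in> Spec C. f \<notin> P}"
abbreviation "D' \<equiv> {Q \<in> Spec B. \<phi> f \<notin> Q}"

lemma map_Spec: "Q \<in> Spec B \<Longrightarrow> Spec_map C \<phi> Q \<in> Spec C"
  using Spec_map_Spec[OF C.is_cring B.is_cring hom.homh] .

lemma sections_iso: "sections_map C B \<phi> D' \<in> ring_iso (sections C D) (sections B D')"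
proof -
  have "openin (subtopology (zariski C) VV) D"
    unfolding openin_subtopology using C.openin_basic[OF f] sub_VV by blast
  moreover have "{Q \<in> VG. Spec_map C \<phi> Q \<in> D} = D'"
    using VG sub_VG map_Spec f by (auto simp: Spec_map_def)
  ultimately show ?thesis
    using iso by (auto simp: restricts_to_iso_def Let_def)
qed

text \<open>The \<open>x\<close> for which \<open>\<phi> x\<close> times \<open>b\<close> is in the
  image of \<open>\<phi>\<close> form an ideal. If it contained no power of \<open>f\<close>, it
  would lie in a prime \<open>Q\<close> missing \<open>f\<close>. The section \<open>b / 1\<close>
  comes from a section over the basic open set of \<open>f\<close>, which near \<open>Q\<close> is a
  fraction \<open>c / d\<close>; clearing this fraction gives an element of the ideal outside
  \<open>Q\<close>.\<close>

lemma denominator: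
  assumes b: "b \<in> carrier B"
  shows "\<exists>k::nat. \<exists>c\<in>carrier C. \<phi> c = \<phi> (f [^]\<^bsub>C\<^esub> k) \<otimes>\<^bsub>B\<^esub> b"
proof (rule ccontr)
  assume no: "\<not> ?thesis"
  define I where "I = {x \<in> carrier C. \<exists>c\<in>carrier C. \<phi> c = \<phi> x \<otimes>\<^bsub>B\<^esub> b}"
  have I: "ideal I C"
  proof (rule C.cring_idealI)
    show "\<zero>\<^bsub>C\<^esub> \<in> I" using b by (auto simp: I_def intro!: bexI[of _ "\<zero>\<^bsub>C\<^esub>"])
    show "x \<oplus>\<^bsub>C\<^esub> y \<in> I" if xy: "x \<in> I" "y \<in> I" for x y
    proof -
      obtain c d where "x \<in> carrier C" "y \<in> carrier C" "c \<in> carrier C" "\<phi> c = \<phi> x \<otimes>\<^bsub>B\<^esub> b"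
        "d \<in> carrier C" "\<phi> d = \<phi> y \<otimes>\<^bsub>B\<^esub> b" using xy by (auto simp: I_def)
      then show ?thesis using b unfolding I_def
        by (intro CollectI conjI bexI[of _ "c \<oplus>\<^bsub>C\<^esub> d"]) (simp_all add: B.l_distr)
    qed
    show "y \<otimes>\<^bsub>C\<^esub> x \<in> I" if xy: "x \<in> I" "y \<in> carrier C" for x y
    proof -
      obtain c where "x \<in> carrier C" "c \<in> carrier C" "\<phi> c = \<phi> x \<otimes>\<^bsub>B\<^esub> b" using xy by (auto simp: I_def)
      then show ?thesis using b xy(2) unfolding I_def
        by (intro CollectI conjI bexI[of _ "y \<otimes>\<^bsub>C\<^esub> c"]) (simp_all add: B.m_assoc)
    qed
  qed (auto simp: I_def)
  have "f [^]\<^bsub>C\<^esub> k \<notin> I" for k :: nat using no by (auto simp: I_def)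
  then obtain Q where Q: "primeideal Q C" "I \<subseteq> Q" "f \<notin> Q"
    by (rule C.prime_avoiding_powers[OF I f])
  interpret Q: primeideal Q C by fact
  have QD: "Q \<in> D" using Q by (simp add: Spec_def)
  let ?\<sigma> = "\<lambda>P\<in>D'. local_frac B P b \<one>\<^bsub>B\<^esub>"
  have "?\<sigma> \<in> sections_map C B \<phi> D' ` carrier (sections C D)"
  proof -
    have "sections_map C B \<phi> D' ` carrier (sections C D) = carrier (sections B D')"
      using sections_iso unfolding ring_iso_def bij_betw_def by blast
    then show ?thesis using B.fraction_section[OF hom.hom_closed[OF f] b] by (simp only:)
  qed
  then obtain s where s: "?\<sigma> = sections_map C B \<phi> D' s" "s \<in> carrier (sections C D)" by (rule imageE)
  obtain E c d where E: "E \<subseteq> carrier C" "\<not> E \<subseteq> Q" "{P \<in> Spec C. \<not> E \<subseteq> P} \<subseteq> D"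
    and c: "c \<in> carrier C" and d: "d \<in> carrier C"
    and frac: "\<And>P. P \<in> Spec C \<Longrightarrow> \<not> E \<subseteq> P \<Longrightarrow> d \<notin> P \<and> s P = local_frac C P c d"
    by (rule section_locally_fraction[OF s(2) QD]) blast
  obtain e where e: "e \<in> E" "e \<notin> Q" using E(2) by blast
  have ec: "e \<in> carrier C" using e E by blast
  \<comment> \<open>\<open>?x\<close> measures the failure of
    \<open>b = \<phi> c / \<phi> d\<close>. It vanishes in the local rings at all primes missing
    \<open>\<phi> e\<close>, so a power of \<open>\<phi> e\<close> kills it.\<close>
  let ?x = "\<phi> d \<otimes>\<^bsub>B\<^esub> b \<ominus>\<^bsub>B\<^esub> \<phi> c"
  have "\<exists>N::nat. \<phi> e [^]\<^bsub>B\<^esub> N \<otimes>\<^bsub>B\<^esub> ?x = \<zero>\<^bsub>B\<^esub>"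
  proof (rule B.vanishing_on_basic_open)
    fix Q' assume Q': "Q' \<in> Spec B" "\<phi> e \<notin> Q'"
    interpret Q': primeideal Q' B using Q' by (simp add: Spec_def)
    let ?P = "Spec_map C \<phi> Q'"
    have P: "?P \<in> Spec C" using map_Spec Q' by blast
    have PE: "\<not> E \<subseteq> ?P" using e Q' by (auto simp: Spec_map_def)
    then have "?P \<in> D" using E(3) P by blast
    then have Q'D: "Q' \<in> D'" using Q' f by (simp add: Spec_map_def)
    note fracP = frac[OF P PE]
    have "(c, d) \<in> s ?P" using fracP C.local_frac_self[OF P c, of d] d by simp
    moreover have "(\<Union>(a, b)\<in>s ?P. local_frac B Q' (\<phi> a) (\<phi> b)) = local_frac B Q' b \<one>\<^bsub>B\<^esub>"
      using fun_cong[OF s(1)[symmetric], of Q'] Q'D by (simp add: sections_map_def)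
    ultimately have "local_frac B Q' (\<phi> c) (\<phi> d) \<subseteq> local_frac B Q' b \<one>\<^bsub>B\<^esub>" by blast
    moreover have "\<phi> d \<in> carrier B - Q'" using fracP d by (auto simp: Spec_map_def)
    ultimately have "(\<phi> c, \<phi> d) \<in> local_frac B Q' b \<one>\<^bsub>B\<^esub>"
      using B.local_frac_self[OF Q'(1), of "\<phi> c" "\<phi> d"] c by auto
    then obtain u where u: "u \<in> carrier B - Q'" "u \<otimes>\<^bsub>B\<^esub> (b \<otimes>\<^bsub>B\<^esub> \<phi> d) = u \<otimes>\<^bsub>B\<^esub> (\<phi> c \<otimes>\<^bsub>B\<^esub> \<one>\<^bsub>B\<^esub>)"
      by (auto simp: local_frac_def)
    have "u \<otimes>\<^bsub>B\<^esub> ?x = u \<otimes>\<^bsub>B\<^esub> (b \<otimes>\<^bsub>B\<^esub> \<phi> d) \<ominus>\<^bsub>B\<^esub> u \<otimes>\<^bsub>B\<^esub> \<phi> c"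
      using u(1) b c d by (simp add: B.minus_eq B.r_distr B.r_minus B.m_comm)
    also have "\<dots> = \<zero>\<^bsub>B\<^esub>" using u b c d by (simp add: B.minus_eq B.r_neg)
    finally show "\<exists>u\<in>carrier B - Q'. u \<otimes>\<^bsub>B\<^esub> ?x = \<zero>\<^bsub>B\<^esub>" using u by blast
  qed (use ec b c d in auto)
  then obtain N where N: "\<phi> e [^]\<^bsub>B\<^esub> (N::nat) \<otimes>\<^bsub>B\<^esub> ?x = \<zero>\<^bsub>B\<^esub>" by blast
  have pow: "\<phi> (e [^]\<^bsub>C\<^esub> N) = \<phi> e [^]\<^bsub>B\<^esub> N" using ec by (induction N) simp_all
  have "\<phi> e [^]\<^bsub>B\<^esub> N \<otimes>\<^bsub>B\<^esub> (\<phi> d \<otimes>\<^bsub>B\<^esub> b) \<ominus>\<^bsub>B\<^esub> \<phi> e [^]\<^bsub>B\<^esub> N \<otimes>\<^bsub>B\<^esub> \<phi> c = \<zero>\<^bsub>B\<^esub>"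
    using N ec b c d by (simp add: B.minus_eq B.r_distr B.r_minus)
  then have "\<phi> e [^]\<^bsub>B\<^esub> N \<otimes>\<^bsub>B\<^esub> (\<phi> d \<otimes>\<^bsub>B\<^esub> b) = \<phi> e [^]\<^bsub>B\<^esub> N \<otimes>\<^bsub>B\<^esub> \<phi> c"
    using ec b c d by simp
  then have "\<phi> (e [^]\<^bsub>C\<^esub> N \<otimes>\<^bsub>C\<^esub> c) = \<phi> (e [^]\<^bsub>C\<^esub> N \<otimes>\<^bsub>C\<^esub> d) \<otimes>\<^bsub>B\<^esub> b"
    using ec b c d by (simp add: pow B.m_assoc)
  then have "e [^]\<^bsub>C\<^esub> N \<otimes>\<^bsub>C\<^esub> d \<in> I" using ec c d unfolding I_def
    by (intro CollectI conjI bexI[of _ "e [^]\<^bsub>C\<^esub> N \<otimes>\<^bsub>C\<^esub> c"]) simp_all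
  then have "e [^]\<^bsub>C\<^esub> N \<otimes>\<^bsub>C\<^esub> d \<in> Q" using Q by blast
  moreover have "e [^]\<^bsub>C\<^esub> N \<in> carrier C - Q" using Q.pow_notin[of e N] ec e by blast
  ultimately show False using Q.I_prime[of "e [^]\<^bsub>C\<^esub> N" d] d frac[OF _ E(2)] QD by blast
qed

text \<open>The map on sections takes a union over all representatives of a class, so every
  representative \<open>(a, b)\<close> of \<open>z / 1\<close> has to be examined. For each of them
  some \<open>u\<close> outside the prime has \<open>u z b = u a\<close>, hence
  \<open>\<phi> u\<close> kills \<open>\<phi> a\<close>.\<close>

lemma local_frac_image_of_kernel:
  assumes Q: "Q \<in> Spec B" and z: "z \<in> carrier C" "\<phi> z = \<zero>\<^bsub>B\<^esub>"
    and ab: "(a, b) \<in> local_frac C (Spec_map C \<phi> Q) z \<one>\<^bsub>C\<^esub>"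
  shows "local_frac B Q (\<phi> a) (\<phi> b) = local_frac B Q \<zero>\<^bsub>B\<^esub> \<one>\<^bsub>B\<^esub>"
proof -
  interpret Q: primeideal Q B using Q by (simp add: Spec_def)
  obtain u where u: "u \<in> carrier C" "\<phi> u \<notin> Q" "u \<otimes>\<^bsub>C\<^esub> (z \<otimes>\<^bsub>C\<^esub> b) = u \<otimes>\<^bsub>C\<^esub> (a \<otimes>\<^bsub>C\<^esub> \<one>\<^bsub>C\<^esub>)"
    and a: "a \<in> carrier C" and b: "b \<in> carrier C" "\<phi> b \<notin> Q"
    using ab unfolding local_frac_def Spec_map_def by blast
  have "\<phi> u \<otimes>\<^bsub>B\<^esub> \<phi> a = \<phi> (u \<otimes>\<^bsub>C\<^esub> (a \<otimes>\<^bsub>C\<^esub> \<one>\<^bsub>C\<^esub>))" using u a by simp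
  also have "\<dots> = \<phi> (u \<otimes>\<^bsub>C\<^esub> (z \<otimes>\<^bsub>C\<^esub> b))" using u(3) by simp
  also have "\<dots> = \<zero>\<^bsub>B\<^esub>" using u(1) z b by simp
  finally have ua: "\<phi> u \<otimes>\<^bsub>B\<^esub> \<phi> a = \<zero>\<^bsub>B\<^esub>" .
  have closed: "x \<otimes>\<^bsub>B\<^esub> y \<in> carrier B - Q" if "x \<in> carrier B - Q" "y \<in> carrier B - Q" for x y
    using Q.I_prime[of x y] that by auto
  have uB: "\<phi> u \<in> carrier B - Q" and bB: "\<phi> b \<in> carrier B - Q" and aB: "\<phi> a \<in> carrier B" using u a b by auto
  have 1: "\<exists>w\<in>carrier B - Q. w \<otimes>\<^bsub>B\<^esub> (\<zero>\<^bsub>B\<^esub> \<otimes>\<^bsub>B\<^esub> d) = w \<otimes>\<^bsub>B\<^esub> (c \<otimes>\<^bsub>B\<^esub> \<one>\<^bsub>B\<^esub>)"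
    if c: "c \<in> carrier B" and d: "d \<in> carrier B" and v: "v \<in> carrier B - Q"
      "v \<otimes>\<^bsub>B\<^esub> (\<phi> a \<otimes>\<^bsub>B\<^esub> d) = v \<otimes>\<^bsub>B\<^esub> (c \<otimes>\<^bsub>B\<^esub> \<phi> b)" for c d v
  proof -
    let ?w = "\<phi> u \<otimes>\<^bsub>B\<^esub> (v \<otimes>\<^bsub>B\<^esub> \<phi> b)"
    have "?w \<otimes>\<^bsub>B\<^esub> c = \<phi> u \<otimes>\<^bsub>B\<^esub> (v \<otimes>\<^bsub>B\<^esub> (c \<otimes>\<^bsub>B\<^esub> \<phi> b))" using uB v(1) bB c by (simp add: B.m_ac)
    also have "\<dots> = v \<otimes>\<^bsub>B\<^esub> ((\<phi> u \<otimes>\<^bsub>B\<^esub> \<phi> a) \<otimes>\<^bsub>B\<^esub> d)" unfolding v(2)[symmetric] using uB v(1) aB d by (simp add: B.m_ac)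
    also have "\<dots> = \<zero>\<^bsub>B\<^esub>" using ua v(1) d by simp
    finally show ?thesis using closed[OF uB closed[OF v(1) bB]] c d by (intro bexI[of _ ?w]) auto
  qed
  have 2: "\<exists>w\<in>carrier B - Q. w \<otimes>\<^bsub>B\<^esub> (\<phi> a \<otimes>\<^bsub>B\<^esub> d) = w \<otimes>\<^bsub>B\<^esub> (c \<otimes>\<^bsub>B\<^esub> \<phi> b)"
    if c: "c \<in> carrier B" and d: "d \<in> carrier B" and v: "v \<in> carrier B - Q"
      "v \<otimes>\<^bsub>B\<^esub> (\<zero>\<^bsub>B\<^esub> \<otimes>\<^bsub>B\<^esub> d) = v \<otimes>\<^bsub>B\<^esub> (c \<otimes>\<^bsub>B\<^esub> \<one>\<^bsub>B\<^esub>)" for c d v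
  proof -
    have vc: "v \<otimes>\<^bsub>B\<^esub> c = \<zero>\<^bsub>B\<^esub>" using v c d by simp
    let ?w = "\<phi> u \<otimes>\<^bsub>B\<^esub> v"
    have "?w \<otimes>\<^bsub>B\<^esub> (\<phi> a \<otimes>\<^bsub>B\<^esub> d) = v \<otimes>\<^bsub>B\<^esub> ((\<phi> u \<otimes>\<^bsub>B\<^esub> \<phi> a) \<otimes>\<^bsub>B\<^esub> d)" using uB v(1) aB d by (simp add: B.m_ac)
    also have "\<dots> = \<zero>\<^bsub>B\<^esub>" using ua v(1) d by simp
    also have "\<dots> = \<phi> u \<otimes>\<^bsub>B\<^esub> ((v \<otimes>\<^bsub>B\<^esub> c) \<otimes>\<^bsub>B\<^esub> \<phi> b)" using vc uB bB by simp
    also have "\<dots> = ?w \<otimes>\<^bsub>B\<^esub> (c \<otimes>\<^bsub>B\<^esub> \<phi> b)" using uB v(1) bB c by (simp add: B.m_ac)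
    finally show ?thesis using closed[OF uB v(1)] by blast
  qed
  show ?thesis unfolding local_frac_def using 1 2 by blast
qed

text \<open>The sections \<open>z / 1\<close> and \<open>0 / 1\<close> over the basic open set of
  \<open>f\<close> have the same image. By injectivity they agree, so \<open>z\<close> vanishes in
  every local ring there, and a power of \<open>f\<close> kills it.\<close>

lemma kernel_torsion:
  assumes z: "z \<in> carrier C" "\<phi> z = \<zero>\<^bsub>B\<^esub>"
  shows "\<exists>k::nat. f [^]\<^bsub>C\<^esub> k \<otimes>\<^bsub>C\<^esub> z = \<zero>\<^bsub>C\<^esub>"
proof (rule C.vanishing_on_basic_open[OF f z(1)])
  fix P assume P: "P \<in> Spec C" "f \<notin> P"
  interpret P: primeideal P C using P by (simp add: Spec_def)
  let ?s = "\<lambda>z. \<lambda>P\<in>D. local_frac C P z \<one>\<^bsub>C\<^esub>"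
  have "sections_map C B \<phi> D' (?s z') = (\<lambda>Q\<in>D'. local_frac B Q \<zero>\<^bsub>B\<^esub> \<one>\<^bsub>B\<^esub>)"
    if z': "z' \<in> carrier C" "\<phi> z' = \<zero>\<^bsub>B\<^esub>" for z'
    unfolding sections_map_def
  proof (rule restrict_ext)
    fix Q assume Q: "Q \<in> D'"
    then have M: "Spec_map C \<phi> Q \<in> D" using map_Spec f by (auto simp: Spec_map_def)
    have "\<one>\<^bsub>C\<^esub> \<notin> Spec_map C \<phi> Q" using M primeideal.one_notin by (auto simp: Spec_def)
    then have "(z', \<one>\<^bsub>C\<^esub>) \<in> local_frac C (Spec_map C \<phi> Q) z' \<one>\<^bsub>C\<^esub>"
      using C.local_frac_self[of "Spec_map C \<phi> Q" z' "\<one>\<^bsub>C\<^esub>"] M z' by auto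
    moreover have "local_frac B Q (\<phi> a) (\<phi> b) = local_frac B Q \<zero>\<^bsub>B\<^esub> \<one>\<^bsub>B\<^esub>"
      if "(a, b) \<in> local_frac C (Spec_map C \<phi> Q) z' \<one>\<^bsub>C\<^esub>" for a b
      using local_frac_image_of_kernel[OF _ z' that] Q by blast
    ultimately show "(\<Union>(a, b)\<in>?s z' (Spec_map C \<phi> Q). local_frac B Q (\<phi> a) (\<phi> b)) = local_frac B Q \<zero>\<^bsub>B\<^esub> \<one>\<^bsub>B\<^esub>"
      using M by (auto split: prod.splits)
  qed
  from this[OF z] this[OF C.zero_closed hom.hom_zero]
  have "sections_map C B \<phi> D' (?s z) = sections_map C B \<phi> D' (?s \<zero>\<^bsub>C\<^esub>)" by simp
  moreover have "inj_on (sections_map C B \<phi> D') (carrier (sections C D))"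
    using sections_iso by (simp add: ring_iso_def bij_betw_def)
  ultimately have "?s z = ?s \<zero>\<^bsub>C\<^esub>"
    using C.fraction_section[OF f z(1)] C.fraction_section[OF f C.zero_closed] by (auto dest: inj_onD)
  from fun_cong[OF this, of P] have "local_frac C P z \<one>\<^bsub>C\<^esub> = local_frac C P \<zero>\<^bsub>C\<^esub> \<one>\<^bsub>C\<^esub>" using P by simp
  then have "(z, \<one>\<^bsub>C\<^esub>) \<in> local_frac C P \<zero>\<^bsub>C\<^esub> \<one>\<^bsub>C\<^esub>"
    using C.local_frac_self[OF P(1) z(1), of "\<one>\<^bsub>C\<^esub>"] P.one_notin by auto
  then show "\<exists>u\<in>carrier C - P. u \<otimes>\<^bsub>C\<^esub> z = \<zero>\<^bsub>C\<^esub>"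
    using z by (auto simp: local_frac_def)
qed

end

section \<open>Finite-dimensional algebras\<close>

text \<open>Fewer equations, indexed by \<open>E\<close>, than unknowns, indexed by
  \<open>J\<close>. Gaussian elimination: the unknown \<open>j0\<close>, with pivot
  \<open>v j0 b0\<close>, is eliminated by means of the equation \<open>b0\<close>.\<close>

lemma (in field) homogeneous_system:
  assumes "finite E" "finite J" "card E < card J" "\<And>j b. j \<in> J \<Longrightarrow> b \<in> E \<Longrightarrow> v j b \<in> carrier R"
  shows "\<exists>c. (\<forall>j\<in>J. c j \<in> carrier R) \<and> (\<exists>j\<in>J. c j \<noteq> \<zero>) \<and> (\<forall>b\<in>E. finsum R (\<lambda>j. c j \<otimes> v j b) J = \<zero>)"
  using assms
proof (induction E arbitrary: J v rule: finite_induct)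
  case empty
  then obtain j where "j \<in> J" by fastforce
  then show ?case by (intro exI[of _ "\<lambda>_. \<one>"]) auto
next
  case (insert b0 E)
  note v = insert.prems(3)
  show ?case
  proof (cases "\<forall>j\<in>J. v j b0 = \<zero>")
    case True
    have "\<exists>c. (\<forall>j\<in>J. c j \<in> carrier R) \<and> (\<exists>j\<in>J. c j \<noteq> \<zero>) \<and> (\<forall>b\<in>E. finsum R (\<lambda>j. c j \<otimes> v j b) J = \<zero>)"
      by (rule insert.IH) (use insert.prems insert.hyps in auto)
    then obtain c where c: "\<forall>j\<in>J. c j \<in> carrier R" "\<exists>j\<in>J. c j \<noteq> \<zero>" "\<forall>b\<in>E. finsum R (\<lambda>j. c j \<otimes> v j b) J = \<zero>"
      by blast
    have "finsum R (\<lambda>j. c j \<otimes> v j b0) J = \<zero>"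
      by (rule add.finprod_one_eqI) (use True c(1) in simp)
    then show ?thesis using c by blast
  next
    case False
    then obtain j0 where j0: "j0 \<in> J" "v j0 b0 \<noteq> \<zero>" by blast
    let ?J = "J - {j0}"
    have fJ: "finite ?J" using insert.prems(1) by simp
    have u: "v j0 b0 \<in> Units R" using j0 v field_Units by auto
    define t where "t j = v j b0 \<otimes> inv (v j0 b0)" for j
    have t: "t j \<in> carrier R" if "j \<in> J" for j using u v that by (simp add: t_def)
    have tb0: "t j \<otimes> v j0 b0 = v j b0" if "j \<in> J" for j
      using u v[OF that, of b0] v[OF j0(1), of b0] by (simp add: t_def m_assoc)
    define w where "w j b = v j b \<ominus> t j \<otimes> v j0 b" for j b
    have w: "w j b \<in> carrier R" if "j \<in> ?J" "b \<in> insert b0 E" for j b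
      using that t v j0(1) by (simp add: w_def)
    have "\<exists>c. (\<forall>j\<in>?J. c j \<in> carrier R) \<and> (\<exists>j\<in>?J. c j \<noteq> \<zero>) \<and> (\<forall>b\<in>E. finsum R (\<lambda>j. c j \<otimes> w j b) ?J = \<zero>)"
      by (rule insert.IH) (use insert.prems(1,2) insert.hyps j0 fJ w in auto)
    then obtain c where c: "\<And>j. j \<in> ?J \<Longrightarrow> c j \<in> carrier R" and c0: "\<exists>j\<in>?J. c j \<noteq> \<zero>"
      and cE: "\<forall>b\<in>E. finsum R (\<lambda>j. c j \<otimes> w j b) ?J = \<zero>"
      by blast
    \<comment> \<open>The value that the equation \<open>b0\<close> forces on the eliminated
      unknown.\<close>
    define s where "s = \<ominus> finsum R (\<lambda>j. c j \<otimes> t j) ?J"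
    have ct: "finsum R (\<lambda>j. c j \<otimes> t j) ?J \<in> carrier R"
      by (rule finsum_closed) (simp add: c t)
    define d where "d j = (if j = j0 then s else c j)" for j
    have d: "d j \<in> carrier R" if "j \<in> J" for j using c ct that by (simp add: d_def s_def)
    have key: "finsum R (\<lambda>j. d j \<otimes> v j b) J = finsum R (\<lambda>j. c j \<otimes> w j b) ?J" if b: "b \<in> insert b0 E" for b
    proof -
      note vb = v[OF _ b]
      have "finsum R (\<lambda>j. d j \<otimes> v j b) J = finsum R (\<lambda>j. d j \<otimes> v j b) (insert j0 ?J)"
        using j0(1) by (simp only: insert_Diff)
      also have "\<dots> = d j0 \<otimes> v j0 b \<oplus> finsum R (\<lambda>j. d j \<otimes> v j b) ?J"
        by (rule finsum_insert[OF fJ]) (simp_all add: d vb j0(1))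
      also have "finsum R (\<lambda>j. d j \<otimes> v j b) ?J = finsum R (\<lambda>j. c j \<otimes> w j b \<oplus> c j \<otimes> t j \<otimes> v j0 b) ?J"
      proof (rule finsum_cong')
        fix j assume j: "j \<in> ?J"
        have cc: "c j \<in> carrier R" "t j \<in> carrier R" "v j b \<in> carrier R" "v j0 b \<in> carrier R"
          using c t vb j j0 by auto
        then have "c j \<otimes> w j b \<oplus> c j \<otimes> t j \<otimes> v j0 b = c j \<otimes> (v j b \<ominus> t j \<otimes> v j0 b \<oplus> t j \<otimes> v j0 b)"
          by (simp add: w_def r_distr m_assoc)
        also have "\<dots> = c j \<otimes> v j b" using cc by (simp add: minus_eq a_assoc l_neg)
        finally show "d j \<otimes> v j b = c j \<otimes> w j b \<oplus> c j \<otimes> t j \<otimes> v j0 b" using j by (simp add: d_def)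
      qed (simp_all add: c t w[OF _ b] vb j0(1))
      also have "\<dots> = finsum R (\<lambda>j. c j \<otimes> w j b) ?J \<oplus> finsum R (\<lambda>j. c j \<otimes> t j \<otimes> v j0 b) ?J"
        by (rule finsum_addf) (simp_all add: c t w[OF _ b] vb j0(1))
      also have "finsum R (\<lambda>j. c j \<otimes> t j \<otimes> v j0 b) ?J = finsum R (\<lambda>j. c j \<otimes> t j) ?J \<otimes> v j0 b"
        by (rule finsum_ldistr[symmetric]) (simp_all add: insert.prems(1) c t vb j0(1))
      finally have "finsum R (\<lambda>j. d j \<otimes> v j b) J = s \<otimes> v j0 b \<oplus>
          (finsum R (\<lambda>j. c j \<otimes> w j b) ?J \<oplus> finsum R (\<lambda>j. c j \<otimes> t j) ?J \<otimes> v j0 b)"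
        by (simp only: d_def refl if_True)
      moreover have "finsum R (\<lambda>j. c j \<otimes> w j b) ?J \<in> carrier R"
        by (rule finsum_closed) (simp add: c w[OF _ b])
      ultimately show ?thesis using ct vb[OF j0(1)]
        by (simp add: s_def l_minus a_comm[of "finsum R (\<lambda>j. c j \<otimes> w j b) ?J"] r_neg1)
    qed
    have "finsum R (\<lambda>j. c j \<otimes> w j b0) ?J = \<zero>"
    proof (rule add.finprod_one_eqI)
      fix j assume j: "j \<in> ?J"
      then have "w j b0 = \<zero>" using tb0[of j] v[of j b0] by (simp add: w_def)
      then show "c j \<otimes> w j b0 = \<zero>" using c[OF j] by simp
    qed
    then have "\<forall>b\<in>insert b0 E. finsum R (\<lambda>j. d j \<otimes> v j b) J = \<zero>" using key cE by simp
    moreover have "\<exists>j\<in>J. d j \<noteq> \<zero>" using c0 by (auto simp: d_def)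
    ultimately show ?thesis using d by blast
  qed
qed

lemma linear_mapsD:
  assumes "f \<in> linear_maps R M N"
  shows "x \<in> carrier M \<Longrightarrow> f x \<in> carrier N"
    and "x \<in> carrier M \<Longrightarrow> y \<in> carrier M \<Longrightarrow> f (x \<oplus>\<^bsub>M\<^esub> y) = f x \<oplus>\<^bsub>N\<^esub> f y"
    and "r \<in> carrier R \<Longrightarrow> x \<in> carrier M \<Longrightarrow> f (r \<odot>\<^bsub>M\<^esub> x) = r \<odot>\<^bsub>N\<^esub> f x"
    and "additive M N f"
  using assms by (auto simp: linear_maps_def additive_def)

lemma regular_simps [simp]:
  "carrier (regular R) = carrier R" "monoid.mult (regular R) = monoid.mult R" "one (regular R) = one R"
  "ring.zero (regular R) = ring.zero R" "ring.add (regular R) = ring.add R" "smult (regular R) = monoid.mult R"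
  by (simp_all add: regular_def)

lemma cring_regular: "cring R \<Longrightarrow> cring (regular R)"
proof -
  assume "cring R"
  then interpret cring R .
  have inv: "\<exists>y\<in>carrier R. y \<oplus>\<^bsub>R\<^esub> x = \<zero>\<^bsub>R\<^esub>" if "x \<in> carrier R" for x
    using that by (intro bexI[of _ "\<ominus>\<^bsub>R\<^esub> x"]) (simp_all add: l_neg)
  have "abelian_group (regular R)"
    by (rule abelian_groupI) (auto simp: inv a_ac)
  moreover have "comm_monoid (regular R)"
    by (rule comm_monoidI) (auto simp: m_ac)
  ultimately show ?thesis
    by (rule cringI) (auto simp: l_distr)
qed

text \<open>A spanning set of least cardinality is a basis, so coordinates are unique and therefore
  linear. Only the expansion by coordinates is recorded, because the later arguments rest on it
  alone.\<close>

lemma dual_basis_exists: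
  assumes "field K" "module K M" and fd: "finite_dimensional K M"
  shows "\<exists>E e. finite E \<and> E \<subseteq> carrier M \<and> (\<forall>b\<in>E. e b \<in> linear_maps K M (regular K)) \<and>
    (\<forall>x\<in>carrier M. x = finsum M (\<lambda>b. e b x \<odot>\<^bsub>M\<^esub> b) E)"
proof -
  interpret K: field K by fact
  interpret M: module K M by fact
  define spans where "spans E \<longleftrightarrow> finite E \<and> E \<subseteq> carrier M \<and>
    (\<forall>x\<in>carrier M. \<exists>c\<in>E \<rightarrow> carrier K. x = finsum M (\<lambda>b. c b \<odot>\<^bsub>M\<^esub> b) E)" for E
  obtain E0 where "spans E0" using fd by (auto simp: finite_dimensional_def spans_def)
  then obtain E where E: "spans E" and min: "\<And>E'. spans E' \<Longrightarrow> card E \<le> card E'"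
    using ex_has_least_nat[of spans _ card] by blast
  have fin: "finite E" and sub: "E \<subseteq> carrier M" using E by (auto simp: spans_def)
  have closed: "finsum M (\<lambda>b. c b \<odot>\<^bsub>M\<^esub> b) E' \<in> carrier M" if "c \<in> E' \<rightarrow> carrier K" "E' \<subseteq> E" for c E'
    by (rule M.finsum_closed) (use that sub in auto)
  have sum_add: "finsum M (\<lambda>b. (c b \<oplus>\<^bsub>K\<^esub> d b) \<odot>\<^bsub>M\<^esub> b) E' = finsum M (\<lambda>b. c b \<odot>\<^bsub>M\<^esub> b) E' \<oplus>\<^bsub>M\<^esub> finsum M (\<lambda>b. d b \<odot>\<^bsub>M\<^esub> b) E'"
    if "c \<in> E' \<rightarrow> carrier K" "d \<in> E' \<rightarrow> carrier K" "E' \<subseteq> E" for c d E'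
  proof -
    have "finsum M (\<lambda>b. (c b \<oplus>\<^bsub>K\<^esub> d b) \<odot>\<^bsub>M\<^esub> b) E' = finsum M (\<lambda>b. c b \<odot>\<^bsub>M\<^esub> b \<oplus>\<^bsub>M\<^esub> d b \<odot>\<^bsub>M\<^esub> b) E'"
      by (rule M.finsum_cong') (use that sub in \<open>auto simp: M.smult_l_distr Pi_iff subset_iff\<close>)
    also have "\<dots> = finsum M (\<lambda>b. c b \<odot>\<^bsub>M\<^esub> b) E' \<oplus>\<^bsub>M\<^esub> finsum M (\<lambda>b. d b \<odot>\<^bsub>M\<^esub> b) E'"
      by (rule M.finsum_addf) (use that sub in \<open>auto simp: Pi_iff subset_iff\<close>)
    finally show ?thesis .
  qed
  have sum_smult: "finsum M (\<lambda>b. (r \<otimes>\<^bsub>K\<^esub> c b) \<odot>\<^bsub>M\<^esub> b) E' = r \<odot>\<^bsub>M\<^esub> finsum M (\<lambda>b. c b \<odot>\<^bsub>M\<^esub> b) E'"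
    if r: "r \<in> carrier K" and c: "c \<in> E' \<rightarrow> carrier K" and E': "E' \<subseteq> E" for r c E'
  proof -
    have ad: "additive M M (\<lambda>x. r \<odot>\<^bsub>M\<^esub> x)" by (rule additiveI) (use r in \<open>auto simp: M.smult_r_distr\<close>)
    have "r \<odot>\<^bsub>M\<^esub> finsum M (\<lambda>b. c b \<odot>\<^bsub>M\<^esub> b) E' = finsum M (\<lambda>b. r \<odot>\<^bsub>M\<^esub> (c b \<odot>\<^bsub>M\<^esub> b)) E'"
      by (rule additive_finsum[OF M.abelian_group_axioms M.abelian_group_axioms ad])
         (use c E' sub finite_subset[OF E' fin] in auto)
    also have "\<dots> = finsum M (\<lambda>b. (r \<otimes>\<^bsub>K\<^esub> c b) \<odot>\<^bsub>M\<^esub> b) E'"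
      by (rule M.finsum_cong') (use r c E' sub in \<open>auto simp: M.smult_assoc1 Pi_iff subset_iff\<close>)
    finally show ?thesis by simp
  qed
  have zero: "c b0 = \<zero>\<^bsub>K\<^esub>"
    if c: "c \<in> E \<rightarrow> carrier K" and s0: "finsum M (\<lambda>b. c b \<odot>\<^bsub>M\<^esub> b) E = \<zero>\<^bsub>M\<^esub>" and b0: "b0 \<in> E" for c b0
  proof (rule ccontr)
    assume nz: "c b0 \<noteq> \<zero>\<^bsub>K\<^esub>"
    let ?E = "E - {b0}"
    have u: "c b0 \<in> Units K" using nz c b0 K.field_Units by auto
    have split: "finsum M (\<lambda>b. d b \<odot>\<^bsub>M\<^esub> b) E = d b0 \<odot>\<^bsub>M\<^esub> b0 \<oplus>\<^bsub>M\<^esub> finsum M (\<lambda>b. d b \<odot>\<^bsub>M\<^esub> b) ?E"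
      if "d \<in> E \<rightarrow> carrier K" for d
    proof -
      have "finsum M (\<lambda>b. d b \<odot>\<^bsub>M\<^esub> b) (insert b0 ?E) = d b0 \<odot>\<^bsub>M\<^esub> b0 \<oplus>\<^bsub>M\<^esub> finsum M (\<lambda>b. d b \<odot>\<^bsub>M\<^esub> b) ?E"
        by (rule M.finsum_insert) (use fin that sub b0 in \<open>auto simp: Pi_iff subset_iff\<close>)
      then show ?thesis using b0 by (simp add: insert_absorb)
    qed
    have "spans ?E" unfolding spans_def
    proof (intro conjI ballI)
      fix x assume "x \<in> carrier M"
      then obtain d where d: "d \<in> E \<rightarrow> carrier K" "x = finsum M (\<lambda>b. d b \<odot>\<^bsub>M\<^esub> b) E" using E by (auto simp: spans_def)
      \<comment> \<open>Adding \<open>t\<close> times the relation cancels the coefficient of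
        \<open>b0\<close>, so that \<open>b0\<close> could be omitted from the spanning set.\<close>
      define t where "t = \<ominus>\<^bsub>K\<^esub> (d b0 \<otimes>\<^bsub>K\<^esub> inv\<^bsub>K\<^esub> c b0)"
      have tK: "t \<in> carrier K" using u d b0 by (auto simp: t_def)
      have tc: "t \<otimes>\<^bsub>K\<^esub> c b0 = \<ominus>\<^bsub>K\<^esub> d b0" using u d b0 c by (auto simp: t_def K.l_minus K.m_assoc Pi_iff)
      let ?d = "\<lambda>b. d b \<oplus>\<^bsub>K\<^esub> t \<otimes>\<^bsub>K\<^esub> c b"
      have d': "?d \<in> E \<rightarrow> carrier K" using d c tK by auto
      have "x = finsum M (\<lambda>b. d b \<odot>\<^bsub>M\<^esub> b) E \<oplus>\<^bsub>M\<^esub> t \<odot>\<^bsub>M\<^esub> finsum M (\<lambda>b. c b \<odot>\<^bsub>M\<^esub> b) E"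
        using d(2) s0 tK closed[OF d(1)] by simp
      also have "t \<odot>\<^bsub>M\<^esub> finsum M (\<lambda>b. c b \<odot>\<^bsub>M\<^esub> b) E = finsum M (\<lambda>b. (t \<otimes>\<^bsub>K\<^esub> c b) \<odot>\<^bsub>M\<^esub> b) E"
        using sum_smult[OF tK c] by simp
      also have "finsum M (\<lambda>b. d b \<odot>\<^bsub>M\<^esub> b) E \<oplus>\<^bsub>M\<^esub> \<dots> = finsum M (\<lambda>b. ?d b \<odot>\<^bsub>M\<^esub> b) E"
        by (rule sum_add[symmetric]) (use d c tK in auto)
      also have "\<dots> = ?d b0 \<odot>\<^bsub>M\<^esub> b0 \<oplus>\<^bsub>M\<^esub> finsum M (\<lambda>b. ?d b \<odot>\<^bsub>M\<^esub> b) ?E" by (rule split[OF d'])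
      also have "?d b0 = \<zero>\<^bsub>K\<^esub>" using tc d b0 by (auto simp: K.r_neg Pi_iff)
      finally have "x = finsum M (\<lambda>b. ?d b \<odot>\<^bsub>M\<^esub> b) ?E"
        using closed[of ?d ?E] d' b0 sub by (simp add: Pi_iff subset_iff)
      then show "\<exists>c\<in>?E \<rightarrow> carrier K. x = finsum M (\<lambda>b. c b \<odot>\<^bsub>M\<^esub> b) ?E" using d' by (intro bexI[of _ ?d]) auto
    qed (use fin sub in auto)
    then have "card E \<le> card ?E" by (rule min)
    moreover have "card ?E < card E" using fin b0 by (rule card_Diff1_less)
    ultimately show False by simp
  qed
  have unique: "c b = d b"
    if c: "c \<in> E \<rightarrow> carrier K" and d: "d \<in> E \<rightarrow> carrier K" and b: "b \<in> E"
      and eq: "finsum M (\<lambda>b. c b \<odot>\<^bsub>M\<^esub> b) E = finsum M (\<lambda>b. d b \<odot>\<^bsub>M\<^esub> b) E" for c d b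
  proof -
    let ?m = "\<ominus>\<^bsub>K\<^esub> \<one>\<^bsub>K\<^esub>"
    have md: "(\<lambda>b. ?m \<otimes>\<^bsub>K\<^esub> d b) \<in> E \<rightarrow> carrier K" using d by auto
    have "finsum M (\<lambda>b. (c b \<oplus>\<^bsub>K\<^esub> ?m \<otimes>\<^bsub>K\<^esub> d b) \<odot>\<^bsub>M\<^esub> b) E
        = finsum M (\<lambda>b. d b \<odot>\<^bsub>M\<^esub> b) E \<oplus>\<^bsub>M\<^esub> ?m \<odot>\<^bsub>M\<^esub> finsum M (\<lambda>b. d b \<odot>\<^bsub>M\<^esub> b) E"
      using sum_add[OF c md order_refl] sum_smult[of ?m, OF _ d order_refl] eq by simp
    also have "\<dots> = \<zero>\<^bsub>M\<^esub>"
      using closed[OF d order_refl] M.smult_l_distr[of "\<one>\<^bsub>K\<^esub>" ?m "finsum M (\<lambda>b. d b \<odot>\<^bsub>M\<^esub> b) E"] by (simp add: K.r_neg)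
    finally have "c b \<oplus>\<^bsub>K\<^esub> ?m \<otimes>\<^bsub>K\<^esub> d b = \<zero>\<^bsub>K\<^esub>" by (intro zero[OF _ _ b]) (use c d in auto)
    then show ?thesis using c d b by (auto simp: K.l_minus Pi_iff K.minus_eq[symmetric])
  qed
  define good where "good x c \<longleftrightarrow> c \<in> E \<rightarrow> carrier K \<and> x = finsum M (\<lambda>b. c b \<odot>\<^bsub>M\<^esub> b) E" for x c
  define co where "co x = (SOME c. good x c)" for x
  have co: "co x \<in> E \<rightarrow> carrier K \<and> x = finsum M (\<lambda>b. co x b \<odot>\<^bsub>M\<^esub> b) E" if x: "x \<in> carrier M" for x
  proof -
    have "\<exists>c. good x c" using bspec[OF conjunct2[OF conjunct2[OF E[unfolded spans_def]]] x]
      by (elim bexE) (auto simp: good_def)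
    then have "good x (co x)" unfolding co_def by (rule someI_ex)
    then show ?thesis by (simp only: good_def)
  qed
  have "(\<lambda>x. co x b) \<in> linear_maps K M (regular K)" if b: "b \<in> E" for b
    unfolding linear_maps_def
  proof (intro CollectI conjI ballI)
    show "(\<lambda>x. co x b) \<in> carrier M \<rightarrow> carrier (regular K)" using co b by (auto simp: Pi_iff)
    show "co (x \<oplus>\<^bsub>M\<^esub> y) b = co x b \<oplus>\<^bsub>regular K\<^esub> co y b" if "x \<in> carrier M" "y \<in> carrier M" for x y
    proof -
      note cs = co[OF that(1)] co[OF that(2)] co[of "x \<oplus>\<^bsub>M\<^esub> y"]
      have "co (x \<oplus>\<^bsub>M\<^esub> y) b = (\<lambda>b. co x b \<oplus>\<^bsub>K\<^esub> co y b) b"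
        by (rule unique[OF _ _ b]) (use cs that sum_add[of "co x" E "co y"] in auto)
      then show ?thesis by simp
    qed
    show "co (r \<odot>\<^bsub>M\<^esub> x) b = r \<odot>\<^bsub>regular K\<^esub> co x b" if "r \<in> carrier K" "x \<in> carrier M" for r x
    proof -
      note cs = co[OF that(2)] co[of "r \<odot>\<^bsub>M\<^esub> x"]
      have "co (r \<odot>\<^bsub>M\<^esub> x) b = (\<lambda>b. r \<otimes>\<^bsub>K\<^esub> co x b) b"
        by (rule unique[OF _ _ b]) (use cs that sum_smult[of r "co x" E] in auto)
      then show ?thesis by simp
    qed
  qed
  then show ?thesis using fin sub co by (intro exI[of _ E] exI[of _ "\<lambda>b x. co x b"]) auto
qed

section \<open>Polynomial relations and eigenvalues\<close>

text \<open>Horner's scheme, on lists of coefficients with the constant coefficient first.\<close>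

primrec horner :: "('k, 'm, 'd) module_scheme \<Rightarrow> 'm \<Rightarrow> 'k list \<Rightarrow> 'm" where
  "horner A a [] = \<zero>\<^bsub>A\<^esub>"
| "horner A a (c # cs) = c \<odot>\<^bsub>A\<^esub> \<one>\<^bsub>A\<^esub> \<oplus>\<^bsub>A\<^esub> a \<otimes>\<^bsub>A\<^esub> horner A a cs"

context algebra
begin

lemma horner_closed: "a \<in> carrier M \<Longrightarrow> set cs \<subseteq> carrier R \<Longrightarrow> horner M a cs \<in> carrier M"
  by (induction cs) auto

lemma smult_assoc2': "r \<in> carrier R \<Longrightarrow> x \<in> carrier M \<Longrightarrow> y \<in> carrier M \<Longrightarrow>
    x \<otimes>\<^bsub>M\<^esub> (r \<odot>\<^bsub>M\<^esub> y) = r \<odot>\<^bsub>M\<^esub> (x \<otimes>\<^bsub>M\<^esub> y)"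
  using smult_assoc2[of r y x] by (simp add: m_comm)

lemma horner_snoc:
  assumes "a \<in> carrier M" "set cs \<subseteq> carrier R" "c \<in> carrier R"
  shows "horner M a (cs @ [c]) = horner M a cs \<oplus>\<^bsub>M\<^esub> c \<odot>\<^bsub>M\<^esub> a [^]\<^bsub>M\<^esub> length cs"
  using assms(2)
proof (induction cs)
  case Nil
  then show ?case using assms by simp
next
  case (Cons d cs)
  then have IH: "horner M a (cs @ [c]) = horner M a cs \<oplus>\<^bsub>M\<^esub> c \<odot>\<^bsub>M\<^esub> a [^]\<^bsub>M\<^esub> length cs" by simp
  have h: "horner M a cs \<in> carrier M" "d \<in> carrier R" using Cons assms horner_closed by auto
  have "a \<otimes>\<^bsub>M\<^esub> (c \<odot>\<^bsub>M\<^esub> a [^]\<^bsub>M\<^esub> length cs) = c \<odot>\<^bsub>M\<^esub> a [^]\<^bsub>M\<^esub> Suc (length cs)"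
    using assms by (simp add: smult_assoc2' m_comm)
  then show ?case using h assms
    by (simp add: IH r_distr M.a_assoc)
qed

lemma horner_map:
  assumes "a \<in> carrier M" "\<And>j. c j \<in> carrier R"
  shows "horner M a (map c [0..<N]) = finsum M (\<lambda>j. c j \<odot>\<^bsub>M\<^esub> a [^]\<^bsub>M\<^esub> j) {..<N}"
proof (induction N)
  case (Suc N)
  have "finsum M (\<lambda>j. c j \<odot>\<^bsub>M\<^esub> a [^]\<^bsub>M\<^esub> j) {..<Suc N} = c N \<odot>\<^bsub>M\<^esub> a [^]\<^bsub>M\<^esub> N \<oplus>\<^bsub>M\<^esub> finsum M (\<lambda>j. c j \<odot>\<^bsub>M\<^esub> a [^]\<^bsub>M\<^esub> j) {..<N}"
    unfolding lessThan_Suc by (rule M.finsum_insert) (use assms in auto)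
  moreover have "horner M a (map c [0..<Suc N]) = horner M a (map c [0..<N]) \<oplus>\<^bsub>M\<^esub> c N \<odot>\<^bsub>M\<^esub> a [^]\<^bsub>M\<^esub> N"
    using horner_snoc[OF assms(1), of "map c [0..<N]" "c N"] assms by auto
  moreover have "finsum M (\<lambda>j. c j \<odot>\<^bsub>M\<^esub> a [^]\<^bsub>M\<^esub> j) {..<N} \<in> carrier M"
    by (rule M.finsum_closed) (use assms in auto)
  ultimately show ?case using Suc assms by (simp add: M.a_comm)
qed simp

text \<open>Synthetic division by \<open>a - \<mu>\<close>. That the quotient keeps the last
  coefficient is what keeps it nonzero when roots are split off repeatedly. The list is reversed for
  \<open>eval\<close>, which expects the leading coefficient first.\<close>

lemma horner_division:
  assumes a: "a \<in> carrier M" and l: "\<mu> \<in> carrier R" and "set cs \<subseteq> carrier R" "cs \<noteq> []"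
  shows "\<exists>q. length q = length cs - 1 \<and> set q \<subseteq> carrier R \<and> (q \<noteq> [] \<longrightarrow> last q = last cs) \<and>
    horner M a cs = (a \<ominus>\<^bsub>M\<^esub> \<mu> \<odot>\<^bsub>M\<^esub> \<one>\<^bsub>M\<^esub>) \<otimes>\<^bsub>M\<^esub> horner M a q \<oplus>\<^bsub>M\<^esub> R.eval (rev cs) \<mu> \<odot>\<^bsub>M\<^esub> \<one>\<^bsub>M\<^esub>"
  using assms(3,4)
proof (induction cs)
  case Nil then show ?case by simp
next
  case (Cons c cs)
  show ?case
  proof (cases "cs = []")
    case True
    then show ?thesis using Cons a l by (intro exI[of _ "[]"]) (auto simp: R.eval_in_carrier)
  next
    case False
    then obtain q where q: "length q = length cs - 1" "set q \<subseteq> carrier R" "q \<noteq> [] \<longrightarrow> last q = last cs"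
      "horner M a cs = (a \<ominus>\<^bsub>M\<^esub> \<mu> \<odot>\<^bsub>M\<^esub> \<one>\<^bsub>M\<^esub>) \<otimes>\<^bsub>M\<^esub> horner M a q \<oplus>\<^bsub>M\<^esub> R.eval (rev cs) \<mu> \<odot>\<^bsub>M\<^esub> \<one>\<^bsub>M\<^esub>"
      using Cons by auto
    let ?v = "R.eval (rev cs) \<mu>" and ?d = "a \<ominus>\<^bsub>M\<^esub> \<mu> \<odot>\<^bsub>M\<^esub> \<one>\<^bsub>M\<^esub>"
    have v: "?v \<in> carrier R" using Cons l by (intro R.eval_in_carrier) auto
    have c: "c \<in> carrier R" using Cons by simp
    have hq: "horner M a q \<in> carrier M" by (rule horner_closed[OF a q(2)])
    have dM: "?d \<in> carrier M" using a l by simp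
    have ev: "R.eval (rev (c # cs)) \<mu> = ?v \<otimes>\<^bsub>R\<^esub> \<mu> \<oplus>\<^bsub>R\<^esub> c"
      using R.eval_append_aux[of "rev cs" c \<mu>] Cons l by simp
    have ad: "a = ?d \<oplus>\<^bsub>M\<^esub> \<mu> \<odot>\<^bsub>M\<^esub> \<one>\<^bsub>M\<^esub>" using a l by (simp add: M.minus_eq M.a_assoc M.l_neg)
    have "a \<otimes>\<^bsub>M\<^esub> (?v \<odot>\<^bsub>M\<^esub> \<one>\<^bsub>M\<^esub>) = ?v \<odot>\<^bsub>M\<^esub> a" using a v by (simp add: smult_assoc2')
    also have "\<dots> = ?v \<odot>\<^bsub>M\<^esub> (?d \<oplus>\<^bsub>M\<^esub> \<mu> \<odot>\<^bsub>M\<^esub> \<one>\<^bsub>M\<^esub>)" using ad by metis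
    also have "\<dots> = ?d \<otimes>\<^bsub>M\<^esub> (?v \<odot>\<^bsub>M\<^esub> \<one>\<^bsub>M\<^esub>) \<oplus>\<^bsub>M\<^esub> (?v \<otimes>\<^bsub>R\<^esub> \<mu>) \<odot>\<^bsub>M\<^esub> \<one>\<^bsub>M\<^esub>"
      using v l dM by (simp add: smult_r_distr smult_assoc1 smult_assoc2')
    finally have av: "a \<otimes>\<^bsub>M\<^esub> (?v \<odot>\<^bsub>M\<^esub> \<one>\<^bsub>M\<^esub>) = ?d \<otimes>\<^bsub>M\<^esub> (?v \<odot>\<^bsub>M\<^esub> \<one>\<^bsub>M\<^esub>) \<oplus>\<^bsub>M\<^esub> (?v \<otimes>\<^bsub>R\<^esub> \<mu>) \<odot>\<^bsub>M\<^esub> \<one>\<^bsub>M\<^esub>" .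
    have "horner M a (c # cs) = c \<odot>\<^bsub>M\<^esub> \<one>\<^bsub>M\<^esub> \<oplus>\<^bsub>M\<^esub> (?d \<otimes>\<^bsub>M\<^esub> (a \<otimes>\<^bsub>M\<^esub> horner M a q) \<oplus>\<^bsub>M\<^esub> a \<otimes>\<^bsub>M\<^esub> (?v \<odot>\<^bsub>M\<^esub> \<one>\<^bsub>M\<^esub>))"
      using q(4) dM hq v a by (simp add: r_distr m_lcomm)
    also have "\<dots> = ?d \<otimes>\<^bsub>M\<^esub> horner M a (?v # q) \<oplus>\<^bsub>M\<^esub> (?v \<otimes>\<^bsub>R\<^esub> \<mu> \<oplus>\<^bsub>R\<^esub> c) \<odot>\<^bsub>M\<^esub> \<one>\<^bsub>M\<^esub>"
      unfolding av using dM hq v a c l by (simp add: r_distr smult_l_distr M.a_ac)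
    finally have "horner M a (c # cs) = ?d \<otimes>\<^bsub>M\<^esub> horner M a (?v # q) \<oplus>\<^bsub>M\<^esub> R.eval (rev (c # cs)) \<mu> \<odot>\<^bsub>M\<^esub> \<one>\<^bsub>M\<^esub>"
      unfolding ev .
    moreover have "last (?v # q) = last (c # cs)"
    proof (cases "q = []")
      case True
      then have "length cs = 1" using q(1) False by (cases cs) auto
      then obtain x where "cs = [x]" by (auto simp: length_Suc_conv)
      then show ?thesis using True Cons.prems l by simp
    next
      case False then show ?thesis using q(3) \<open>cs \<noteq> []\<close> by simp
    qed
    ultimately show ?thesis using q v False
      by (intro exI[of _ "?v # q"]) (auto simp: Suc_diff_1)
  qed
qed

end

text \<open>The first \<open>card E + 1\<close> powers of \<open>a\<close> have only
  \<open>card E\<close> coordinates, so \<open>homogeneous_system\<close> gives a nontrivial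
  relation between them.\<close>

lemma algebraic_relation:
  assumes K: "field K" and A: "algebra K A" and fd: "finite_dimensional K A" and a: "a \<in> carrier A"
  shows "\<exists>cs. set cs \<subseteq> carrier K \<and> cs \<noteq> [] \<and> last cs \<noteq> \<zero>\<^bsub>K\<^esub> \<and> horner A a cs = \<zero>\<^bsub>A\<^esub>"
proof -
  interpret K: field K by fact
  interpret A: algebra K A by fact
  obtain E e where E: "finite E" "E \<subseteq> carrier A" "\<And>b. b \<in> E \<Longrightarrow> e b \<in> linear_maps K A (regular K)"
    "\<And>x. x \<in> carrier A \<Longrightarrow> x = finsum A (\<lambda>b. e b x \<odot>\<^bsub>A\<^esub> b) E"
    using dual_basis_exists[OF K A.module fd] by blast
  have e: "e b x \<in> carrier K" if "b \<in> E" "x \<in> carrier A" for b x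
    using linear_mapsD(1)[OF E(3)[OF that(1)] that(2)] by simp
  let ?J = "{..<Suc (card E)}"
  have "\<exists>c. (\<forall>j\<in>?J. c j \<in> carrier K) \<and> (\<exists>j\<in>?J. c j \<noteq> \<zero>\<^bsub>K\<^esub>) \<and> (\<forall>b\<in>E. finsum K (\<lambda>j. c j \<otimes>\<^bsub>K\<^esub> e b (a [^]\<^bsub>A\<^esub> j)) ?J = \<zero>\<^bsub>K\<^esub>)"
    by (rule K.homogeneous_system) (use E(1) e a in auto)
  then obtain c' where c': "\<forall>j\<in>?J. c' j \<in> carrier K" "\<exists>j\<in>?J. c' j \<noteq> \<zero>\<^bsub>K\<^esub>"
    "\<forall>b\<in>E. finsum K (\<lambda>j. c' j \<otimes>\<^bsub>K\<^esub> e b (a [^]\<^bsub>A\<^esub> j)) ?J = \<zero>\<^bsub>K\<^esub>" by blast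
  define c where "c j = (if j \<in> ?J then c' j else \<zero>\<^bsub>K\<^esub>)" for j
  have c: "c j \<in> carrier K" for j using c' by (auto simp: c_def)
  let ?x = "finsum A (\<lambda>j. c j \<odot>\<^bsub>A\<^esub> a [^]\<^bsub>A\<^esub> j) ?J"
  have x: "?x \<in> carrier A" by (rule A.M.finsum_closed) (use c a in auto)
  have "e b ?x = \<zero>\<^bsub>K\<^esub>" if b: "b \<in> E" for b
  proof -
    note lin = linear_mapsD[OF E(3)[OF b]]
    have "e b ?x = finsum (regular K) (\<lambda>j. e b (c j \<odot>\<^bsub>A\<^esub> a [^]\<^bsub>A\<^esub> j)) ?J"
      by (rule additive_finsum[OF A.M.abelian_group_axioms _ lin(4)])
         (use c a cring_regular[OF K.is_cring] in \<open>auto simp: cring_def ring_def\<close>)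
    also have "\<dots> = finsum K (\<lambda>j. e b (c j \<odot>\<^bsub>A\<^esub> a [^]\<^bsub>A\<^esub> j)) ?J"
      by (simp add: finsum_def finprod_def)
    also have "\<dots> = finsum K (\<lambda>j. c' j \<otimes>\<^bsub>K\<^esub> e b (a [^]\<^bsub>A\<^esub> j)) ?J"
    proof (rule K.finsum_cong')
      fix j assume "j \<in> ?J"
      then show "e b (c j \<odot>\<^bsub>A\<^esub> a [^]\<^bsub>A\<^esub> j) = c' j \<otimes>\<^bsub>K\<^esub> e b (a [^]\<^bsub>A\<^esub> j)"
        using lin(3)[OF c A.nat_pow_closed[OF a], of j j] by (simp add: c_def)
    qed (use c'(1) e[OF b] a in auto)
    finally show ?thesis using c'(3) b by simp
  qed
  then have "finsum A (\<lambda>b. e b ?x \<odot>\<^bsub>A\<^esub> b) E = \<zero>\<^bsub>A\<^esub>"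
    by (intro A.M.add.finprod_one_eqI) (use E(2) in \<open>auto simp: subset_iff\<close>)
  then have x0: "?x = \<zero>\<^bsub>A\<^esub>" using E(4)[OF x] by simp
  have "horner A a (map c [0..<Suc (card E)]) = \<zero>\<^bsub>A\<^esub>"
    unfolding A.horner_map[OF a c] by (rule x0)
  moreover have "\<exists>d\<in>set (map c [0..<Suc (card E)]). d \<noteq> \<zero>\<^bsub>K\<^esub>"
  proof -
    obtain j where "j \<in> ?J" "c' j \<noteq> \<zero>\<^bsub>K\<^esub>" using c'(2) by blast
    then have "c j \<in> set (map c [0..<Suc (card E)])" "c j \<noteq> \<zero>\<^bsub>K\<^esub>"
      by (simp_all only: set_map set_upt image_eqI[OF refl] atLeast0LessThan) (simp add: c_def)
    then show ?thesis by blast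
  qed
  moreover have "set (map c [0..<Suc (card E)]) \<subseteq> carrier K" using c by auto
  ultimately obtain cs where cs: "horner A a cs = \<zero>\<^bsub>A\<^esub>" "\<exists>d\<in>set cs. d \<noteq> \<zero>\<^bsub>K\<^esub>" "set cs \<subseteq> carrier K" by metis
  \<comment> \<open>Vanishing coefficients at the end of the list are removed until the last one is
    nonzero.\<close>
  then show ?thesis
  proof (induction cs rule: rev_induct)
    case Nil then show ?case by simp
  next
    case (snoc d cs)
    show ?case
    proof (cases "d = \<zero>\<^bsub>K\<^esub>")
      case True
      then have "horner A a cs = \<zero>\<^bsub>A\<^esub>"
        using snoc.prems A.horner_snoc[OF a, of cs d] A.horner_closed[OF a, of cs] a by simp
      then show ?thesis using snoc True by auto
    next
      case False then show ?thesis using snoc.prems by (intro exI[of _ "cs @ [d]"]) auto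
    qed
  qed
qed

lemma reversed_polynomial:
  assumes "set cs \<subseteq> carrier K" "cs \<noteq> []" "last cs \<noteq> \<zero>\<^bsub>K\<^esub>"
  shows "rev cs \<in> carrier (poly_ring K)"
  using assms unfolding sym[OF univ_poly_carrier] polynomial_def by (simp add: hd_rev)

text \<open>Split off a root \<open>\<mu>\<close> of the polynomial: as \<open>P\<close> is prime,
  it contains \<open>a - \<mu>\<close> or the value of a shorter polynomial. The descent cannot
  reach a constant, because a nonzero scalar is a unit.\<close>

lemma eigenvalue_modulo_prime:
  assumes K: "algebraically_closed K" and A: "algebra K A" and P: "primeideal P A" and a: "a \<in> carrier A"
    and cs: "set cs \<subseteq> carrier K" "cs \<noteq> []" "last cs \<noteq> \<zero>\<^bsub>K\<^esub>" "horner A a cs \<in> P"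
  shows "\<exists>\<mu>\<in>carrier K. a \<ominus>\<^bsub>A\<^esub> \<mu> \<odot>\<^bsub>A\<^esub> \<one>\<^bsub>A\<^esub> \<in> P"
  using cs
proof (induction "length cs" arbitrary: cs rule: less_induct)
  case less
  interpret K: algebraically_closed K by fact
  interpret A: algebra K A by fact
  interpret P: primeideal P A by fact
  have p: "rev cs \<in> carrier (poly_ring K)" using reversed_polynomial less by blast
  show ?case
  proof (cases "length cs = 1")
    case True
    then obtain c where c: "cs = [c]" by (auto simp: length_Suc_conv)
    then have "c \<odot>\<^bsub>A\<^esub> \<one>\<^bsub>A\<^esub> \<in> P" "c \<in> Units K" using less a K.field_Units by auto
    then have "(inv\<^bsub>K\<^esub> c \<odot>\<^bsub>A\<^esub> \<one>\<^bsub>A\<^esub>) \<otimes>\<^bsub>A\<^esub> (c \<odot>\<^bsub>A\<^esub> \<one>\<^bsub>A\<^esub>) \<in> P" by (intro P.I_l_closed) auto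
    also have "(inv\<^bsub>K\<^esub> c \<odot>\<^bsub>A\<^esub> \<one>\<^bsub>A\<^esub>) \<otimes>\<^bsub>A\<^esub> (c \<odot>\<^bsub>A\<^esub> \<one>\<^bsub>A\<^esub>) = \<one>\<^bsub>A\<^esub>"
      using \<open>c \<in> Units K\<close> K.Units_closed by (simp add: A.smult_assoc2 A.smult_assoc1[symmetric])
    finally show ?thesis using P.I_notcarr P.one_imp_carrier by blast
  next
    case False
    then have len: "length cs \<ge> 2" using less(3) by (cases cs) (auto simp: Suc_le_eq)
    have "K.splitted (rev cs)" using K.roots_over_carrier p by blast
    then have "size (K.roots (rev cs)) = length cs - 1" by (simp add: K.splitted_def)
    then have "K.roots (rev cs) \<noteq> {#}" using len by auto
    then obtain \<mu> where "\<mu> \<in># K.roots (rev cs)" by (meson multiset_nonemptyE)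
    then have \<mu>: "\<mu> \<in> carrier K" "K.eval (rev cs) \<mu> = \<zero>\<^bsub>K\<^esub>"
      using K.roots_mem_iff_is_root[OF p] by (auto simp: K.is_root_def)
    obtain q where q: "length q = length cs - 1" "set q \<subseteq> carrier K" "q \<noteq> [] \<longrightarrow> last q = last cs"
      "horner A a cs = (a \<ominus>\<^bsub>A\<^esub> \<mu> \<odot>\<^bsub>A\<^esub> \<one>\<^bsub>A\<^esub>) \<otimes>\<^bsub>A\<^esub> horner A a q \<oplus>\<^bsub>A\<^esub> K.eval (rev cs) \<mu> \<odot>\<^bsub>A\<^esub> \<one>\<^bsub>A\<^esub>"
      using A.horner_division[OF a \<mu>(1) less(2,3)] by blast
    have hq: "horner A a q \<in> carrier A" by (rule A.horner_closed[OF a q(2)])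
    have "(a \<ominus>\<^bsub>A\<^esub> \<mu> \<odot>\<^bsub>A\<^esub> \<one>\<^bsub>A\<^esub>) \<otimes>\<^bsub>A\<^esub> horner A a q \<in> P"
      using q(4) \<mu> less(5) hq a by simp
    then have "a \<ominus>\<^bsub>A\<^esub> \<mu> \<odot>\<^bsub>A\<^esub> \<one>\<^bsub>A\<^esub> \<in> P \<or> horner A a q \<in> P"
      using P.I_prime hq a \<mu> by simp
    then show ?thesis
    proof
      assume h: "horner A a q \<in> P"
      have "q \<noteq> []" using q(1) len by auto
      then show ?thesis using less(1)[of q] q len less(4) h by auto
    qed (use \<mu> in blast)
  qed
qed

section \<open>Rational points and invariants\<close>

locale action =
  fixes K :: "('k, 'c) ring_scheme" and A :: "('k, 'a) hopf" and S :: "('k, 's) module"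
    and \<rho> :: "'s \<Rightarrow> ('s \<times> 'a \<Rightarrow>\<^sub>0 int) set"
  assumes group_action: "group_scheme_action K A S \<rho>"
begin

lemma group_scheme: "finite_group_scheme K A"
  and algebra_A: "algebra K A" and algebra_S: "algebra K S" and cring_K: "cring K"
  using group_action
  by (auto simp: group_scheme_action_def finite_group_scheme_def dest: algebra.R_cring)

lemmas finite_dim = finite_group_scheme.finite_dim[OF group_scheme]
lemmas comult_hom = finite_group_scheme.comult_hom[OF group_scheme]
lemmas counit_hom = finite_group_scheme.counit_hom[OF group_scheme]
lemmas antipode_linear = finite_group_scheme.antipode_linear[OF group_scheme]
lemmas antipode_left = finite_group_scheme.antipode_left[OF group_scheme]
lemmas coaction_hom = group_scheme_action.coaction_hom[OF group_action]
lemmas coaction_coassoc = group_scheme_action.coaction_coassoc[OF group_action]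
lemmas coaction_counit = group_scheme_action.coaction_counit[OF group_action]

end

sublocale action \<subseteq> K: cring K by (rule cring_K)
sublocale action \<subseteq> A: algebra K A by (rule algebra_A)
sublocale action \<subseteq> S: algebra K S by (rule algebra_S)

sublocale action \<subseteq> AA: tensor_algebra K A A
  by (rule tensor_algebra.intro[OF algebra_A algebra_A])

sublocale action \<subseteq> SA: tensor_algebra K S A
  by (rule tensor_algebra.intro[OF algebra_S algebra_A])

context action
begin

abbreviation "functionals \<equiv> linear_maps K A (regular K)"

lemma functionalD:
  assumes "h \<in> functionals"
  shows "a \<in> carrier A \<Longrightarrow> h a \<in> carrier K"
    and "a \<in> carrier A \<Longrightarrow> b \<in> carrier A \<Longrightarrow> h (a \<oplus>\<^bsub>A\<^esub> b) = h a \<oplus>\<^bsub>K\<^esub> h b"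
    and "r \<in> carrier K \<Longrightarrow> a \<in> carrier A \<Longrightarrow> h (r \<odot>\<^bsub>A\<^esub> a) = r \<otimes>\<^bsub>K\<^esub> h a"
  using linear_mapsD[OF assms] by simp_all

lemma functionalI:
  assumes "\<And>a. a \<in> carrier A \<Longrightarrow> h a \<in> carrier K"
    and "\<And>a b. a \<in> carrier A \<Longrightarrow> b \<in> carrier A \<Longrightarrow> h (a \<oplus>\<^bsub>A\<^esub> b) = h a \<oplus>\<^bsub>K\<^esub> h b"
    and "\<And>r a. r \<in> carrier K \<Longrightarrow> a \<in> carrier A \<Longrightarrow> h (r \<odot>\<^bsub>A\<^esub> a) = r \<otimes>\<^bsub>K\<^esub> h a"
  shows "h \<in> functionals"
  using assms by (simp add: linear_maps_def)

text \<open>\<open>ev h\<close> is \<open>id \<otimes> h\<close>, and \<open>pairing h g\<close> is \<open>h \<otimes> g\<close>.\<close>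

abbreviation "ev h \<equiv> tensor_lift (add_monoid S) (\<lambda>t a. h a \<odot>\<^bsub>S\<^esub> t)"
abbreviation "pairing h g \<equiv> tensor_lift (add_monoid K) (\<lambda>b c. h b \<otimes>\<^bsub>K\<^esub> g c)"
abbreviation "conv h g \<equiv> \<lambda>a. pairing h g (comult A a)"

lemma ev_balanced: "h \<in> functionals \<Longrightarrow> balanced K S A S (\<lambda>t a. h a \<odot>\<^bsub>S\<^esub> t)"
  by (rule balancedI)
     (simp_all add: functionalD S.smult_r_distr S.smult_l_distr S.smult_assoc1[symmetric] K.m_comm)

lemmas ev_pure = SA.lift_pure[OF S.M.abelian_group_axioms ev_balanced]
lemmas ev_additive = SA.lift_additive[OF S.M.abelian_group_axioms ev_balanced]
lemmas ev_closed = additive_closed[OF ev_additive]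

lemma pairing_balanced: "h \<in> functionals \<Longrightarrow> g \<in> functionals \<Longrightarrow> balanced K A A K (\<lambda>b c. h b \<otimes>\<^bsub>K\<^esub> g c)"
  by (rule balancedI) (simp_all add: functionalD K.l_distr K.r_distr K.m_ac)

lemmas pairing_pure = AA.lift_pure[OF K.abelian_group_axioms pairing_balanced]
lemmas pairing_additive = AA.lift_additive[OF K.abelian_group_axioms pairing_balanced]
lemmas pairing_closed = additive_closed[OF pairing_additive]

lemma comult_facts:
  shows comult_closed: "a \<in> carrier A \<Longrightarrow> comult A a \<in> carrier (tensor K A A)"
    and comult_additive: "additive A (tensor K A A) (comult A)"
    and comult_smult: "r \<in> carrier K \<Longrightarrow> a \<in> carrier A \<Longrightarrow> comult A (r \<odot>\<^bsub>A\<^esub> a) = r \<odot>\<^bsub>tensor K A A\<^esub> comult A a"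
    and comult_mult: "a \<in> carrier A \<Longrightarrow> b \<in> carrier A \<Longrightarrow> comult A (a \<otimes>\<^bsub>A\<^esub> b) = comult A a \<otimes>\<^bsub>tensor K A A\<^esub> comult A b"
    and comult_one: "comult A \<one>\<^bsub>A\<^esub> = \<one>\<^bsub>tensor K A A\<^esub>"
  using comult_hom linear_mapsD[of "comult A" K A "tensor K A A"]
  by (auto simp: algebra_homs_def ring_hom_def)

lemma coaction_facts:
  shows coaction_closed: "s \<in> carrier S \<Longrightarrow> \<rho> s \<in> carrier (tensor K S A)"
    and coaction_additive: "additive S (tensor K S A) \<rho>"
    and coaction_smult: "r \<in> carrier K \<Longrightarrow> s \<in> carrier S \<Longrightarrow> \<rho> (r \<odot>\<^bsub>S\<^esub> s) = r \<odot>\<^bsub>tensor K S A\<^esub> \<rho> s"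
    and coaction_mult: "s \<in> carrier S \<Longrightarrow> t \<in> carrier S \<Longrightarrow> \<rho> (s \<otimes>\<^bsub>S\<^esub> t) = \<rho> s \<otimes>\<^bsub>tensor K S A\<^esub> \<rho> t"
    and coaction_one: "\<rho> \<one>\<^bsub>S\<^esub> = \<one>\<^bsub>tensor K S A\<^esub>"
    and coaction_ring_hom: "\<rho> \<in> ring_hom S (tensor K S A)"
  using coaction_hom linear_mapsD[of \<rho> K S "tensor K S A"]
  by (auto simp: algebra_homs_def ring_hom_def)

lemma counit_functional: "counit A \<in> functionals"
  using counit_hom by (simp add: algebra_homs_def)

lemma smult_K_additive: "r \<in> carrier K \<Longrightarrow> additive K K (\<lambda>x. r \<otimes>\<^bsub>K\<^esub> x)"
  by (rule additiveI) (simp_all add: K.r_distr)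

lemma smult_S_additive: "r \<in> carrier K \<Longrightarrow> additive S S (\<lambda>x. r \<odot>\<^bsub>S\<^esub> x)"
  by (rule additiveI) (simp_all add: S.smult_r_distr)

lemma ev_smult:
  assumes "h \<in> functionals" "r \<in> carrier K" "z \<in> carrier (tensor K S A)"
  shows "ev h (r \<odot>\<^bsub>tensor K S A\<^esub> z) = r \<odot>\<^bsub>S\<^esub> ev h z"
  by (rule SA.additive_eqI[OF _ _ _ assms(3)])
     (use assms in \<open>auto intro!: additive_comp[OF SA.smult_additive ev_additive] additive_comp[OF ev_additive smult_S_additive]
        simp: SA.smult_pure ev_pure functionalD S.smult_assoc1[symmetric] K.m_comm\<close>)

lemma pairing_smult:
  assumes "h \<in> functionals" "g \<in> functionals" "r \<in> carrier K" "z \<in> carrier (tensor K A A)"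
  shows "pairing h g (r \<odot>\<^bsub>tensor K A A\<^esub> z) = r \<otimes>\<^bsub>K\<^esub> pairing h g z"
  by (rule AA.additive_eqI[OF _ _ _ assms(4)])
     (use assms in \<open>auto intro!: additive_comp[OF AA.smult_additive pairing_additive] additive_comp[OF pairing_additive smult_K_additive]
        simp: AA.smult_pure pairing_pure functionalD K.m_assoc\<close>)

lemma conv_functional: "h \<in> functionals \<Longrightarrow> g \<in> functionals \<Longrightarrow> conv h g \<in> functionals"
  by (rule functionalI)
     (simp_all add: pairing_closed comult_closed additive_add[OF comult_additive] additive_add[OF pairing_additive]
        comult_smult pairing_smult)

text \<open>The action of \<open>H\<close> is associative because the coaction is coassociative: the
  claim arises by applying \<open>id \<otimes> h \<otimes> g\<close> to both sides of
  \<open>coaction_coassoc\<close>.\<close>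

lemma act_conv:
  assumes h: "h \<in> functionals" and g: "g \<in> functionals" and s: "s \<in> carrier S"
  shows "ev (conv h g) (\<rho> s) = ev h (\<rho> (ev g (\<rho> s)))"
proof -
  interpret S_AA: tensor_algebra K S "tensor K A A"
    by (rule tensor_algebra.intro[OF algebra_S AA.algebra_tensor])
  interpret SA_A: tensor_algebra K "tensor K S A" A
    by (rule tensor_algebra.intro[OF SA.algebra_tensor algebra_A])
  let ?AA = "tensor K A A" and ?SA = "tensor K S A"
  \<comment> \<open>\<open>?F\<close> is \<open>id \<otimes> h \<otimes> g\<close> on
    \<open>S \<otimes> (A \<otimes> A)\<close>. The facts \<open>R\<close> and \<open>L\<close>
    below compute it on the two sides of coassociativity.\<close>
  let ?F = "tensor_lift (add_monoid S) (\<lambda>t z. pairing h g z \<odot>\<^bsub>S\<^esub> t)"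
  note hg = h g
  have Fb: "balanced K S ?AA S (\<lambda>t z. pairing h g z \<odot>\<^bsub>S\<^esub> t)"
    by (rule balancedI)
       (simp_all add: hg pairing_closed additive_add[OF pairing_additive] pairing_smult S.smult_r_distr S.smult_l_distr
          S.smult_assoc1[symmetric] K.m_comm)
  note F_pure = S_AA.lift_pure[OF S.M.abelian_group_axioms Fb] and F_add = S_AA.lift_additive[OF S.M.abelian_group_axioms Fb]
  have idb: "balanced K S A (tensor K S ?AA) (\<lambda>t a. pure_tensor K S ?AA t (comult A a))"
    by (rule balancedI)
       (simp_all add: comult_closed S_AA.pure_add_left S_AA.pure_add_right additive_add[OF comult_additive]
          comult_smult S_AA.pure_smult)
  note R_pure = SA.lift_pure'[OF S_AA.group_facts idb] and R_add = SA.lift_additive'[OF S_AA.group_facts idb]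
  have rb: "balanced K S A (tensor K ?SA A) (\<lambda>t a. pure_tensor K ?SA A (\<rho> t) a)"
    by (rule balancedI)
       (simp_all add: coaction_closed SA_A.pure_add_left SA_A.pure_add_right additive_add[OF coaction_additive]
          coaction_smult SA_A.pure_smult)
  note L_pure = SA.lift_pure'[OF SA_A.group_facts rb] and L_add = SA.lift_additive'[OF SA_A.group_facts rb]
  have ib1: "balanced K S A (tensor K S ?AA) (\<lambda>t x. pure_tensor K S ?AA t (pure_tensor K A A x y))" if "y \<in> carrier A" for y
    by (rule balancedI)
       (use that in \<open>simp_all add: S_AA.pure_add_left S_AA.pure_add_right AA.pure_add_left S_AA.pure_smult AA.smult_pure\<close>)
  note I_pure = SA.lift_pure'[OF S_AA.group_facts ib1] and I_add = SA.lift_additive'[OF S_AA.group_facts ib1]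
  note I_closed = additive_closed[OF I_add]
  let ?I = "\<lambda>z y. tensor_lift (tensor_group K S ?AA) (\<lambda>t x. pure_tensor K S ?AA t (pure_tensor K A A x y)) z"
  have ib: "balanced K ?SA A (tensor K S ?AA) ?I"
  proof (rule balancedI)
    fix z y assume zy: "z \<in> carrier ?SA" "y \<in> carrier A"
    show "?I z y \<in> carrier (tensor K S ?AA)" using I_closed zy by blast
    show "?I (z \<oplus>\<^bsub>?SA\<^esub> z') y = ?I z y \<oplus>\<^bsub>tensor K S ?AA\<^esub> ?I z' y" if "z' \<in> carrier ?SA" for z'
      using additive_add[OF I_add] zy that by blast
    show "?I z (y \<oplus>\<^bsub>A\<^esub> y') = ?I z y \<oplus>\<^bsub>tensor K S ?AA\<^esub> ?I z y'" if y': "y' \<in> carrier A" for y'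
      by (rule SA.additive_eqI[OF _ _ _ zy(1)])
         (use zy y' in \<open>auto intro!: additive_plus I_add S_AA.T.abelian_group_axioms simp: I_pure AA.pure_add_right S_AA.pure_add_right\<close>)
    show "?I (r \<odot>\<^bsub>?SA\<^esub> z) y = ?I z (r \<odot>\<^bsub>A\<^esub> y)" if r: "r \<in> carrier K" for r
      by (rule SA.additive_eqI[OF _ _ _ zy(1)])
         (use zy r in \<open>auto intro!: additive_comp[OF SA.smult_additive I_add] I_add simp: I_pure SA.smult_pure S_AA.pure_smult AA.smult_pure AA.pure_smult[symmetric]\<close>)
  qed
  note assoc_pure = SA_A.lift_pure'[OF S_AA.group_facts ib] and assoc_add = SA_A.lift_additive'[OF S_AA.group_facts ib]
  have assoc_eq: "tensor_assoc K S A A w = tensor_lift (tensor_group K S ?AA) ?I w" for w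
    by (simp add: tensor_assoc_def Let_def)
  have FI: "?F (?I w y) = g y \<odot>\<^bsub>S\<^esub> ev h w" if w: "w \<in> carrier ?SA" and y: "y \<in> carrier A" for w y
    by (rule SA.additive_eqI[OF _ _ _ w])
       (use y in \<open>auto intro!: additive_comp[OF I_add F_add] additive_comp[OF ev_additive smult_S_additive]
          simp: hg I_pure F_pure ev_pure pairing_pure functionalD S.smult_assoc1[symmetric] K.m_comm\<close>)
  have R: "?F (tensor_map K S ?AA (\<lambda>t. t) (comult A) z) = ev (conv h g) z" if z: "z \<in> carrier ?SA" for z
    unfolding tensor_map_def
    by (rule SA.additive_eqI[OF _ _ _ z])
       (auto intro!: additive_comp[OF R_add F_add] ev_additive[OF conv_functional[OF h g]]
          simp: R_pure F_pure ev_pure[OF conv_functional[OF h g]] comult_closed)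
  have L: "?F (tensor_assoc K S A A (tensor_map K ?SA A \<rho> (\<lambda>a. a) z)) = ev h (\<rho> (ev g z))" if z: "z \<in> carrier ?SA" for z
    unfolding tensor_map_def assoc_eq
    by (rule SA.additive_eqI[OF _ _ _ z])
       (auto intro!: additive_comp[OF L_add additive_comp[OF assoc_add F_add]]
          additive_comp[OF ev_additive additive_comp[OF coaction_additive ev_additive]]
          simp: hg L_pure assoc_pure FI coaction_closed ev_pure functionalD coaction_smult ev_smult)
  show ?thesis
    using coaction_coassoc[OF s] L[OF coaction_closed[OF s]] R[OF coaction_closed[OF s]] by simp
qed

lemma act_counit: "s \<in> carrier S \<Longrightarrow> ev (counit A) (\<rho> s) = s"
  by (rule coaction_counit)

lemma ev_cong: "(\<And>a. a \<in> carrier A \<Longrightarrow> h a = h' a) \<Longrightarrow> h \<in> functionals \<Longrightarrow> z \<in> carrier (tensor K S A) \<Longrightarrow> ev h z = ev h' z"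
proof -
  assume eq: "\<And>a. a \<in> carrier A \<Longrightarrow> h a = h' a" and h: "h \<in> functionals" and z: "z \<in> carrier (tensor K S A)"
  have h': "h' \<in> functionals" by (rule functionalI) (simp_all add: eq[symmetric] functionalD[OF h])
  show ?thesis
    by (rule SA.additive_eqI[OF _ _ _ z]) (use h h' in \<open>auto intro!: ev_additive simp: ev_pure eq\<close>)
qed

abbreviation "act h s \<equiv> ev h (\<rho> s)"

lemma act_closed: "h \<in> functionals \<Longrightarrow> s \<in> carrier S \<Longrightarrow> act h s \<in> carrier S"
  by (simp add: ev_closed coaction_closed)

lemma act_additive: "h \<in> functionals \<Longrightarrow> additive S S (act h)"
  by (rule additive_comp[OF coaction_additive ev_additive])

section \<open>The rational points of the group scheme\<close>

definition points :: "('a \<Rightarrow> 'k) set" where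
  "points = algebra_homs K A (regular K) \<inter> extensional (carrier A)"

lemma pointD:
  assumes "\<gamma> \<in> algebra_homs K A (regular K)"
  shows "\<gamma> \<in> functionals"
    and "a \<in> carrier A \<Longrightarrow> b \<in> carrier A \<Longrightarrow> \<gamma> (a \<otimes>\<^bsub>A\<^esub> b) = \<gamma> a \<otimes>\<^bsub>K\<^esub> \<gamma> b"
    and "\<gamma> \<one>\<^bsub>A\<^esub> = \<one>\<^bsub>K\<^esub>"
  using assms by (auto simp: algebra_homs_def ring_hom_def)

lemma pointI:
  assumes "\<gamma> \<in> functionals"
    and "\<And>a b. a \<in> carrier A \<Longrightarrow> b \<in> carrier A \<Longrightarrow> \<gamma> (a \<otimes>\<^bsub>A\<^esub> b) = \<gamma> a \<otimes>\<^bsub>K\<^esub> \<gamma> b"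
    and "\<gamma> \<one>\<^bsub>A\<^esub> = \<one>\<^bsub>K\<^esub>"
  shows "\<gamma> \<in> algebra_homs K A (regular K)"
  using assms functionalD(1)[OF assms(1)] functionalD(2)[OF assms(1)]
  by (simp add: algebra_homs_def ring_hom_def)

lemma restrict_point: "\<gamma> \<in> algebra_homs K A (regular K) \<Longrightarrow> restrict \<gamma> (carrier A) \<in> points"
  unfolding points_def
  by (intro IntI pointI functionalI) (auto simp: pointD functionalD[OF pointD(1)])

text \<open>For a point \<open>\<gamma>\<close> the map \<open>ev \<gamma>\<close> is the comorphism
  of \<open>v \<mapsto> (v, \<gamma>)\<close>, and \<open>act \<gamma>\<close> is the endomorphism
  of \<open>S\<close> by which \<open>\<gamma>\<close> acts.\<close>

lemma ev_point_ring_hom: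
  assumes \<gamma>: "\<gamma> \<in> algebra_homs K A (regular K)"
  shows "ev \<gamma> \<in> ring_hom (tensor K S A) S"
proof (rule ring_hom_memI)
  note f = pointD(1)[OF \<gamma>]
  show "ev \<gamma> x \<in> carrier S" if "x \<in> carrier (tensor K S A)" for x using ev_closed f that by blast
  show "ev \<gamma> (x \<oplus>\<^bsub>tensor K S A\<^esub> y) = ev \<gamma> x \<oplus>\<^bsub>S\<^esub> ev \<gamma> y"
    if "x \<in> carrier (tensor K S A)" "y \<in> carrier (tensor K S A)" for x y
    using additive_add[OF ev_additive[OF f]] that by blast
  show "ev \<gamma> \<one>\<^bsub>tensor K S A\<^esub> = \<one>\<^bsub>S\<^esub>"
    by (simp add: SA.one_tensor ev_pure f pointD[OF \<gamma>])
  have mS: "additive S S (\<lambda>x. x \<otimes>\<^bsub>S\<^esub> y)" if "y \<in> carrier S" for y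
    by (rule additiveI) (use that in \<open>simp_all add: S.l_distr\<close>)
  have mS': "additive S S (\<lambda>x. y \<otimes>\<^bsub>S\<^esub> x)" if "y \<in> carrier S" for y
    by (rule additiveI) (use that in \<open>simp_all add: S.r_distr\<close>)
  have 1: "ev \<gamma> (SA.\<tau> s a \<otimes>\<^bsub>tensor K S A\<^esub> y) = ev \<gamma> (SA.\<tau> s a) \<otimes>\<^bsub>S\<^esub> ev \<gamma> y"
    if sa: "s \<in> carrier S" "a \<in> carrier A" and y: "y \<in> carrier (tensor K S A)" for s a y
    by (rule SA.additive_eqI[OF _ _ _ y])
       (use sa f in \<open>auto intro!: additive_comp[OF SA.mult_additive_right ev_additive] additive_comp[OF ev_additive mS']
         simp: SA.mult_pure ev_pure functionalD pointD[OF \<gamma>] S.smult_assoc1[symmetric] K.m_comm S.smult_assoc2 S.smult_assoc2'\<close>)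
  show "ev \<gamma> (x \<otimes>\<^bsub>tensor K S A\<^esub> y) = ev \<gamma> x \<otimes>\<^bsub>S\<^esub> ev \<gamma> y"
    if x: "x \<in> carrier (tensor K S A)" and y: "y \<in> carrier (tensor K S A)" for x y
    by (rule SA.additive_eqI[OF _ _ _ x])
       (use f y in \<open>auto intro!: additive_comp[OF SA.mult_additive_left ev_additive] additive_comp[OF ev_additive mS]
          ev_closed simp: 1\<close>)
qed

lemma act_point_ring_hom:
  assumes \<gamma>: "\<gamma> \<in> algebra_homs K A (regular K)"
  shows "act \<gamma> \<in> ring_hom S S"
  using ring_hom_trans[OF coaction_ring_hom ev_point_ring_hom[OF \<gamma>]] by (simp add: comp_def)

lemma conv_point:
  assumes \<gamma>: "\<gamma> \<in> algebra_homs K A (regular K)" and \<delta>: "\<delta> \<in> algebra_homs K A (regular K)"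
  shows "conv \<gamma> \<delta> \<in> algebra_homs K A (regular K)"
proof (rule pointI)
  note f = pointD(1)[OF \<gamma>] pointD(1)[OF \<delta>]
  show "conv \<gamma> \<delta> \<in> functionals" by (rule conv_functional[OF f])
  show "conv \<gamma> \<delta> \<one>\<^bsub>A\<^esub> = \<one>\<^bsub>K\<^esub>"
    by (simp add: comult_one AA.one_tensor pairing_pure f pointD[OF \<gamma>] pointD[OF \<delta>])
  have mK: "additive K K (\<lambda>x. x \<otimes>\<^bsub>K\<^esub> y)" if "y \<in> carrier K" for y
    by (rule additiveI) (use that in \<open>simp_all add: K.l_distr\<close>)
  have 1: "pairing \<gamma> \<delta> (AA.\<tau> s a \<otimes>\<^bsub>tensor K A A\<^esub> y) = pairing \<gamma> \<delta> (AA.\<tau> s a) \<otimes>\<^bsub>K\<^esub> pairing \<gamma> \<delta> y"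
    if sa: "s \<in> carrier A" "a \<in> carrier A" and y: "y \<in> carrier (tensor K A A)" for s a y
    by (rule AA.additive_eqI[OF _ _ _ y])
       (use sa f in \<open>auto intro!: additive_comp[OF AA.mult_additive_right pairing_additive] additive_comp[OF pairing_additive smult_K_additive]
         simp: AA.mult_pure pairing_pure functionalD pointD[OF \<gamma>] pointD[OF \<delta>] K.m_ac\<close>)
  have 2: "pairing \<gamma> \<delta> (x \<otimes>\<^bsub>tensor K A A\<^esub> y) = pairing \<gamma> \<delta> x \<otimes>\<^bsub>K\<^esub> pairing \<gamma> \<delta> y"
    if x: "x \<in> carrier (tensor K A A)" and y: "y \<in> carrier (tensor K A A)" for x y
    by (rule AA.additive_eqI[OF _ _ _ x])
       (use f y in \<open>auto intro!: additive_comp[OF AA.mult_additive_left pairing_additive] additive_comp[OF pairing_additive mK]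
          pairing_closed simp: 1\<close>)
  show "conv \<gamma> \<delta> (a \<otimes>\<^bsub>A\<^esub> b) = conv \<gamma> \<delta> a \<otimes>\<^bsub>K\<^esub> conv \<gamma> \<delta> b" if "a \<in> carrier A" "b \<in> carrier A" for a b
    using that by (simp add: comult_mult 2 comult_closed)
qed

text \<open>Composition with the antipode inverts a point under convolution: apply the
  multiplicative map \<open>\<delta>\<close> to the antipode axiom.\<close>

lemma act_inverse:
  assumes \<delta>: "\<delta> \<in> algebra_homs K A (regular K)" and s: "s \<in> carrier S"
  shows "act (\<lambda>a. \<delta> (antipode A a)) (act \<delta> s) = s"
proof -
  note f = pointD(1)[OF \<delta>]
  note ant = linear_mapsD[OF antipode_linear]
  let ?i = "\<lambda>a. \<delta> (antipode A a)"
  have i: "?i \<in> functionals" by (rule functionalI) (simp_all add: ant functionalD[OF f])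
  have mb: "balanced K A A A (\<lambda>b c. antipode A b \<otimes>\<^bsub>A\<^esub> c)"
    by (rule balancedI) (simp_all add: ant A.l_distr A.r_distr A.smult_assoc2 A.smult_assoc2')
  note m_pure = AA.lift_pure[OF A.M.abelian_group_axioms mb] and m_add = AA.lift_additive[OF A.M.abelian_group_axioms mb]
  have dadd: "additive A K \<delta>" by (rule additiveI) (simp_all add: functionalD[OF f])
  have *: "pairing ?i \<delta> z = \<delta> (tensor_lift (add_monoid A) (\<lambda>b c. antipode A b \<otimes>\<^bsub>A\<^esub> c) z)" if z: "z \<in> carrier (tensor K A A)" for z
    by (rule AA.additive_eqI[OF _ _ _ z])
       (auto intro!: pairing_additive i f additive_comp[OF m_add dadd] simp: pairing_pure[OF i f] m_pure ant pointD[OF \<delta>])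
  have "conv ?i \<delta> a = counit A a" if a: "a \<in> carrier A" for a
    using *[OF comult_closed[OF a]] antipode_left[OF a] functionalD(1)[OF counit_functional a]
    by (simp add: functionalD(3)[OF f] pointD[OF \<delta>])
  then have "ev (conv ?i \<delta>) (\<rho> s) = ev (counit A) (\<rho> s)"
    by (intro ev_cong conv_functional i f coaction_closed s)
  then show ?thesis using act_conv[OF i f s] act_counit[OF s] by simp
qed

text \<open>Every element of \<open>A\<close> satisfies a polynomial relation over the algebraically
  closed field \<open>K\<close>, so modulo the contraction \<open>P\<close> of \<open>Q\<close> it
  equals a scalar. The scalars form a point \<open>\<gamma>\<close>, and modulo \<open>Q\<close>
  every element \<open>w\<close> of \<open>S \<otimes> A\<close> becomes equal to
  \<open>ev \<gamma> w \<otimes> 1\<close>.\<close>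

lemma point_at_prime:
  assumes alg_closed: "algebraically_closed K" and Q: "primeideal Q (tensor K S A)"
  shows "\<exists>\<gamma>\<in>points. \<forall>w\<in>carrier (tensor K S A). w \<ominus>\<^bsub>tensor K S A\<^esub> SA.\<tau> (ev \<gamma> w) \<one>\<^bsub>A\<^esub> \<in> Q"
proof -
  interpret K: algebraically_closed K by fact
  interpret Q: primeideal Q "tensor K S A" by fact
  let ?SA = "tensor K S A"
  let ?j = "\<lambda>a. SA.\<tau> \<one>\<^bsub>S\<^esub> a"
  have j: "?j \<in> ring_hom A ?SA"
    by (rule ring_hom_memI) (simp_all add: SA.mult_pure SA.pure_add_right SA.one_tensor)
  define P where "P = Spec_map A ?j Q"
  have memP: "a \<in> P \<longleftrightarrow> a \<in> carrier A \<and> ?j a \<in> Q" for a by (simp add: P_def Spec_map_def)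
  have "P \<in> Spec A"
    unfolding P_def by (rule Spec_map_Spec[OF A.is_cring SA.cring_tensor j]) (use Q in \<open>simp add: Spec_def\<close>)
  then have P: "primeideal P A" by (simp add: Spec_def)
  interpret P: primeideal P A by (rule P)
  have ex: "\<exists>l\<in>carrier K. a \<ominus>\<^bsub>A\<^esub> l \<odot>\<^bsub>A\<^esub> \<one>\<^bsub>A\<^esub> \<in> P" if a: "a \<in> carrier A" for a
  proof -
    obtain cs where cs: "set cs \<subseteq> carrier K" "cs \<noteq> []" "last cs \<noteq> \<zero>\<^bsub>K\<^esub>" "horner A a cs = \<zero>\<^bsub>A\<^esub>"
      using algebraic_relation[OF K.field_axioms algebra_A finite_dim a] by blast
    have "horner A a cs \<in> P" using cs(4) P.zero_closed by simp
    then show ?thesis by (rule eigenvalue_modulo_prime[OF alg_closed algebra_A P a cs(1-3)])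
  qed
  \<comment> \<open>Two different scalars would put their difference, a unit, into
    \<open>P\<close>.\<close>
  have uniq: "l = m" if lm: "l \<in> carrier K" "m \<in> carrier K" and a: "a \<in> carrier A"
    and l: "a \<ominus>\<^bsub>A\<^esub> l \<odot>\<^bsub>A\<^esub> \<one>\<^bsub>A\<^esub> \<in> P" and m: "a \<ominus>\<^bsub>A\<^esub> m \<odot>\<^bsub>A\<^esub> \<one>\<^bsub>A\<^esub> \<in> P" for l m a
  proof (rule ccontr)
    assume "l \<noteq> m"
    then have u: "l \<ominus>\<^bsub>K\<^esub> m \<in> Units K" using lm K.field_Units by auto
    have "(a \<ominus>\<^bsub>A\<^esub> m \<odot>\<^bsub>A\<^esub> \<one>\<^bsub>A\<^esub>) \<oplus>\<^bsub>A\<^esub> \<ominus>\<^bsub>A\<^esub> (a \<ominus>\<^bsub>A\<^esub> l \<odot>\<^bsub>A\<^esub> \<one>\<^bsub>A\<^esub>) \<in> P"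
      by (intro P.a_closed P.a_inv_closed l m)
    also have "(a \<ominus>\<^bsub>A\<^esub> m \<odot>\<^bsub>A\<^esub> \<one>\<^bsub>A\<^esub>) \<oplus>\<^bsub>A\<^esub> \<ominus>\<^bsub>A\<^esub> (a \<ominus>\<^bsub>A\<^esub> l \<odot>\<^bsub>A\<^esub> \<one>\<^bsub>A\<^esub>) = l \<odot>\<^bsub>A\<^esub> \<one>\<^bsub>A\<^esub> \<oplus>\<^bsub>A\<^esub> \<ominus>\<^bsub>A\<^esub> (m \<odot>\<^bsub>A\<^esub> \<one>\<^bsub>A\<^esub>)"
    proof -
      have c: "l \<odot>\<^bsub>A\<^esub> \<one>\<^bsub>A\<^esub> \<in> carrier A" "m \<odot>\<^bsub>A\<^esub> \<one>\<^bsub>A\<^esub> \<in> carrier A" using lm by auto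
      show ?thesis using a c
        by (simp add: A.minus_eq A.minus_add A.a_ac A.r_neg1 A.r_neg2)
    qed
    also have "\<dots> = (l \<ominus>\<^bsub>K\<^esub> m) \<odot>\<^bsub>A\<^esub> \<one>\<^bsub>A\<^esub>"
      using lm by (simp add: K.minus_eq A.smult_l_distr A.smult_l_minus)
    finally have "(inv\<^bsub>K\<^esub> (l \<ominus>\<^bsub>K\<^esub> m) \<odot>\<^bsub>A\<^esub> \<one>\<^bsub>A\<^esub>) \<otimes>\<^bsub>A\<^esub> ((l \<ominus>\<^bsub>K\<^esub> m) \<odot>\<^bsub>A\<^esub> \<one>\<^bsub>A\<^esub>) \<in> P"
      using u by (intro P.I_l_closed) auto
    also have "(inv\<^bsub>K\<^esub> (l \<ominus>\<^bsub>K\<^esub> m) \<odot>\<^bsub>A\<^esub> \<one>\<^bsub>A\<^esub>) \<otimes>\<^bsub>A\<^esub> ((l \<ominus>\<^bsub>K\<^esub> m) \<odot>\<^bsub>A\<^esub> \<one>\<^bsub>A\<^esub>) = \<one>\<^bsub>A\<^esub>"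
      using u K.Units_closed[OF u] by (simp add: A.smult_assoc2 A.smult_assoc1[symmetric])
    finally show False using P.one_notin by blast
  qed
  define \<gamma> where "\<gamma> = (\<lambda>a. SOME l. l \<in> carrier K \<and> a \<ominus>\<^bsub>A\<^esub> l \<odot>\<^bsub>A\<^esub> \<one>\<^bsub>A\<^esub> \<in> P)"
  have \<gamma>: "\<gamma> a \<in> carrier K" "a \<ominus>\<^bsub>A\<^esub> \<gamma> a \<odot>\<^bsub>A\<^esub> \<one>\<^bsub>A\<^esub> \<in> P" if a: "a \<in> carrier A" for a
    using someI_ex[of "\<lambda>l. l \<in> carrier K \<and> a \<ominus>\<^bsub>A\<^esub> l \<odot>\<^bsub>A\<^esub> \<one>\<^bsub>A\<^esub> \<in> P"] ex[OF a] unfolding \<gamma>_def by blast+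
  \<comment> \<open>By uniqueness each homomorphism law for \<open>\<gamma>\<close> reduces to
    showing that one explicit element lies in \<open>P\<close>.\<close>
  have \<gamma>_eq: "\<gamma> a = l" if "l \<in> carrier K" "a \<in> carrier A" "a \<ominus>\<^bsub>A\<^esub> l \<odot>\<^bsub>A\<^esub> \<one>\<^bsub>A\<^esub> \<in> P" for a l
    by (rule uniq[OF \<gamma>(1)[OF that(2)] that(1,2) \<gamma>(2)[OF that(2)] that(3)])
  have "\<gamma> \<in> algebra_homs K A (regular K)"
  proof (rule pointI[OF functionalI])
    show "\<gamma> a \<in> carrier K" if "a \<in> carrier A" for a by (rule \<gamma>(1)[OF that])
    show "\<gamma> (a \<oplus>\<^bsub>A\<^esub> b) = \<gamma> a \<oplus>\<^bsub>K\<^esub> \<gamma> b" if ab: "a \<in> carrier A" "b \<in> carrier A" for a b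
    proof (rule \<gamma>_eq)
      note c = \<gamma>(1)[OF ab(1)] \<gamma>(1)[OF ab(2)]
      have "(a \<ominus>\<^bsub>A\<^esub> \<gamma> a \<odot>\<^bsub>A\<^esub> \<one>\<^bsub>A\<^esub>) \<oplus>\<^bsub>A\<^esub> (b \<ominus>\<^bsub>A\<^esub> \<gamma> b \<odot>\<^bsub>A\<^esub> \<one>\<^bsub>A\<^esub>) \<in> P" by (intro P.a_closed \<gamma> ab)
      also have "(a \<ominus>\<^bsub>A\<^esub> \<gamma> a \<odot>\<^bsub>A\<^esub> \<one>\<^bsub>A\<^esub>) \<oplus>\<^bsub>A\<^esub> (b \<ominus>\<^bsub>A\<^esub> \<gamma> b \<odot>\<^bsub>A\<^esub> \<one>\<^bsub>A\<^esub>) = (a \<oplus>\<^bsub>A\<^esub> b) \<ominus>\<^bsub>A\<^esub> (\<gamma> a \<oplus>\<^bsub>K\<^esub> \<gamma> b) \<odot>\<^bsub>A\<^esub> \<one>\<^bsub>A\<^esub>"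
        using ab c by (simp add: A.minus_eq A.smult_l_distr A.minus_add A.a_ac)
      finally show "(a \<oplus>\<^bsub>A\<^esub> b) \<ominus>\<^bsub>A\<^esub> (\<gamma> a \<oplus>\<^bsub>K\<^esub> \<gamma> b) \<odot>\<^bsub>A\<^esub> \<one>\<^bsub>A\<^esub> \<in> P" .
    qed (use ab \<gamma> in auto)
    show "\<gamma> (r \<odot>\<^bsub>A\<^esub> a) = r \<otimes>\<^bsub>K\<^esub> \<gamma> a" if ra: "r \<in> carrier K" "a \<in> carrier A" for r a
    proof (rule \<gamma>_eq)
      note c = \<gamma>(1)[OF ra(2)]
      have "(r \<odot>\<^bsub>A\<^esub> \<one>\<^bsub>A\<^esub>) \<otimes>\<^bsub>A\<^esub> (a \<ominus>\<^bsub>A\<^esub> \<gamma> a \<odot>\<^bsub>A\<^esub> \<one>\<^bsub>A\<^esub>) \<in> P" by (intro P.I_l_closed \<gamma> ra) (use ra in simp)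
      also have "(r \<odot>\<^bsub>A\<^esub> \<one>\<^bsub>A\<^esub>) \<otimes>\<^bsub>A\<^esub> (a \<ominus>\<^bsub>A\<^esub> \<gamma> a \<odot>\<^bsub>A\<^esub> \<one>\<^bsub>A\<^esub>) = r \<odot>\<^bsub>A\<^esub> a \<ominus>\<^bsub>A\<^esub> (r \<otimes>\<^bsub>K\<^esub> \<gamma> a) \<odot>\<^bsub>A\<^esub> \<one>\<^bsub>A\<^esub>"
        using ra c by (simp add: A.minus_eq A.smult_assoc2 A.smult_r_distr A.smult_r_minus A.smult_assoc1)
      finally show "r \<odot>\<^bsub>A\<^esub> a \<ominus>\<^bsub>A\<^esub> (r \<otimes>\<^bsub>K\<^esub> \<gamma> a) \<odot>\<^bsub>A\<^esub> \<one>\<^bsub>A\<^esub> \<in> P" .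
    qed (use ra \<gamma> in auto)
    show "\<gamma> (a \<otimes>\<^bsub>A\<^esub> b) = \<gamma> a \<otimes>\<^bsub>K\<^esub> \<gamma> b" if ab: "a \<in> carrier A" "b \<in> carrier A" for a b
    proof (rule \<gamma>_eq)
      note c = \<gamma>(1)[OF ab(1)] \<gamma>(1)[OF ab(2)]
      have "b \<otimes>\<^bsub>A\<^esub> (a \<ominus>\<^bsub>A\<^esub> \<gamma> a \<odot>\<^bsub>A\<^esub> \<one>\<^bsub>A\<^esub>) \<oplus>\<^bsub>A\<^esub> (\<gamma> a \<odot>\<^bsub>A\<^esub> \<one>\<^bsub>A\<^esub>) \<otimes>\<^bsub>A\<^esub> (b \<ominus>\<^bsub>A\<^esub> \<gamma> b \<odot>\<^bsub>A\<^esub> \<one>\<^bsub>A\<^esub>) \<in> P"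
        by (intro P.a_closed P.I_l_closed \<gamma> ab) (use c in simp)
      also have "b \<otimes>\<^bsub>A\<^esub> (a \<ominus>\<^bsub>A\<^esub> \<gamma> a \<odot>\<^bsub>A\<^esub> \<one>\<^bsub>A\<^esub>) = a \<otimes>\<^bsub>A\<^esub> b \<ominus>\<^bsub>A\<^esub> \<gamma> a \<odot>\<^bsub>A\<^esub> b"
        using ab c by (simp add: A.minus_eq A.r_distr A.r_minus A.smult_assoc2' A.m_comm)
      also have "(\<gamma> a \<odot>\<^bsub>A\<^esub> \<one>\<^bsub>A\<^esub>) \<otimes>\<^bsub>A\<^esub> (b \<ominus>\<^bsub>A\<^esub> \<gamma> b \<odot>\<^bsub>A\<^esub> \<one>\<^bsub>A\<^esub>) = \<gamma> a \<odot>\<^bsub>A\<^esub> b \<ominus>\<^bsub>A\<^esub> (\<gamma> a \<otimes>\<^bsub>K\<^esub> \<gamma> b) \<odot>\<^bsub>A\<^esub> \<one>\<^bsub>A\<^esub>"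
        using ab c by (simp add: A.minus_eq A.smult_assoc2 A.smult_r_distr A.smult_r_minus A.smult_assoc1)
      also have "a \<otimes>\<^bsub>A\<^esub> b \<ominus>\<^bsub>A\<^esub> \<gamma> a \<odot>\<^bsub>A\<^esub> b \<oplus>\<^bsub>A\<^esub> (\<gamma> a \<odot>\<^bsub>A\<^esub> b \<ominus>\<^bsub>A\<^esub> (\<gamma> a \<otimes>\<^bsub>K\<^esub> \<gamma> b) \<odot>\<^bsub>A\<^esub> \<one>\<^bsub>A\<^esub>)
          = a \<otimes>\<^bsub>A\<^esub> b \<ominus>\<^bsub>A\<^esub> (\<gamma> a \<otimes>\<^bsub>K\<^esub> \<gamma> b) \<odot>\<^bsub>A\<^esub> \<one>\<^bsub>A\<^esub>"
        using ab c by (simp add: A.minus_eq A.a_assoc A.r_neg1)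
      finally show "a \<otimes>\<^bsub>A\<^esub> b \<ominus>\<^bsub>A\<^esub> (\<gamma> a \<otimes>\<^bsub>K\<^esub> \<gamma> b) \<odot>\<^bsub>A\<^esub> \<one>\<^bsub>A\<^esub> \<in> P" .
    qed (use ab \<gamma> in auto)
    have "\<one>\<^bsub>A\<^esub> \<ominus>\<^bsub>A\<^esub> \<one>\<^bsub>K\<^esub> \<odot>\<^bsub>A\<^esub> \<one>\<^bsub>A\<^esub> \<in> P" using P.zero_closed by (simp add: A.minus_eq A.r_neg)
    then show "\<gamma> \<one>\<^bsub>A\<^esub> = \<one>\<^bsub>K\<^esub>" by (intro \<gamma>_eq) auto
  qed
  then have pt: "restrict \<gamma> (carrier A) \<in> points" by (rule restrict_point)
  define g where "g = restrict \<gamma> (carrier A)"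
  have g: "g a = \<gamma> a" if "a \<in> carrier A" for a using that by (simp add: g_def)
  have pt: "g \<in> points" using pt by (simp add: g_def)
  have gh: "g \<in> functionals" using pt pointD(1) by (simp add: points_def)
  have "w \<ominus>\<^bsub>?SA\<^esub> SA.\<tau> (ev g w) \<one>\<^bsub>A\<^esub> \<in> Q" if "w \<in> carrier ?SA" for w
    using that
  proof (induction rule: SA.tensor_induct)
    case (pure s a)
    note c = \<gamma>(1)[OF pure(2)]
    have e: "ev g (SA.\<tau> s a) = \<gamma> a \<odot>\<^bsub>S\<^esub> s" using pure g by (simp add: ev_pure[OF gh])
    have "?j (a \<ominus>\<^bsub>A\<^esub> \<gamma> a \<odot>\<^bsub>A\<^esub> \<one>\<^bsub>A\<^esub>) \<in> Q" using \<gamma>(2)[OF pure(2)] memP by blast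
    then have "SA.\<tau> s \<one>\<^bsub>A\<^esub> \<otimes>\<^bsub>?SA\<^esub> ?j (a \<ominus>\<^bsub>A\<^esub> \<gamma> a \<odot>\<^bsub>A\<^esub> \<one>\<^bsub>A\<^esub>) \<in> Q"
      using pure by (intro Q.I_l_closed) auto
    also have "SA.\<tau> s \<one>\<^bsub>A\<^esub> \<otimes>\<^bsub>?SA\<^esub> ?j (a \<ominus>\<^bsub>A\<^esub> \<gamma> a \<odot>\<^bsub>A\<^esub> \<one>\<^bsub>A\<^esub>) = SA.\<tau> s (a \<ominus>\<^bsub>A\<^esub> \<gamma> a \<odot>\<^bsub>A\<^esub> \<one>\<^bsub>A\<^esub>)"
      using pure c by (simp add: SA.mult_pure)
    also have "\<dots> = SA.\<tau> s a \<oplus>\<^bsub>?SA\<^esub> SA.\<tau> s (\<ominus>\<^bsub>A\<^esub> (\<gamma> a \<odot>\<^bsub>A\<^esub> \<one>\<^bsub>A\<^esub>))"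
      using pure c by (simp add: A.minus_eq SA.pure_add_right)
    also have "SA.\<tau> s (\<ominus>\<^bsub>A\<^esub> (\<gamma> a \<odot>\<^bsub>A\<^esub> \<one>\<^bsub>A\<^esub>)) = \<ominus>\<^bsub>?SA\<^esub> SA.\<tau> s (\<gamma> a \<odot>\<^bsub>A\<^esub> \<one>\<^bsub>A\<^esub>)"
    proof -
      have "additive A ?SA (SA.\<tau> s)" by (rule additiveI) (use pure in \<open>simp_all add: SA.pure_add_right\<close>)
      then show ?thesis using c by (intro additive_minus[OF A.M.abelian_group_axioms SA.abelian_group_tensor]) auto
    qed
    also have "SA.\<tau> s (\<gamma> a \<odot>\<^bsub>A\<^esub> \<one>\<^bsub>A\<^esub>) = SA.\<tau> (\<gamma> a \<odot>\<^bsub>S\<^esub> s) \<one>\<^bsub>A\<^esub>" using pure c by (simp add: SA.pure_smult)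
    finally show ?case unfolding e by (simp add: a_minus_def)
  next
    case (add z w)
    have c: "ev g z \<in> carrier S" "ev g w \<in> carrier S" using add by (auto intro: ev_closed[OF gh])
    have "(z \<ominus>\<^bsub>?SA\<^esub> SA.\<tau> (ev g z) \<one>\<^bsub>A\<^esub>) \<oplus>\<^bsub>?SA\<^esub> (w \<ominus>\<^bsub>?SA\<^esub> SA.\<tau> (ev g w) \<one>\<^bsub>A\<^esub>) \<in> Q"
      by (rule Q.a_closed[OF add(3,4)])
    also have "(z \<ominus>\<^bsub>?SA\<^esub> SA.\<tau> (ev g z) \<one>\<^bsub>A\<^esub>) \<oplus>\<^bsub>?SA\<^esub> (w \<ominus>\<^bsub>?SA\<^esub> SA.\<tau> (ev g w) \<one>\<^bsub>A\<^esub>)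
        = (z \<oplus>\<^bsub>?SA\<^esub> w) \<ominus>\<^bsub>?SA\<^esub> SA.\<tau> (ev g (z \<oplus>\<^bsub>?SA\<^esub> w)) \<one>\<^bsub>A\<^esub>"
      using add(1,2) c by (simp add: additive_add[OF ev_additive[OF gh]] SA.pure_add_left SA.T.minus_eq SA.T.minus_add SA.T.a_ac)
    finally show ?case .
  qed
  then show ?thesis using pt by blast
qed

lemma horner_point:
  assumes \<gamma>: "\<gamma> \<in> algebra_homs K A (regular K)" and a: "a \<in> carrier A" and "set cs \<subseteq> carrier K"
  shows "\<gamma> (horner A a cs) = K.eval (rev cs) (\<gamma> a)"
  using assms(3)
proof (induction cs)
  note f = functionalD[OF pointD(1)[OF \<gamma>]]
  case Nil
  have "\<gamma> (\<zero>\<^bsub>K\<^esub> \<odot>\<^bsub>A\<^esub> \<zero>\<^bsub>A\<^esub>) = \<zero>\<^bsub>K\<^esub>" by (subst f(3)) (simp_all add: f(1))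
  then show ?case by simp
next
  note f = functionalD[OF pointD(1)[OF \<gamma>]]
  case (Cons c cs)
  then show ?case
    using K.eval_append_aux[of "rev cs" c "\<gamma> a"] a A.horner_closed[OF a, of cs] K.eval_in_carrier[of "rev cs" "\<gamma> a"]
    by (simp add: f pointD[OF \<gamma>] K.a_comm K.m_comm)
qed

text \<open>A point is extensional and linear, hence determined by its values on the finite spanning
  set \<open>E\<close>. Its value at \<open>b\<close> is a root of any polynomial that annihilates
  \<open>b\<close>, which leaves finitely many choices.\<close>

lemma finite_points:
  assumes K: "field K"
  shows "finite points"
proof -
  interpret K: field K by fact
  obtain E e where E: "finite E" "E \<subseteq> carrier A" "\<And>b. b \<in> E \<Longrightarrow> e b \<in> functionals"
    "\<And>x. x \<in> carrier A \<Longrightarrow> x = finsum A (\<lambda>b. e b x \<odot>\<^bsub>A\<^esub> b) E"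
    using dual_basis_exists[OF K A.module finite_dim] by blast
  have "\<exists>F. finite F \<and> (\<forall>\<gamma>\<in>points. \<gamma> b \<in> F)" if b: "b \<in> E" for b
  proof -
    have bA: "b \<in> carrier A" using b E by blast
    obtain cs where cs: "set cs \<subseteq> carrier K" "cs \<noteq> []" "last cs \<noteq> \<zero>\<^bsub>K\<^esub>" "horner A b cs = \<zero>\<^bsub>A\<^esub>"
      using algebraic_relation[OF K algebra_A finite_dim bA] by blast
    note p = reversed_polynomial[OF cs(1-3)]
    have "\<gamma> b \<in> set_mset (K.roots (rev cs))" if \<gamma>: "\<gamma> \<in> points" for \<gamma>
    proof -
      have h: "\<gamma> \<in> algebra_homs K A (regular K)" using \<gamma> by (simp add: points_def)
      have "K.eval (rev cs) (\<gamma> b) = \<gamma> \<zero>\<^bsub>A\<^esub>" using horner_point[OF h bA cs(1)] cs(4) by simp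
      also have "\<dots> = \<zero>\<^bsub>K\<^esub>"
        using horner_point[OF h bA, of "[]"] by simp
      finally show ?thesis
        using K.roots_mem_iff_is_root[OF p] functionalD(1)[OF pointD(1)[OF h] bA] cs(2) by (simp add: K.is_root_def)
    qed
    then show ?thesis by (intro exI[of _ "set_mset (K.roots (rev cs))"]) auto
  qed
  then obtain F where F: "\<And>b. b \<in> E \<Longrightarrow> finite (F b)" "\<And>b \<gamma>. b \<in> E \<Longrightarrow> \<gamma> \<in> points \<Longrightarrow> \<gamma> b \<in> F b" by metis
  have "inj_on (\<lambda>\<gamma>. restrict \<gamma> E) points"
  proof (rule inj_onI)
    fix \<gamma> \<delta> assume g: "\<gamma> \<in> points" and d: "\<delta> \<in> points" and eq: "restrict \<gamma> E = restrict \<delta> E"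
    have exp: "\<epsilon> x = finsum K (\<lambda>b. e b x \<otimes>\<^bsub>K\<^esub> \<epsilon> b) E" if \<epsilon>: "\<epsilon> \<in> points" and x: "x \<in> carrier A" for \<epsilon> x
    proof -
      have f: "\<epsilon> \<in> functionals" using \<epsilon> pointD(1) by (simp add: points_def)
      have ad: "additive A K \<epsilon>" by (rule additiveI) (simp_all add: functionalD[OF f])
      have t: "e b x \<odot>\<^bsub>A\<^esub> b \<in> carrier A" if "b \<in> E" for b using functionalD(1)[OF E(3)] E(2) that x by blast
      have "\<epsilon> x = \<epsilon> (finsum A (\<lambda>b. e b x \<odot>\<^bsub>A\<^esub> b) E)" using E(4)[OF x] by simp
      also have "\<dots> = finsum K (\<lambda>b. \<epsilon> (e b x \<odot>\<^bsub>A\<^esub> b)) E"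
        by (rule additive_finsum[OF A.M.abelian_group_axioms K.abelian_group_axioms ad E(1) t])
      also have "\<dots> = finsum K (\<lambda>b. e b x \<otimes>\<^bsub>K\<^esub> \<epsilon> b) E"
      proof (rule K.finsum_cong')
        fix b assume b: "b \<in> E"
        then have "e b x \<in> carrier K" "b \<in> carrier A" using functionalD(1)[OF E(3) x] E(2) by auto
        then show "\<epsilon> (e b x \<odot>\<^bsub>A\<^esub> b) = e b x \<otimes>\<^bsub>K\<^esub> \<epsilon> b" by (rule functionalD(3)[OF f])
      next
        show "(\<lambda>b. e b x \<otimes>\<^bsub>K\<^esub> \<epsilon> b) \<in> E \<rightarrow> carrier K"
          using functionalD(1)[OF E(3) x] functionalD(1)[OF f] E(2) by blast
      qed simp
      finally show ?thesis .
    qed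
    have "\<gamma> x = \<delta> x" if x: "x \<in> carrier A" for x
    proof -
      have gb: "\<gamma> b = \<delta> b" if "b \<in> E" for b using fun_cong[OF eq, of b] that by simp
      have df: "\<delta> \<in> functionals" using d pointD(1) by (simp add: points_def)
      have "finsum K (\<lambda>b. e b x \<otimes>\<^bsub>K\<^esub> \<gamma> b) E = finsum K (\<lambda>b. e b x \<otimes>\<^bsub>K\<^esub> \<delta> b) E"
      proof (rule K.finsum_cong')
        show "(\<lambda>b. e b x \<otimes>\<^bsub>K\<^esub> \<delta> b) \<in> E \<rightarrow> carrier K"
          using functionalD(1)[OF E(3) x] functionalD(1)[OF df] E(2) by blast
      qed (simp_all add: gb)
      then show ?thesis using exp[OF g x] exp[OF d x] by simp
    qed
    then show "\<gamma> = \<delta>" using g d by (intro extensionalityI[of _ "carrier A"]) (auto simp: points_def)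
  qed
  moreover have "finite ((\<lambda>\<gamma>. restrict \<gamma> E) ` points)"
    by (rule finite_subset[OF _ finite_PiE[of E F]]) (use E(1) F in \<open>auto simp: PiE_iff\<close>)
  ultimately show ?thesis by (rule finite_imageD[rotated])
qed

end

section \<open>Invariant elements in positive characteristic\<close>

lemma add_monoid_pow_eq_smult:
  assumes "algebra K M" "x \<in> carrier M"
  shows "[(n::nat)] \<cdot>\<^bsub>M\<^esub> x = ([n] \<cdot>\<^bsub>K\<^esub> \<one>\<^bsub>K\<^esub>) \<odot>\<^bsub>M\<^esub> x"
proof -
  interpret algebra K M by fact
  show ?thesis
  proof (induction n)
    case 0 then show ?case using assms(2) by simp
  next
    case (Suc n)
    have "[Suc n] \<cdot>\<^bsub>M\<^esub> x = [n] \<cdot>\<^bsub>M\<^esub> x \<oplus>\<^bsub>M\<^esub> x" by (rule M.add.nat_pow_Suc)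
    moreover have "[Suc n] \<cdot>\<^bsub>K\<^esub> \<one>\<^bsub>K\<^esub> = [n] \<cdot>\<^bsub>K\<^esub> \<one>\<^bsub>K\<^esub> \<oplus>\<^bsub>K\<^esub> \<one>\<^bsub>K\<^esub>" by (rule R.add.nat_pow_Suc)
    ultimately show ?case using Suc assms(2) by (simp add: smult_l_distr)
  qed
qed

lemma closed_in_Spec:
  assumes "cring R" "closedin (zariski R) Z"
  obtains E where "E \<subseteq> carrier R" "Z = {P \<in> Spec R. E \<subseteq> P}"
proof -
  interpret cring R by fact
  have "\<one>\<^bsub>R\<^esub> \<notin> P" if "P \<in> Spec R" for P
    using that primeideal.one_notin by (auto simp: Spec_def)
  then have "{P \<in> Spec R. \<one>\<^bsub>R\<^esub> \<notin> P} = Spec R" by blast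
  with openin_basic[OF one_closed] have top1: "openin (zariski R) (Spec R)" by simp
  have top: "topspace (zariski R) = Spec R"
  proof
    show "topspace (zariski R) \<subseteq> Spec R"
      using openin_topspace[of "zariski R"] unfolding openin_zariski by blast
    show "Spec R \<subseteq> topspace (zariski R)" by (rule openin_subset[OF top1])
  qed
  have Z: "Z \<subseteq> Spec R" "openin (zariski R) (Spec R - Z)"
    using assms(2) unfolding closedin_def top by auto
  from Z(2) obtain E where E: "E \<subseteq> carrier R" "Spec R - Z = {P \<in> Spec R. \<not> E \<subseteq> P}"
    unfolding openin_zariski by (elim exE conjE)
  have "Z = {P \<in> Spec R. E \<subseteq> P}" using Z(1) E(2) by blast
  then show ?thesis using that E(1) by blast
qed

context action
begin

text \<open>The factors of the orbit product are indexed by the maps and not by the points: that a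
  point permutes the maps follows from \<open>act_inverse\<close> alone, also when different points
  act in the same way.\<close>

definition transformations :: "('s \<Rightarrow> 's) set" where
  "transformations = (\<lambda>\<gamma>. restrict (act \<gamma>) (carrier S)) ` points"

definition orbit_product :: "'s \<Rightarrow> 's" where
  "orbit_product s = finprod S (\<lambda>\<sigma>. \<sigma> s) transformations"

lemma points_homs: "\<gamma> \<in> points \<Longrightarrow> \<gamma> \<in> algebra_homs K A (regular K)"
  by (simp add: points_def)

lemma transformation_closed: "\<sigma> \<in> transformations \<Longrightarrow> s \<in> carrier S \<Longrightarrow> \<sigma> s \<in> carrier S"
  using act_closed pointD(1) points_homs by (auto simp: transformations_def)

lemma compose_transformation:
  assumes \<delta>: "\<delta> \<in> points" and \<sigma>: "\<sigma> \<in> transformations"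
  shows "(\<lambda>s\<in>carrier S. act \<delta> (\<sigma> s)) \<in> transformations"
proof -
  obtain \<gamma> where g: "\<gamma> \<in> points" "\<sigma> = restrict (act \<gamma>) (carrier S)" using \<sigma> by (auto simp: transformations_def)
  note h = points_homs[OF \<delta>] points_homs[OF g(1)]
  note f = pointD(1)[OF h(1)] pointD(1)[OF h(2)]
  let ?c = "restrict (conv \<delta> \<gamma>) (carrier A)"
  have c: "?c \<in> points" by (rule restrict_point[OF conv_point[OF h]])
  have "act \<delta> (\<sigma> s) = act ?c s" if s: "s \<in> carrier S" for s
  proof -
    have "ev (conv \<delta> \<gamma>) (\<rho> s) = ev ?c (\<rho> s)"
      by (rule ev_cong[OF _ conv_functional[OF f] coaction_closed[OF s]]) simp
    then show ?thesis using act_conv[OF f s] s g(2) by simp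
  qed
  then have "(\<lambda>s\<in>carrier S. act \<delta> (\<sigma> s)) = restrict (act ?c) (carrier S)" by (rule restrict_ext)
  then show ?thesis unfolding transformations_def using c by (rule image_eqI)
qed

text \<open>\<open>act \<delta>\<close> is a ring homomorphism, and composing with it is an
  injective self-map of the finite set of transformations, so it only permutes the factors.\<close>

lemma orbit_product_fixed:
  assumes K: "field K" and \<delta>: "\<delta> \<in> points" and s: "s \<in> carrier S"
  shows "act \<delta> (orbit_product s) = orbit_product s"
proof -
  note h = points_homs[OF \<delta>]
  interpret act: ring_hom_cring S S "act \<delta>"
    by (intro ring_hom_cring.intro ring_hom_cring_axioms.intro S.is_cring act_point_ring_hom[OF h])
  have fin: "finite transformations"
    unfolding transformations_def by (rule finite_imageI[OF finite_points[OF K]])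
  let ?L = "\<lambda>\<sigma>. \<lambda>s\<in>carrier S. act \<delta> (\<sigma> s)"
  have inj: "inj_on ?L transformations"
  proof (rule inj_onI)
    fix \<sigma> \<sigma>' assume \<sigma>: "\<sigma> \<in> transformations" "\<sigma>' \<in> transformations" and eq: "?L \<sigma> = ?L \<sigma>'"
    have "\<sigma> t = \<sigma>' t" if t: "t \<in> carrier S" for t
    proof -
      have "act \<delta> (\<sigma> t) = act \<delta> (\<sigma>' t)" using fun_cong[OF eq, of t] t by simp
      then have "act (\<lambda>a. \<delta> (antipode A a)) (act \<delta> (\<sigma> t)) = act (\<lambda>a. \<delta> (antipode A a)) (act \<delta> (\<sigma>' t))"
        by (rule arg_cong)
      then show ?thesis using act_inverse[OF h] transformation_closed[OF \<sigma>(1) t] transformation_closed[OF \<sigma>(2) t]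
        by metis
    qed
    moreover have "\<sigma> \<in> extensional (carrier S)" "\<sigma>' \<in> extensional (carrier S)"
      using \<sigma> by (auto simp: transformations_def)
    ultimately show "\<sigma> = \<sigma>'" by (intro extensionalityI) auto
  qed
  have "?L ` transformations \<subseteq> transformations" using compose_transformation[OF \<delta>] by blast
  then have img: "?L ` transformations = transformations" using endo_inj_surj[OF fin _ inj] by blast
  have cl: "(\<lambda>\<sigma>. \<sigma> s) \<in> transformations \<rightarrow> carrier S" using transformation_closed s by blast
  have "act \<delta> (orbit_product s) = finprod S (act \<delta> \<circ> (\<lambda>\<sigma>. \<sigma> s)) transformations"
    unfolding orbit_product_def using act.hom_finprod[OF cl] by (simp add: comp_def)
  also have "\<dots> = finprod S (\<lambda>\<sigma>. (?L \<sigma>) s) transformations"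
    using s by (simp add: comp_def)
  also have "\<dots> = finprod S (\<lambda>\<sigma>. \<sigma> s) (?L ` transformations)"
    by (rule S.finprod_reindex[symmetric, OF _ inj]) (use cl img in simp)
  also have "\<dots> = orbit_product s" unfolding img orbit_product_def ..
  finally show ?thesis .
qed

text \<open>At every prime of \<open>S \<otimes> A\<close> there is a point \<open>\<gamma>\<close>
  such that the difference is congruent to \<open>ev \<gamma>\<close> of it, tensored with
  \<open>1\<close>; this is \<open>act \<gamma> x - x = 0\<close>. The difference thus lies in every
  prime. It need not vanish, since \<open>A\<close> may have nilpotents.\<close>

lemma fixed_nilpotent:
  assumes alg_closed: "algebraically_closed K" and x: "x \<in> carrier S"
    and fixed: "\<And>\<delta>. \<delta> \<in> points \<Longrightarrow> act \<delta> x = x"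
  shows "\<exists>N::nat. (\<rho> x \<ominus>\<^bsub>tensor K S A\<^esub> SA.\<tau> x \<one>\<^bsub>A\<^esub>) [^]\<^bsub>tensor K S A\<^esub> N = \<zero>\<^bsub>tensor K S A\<^esub>"
proof (rule ccontr)
  let ?SA = "tensor K S A"
  let ?v = "\<rho> x \<ominus>\<^bsub>?SA\<^esub> SA.\<tau> x \<one>\<^bsub>A\<^esub>"
  have xS: "SA.\<tau> x \<one>\<^bsub>A\<^esub> \<in> carrier ?SA" "\<rho> x \<in> carrier ?SA" using x coaction_closed by auto
  then have v: "?v \<in> carrier ?SA" by simp
  assume "\<not> ?thesis"
  then have no: "\<And>k::nat. ?v [^]\<^bsub>?SA\<^esub> k \<notin> {\<zero>\<^bsub>?SA\<^esub>}" by simp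
  obtain Q where Q: "primeideal Q ?SA" "?v \<notin> Q"
    by (rule SA.T.prime_avoiding_powers[OF SA.T.zeroideal v no])
  interpret Q: primeideal Q ?SA by (rule Q)
  obtain \<gamma> where g: "\<gamma> \<in> points" "\<And>w. w \<in> carrier ?SA \<Longrightarrow> w \<ominus>\<^bsub>?SA\<^esub> SA.\<tau> (ev \<gamma> w) \<one>\<^bsub>A\<^esub> \<in> Q"
    using point_at_prime[OF alg_closed Q(1)] by blast
  note f = pointD[OF points_homs[OF g(1)]]
  have "ev \<gamma> ?v = act \<gamma> x \<ominus>\<^bsub>S\<^esub> ev \<gamma> (SA.\<tau> x \<one>\<^bsub>A\<^esub>)"
    by (rule additive_diff[OF SA.abelian_group_tensor S.M.abelian_group_axioms ev_additive[OF f(1)] xS(2,1)])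
  also have "\<dots> = \<zero>\<^bsub>S\<^esub>" using fixed[OF g(1)] x by (simp add: ev_pure f S.M.minus_eq S.M.r_neg)
  finally have "?v \<ominus>\<^bsub>?SA\<^esub> SA.\<tau> \<zero>\<^bsub>S\<^esub> \<one>\<^bsub>A\<^esub> \<in> Q" using g(2)[OF v] by simp
  then have "?v \<in> Q" using v by (simp add: SA.pure_zero_left SA.T.minus_eq)
  then show False using Q by blast
qed

lemma invariants_simps [simp]:
  "monoid.mult (invariants K A S \<rho>) = monoid.mult S" "one (invariants K A S \<rho>) = one S"
  "ring.zero (invariants K A S \<rho>) = ring.zero S" "ring.add (invariants K A S \<rho>) = ring.add S"
  "x \<in> carrier (invariants K A S \<rho>) \<longleftrightarrow> x \<in> carrier S \<and> \<rho> x = SA.\<tau> x \<one>\<^bsub>A\<^esub>"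
  by (simp_all add: invariants_def)

lemma cring_invariants: "cring (invariants K A S \<rho>)"
proof -
  have z: "\<rho> \<zero>\<^bsub>S\<^esub> = SA.\<tau> \<zero>\<^bsub>S\<^esub> \<one>\<^bsub>A\<^esub>"
    using additive_zero[OF S.M.abelian_group_axioms SA.abelian_group_tensor coaction_additive]
    by (simp add: SA.pure_zero_left)
  have inv: "\<exists>y. y \<in> carrier S \<and> \<rho> y = SA.\<tau> y \<one>\<^bsub>A\<^esub> \<and> x \<oplus>\<^bsub>S\<^esub> y = \<zero>\<^bsub>S\<^esub>"
    if "x \<in> carrier S" "\<rho> x = SA.\<tau> x \<one>\<^bsub>A\<^esub>" for x
    using that additive_minus[OF S.M.abelian_group_axioms SA.abelian_group_tensor coaction_additive, of x]
    by (intro exI[of _ "\<ominus>\<^bsub>S\<^esub> x"]) (simp add: SA.pure_minus_left S.M.r_neg)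
  have "abelian_group (invariants K A S \<rho>)"
    by (rule abelian_groupI)
       (auto simp: z inv S.M.a_ac additive_add[OF coaction_additive] SA.pure_add_left Bex_def)
  moreover have "comm_monoid (invariants K A S \<rho>)"
    by (rule comm_monoidI)
       (auto simp: coaction_one SA.one_tensor coaction_mult SA.mult_pure S.m_ac)
  ultimately show ?thesis
    by (rule cringI) (auto simp: S.l_distr)
qed

text \<open>Write \<open>\<rho> x = x \<otimes> 1 + v\<close> with \<open>v\<close> nilpotent. In
  the \<open>p\<close>-th power of a sum the linear term has the coefficient \<open>p = 0\<close>,
  so the error of the next power is a multiple of the square of the previous one. After enough steps
  the error is a multiple of a vanishing power of \<open>v\<close>.\<close>

lemma invariant_power:
  assumes alg_closed: "algebraically_closed K" and p: "0 < (p::nat)" "[p] \<cdot>\<^bsub>K\<^esub> \<one>\<^bsub>K\<^esub> = \<zero>\<^bsub>K\<^esub>" and x: "x \<in> carrier S"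
    and fixed: "\<And>\<delta>. \<delta> \<in> points \<Longrightarrow> act \<delta> x = x"
  shows "\<exists>k::nat. x [^]\<^bsub>S\<^esub> Suc k \<in> carrier (invariants K A S \<rho>)"
proof -
  let ?SA = "tensor K S A"
  let ?i = "\<lambda>x. SA.\<tau> x \<one>\<^bsub>A\<^esub>"
  define v where "v = \<rho> x \<ominus>\<^bsub>?SA\<^esub> ?i x"
  have v: "v \<in> carrier ?SA" using x coaction_closed by (simp add: v_def)
  obtain N where N: "v [^]\<^bsub>?SA\<^esub> (N::nat) = \<zero>\<^bsub>?SA\<^esub>"
    using fixed_nilpotent[OF alg_closed x fixed] unfolding v_def by blast
  interpret coact: ring_hom_cring S ?SA \<rho>
    by (intro ring_hom_cring.intro ring_hom_cring_axioms.intro S.is_cring SA.cring_tensor coaction_ring_hom)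
  interpret i: ring_hom_cring S ?SA ?i
    by (intro ring_hom_cring.intro ring_hom_cring_axioms.intro S.is_cring SA.cring_tensor ring_hom_memI)
       (simp_all add: SA.mult_pure SA.pure_add_left SA.one_tensor)
  have pow: "\<rho> (y [^]\<^bsub>S\<^esub> (m::nat)) = \<rho> y [^]\<^bsub>?SA\<^esub> m" "?i (y [^]\<^bsub>S\<^esub> m) = ?i y [^]\<^bsub>?SA\<^esub> m" if "y \<in> carrier S" for y m
    using that by (induction m) simp_all
  obtain m where m: "p = Suc m" using p(1) gr0_implies_Suc by blast
  have char: "[p] \<cdot>\<^bsub>?SA\<^esub> z = \<zero>\<^bsub>?SA\<^esub>" if z: "z \<in> carrier ?SA" for z
  proof -
    interpret T: algebra K ?SA by (rule SA.algebra_tensor)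
    show ?thesis using add_monoid_pow_eq_smult[OF SA.algebra_tensor z, of p] p(2) z by simp
  qed
  \<comment> \<open>The error of the power \<open>p ^ k\<close> is a multiple of \<open>v\<close> to
    the power \<open>2 ^ k\<close>; the exponent 2 is all that \<open>pow_add_expansion\<close>
    guarantees in each step.\<close>
  have "\<exists>y\<in>carrier ?SA. \<rho> (x [^]\<^bsub>S\<^esub> (p ^ k)) = ?i (x [^]\<^bsub>S\<^esub> (p ^ k)) \<oplus>\<^bsub>?SA\<^esub> v [^]\<^bsub>?SA\<^esub> ((2::nat) ^ k) \<otimes>\<^bsub>?SA\<^esub> y" for k
  proof (induction k)
    case 0
    have ix: "?i x \<in> carrier ?SA" using x by simp
    have "?i x \<oplus>\<^bsub>?SA\<^esub> v = \<rho> x \<oplus>\<^bsub>?SA\<^esub> (?i x \<oplus>\<^bsub>?SA\<^esub> \<ominus>\<^bsub>?SA\<^esub> ?i x)"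
      unfolding v_def SA.T.minus_eq using coaction_closed[OF x] ix by (simp only: SA.T.a_lcomm SA.T.a_inv_closed)
    also have "\<dots> = \<rho> x" using coaction_closed[OF x] ix SA.T.r_neg[OF ix] by simp
    finally show ?case using v x by (intro bexI[of _ "\<one>\<^bsub>?SA\<^esub>"]) simp_all
  next
    case (Suc k)
    let ?x = "x [^]\<^bsub>S\<^esub> (p ^ k)"
    obtain y where y: "y \<in> carrier ?SA" "\<rho> ?x = ?i ?x \<oplus>\<^bsub>?SA\<^esub> v [^]\<^bsub>?SA\<^esub> ((2::nat) ^ k) \<otimes>\<^bsub>?SA\<^esub> y" using Suc by blast
    let ?V = "v [^]\<^bsub>?SA\<^esub> ((2::nat) ^ k)"
    let ?w = "?V \<otimes>\<^bsub>?SA\<^esub> y"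
    have V: "?V \<in> carrier ?SA" using v by simp
    have w: "?w \<in> carrier ?SA" using V y by simp
    have xk: "?x \<in> carrier S" "?i ?x \<in> carrier ?SA" using x by auto
    obtain z where z: "z \<in> carrier ?SA" "(?i ?x \<oplus>\<^bsub>?SA\<^esub> ?w) [^]\<^bsub>?SA\<^esub> Suc m = ?i ?x [^]\<^bsub>?SA\<^esub> Suc m \<oplus>\<^bsub>?SA\<^esub>
        ([Suc m] \<cdot>\<^bsub>?SA\<^esub> (?i ?x [^]\<^bsub>?SA\<^esub> m) \<otimes>\<^bsub>?SA\<^esub> ?w \<oplus>\<^bsub>?SA\<^esub> ?w \<otimes>\<^bsub>?SA\<^esub> ?w \<otimes>\<^bsub>?SA\<^esub> z)"
      using SA.T.pow_add_expansion[OF xk(2) w, of m] by blast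
    have c0: "[Suc m] \<cdot>\<^bsub>?SA\<^esub> (?i ?x [^]\<^bsub>?SA\<^esub> m) = \<zero>\<^bsub>?SA\<^esub>" using char[of "?i ?x [^]\<^bsub>?SA\<^esub> m"] xk m by simp
    have x2: "x [^]\<^bsub>S\<^esub> (p ^ Suc k) = ?x [^]\<^bsub>S\<^esub> Suc m" using x m S.nat_pow_pow[of x "p ^ k" p] by (simp add: mult.commute)
    have V2: "v [^]\<^bsub>?SA\<^esub> ((2::nat) ^ Suc k) = ?V \<otimes>\<^bsub>?SA\<^esub> ?V"
      using v SA.T.nat_pow_mult[of v "2 ^ k" "2 ^ k"] by (simp add: mult_2)
    have "\<rho> (x [^]\<^bsub>S\<^esub> (p ^ Suc k)) = (?i ?x \<oplus>\<^bsub>?SA\<^esub> ?w) [^]\<^bsub>?SA\<^esub> Suc m"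
      unfolding x2 y(2)[symmetric] by (rule pow(1)[OF xk(1)])
    also have "\<dots> = ?i ?x [^]\<^bsub>?SA\<^esub> Suc m \<oplus>\<^bsub>?SA\<^esub> ?w \<otimes>\<^bsub>?SA\<^esub> ?w \<otimes>\<^bsub>?SA\<^esub> z"
      unfolding z(2) c0 using w z(1) by simp
    also have "?i ?x [^]\<^bsub>?SA\<^esub> Suc m = ?i (x [^]\<^bsub>S\<^esub> (p ^ Suc k))"
      unfolding x2 by (rule pow(2)[OF xk(1), symmetric])
    also have "?w \<otimes>\<^bsub>?SA\<^esub> ?w \<otimes>\<^bsub>?SA\<^esub> z = v [^]\<^bsub>?SA\<^esub> ((2::nat) ^ Suc k) \<otimes>\<^bsub>?SA\<^esub> (y \<otimes>\<^bsub>?SA\<^esub> y \<otimes>\<^bsub>?SA\<^esub> z)"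
      unfolding V2 using V y(1) z(1) by (simp add: SA.T.m_ac)
    finally show ?case using y(1) z(1) by blast
  qed
  from this[of N] obtain y where y: "y \<in> carrier ?SA"
    "\<rho> (x [^]\<^bsub>S\<^esub> (p ^ N)) = ?i (x [^]\<^bsub>S\<^esub> (p ^ N)) \<oplus>\<^bsub>?SA\<^esub> v [^]\<^bsub>?SA\<^esub> ((2::nat) ^ N) \<otimes>\<^bsub>?SA\<^esub> y" by blast
  have "v [^]\<^bsub>?SA\<^esub> ((2::nat) ^ N) = v [^]\<^bsub>?SA\<^esub> N \<otimes>\<^bsub>?SA\<^esub> v [^]\<^bsub>?SA\<^esub> ((2::nat) ^ N - N)"
    using v SA.T.nat_pow_mult[of v N "2 ^ N - N"] less_exp[of N] by simp
  then have "v [^]\<^bsub>?SA\<^esub> ((2::nat) ^ N) = \<zero>\<^bsub>?SA\<^esub>" using N v by simp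
  then have "\<rho> (x [^]\<^bsub>S\<^esub> (p ^ N)) = ?i (x [^]\<^bsub>S\<^esub> (p ^ N))" using y x by simp
  then have "x [^]\<^bsub>S\<^esub> (p ^ N) \<in> carrier (invariants K A S \<rho>)" using x by simp
  \<comment> \<open>The exponent has to be positive, so that the power still vanishes wherever
    \<open>x\<close> does.\<close>
  moreover obtain k where "p ^ N = Suc k" using p(1) by (metis gr0_implies_Suc zero_less_power)
  ultimately show ?thesis by metis
qed

text \<open>By stability the translates of \<open>P\<close> under the finitely many points stay
  outside \<open>Z\<close>, so prime avoidance gives \<open>s\<close> vanishing on \<open>Z\<close>
  and at none of the translates. The product of the images of \<open>s\<close> vanishes on
  \<open>Z\<close> because \<open>s\<close> is one of them, and it does not vanish at
  \<open>P\<close> because no factor does. A power of it is invariant.\<close>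

lemma invariant_outside:
  assumes alg_closed: "algebraically_closed K" and p: "0 < (p::nat)" "[p] \<cdot>\<^bsub>K\<^esub> \<one>\<^bsub>K\<^esub> = \<zero>\<^bsub>K\<^esub>"
    and Z: "closedin (zariski S) Z"
    and stable: "\<And>Q. Q \<in> Spec (tensor K S A) \<Longrightarrow> Spec_map S (\<lambda>s. SA.\<tau> s \<one>\<^bsub>A\<^esub>) Q \<in> Spec S - Z \<Longrightarrow> Spec_map S \<rho> Q \<in> Spec S - Z"
    and P: "P \<in> Spec S - Z"
  shows "\<exists>r\<in>carrier (invariants K A S \<rho>). (\<forall>P'\<in>Z. r \<in> P') \<and> r \<notin> P"
proof -
  have K: "field K" using alg_closed by (simp add: algebraically_closed_def)
  obtain E where E: "E \<subseteq> carrier S" "Z = {P \<in> Spec S. E \<subseteq> P}"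
    by (rule closed_in_Spec[OF S.is_cring Z])
  interpret P: primeideal P S using P by (simp add: Spec_def)
  have ZP: "ideal P' S" if "P' \<in> Z" for P' using that E(2) by (simp add: Spec_def primeideal.axioms(1))
  define I where "I = {s \<in> carrier S. \<forall>P'\<in>Z. s \<in> P'}"
  have I: "ideal I S"
  proof (rule S.cring_idealI)
    show "\<zero>\<^bsub>S\<^esub> \<in> I" using ZP by (auto simp: I_def ideal.axioms(1) additive_subgroup.zero_closed)
    show "a \<oplus>\<^bsub>S\<^esub> b \<in> I" if "a \<in> I" "b \<in> I" for a b
      using that ZP by (auto simp: I_def ideal.axioms(1) additive_subgroup.a_closed)
    show "x \<otimes>\<^bsub>S\<^esub> a \<in> I" if "a \<in> I" "x \<in> carrier S" for a x
      using that ZP by (auto simp: I_def ideal.I_l_closed)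
  qed (auto simp: I_def)
  define F where "F = (\<lambda>\<gamma>. Spec_map S (act \<gamma>) P) ` points"
  have finF: "finite F" unfolding F_def by (rule finite_imageI[OF finite_points[OF K]])
  have F: "P' \<in> Spec S - Z" if P': "P' \<in> F" for P'
  proof -
    obtain \<gamma> where g: "\<gamma> \<in> points" "P' = Spec_map S (act \<gamma>) P" using P' by (auto simp: F_def)
    note h = points_homs[OF g(1)]
    note f = pointD[OF h]
    \<comment> \<open>This is the point \<open>(P, \<gamma>)\<close> of
      \<open>Spec (S \<otimes> A)\<close>: its projection is \<open>P\<close> and its image under
      the action is the translate.\<close>
    let ?Q = "Spec_map (tensor K S A) (ev \<gamma>) P"
    have Q: "?Q \<in> Spec (tensor K S A)"
      by (rule Spec_map_Spec[OF SA.cring_tensor S.is_cring ev_point_ring_hom[OF h]]) (use P in simp)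
    have "Spec_map S (\<lambda>s. SA.\<tau> s \<one>\<^bsub>A\<^esub>) ?Q = P"
      using P.Icarr by (auto simp: Spec_map_def ev_pure f)
    then have "Spec_map S \<rho> ?Q \<in> Spec S - Z" using stable[OF Q] P by simp
    moreover have "Spec_map S \<rho> ?Q = P'" unfolding g(2) by (auto simp: Spec_map_def coaction_closed)
    ultimately show ?thesis by simp
  qed
  obtain s where s: "s \<in> I" "\<And>P'. P' \<in> F \<Longrightarrow> s \<notin> P'"
  proof (rule S.prime_avoidance[OF finF I])
    show "primeideal P' S" if "P' \<in> F" for P' using F[OF that] by (simp add: Spec_def)
    show "\<not> I \<subseteq> P'" if "P' \<in> F" for P'
    proof
      assume "I \<subseteq> P'"
      moreover have "E \<subseteq> I" using E by (auto simp: I_def)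
      ultimately show False using F[OF that] E(2) by auto
    qed
  qed blast
  have sS: "s \<in> carrier S" using s by (simp add: I_def)
  let ?x = "orbit_product s"
  have fin: "finite transformations"
    unfolding transformations_def by (rule finite_imageI[OF finite_points[OF K]])
  have "\<sigma> s \<in> carrier S - P" if \<sigma>: "\<sigma> \<in> transformations" for \<sigma>
  proof -
    obtain \<gamma> where g: "\<gamma> \<in> points" "\<sigma> = restrict (act \<gamma>) (carrier S)" using \<sigma> by (auto simp: transformations_def)
    have "Spec_map S (act \<gamma>) P \<in> F" using g(1) by (auto simp: F_def)
    from s(2)[OF this] have "act \<gamma> s \<notin> P" using sS by (simp add: Spec_map_def)
    then show ?thesis using transformation_closed[OF \<sigma> sS] sS g(2) by simp
  qed
  then have xP: "?x \<in> carrier S - P" unfolding orbit_product_def by (intro P.prod_notin fin) blast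
  \<comment> \<open>The counit acts as the identity, so \<open>s\<close> itself is a factor of its
    orbit product.\<close>
  have "restrict (act (restrict (counit A) (carrier A))) (carrier S) \<in> transformations"
    unfolding transformations_def using counit_hom by (intro imageI restrict_point)
  moreover have e: "restrict (act (restrict (counit A) (carrier A))) (carrier S) s = s"
    using sS act_counit[OF sS] ev_cong[of "counit A" "restrict (counit A) (carrier A)" "\<rho> s"] counit_functional coaction_closed[OF sS]
    by simp
  ultimately obtain \<epsilon> where \<epsilon>: "\<epsilon> \<in> transformations" "\<epsilon> s = s" by blast
  have xZ: "?x \<in> P'" if "P' \<in> Z" for P'
    unfolding orbit_product_def
    by (rule ideal.prod_in[OF ZP[OF that] S.is_cring fin _ \<epsilon>(1)]) (use s(1) that \<epsilon>(2) transformation_closed sS in \<open>auto simp: I_def\<close>)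
  obtain k where k: "?x [^]\<^bsub>S\<^esub> Suc k \<in> carrier (invariants K A S \<rho>)"
    using invariant_power[OF alg_closed p _ orbit_product_fixed[OF K _ sS]] xP by blast
  have "?x [^]\<^bsub>S\<^esub> Suc k \<in> carrier S - P" by (rule P.pow_notin[OF xP])
  moreover have "?x [^]\<^bsub>S\<^esub> Suc k \<in> P'" if P': "P' \<in> Z" for P'
    using xP ideal.I_l_closed[OF ZP[OF P'] xZ[OF P'], of "?x [^]\<^bsub>S\<^esub> k"] by simp
  ultimately show ?thesis using k by blast
qed

end

section \<open>The dual Hopf algebra\<close>

lemma additive_sum:
  assumes "abelian_group V" "finite I" "\<And>i. i \<in> I \<Longrightarrow> additive U V (f i)"
  shows "additive U V (\<lambda>z. finsum V (\<lambda>i. f i z) I)"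
proof -
  interpret V: abelian_group V by fact
  show ?thesis
  proof (rule additiveI)
    show "finsum V (\<lambda>i. f i z) I \<in> carrier V" if "z \<in> carrier U" for z
      using additive_closed[OF assms(3)] that by (intro V.finsum_closed) blast
    show "finsum V (\<lambda>i. f i (z \<oplus>\<^bsub>U\<^esub> w)) I = finsum V (\<lambda>i. f i z) I \<oplus>\<^bsub>V\<^esub> finsum V (\<lambda>i. f i w) I"
      if zw: "z \<in> carrier U" "w \<in> carrier U" for z w
    proof -
      have c: "(\<lambda>i. f i z) \<in> I \<rightarrow> carrier V" "(\<lambda>i. f i w) \<in> I \<rightarrow> carrier V"
        using additive_closed[OF assms(3)] zw by blast+
      have "finsum V (\<lambda>i. f i (z \<oplus>\<^bsub>U\<^esub> w)) I = finsum V (\<lambda>i. f i z \<oplus>\<^bsub>V\<^esub> f i w) I"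
        by (rule V.finsum_cong') (use additive_add[OF assms(3)] zw c in \<open>auto simp: Pi_iff\<close>)
      then show ?thesis using V.finsum_addf[OF c] by simp
    qed
  qed
qed

lemma balanced_sum:
  assumes "abelian_group V" "finite I" and b: "\<And>i. i \<in> I \<Longrightarrow> balanced R M N V (f i)"
    and closed: "\<And>r y. r \<in> carrier R \<Longrightarrow> y \<in> carrier N \<Longrightarrow> r \<odot>\<^bsub>N\<^esub> y \<in> carrier N"
  shows "balanced R M N V (\<lambda>x y. finsum V (\<lambda>i. f i x y) I)"
proof -
  interpret V: abelian_group V by fact
  have cl: "f i x y \<in> carrier V" if "i \<in> I" "x \<in> carrier M" "y \<in> carrier N" for i x y
    using b[OF that(1)] that by (simp add: balanced_def)
  show ?thesis
  proof (rule balancedI)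
    show "finsum V (\<lambda>i. f i x y) I \<in> carrier V" if "x \<in> carrier M" "y \<in> carrier N" for x y
      by (rule V.finsum_closed) (use cl that in blast)
    show "finsum V (\<lambda>i. f i (x \<oplus>\<^bsub>M\<^esub> x') y) I = finsum V (\<lambda>i. f i x y) I \<oplus>\<^bsub>V\<^esub> finsum V (\<lambda>i. f i x' y) I"
      if "x \<in> carrier M" "x' \<in> carrier M" "y \<in> carrier N" for x x' y
    proof -
      have "finsum V (\<lambda>i. f i (x \<oplus>\<^bsub>M\<^esub> x') y) I = finsum V (\<lambda>i. f i x y \<oplus>\<^bsub>V\<^esub> f i x' y) I"
        by (rule V.finsum_cong') (use b cl that in \<open>auto simp: balanced_def\<close>)
      then show ?thesis using cl that by (simp add: V.finsum_addf Pi_iff)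
    qed
    show "finsum V (\<lambda>i. f i x (y \<oplus>\<^bsub>N\<^esub> y')) I = finsum V (\<lambda>i. f i x y) I \<oplus>\<^bsub>V\<^esub> finsum V (\<lambda>i. f i x y') I"
      if "x \<in> carrier M" "y \<in> carrier N" "y' \<in> carrier N" for x y y'
    proof -
      have "finsum V (\<lambda>i. f i x (y \<oplus>\<^bsub>N\<^esub> y')) I = finsum V (\<lambda>i. f i x y \<oplus>\<^bsub>V\<^esub> f i x y') I"
        by (rule V.finsum_cong') (use b cl that in \<open>auto simp: balanced_def\<close>)
      then show ?thesis using cl that by (simp add: V.finsum_addf Pi_iff)
    qed
    show "finsum V (\<lambda>i. f i (r \<odot>\<^bsub>M\<^esub> x) y) I = finsum V (\<lambda>i. f i x (r \<odot>\<^bsub>N\<^esub> y)) I"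
      if rxy: "r \<in> carrier R" "x \<in> carrier M" "y \<in> carrier N" for r x y
      by (rule V.finsum_cong') (use b cl closed rxy in \<open>auto simp: balanced_def\<close>)
  qed
qed

context action
begin

abbreviation "D \<equiv> dual_algebra K A"
abbreviation "H \<equiv> dual_hopf K A"

lemma dual_algebra_simps:
  "carrier D = functionals \<inter> extensional (carrier A)"
  "\<zero>\<^bsub>D\<^esub> = (\<lambda>a\<in>carrier A. \<zero>\<^bsub>K\<^esub>)"
  "h \<oplus>\<^bsub>D\<^esub> g = (\<lambda>a\<in>carrier A. h a \<oplus>\<^bsub>K\<^esub> g a)"
  "r \<odot>\<^bsub>D\<^esub> h = (\<lambda>a\<in>carrier A. r \<otimes>\<^bsub>K\<^esub> h a)"
  by (simp_all add: dual_algebra_def)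

lemma dual_hopf_simps:
  "carrier H = carrier D" "\<zero>\<^bsub>H\<^esub> = \<zero>\<^bsub>D\<^esub>" "ring.add H = ring.add D" "smult H = smult D"
  "h \<otimes>\<^bsub>H\<^esub> g = restrict (conv h g) (carrier A)"
  "\<one>\<^bsub>H\<^esub> = restrict (counit A) (carrier A)"
  "comult H h = (THE z. z \<in> carrier (tensor K D D) \<and>
     (\<forall>a\<in>carrier A. \<forall>b\<in>carrier A. tensor_lift (add_monoid K) (\<lambda>f g. f a \<otimes>\<^bsub>K\<^esub> g b) z = h (a \<otimes>\<^bsub>A\<^esub> b)))"
  by (simp_all add: dual_hopf_def dual_algebra_def module.extend_def hopf.defs)

lemma dual_apply:
  "a \<in> carrier A \<Longrightarrow> (h \<oplus>\<^bsub>D\<^esub> g) a = h a \<oplus>\<^bsub>K\<^esub> g a"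
  "a \<in> carrier A \<Longrightarrow> (r \<odot>\<^bsub>D\<^esub> h) a = r \<otimes>\<^bsub>K\<^esub> h a"
  "a \<in> carrier A \<Longrightarrow> \<zero>\<^bsub>D\<^esub> a = \<zero>\<^bsub>K\<^esub>"
  by (simp_all add: dual_algebra_simps)

lemma dual_functional: "h \<in> carrier D \<Longrightarrow> h \<in> functionals"
  by (simp add: dual_algebra_simps)

lemma dual_restrict: "h \<in> functionals \<Longrightarrow> restrict h (carrier A) \<in> carrier D"
  unfolding dual_algebra_simps by (intro IntI functionalI) (auto simp: functionalD)

lemma dual_eqI: "h \<in> carrier D \<Longrightarrow> g \<in> carrier D \<Longrightarrow> (\<And>a. a \<in> carrier A \<Longrightarrow> h a = g a) \<Longrightarrow> h = g"
  unfolding dual_algebra_simps by (blast intro: extensionalityI)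

lemma dual_add_closed: "h \<in> carrier D \<Longrightarrow> g \<in> carrier D \<Longrightarrow> h \<oplus>\<^bsub>D\<^esub> g \<in> carrier D"
  unfolding dual_algebra_simps
  by (intro IntI functionalI) (auto simp: functionalD K.a_ac K.r_distr)

lemma dual_smult_closed: "r \<in> carrier K \<Longrightarrow> h \<in> carrier D \<Longrightarrow> r \<odot>\<^bsub>D\<^esub> h \<in> carrier D"
  unfolding dual_algebra_simps
  by (intro IntI functionalI) (auto simp: functionalD K.r_distr K.m_lcomm)

lemma dual_zero_closed: "\<zero>\<^bsub>D\<^esub> \<in> carrier D"
  unfolding dual_algebra_simps by (intro IntI functionalI) auto

lemma abelian_group_D: "abelian_group D"
proof (rule abelian_groupI)
  show "\<zero>\<^bsub>D\<^esub> \<in> carrier D" by (rule dual_zero_closed)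
next
  fix x y z assume x: "x \<in> carrier D"
  note fx = functionalD[OF dual_functional[OF x]]
  show "\<zero>\<^bsub>D\<^esub> \<oplus>\<^bsub>D\<^esub> x = x"
    by (rule dual_eqI) (simp_all add: x dual_add_closed dual_zero_closed dual_apply fx)
  have "\<ominus>\<^bsub>K\<^esub> \<one>\<^bsub>K\<^esub> \<odot>\<^bsub>D\<^esub> x \<oplus>\<^bsub>D\<^esub> x = \<zero>\<^bsub>D\<^esub>"
    by (rule dual_eqI)
       (simp_all add: x dual_add_closed dual_smult_closed dual_zero_closed dual_apply fx K.l_minus K.l_neg)
  then show "\<exists>y\<in>carrier D. y \<oplus>\<^bsub>D\<^esub> x = \<zero>\<^bsub>D\<^esub>"
    using dual_smult_closed[OF _ x, of "\<ominus>\<^bsub>K\<^esub> \<one>\<^bsub>K\<^esub>"] by blast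
  assume y: "y \<in> carrier D"
  note fy = functionalD[OF dual_functional[OF y]]
  show "x \<oplus>\<^bsub>D\<^esub> y \<in> carrier D" by (rule dual_add_closed[OF x y])
  show "x \<oplus>\<^bsub>D\<^esub> y = y \<oplus>\<^bsub>D\<^esub> x"
    by (rule dual_eqI) (simp_all add: x y dual_add_closed dual_apply fx fy K.a_comm)
  assume z: "z \<in> carrier D"
  note fz = functionalD[OF dual_functional[OF z]]
  show "x \<oplus>\<^bsub>D\<^esub> y \<oplus>\<^bsub>D\<^esub> z = x \<oplus>\<^bsub>D\<^esub> (y \<oplus>\<^bsub>D\<^esub> z)"
    by (rule dual_eqI) (simp_all add: x y z dual_add_closed dual_apply fx fy fz K.a_assoc)
qed

lemma abelian_group_H: "abelian_group H"
proof -
  interpret D: abelian_group D by (rule abelian_group_D)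
  show ?thesis
    by (rule abelian_groupI) (simp_all add: dual_hopf_simps D.a_ac D.add.l_inv_ex[simplified])
qed

end

sublocale action \<subseteq> DD: tensor_pair K "dual_algebra K A" "dual_algebra K A"
  by (rule tensor_pair.intro) (simp_all add: abelian_group_D dual_smult_closed)

sublocale action \<subseteq> SH: tensor_pair K S "dual_hopf K A"
  by (rule tensor_pair.intro)
     (simp_all add: S.M.abelian_group_axioms abelian_group_H dual_hopf_simps dual_smult_closed)

section \<open>Comultiplication of the dual in terms of a dual basis\<close>

locale dual_action = action K A S \<rho>
  for K :: "('k, 'c) ring_scheme" and A :: "('k, 'a) hopf" and S :: "('k, 's) module" and \<rho> +
  fixes E :: "'a set" and e :: "'a \<Rightarrow> 'a \<Rightarrow> 'k"
  assumes finite_E: "finite E" and E_sub: "E \<subseteq> carrier A"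
    and e_dual: "\<And>b. b \<in> E \<Longrightarrow> e b \<in> carrier (dual_algebra K A)"
    and expansion: "\<And>a. a \<in> carrier A \<Longrightarrow> a = finsum A (\<lambda>b. e b a \<odot>\<^bsub>A\<^esub> b) E"
begin

lemma E_closed: "b \<in> E \<Longrightarrow> b \<in> carrier A"
  using E_sub by blast

lemma e_functional: "b \<in> E \<Longrightarrow> e b \<in> functionals"
  by (rule dual_functional[OF e_dual])

lemma e_closed: "b \<in> E \<Longrightarrow> a \<in> carrier A \<Longrightarrow> e b a \<in> carrier K"
  by (rule functionalD(1)[OF e_functional])

lemma functional_expansion:
  assumes h: "h \<in> functionals" and a: "a \<in> carrier A"
  shows "h a = finsum K (\<lambda>b. e b a \<otimes>\<^bsub>K\<^esub> h b) E"
proof -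
  have ad: "additive A K h" by (rule additiveI) (simp_all add: functionalD[OF h])
  have "h a = h (finsum A (\<lambda>b. e b a \<odot>\<^bsub>A\<^esub> b) E)" using expansion[OF a] by simp
  also have "\<dots> = finsum K (\<lambda>b. h (e b a \<odot>\<^bsub>A\<^esub> b)) E"
    by (rule additive_finsum[OF A.M.abelian_group_axioms K.abelian_group_axioms ad finite_E])
       (simp add: e_closed[OF _ a] E_closed)
  also have "\<dots> = finsum K (\<lambda>b. e b a \<otimes>\<^bsub>K\<^esub> h b) E"
    by (rule K.finsum_cong') (simp_all add: functionalD[OF h] e_closed[OF _ a] E_closed)
  finally show ?thesis .
qed

lemma dual_expansion:
  assumes h: "h \<in> carrier D"
  shows "h = finsum D (\<lambda>b. h b \<odot>\<^bsub>D\<^esub> e b) E"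
proof -
  interpret D: abelian_group D by (rule abelian_group_D)
  note hf = dual_functional[OF h]
  have t: "h b \<odot>\<^bsub>D\<^esub> e b \<in> carrier D" if "b \<in> E" for b
    using that by (simp add: dual_smult_closed functionalD(1)[OF hf] E_closed e_dual)
  have s: "finsum D (\<lambda>b. h b \<odot>\<^bsub>D\<^esub> e b) E \<in> carrier D"
    by (rule D.finsum_closed) (use t in blast)
  show ?thesis
  proof (rule dual_eqI[OF h s])
    fix a assume a: "a \<in> carrier A"
    have ad: "additive D K (\<lambda>h. h a)"
      by (rule additiveI) (simp_all add: a dual_apply functionalD(1)[OF dual_functional])
    have "(finsum D (\<lambda>b. h b \<odot>\<^bsub>D\<^esub> e b) E) a = finsum K (\<lambda>b. (h b \<odot>\<^bsub>D\<^esub> e b) a) E"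
      by (rule additive_finsum[OF abelian_group_D K.abelian_group_axioms ad finite_E t])
    also have "\<dots> = finsum K (\<lambda>b. e b a \<otimes>\<^bsub>K\<^esub> h b) E"
      by (rule K.finsum_cong')
         (simp_all add: a dual_apply K.m_comm functionalD(1)[OF hf] e_closed[OF _ a] E_closed)
    finally show "h a = (finsum D (\<lambda>b. h b \<odot>\<^bsub>D\<^esub> e b) E) a" using functional_expansion[OF hf a] by simp
  qed
qed

text \<open>These functionals are the second factors of the explicit comultiplication, the sum of
  the \<open>e b \<otimes> h (b -)\<close> over the basis.\<close>

definition translate :: "('a \<Rightarrow> 'k) \<Rightarrow> 'a \<Rightarrow> 'a \<Rightarrow> 'k" where
  "translate h b = (\<lambda>a\<in>carrier A. h (b \<otimes>\<^bsub>A\<^esub> a))"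

lemma translate_closed: "h \<in> functionals \<Longrightarrow> b \<in> carrier A \<Longrightarrow> translate h b \<in> carrier D"
  unfolding translate_def
  by (intro dual_restrict functionalI) (simp_all add: functionalD A.r_distr A.smult_assoc2')

abbreviation "double_pairing a b \<equiv> tensor_lift (add_monoid K) (\<lambda>f g. f a \<otimes>\<^bsub>K\<^esub> g b)"

lemma double_pairing_balanced: "a \<in> carrier A \<Longrightarrow> b \<in> carrier A \<Longrightarrow> balanced K D D K (\<lambda>f g. f a \<otimes>\<^bsub>K\<^esub> g b)"
  by (rule balancedI)
     (simp_all add: functionalD(1)[OF dual_functional] dual_apply K.l_distr K.r_distr K.m_ac)

lemmas double_pairing_pure = DD.lift_pure[OF K.abelian_group_axioms double_pairing_balanced]
lemmas double_pairing_additive = DD.lift_additive[OF K.abelian_group_axioms double_pairing_balanced]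

lemma double_pairing_functional:
  assumes a: "a \<in> carrier A" and z: "z \<in> carrier (tensor K D D)"
  shows "(\<lambda>b. double_pairing a b z) \<in> functionals"
proof (rule functionalI)
  show "double_pairing a b z \<in> carrier K" if "b \<in> carrier A" for b
    using additive_closed[OF double_pairing_additive[OF a that] z] .
  show "double_pairing a (b \<oplus>\<^bsub>A\<^esub> c) z = double_pairing a b z \<oplus>\<^bsub>K\<^esub> double_pairing a c z" if "b \<in> carrier A" "c \<in> carrier A" for b c
    by (rule DD.additive_eqI[OF _ _ _ z])
       (use that a in \<open>auto intro!: additive_plus double_pairing_additive K.abelian_group_axioms
         simp: double_pairing_pure functionalD[OF dual_functional] K.r_distr\<close>)
  show "double_pairing a (r \<odot>\<^bsub>A\<^esub> b) z = r \<otimes>\<^bsub>K\<^esub> double_pairing a b z" if "r \<in> carrier K" "b \<in> carrier A" for r b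
    by (rule DD.additive_eqI[OF _ _ _ z])
       (use that a in \<open>auto intro!: additive_comp[OF double_pairing_additive smult_K_additive] double_pairing_additive
         simp: double_pairing_pure functionalD[OF dual_functional] K.m_lcomm\<close>)
qed

text \<open>Consequently an element of the tensor square of the dual is determined by its values on
  pairs of elements of \<open>A\<close>. This is the uniqueness behind the comultiplication of the
  dual.\<close>

lemma DD_expansion:
  assumes z: "z \<in> carrier (tensor K D D)"
  shows "z = finsum (tensor K D D) (\<lambda>b. DD.\<tau> (e b) (\<lambda>c\<in>carrier A. double_pairing b c z)) E"
proof (rule DD.additive_eqI[OF additive_id _ _ z])
  interpret D: abelian_group D by (rule abelian_group_D)
  have cl: "(\<lambda>c\<in>carrier A. double_pairing b c z) \<in> carrier D" if "b \<in> carrier A" "z \<in> carrier (tensor K D D)" for b z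
    using dual_restrict[OF double_pairing_functional[OF that]] .
  have "additive (tensor K D D) (tensor K D D) (\<lambda>z. DD.\<tau> (e b) (\<lambda>c\<in>carrier A. double_pairing b c z))" if b: "b \<in> E" for b
  proof (rule additiveI)
    show "DD.\<tau> (e b) (\<lambda>c\<in>carrier A. double_pairing b c z) \<in> carrier (tensor K D D)" if "z \<in> carrier (tensor K D D)" for z
      using cl[OF E_closed[OF b] that] e_dual[OF b] by simp
    fix z w assume zw: "z \<in> carrier (tensor K D D)" "w \<in> carrier (tensor K D D)"
    have "(\<lambda>c\<in>carrier A. double_pairing b c (z \<oplus>\<^bsub>tensor K D D\<^esub> w)) = (\<lambda>c\<in>carrier A. double_pairing b c z) \<oplus>\<^bsub>D\<^esub> (\<lambda>c\<in>carrier A. double_pairing b c w)"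
      by (rule dual_eqI)
         (use zw b E_closed in \<open>simp_all add: cl dual_apply dual_add_closed additive_add[OF double_pairing_additive] del: restrict_apply\<close>, simp add: additive_add[OF double_pairing_additive])
    then show "DD.\<tau> (e b) (\<lambda>c\<in>carrier A. double_pairing b c (z \<oplus>\<^bsub>tensor K D D\<^esub> w)) =
        DD.\<tau> (e b) (\<lambda>c\<in>carrier A. double_pairing b c z) \<oplus>\<^bsub>tensor K D D\<^esub> DD.\<tau> (e b) (\<lambda>c\<in>carrier A. double_pairing b c w)"
      using DD.pure_add_right[OF e_dual[OF b] cl[OF E_closed[OF b] zw(1)] cl[OF E_closed[OF b] zw(2)]] by simp
  qed
  then show "additive (tensor K D D) (tensor K D D) (\<lambda>z. finsum (tensor K D D) (\<lambda>b. DD.\<tau> (e b) (\<lambda>c\<in>carrier A. double_pairing b c z)) E)"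
    by (intro additive_sum DD.T.abelian_group_axioms finite_E)
  fix f g assume fg: "f \<in> carrier D" "g \<in> carrier D"
  note ff = functionalD(1)[OF dual_functional[OF fg(1)]]
  have ad: "additive D (tensor K D D) (\<lambda>f. DD.\<tau> f g)"
    by (rule additiveI) (use fg in \<open>simp_all add: DD.pure_add_left\<close>)
  have t: "f b \<odot>\<^bsub>D\<^esub> e b \<in> carrier D" if "b \<in> E" for b
    using that by (simp add: dual_smult_closed ff E_closed e_dual)
  have "DD.\<tau> f g = DD.\<tau> (finsum D (\<lambda>b. f b \<odot>\<^bsub>D\<^esub> e b) E) g" using dual_expansion[OF fg(1)] by simp
  also have "\<dots> = finsum (tensor K D D) (\<lambda>b. DD.\<tau> (f b \<odot>\<^bsub>D\<^esub> e b) g) E"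
    by (rule additive_finsum[OF abelian_group_D DD.T.abelian_group_axioms ad finite_E t])
  also have "\<dots> = finsum (tensor K D D) (\<lambda>b. DD.\<tau> (e b) (\<lambda>c\<in>carrier A. double_pairing b c (DD.\<tau> f g))) E"
  proof (rule DD.T.finsum_cong')
    fix b assume b: "b \<in> E"
    have "(\<lambda>c\<in>carrier A. double_pairing b c (DD.\<tau> f g)) = f b \<odot>\<^bsub>D\<^esub> g"
      unfolding dual_algebra_simps(4) by (rule restrict_ext) (simp add: double_pairing_pure fg E_closed[OF b])
    then show "DD.\<tau> (f b \<odot>\<^bsub>D\<^esub> e b) g = DD.\<tau> (e b) (\<lambda>c\<in>carrier A. double_pairing b c (DD.\<tau> f g))"
      using DD.pure_smult[OF ff[OF E_closed[OF b]] e_dual[OF b] fg(2)] by simp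
  next
    show "(\<lambda>b. DD.\<tau> (e b) (\<lambda>c\<in>carrier A. double_pairing b c (DD.\<tau> f g))) \<in> E \<rightarrow> carrier (tensor K D D)"
      using cl[OF E_closed] e_dual fg by blast
  qed simp
  finally show "DD.\<tau> f g = finsum (tensor K D D) (\<lambda>b. DD.\<tau> (e b) (\<lambda>c\<in>carrier A. double_pairing b c (DD.\<tau> f g))) E" .
qed

text \<open>The definite description is replaced by a finite sum. The sum has the required pairings
  by expanding the functional \<open>h (- c)\<close> along the basis, and
  \<open>DD_expansion\<close> shows that nothing else has them.\<close>

lemma comult_dual:
  assumes h: "h \<in> functionals"
  shows "comult H h = finsum (tensor K D D) (\<lambda>b. DD.\<tau> (e b) (translate h b)) E"
  unfolding dual_hopf_simps
proof (rule the_equality)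
  let ?z = "finsum (tensor K D D) (\<lambda>b. DD.\<tau> (e b) (translate h b)) E"
  have t: "DD.\<tau> (e b) (translate h b) \<in> carrier (tensor K D D)" if "b \<in> E" for b
    using that by (simp add: e_dual translate_closed h E_closed)
  have z: "?z \<in> carrier (tensor K D D)" by (rule DD.T.finsum_closed) (use t in blast)
  have "double_pairing a c ?z = h (a \<otimes>\<^bsub>A\<^esub> c)" if ac: "a \<in> carrier A" "c \<in> carrier A" for a c
  proof -
    have hc: "(\<lambda>b. h (b \<otimes>\<^bsub>A\<^esub> c)) \<in> functionals"
      by (rule functionalI) (use ac in \<open>simp_all add: functionalD[OF h] A.l_distr A.smult_assoc2\<close>)
    have "double_pairing a c ?z = finsum K (\<lambda>b. double_pairing a c (DD.\<tau> (e b) (translate h b))) E"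
      by (rule additive_finsum[OF DD.T.abelian_group_axioms K.abelian_group_axioms double_pairing_additive[OF ac] finite_E t])
    also have "\<dots> = finsum K (\<lambda>b. e b a \<otimes>\<^bsub>K\<^esub> h (b \<otimes>\<^bsub>A\<^esub> c)) E"
    proof (rule K.finsum_cong')
      fix b assume b: "b \<in> E"
      show "double_pairing a c (DD.\<tau> (e b) (translate h b)) = e b a \<otimes>\<^bsub>K\<^esub> h (b \<otimes>\<^bsub>A\<^esub> c)"
        using double_pairing_pure[OF ac e_dual[OF b] translate_closed[OF h E_closed[OF b]]] ac by (simp add: translate_def)
    qed (use ac in \<open>simp_all add: e_closed functionalD(1)[OF h] E_closed\<close>)
    also have "\<dots> = h (a \<otimes>\<^bsub>A\<^esub> c)" using functional_expansion[OF hc ac(1)] by simp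
    finally show ?thesis .
  qed
  then show "?z \<in> carrier (tensor K D D) \<and> (\<forall>a\<in>carrier A. \<forall>b\<in>carrier A. double_pairing a b ?z = h (a \<otimes>\<^bsub>A\<^esub> b))"
    using z by blast
  fix w assume w: "w \<in> carrier (tensor K D D) \<and> (\<forall>a\<in>carrier A. \<forall>b\<in>carrier A. double_pairing a b w = h (a \<otimes>\<^bsub>A\<^esub> b))"
  have "w = finsum (tensor K D D) (\<lambda>b. DD.\<tau> (e b) (\<lambda>c\<in>carrier A. double_pairing b c w)) E" using DD_expansion w by blast
  also have "\<dots> = ?z"
  proof (rule DD.T.finsum_cong')
    fix b assume b: "b \<in> E"
    have "(\<lambda>c\<in>carrier A. double_pairing b c w) = translate h b"
      unfolding translate_def by (rule restrict_ext) (use w E_closed[OF b] in blast)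
    then show "DD.\<tau> (e b) (\<lambda>c\<in>carrier A. double_pairing b c w) = DD.\<tau> (e b) (translate h b)" by simp
  qed (use t in auto)
  finally show "w = ?z" .
qed

text \<open>Applied to \<open>\<rho> s\<close> and \<open>\<rho> t\<close> this is the law
  \<open>h \<cdot> (s t) = \<Sum> (h1 \<cdot> s) (h2 \<cdot> t)\<close> of a module algebra, with
  the comultiplication written out. On pure tensors it is the expansion of the functional
  \<open>h (- c)\<close>.\<close>

lemma act_mult:
  assumes h: "h \<in> functionals" and z: "z \<in> carrier (tensor K S A)" and w: "w \<in> carrier (tensor K S A)"
  shows "ev h (z \<otimes>\<^bsub>tensor K S A\<^esub> w) = finsum S (\<lambda>b. ev (e b) z \<otimes>\<^bsub>S\<^esub> ev (translate h b) w) E"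
proof -
  let ?SA = "tensor K S A"
  have tr: "translate h b \<in> functionals" if "b \<in> E" for b
    using translate_closed[OF h E_closed[OF that]] by (rule dual_functional)
  have mS: "additive S S (\<lambda>x. x \<otimes>\<^bsub>S\<^esub> y)" if "y \<in> carrier S" for y
    by (rule additiveI) (use that in \<open>simp_all add: S.l_distr\<close>)
  have mS': "additive S S (\<lambda>x. y \<otimes>\<^bsub>S\<^esub> x)" if "y \<in> carrier S" for y
    by (rule additiveI) (use that in \<open>simp_all add: S.r_distr\<close>)
  have 0: "ev h (SA.\<tau> s a \<otimes>\<^bsub>?SA\<^esub> SA.\<tau> t c) = finsum S (\<lambda>b. ev (e b) (SA.\<tau> s a) \<otimes>\<^bsub>S\<^esub> ev (translate h b) (SA.\<tau> t c)) E"
    if "s \<in> carrier S" "a \<in> carrier A" "t \<in> carrier S" "c \<in> carrier A" for s a t c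
  proof -
    have hc: "(\<lambda>b. h (b \<otimes>\<^bsub>A\<^esub> c)) \<in> functionals"
      by (rule functionalI) (use that in \<open>simp_all add: functionalD[OF h] A.l_distr A.smult_assoc2\<close>)
    have ad: "additive K S (\<lambda>r. r \<odot>\<^bsub>S\<^esub> (s \<otimes>\<^bsub>S\<^esub> t))"
      by (rule additiveI) (use that in \<open>simp_all add: S.smult_l_distr\<close>)
    have cl: "e b a \<otimes>\<^bsub>K\<^esub> h (b \<otimes>\<^bsub>A\<^esub> c) \<in> carrier K" if "b \<in> E" for b
      using that \<open>a \<in> carrier A\<close> \<open>c \<in> carrier A\<close> by (simp add: e_closed functionalD(1)[OF h] E_closed)
    have "ev h (SA.\<tau> s a \<otimes>\<^bsub>?SA\<^esub> SA.\<tau> t c) = h (a \<otimes>\<^bsub>A\<^esub> c) \<odot>\<^bsub>S\<^esub> (s \<otimes>\<^bsub>S\<^esub> t)"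
      using that by (simp add: SA.mult_pure ev_pure[OF h])
    also have "\<dots> = finsum K (\<lambda>b. e b a \<otimes>\<^bsub>K\<^esub> h (b \<otimes>\<^bsub>A\<^esub> c)) E \<odot>\<^bsub>S\<^esub> (s \<otimes>\<^bsub>S\<^esub> t)"
      using functional_expansion[OF hc that(2)] by simp
    also have "\<dots> = finsum S (\<lambda>b. (e b a \<otimes>\<^bsub>K\<^esub> h (b \<otimes>\<^bsub>A\<^esub> c)) \<odot>\<^bsub>S\<^esub> (s \<otimes>\<^bsub>S\<^esub> t)) E"
      by (rule additive_finsum[OF K.abelian_group_axioms S.M.abelian_group_axioms ad finite_E cl])
    also have "\<dots> = finsum S (\<lambda>b. ev (e b) (SA.\<tau> s a) \<otimes>\<^bsub>S\<^esub> ev (translate h b) (SA.\<tau> t c)) E"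
    proof (rule S.finsum_cong')
      fix b assume b: "b \<in> E"
      have k: "e b a \<in> carrier K" "h (b \<otimes>\<^bsub>A\<^esub> c) \<in> carrier K"
        using that b by (simp_all add: e_closed functionalD(1)[OF h] E_closed)
      have "ev (e b) (SA.\<tau> s a) \<otimes>\<^bsub>S\<^esub> ev (translate h b) (SA.\<tau> t c) = (e b a \<odot>\<^bsub>S\<^esub> s) \<otimes>\<^bsub>S\<^esub> (h (b \<otimes>\<^bsub>A\<^esub> c) \<odot>\<^bsub>S\<^esub> t)"
        using that ev_pure[OF e_functional[OF b] that(1,2)] ev_pure[OF tr[OF b] that(3,4)]
        by (simp only: translate_def restrict_apply if_True)
      also have "\<dots> = (e b a \<otimes>\<^bsub>K\<^esub> h (b \<otimes>\<^bsub>A\<^esub> c)) \<odot>\<^bsub>S\<^esub> (s \<otimes>\<^bsub>S\<^esub> t)"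
        using that k by (simp add: S.smult_assoc2 S.smult_assoc2' S.smult_assoc1[symmetric] K.m_comm)
      finally show "(e b a \<otimes>\<^bsub>K\<^esub> h (b \<otimes>\<^bsub>A\<^esub> c)) \<odot>\<^bsub>S\<^esub> (s \<otimes>\<^bsub>S\<^esub> t) = ev (e b) (SA.\<tau> s a) \<otimes>\<^bsub>S\<^esub> ev (translate h b) (SA.\<tau> t c)" by simp
    next
      show "(\<lambda>b. ev (e b) (SA.\<tau> s a) \<otimes>\<^bsub>S\<^esub> ev (translate h b) (SA.\<tau> t c)) \<in> E \<rightarrow> carrier S"
        using SA.pure_closed[OF that(1,2)] SA.pure_closed[OF that(3,4)]
        by (simp add: ev_closed[OF e_functional] ev_closed[OF tr])
    qed simp
    finally show ?thesis .
  qed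
  have 1: "ev h (SA.\<tau> s a \<otimes>\<^bsub>?SA\<^esub> w) = finsum S (\<lambda>b. ev (e b) (SA.\<tau> s a) \<otimes>\<^bsub>S\<^esub> ev (translate h b) w) E"
    if "s \<in> carrier S" "a \<in> carrier A" for s a
    by (rule SA.additive_eqI[OF _ _ _ w])
       (use that h tr e_functional finite_E in \<open>auto intro!: additive_sum S.M.abelian_group_axioms
          additive_comp[OF ev_additive mS'] additive_comp[OF SA.mult_additive_right ev_additive] ev_closed simp: 0\<close>)
  show ?thesis
    by (rule SA.additive_eqI[OF _ _ _ z])
       (use w h tr e_functional finite_E in \<open>auto intro!: additive_sum S.M.abelian_group_axioms
          additive_comp[OF ev_additive mS] additive_comp[OF SA.mult_additive_left ev_additive] ev_closed simp: 1\<close>)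
qed

end

section \<open>The skew group scheme ring\<close>

lemma End_algebra_simps [simp]:
  "f \<in> carrier (End_algebra R M) \<longleftrightarrow> f \<in> linear_maps R M M \<and> f \<in> extensional (carrier M)"
  "f \<otimes>\<^bsub>End_algebra R M\<^esub> g = compose (carrier M) f g"
  "\<one>\<^bsub>End_algebra R M\<^esub> = (\<lambda>x\<in>carrier M. x)"
  "\<zero>\<^bsub>End_algebra R M\<^esub> = (\<lambda>x\<in>carrier M. \<zero>\<^bsub>M\<^esub>)"
  "f \<oplus>\<^bsub>End_algebra R M\<^esub> g = (\<lambda>x\<in>carrier M. f x \<oplus>\<^bsub>M\<^esub> g x)"
  "r \<odot>\<^bsub>End_algebra R M\<^esub> f = (\<lambda>x\<in>carrier M. r \<odot>\<^bsub>M\<^esub> f x)"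
  by (simp_all add: End_algebra_def)

lemma linear_mapsI:
  assumes "\<And>x. x \<in> carrier M \<Longrightarrow> f x \<in> carrier N"
    and "\<And>x y. x \<in> carrier M \<Longrightarrow> y \<in> carrier M \<Longrightarrow> f (x \<oplus>\<^bsub>M\<^esub> y) = f x \<oplus>\<^bsub>N\<^esub> f y"
    and "\<And>r x. r \<in> carrier R \<Longrightarrow> x \<in> carrier M \<Longrightarrow> f (r \<odot>\<^bsub>M\<^esub> x) = r \<odot>\<^bsub>N\<^esub> f x"
  shows "f \<in> linear_maps R M N"
  using assms by (simp add: linear_maps_def)

lemma assoc_algebra_End:
  assumes "module R M"
  shows "assoc_algebra R (End_algebra R M)"
proof -
  interpret module R M by fact
  let ?E = "End_algebra R M"
  have lin: "f x \<in> carrier M" "f (x \<oplus>\<^bsub>M\<^esub> y) = f x \<oplus>\<^bsub>M\<^esub> f y" "f (r \<odot>\<^bsub>M\<^esub> x) = r \<odot>\<^bsub>M\<^esub> f x"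
    if "f \<in> linear_maps R M M" "x \<in> carrier M" "y \<in> carrier M" "r \<in> carrier R" for f x y r
    using linear_mapsD[OF that(1)] that by blast+
  have lin1: "f x \<in> carrier M" if "f \<in> linear_maps R M M" "x \<in> carrier M" for f x
    using linear_mapsD(1)[OF that] .
  have add: "f \<oplus>\<^bsub>?E\<^esub> g \<in> carrier ?E" if "f \<in> carrier ?E" "g \<in> carrier ?E" for f g
    using that by (auto intro!: linear_mapsI simp: linear_mapsD M.a_ac smult_r_distr)
  have mult: "f \<otimes>\<^bsub>?E\<^esub> g \<in> carrier ?E" if "f \<in> carrier ?E" "g \<in> carrier ?E" for f g
    using that by (auto intro!: linear_mapsI simp: linear_mapsD compose_def)
  have smult: "r \<odot>\<^bsub>?E\<^esub> f \<in> carrier ?E" if "r \<in> carrier R" "f \<in> carrier ?E" for r f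
    using that by (auto intro!: linear_mapsI simp: linear_mapsD smult_r_distr smult_assoc1[symmetric] R.m_comm)
  have zero: "\<zero>\<^bsub>?E\<^esub> \<in> carrier ?E" by (auto intro!: linear_mapsI)
  have one: "\<one>\<^bsub>?E\<^esub> \<in> carrier ?E" by (auto intro!: linear_mapsI)
  have ext: "f = g" if "f \<in> carrier ?E" "g \<in> carrier ?E" "\<And>x. x \<in> carrier M \<Longrightarrow> f x = g x" for f g
    using that by (intro extensionalityI[of f "carrier M" g]) auto
  have ab: "abelian_group ?E"
  proof (rule abelian_groupI)
    fix f assume f: "f \<in> carrier ?E"
    show "\<zero>\<^bsub>?E\<^esub> \<oplus>\<^bsub>?E\<^esub> f = f"
      by (rule ext[OF add[OF zero f] f]) (use f in \<open>simp add: lin1\<close>)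
    have m: "(\<ominus>\<^bsub>R\<^esub> \<one>\<^bsub>R\<^esub>) \<odot>\<^bsub>?E\<^esub> f \<in> carrier ?E" by (rule smult[OF _ f]) simp
    have "(\<ominus>\<^bsub>R\<^esub> \<one>\<^bsub>R\<^esub>) \<odot>\<^bsub>?E\<^esub> f \<oplus>\<^bsub>?E\<^esub> f = \<zero>\<^bsub>?E\<^esub>"
      by (rule ext[OF add[OF m f] zero]) (use f in \<open>simp add: lin1 smult_l_minus M.l_neg\<close>)
    then show "\<exists>g\<in>carrier ?E. g \<oplus>\<^bsub>?E\<^esub> f = \<zero>\<^bsub>?E\<^esub>" using m by blast
    fix g assume g: "g \<in> carrier ?E"
    show "f \<oplus>\<^bsub>?E\<^esub> g = g \<oplus>\<^bsub>?E\<^esub> f"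
      by (rule ext[OF add[OF f g] add[OF g f]]) (use f g in \<open>simp add: lin1 M.a_comm\<close>)
    fix h assume h: "h \<in> carrier ?E"
    show "f \<oplus>\<^bsub>?E\<^esub> g \<oplus>\<^bsub>?E\<^esub> h = f \<oplus>\<^bsub>?E\<^esub> (g \<oplus>\<^bsub>?E\<^esub> h)"
      by (rule ext[OF add[OF add[OF f g] h] add[OF f add[OF g h]]]) (use f g h in \<open>simp add: lin1 M.a_assoc\<close>)
  qed (use add zero in auto)
  have mon: "monoid ?E"
  proof (rule monoidI)
    fix f assume f: "f \<in> carrier ?E"
    show "\<one>\<^bsub>?E\<^esub> \<otimes>\<^bsub>?E\<^esub> f = f"
      by (rule ext[OF mult[OF one f] f]) (use f in \<open>simp add: lin1 compose_def\<close>)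
    show "f \<otimes>\<^bsub>?E\<^esub> \<one>\<^bsub>?E\<^esub> = f"
      by (rule ext[OF mult[OF f one] f]) (use f in \<open>simp add: lin1 compose_def\<close>)
    fix g h assume g: "g \<in> carrier ?E" and h: "h \<in> carrier ?E"
    show "f \<otimes>\<^bsub>?E\<^esub> g \<otimes>\<^bsub>?E\<^esub> h = f \<otimes>\<^bsub>?E\<^esub> (g \<otimes>\<^bsub>?E\<^esub> h)"
      by (rule ext[OF mult[OF mult[OF f g] h] mult[OF f mult[OF g h]]]) (use f g h in \<open>simp add: lin1 compose_def\<close>)
  qed (use mult one in auto)
  have rng: "ring ?E"
  proof (rule ringI[OF ab mon])
    fix f g h assume f: "f \<in> carrier ?E" and g: "g \<in> carrier ?E" and h: "h \<in> carrier ?E"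
    show "(f \<oplus>\<^bsub>?E\<^esub> g) \<otimes>\<^bsub>?E\<^esub> h = f \<otimes>\<^bsub>?E\<^esub> h \<oplus>\<^bsub>?E\<^esub> g \<otimes>\<^bsub>?E\<^esub> h"
      by (rule ext[OF mult[OF add[OF f g] h] add[OF mult[OF f h] mult[OF g h]]])
         (use f g h in \<open>simp add: lin1 compose_def\<close>)
    show "h \<otimes>\<^bsub>?E\<^esub> (f \<oplus>\<^bsub>?E\<^esub> g) = h \<otimes>\<^bsub>?E\<^esub> f \<oplus>\<^bsub>?E\<^esub> h \<otimes>\<^bsub>?E\<^esub> g"
      by (rule ext[OF mult[OF h add[OF f g]] add[OF mult[OF h f] mult[OF h g]]])
         (use f g h in \<open>simp add: lin1 compose_def linear_mapsD(2)[of h R M M]\<close>)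
  qed
  have mod: "module R ?E"
  proof (rule moduleI[OF R.is_cring ab smult])
    fix f assume f: "f \<in> carrier ?E"
    show "\<one>\<^bsub>R\<^esub> \<odot>\<^bsub>?E\<^esub> f = f"
      by (rule ext[OF smult[OF R.one_closed f] f]) (use f in \<open>simp add: lin1\<close>)
    fix a assume a: "a \<in> carrier R"
    show "a \<odot>\<^bsub>?E\<^esub> (f \<oplus>\<^bsub>?E\<^esub> g) = a \<odot>\<^bsub>?E\<^esub> f \<oplus>\<^bsub>?E\<^esub> a \<odot>\<^bsub>?E\<^esub> g" if g: "g \<in> carrier ?E" for g
      by (rule ext[OF smult[OF a add[OF f g]] add[OF smult[OF a f] smult[OF a g]]])
         (use a f g in \<open>simp add: lin1 smult_r_distr\<close>)
    fix b assume b: "b \<in> carrier R"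
    have ab: "a \<oplus>\<^bsub>R\<^esub> b \<in> carrier R" "a \<otimes>\<^bsub>R\<^esub> b \<in> carrier R" using a b by auto
    show "(a \<oplus>\<^bsub>R\<^esub> b) \<odot>\<^bsub>?E\<^esub> f = a \<odot>\<^bsub>?E\<^esub> f \<oplus>\<^bsub>?E\<^esub> b \<odot>\<^bsub>?E\<^esub> f"
      by (rule ext[OF smult[OF ab(1) f] add[OF smult[OF a f] smult[OF b f]]])
         (use a b f in \<open>simp add: lin1 smult_l_distr\<close>)
    show "(a \<otimes>\<^bsub>R\<^esub> b) \<odot>\<^bsub>?E\<^esub> f = a \<odot>\<^bsub>?E\<^esub> (b \<odot>\<^bsub>?E\<^esub> f)"
      by (rule ext[OF smult[OF ab(2) f] smult[OF a smult[OF b f]]])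
         (use a b f in \<open>simp add: lin1 smult_assoc1\<close>)
  qed
  show ?thesis
  proof (rule assoc_algebra.intro[OF mod rng assoc_algebra_axioms.intro])
    fix a f g assume a: "a \<in> carrier R" and f: "f \<in> carrier ?E" and g: "g \<in> carrier ?E"
    show "(a \<odot>\<^bsub>?E\<^esub> f) \<otimes>\<^bsub>?E\<^esub> g = a \<odot>\<^bsub>?E\<^esub> (f \<otimes>\<^bsub>?E\<^esub> g)"
      by (rule ext[OF mult[OF smult[OF a f] g] smult[OF a mult[OF f g]]])
         (use a f g in \<open>simp add: lin1 compose_def\<close>)
    show "f \<otimes>\<^bsub>?E\<^esub> (a \<odot>\<^bsub>?E\<^esub> g) = a \<odot>\<^bsub>?E\<^esub> (f \<otimes>\<^bsub>?E\<^esub> g)"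
      by (rule ext[OF mult[OF f smult[OF a g]] smult[OF a mult[OF f g]]])
         (use a f g in \<open>simp add: lin1 compose_def linear_mapsD(3)[of f R M M]\<close>)
  qed
qed

text \<open>Each law of an associative algebra holds in \<open>Q\<close> because it holds for the
  images under the injective \<open>f\<close>. For the smash product this replaces a computation of
  associativity from the Hopf algebra axioms by composition of operators.\<close>

lemma assoc_algebra_transport:
  assumes E: "assoc_algebra R E" and Q: "abelian_group Q"
    and mult: "\<And>x y. x \<in> carrier Q \<Longrightarrow> y \<in> carrier Q \<Longrightarrow> x \<otimes>\<^bsub>Q\<^esub> y \<in> carrier Q"
    and one: "\<one>\<^bsub>Q\<^esub> \<in> carrier Q"
    and smult: "\<And>r x. r \<in> carrier R \<Longrightarrow> x \<in> carrier Q \<Longrightarrow> r \<odot>\<^bsub>Q\<^esub> x \<in> carrier Q"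
    and inj: "inj_on f (carrier Q)" and f: "\<And>x. x \<in> carrier Q \<Longrightarrow> f x \<in> carrier E"
    and f_add: "\<And>x y. x \<in> carrier Q \<Longrightarrow> y \<in> carrier Q \<Longrightarrow> f (x \<oplus>\<^bsub>Q\<^esub> y) = f x \<oplus>\<^bsub>E\<^esub> f y"
    and f_mult: "\<And>x y. x \<in> carrier Q \<Longrightarrow> y \<in> carrier Q \<Longrightarrow> f (x \<otimes>\<^bsub>Q\<^esub> y) = f x \<otimes>\<^bsub>E\<^esub> f y"
    and f_one: "f \<one>\<^bsub>Q\<^esub> = \<one>\<^bsub>E\<^esub>"
    and f_smult: "\<And>r x. r \<in> carrier R \<Longrightarrow> x \<in> carrier Q \<Longrightarrow> f (r \<odot>\<^bsub>Q\<^esub> x) = r \<odot>\<^bsub>E\<^esub> f x"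
  shows "assoc_algebra R Q"
proof -
  interpret E: assoc_algebra R E by fact
  interpret Q: abelian_group Q by fact
  note rules = mult one smult f f_add f_mult f_one f_smult Q.a_closed
  have mon: "monoid Q"
    by (rule monoidI; (rule inj_onD[OF inj])?) (simp_all add: rules E.m_assoc)
  have rng: "ring Q"
    by (rule ringI[OF Q mon]; rule inj_onD[OF inj]) (simp_all add: rules E.l_distr E.r_distr)
  have mod: "module R Q"
    by (rule moduleI[OF E.R.is_cring Q smult]; (rule inj_onD[OF inj])?)
       (simp_all add: rules E.smult_l_distr E.smult_r_distr E.smult_assoc1)
  show ?thesis
    by (rule assoc_algebra.intro[OF mod rng assoc_algebra_axioms.intro]; rule inj_onD[OF inj])
       (simp_all add: rules E.smult_mult_left E.smult_mult_right)
qed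

lemma balanced_cong:
  assumes "balanced R M N V f" and eq: "\<And>x y. x \<in> carrier M \<Longrightarrow> y \<in> carrier N \<Longrightarrow> g x y = f x y"
    and "tensor_pair R M N"
  shows "balanced R M N V g"
proof -
  interpret tensor_pair R M N by fact
  interpret M: abelian_group M by (rule left)
  interpret N: abelian_group N by (rule right)
  show ?thesis
    by (rule balancedI) (use assms(1) in \<open>simp_all add: eq balanced_def smult_left smult_right\<close>)
qed

section \<open>Operators on \<open>S\<close> and the natural homomorphism\<close>

context action
begin

abbreviation "R \<equiv> invariants K A S \<rho>"
abbreviation "End_S \<equiv> End_algebra R (regular S)"
abbreviation "N \<equiv> natural_hom K A S \<rho>"
abbreviation "Q \<equiv> skew_group_scheme_ring K A S \<rho>"

lemma algebra_regular: "algebra R (regular S)"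
  by (rule algebraI[OF cring_invariants cring_regular[OF S.is_cring]])
     (simp_all add: S.l_distr S.r_distr S.m_assoc)

lemma assoc_algebra_End_S: "assoc_algebra R End_S"
  by (rule assoc_algebra_End[OF algebra.module[OF algebra_regular]])

lemma abelian_group_End_S: "abelian_group End_S"
  using assoc_algebra_End_S by (simp add: assoc_algebra_def ring_def)

lemma ev_left_mult:
  assumes h: "h \<in> functionals" and s: "s \<in> carrier S" and z: "z \<in> carrier (tensor K S A)"
  shows "ev h (SA.\<tau> s \<one>\<^bsub>A\<^esub> \<otimes>\<^bsub>tensor K S A\<^esub> z) = s \<otimes>\<^bsub>S\<^esub> ev h z"
proof -
  have mS': "additive S S (\<lambda>x. s \<otimes>\<^bsub>S\<^esub> x)"
    by (rule additiveI) (use s in \<open>simp_all add: S.r_distr\<close>)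
  show ?thesis
    by (rule SA.additive_eqI[OF _ _ _ z])
       (use s h in \<open>auto intro!: additive_comp[OF SA.mult_additive_right ev_additive] additive_comp[OF ev_additive mS']
          simp: SA.mult_pure ev_pure functionalD S.smult_assoc2'\<close>)
qed

lemma ev_dual_add:
  assumes "h \<in> functionals" "g \<in> functionals" "z \<in> carrier (tensor K S A)"
  shows "ev (h \<oplus>\<^bsub>D\<^esub> g) z = ev h z \<oplus>\<^bsub>S\<^esub> ev g z"
proof -
  have hg: "h \<oplus>\<^bsub>D\<^esub> g \<in> functionals"
    unfolding dual_algebra_simps by (rule functionalI) (use assms in \<open>auto simp: functionalD K.a_ac K.r_distr\<close>)
  show ?thesis
    by (rule SA.additive_eqI[OF _ _ _ assms(3)])
       (use assms hg in \<open>auto intro!: ev_additive additive_plus S.M.abelian_group_axioms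
         simp: ev_pure[OF hg] ev_pure dual_apply S.smult_l_distr functionalD\<close>)
qed

lemma ev_dual_smult:
  assumes "h \<in> functionals" "r \<in> carrier K" "z \<in> carrier (tensor K S A)"
  shows "ev (r \<odot>\<^bsub>D\<^esub> h) z = r \<odot>\<^bsub>S\<^esub> ev h z"
proof -
  have hg: "r \<odot>\<^bsub>D\<^esub> h \<in> functionals"
    unfolding dual_algebra_simps by (rule functionalI) (use assms in \<open>auto simp: functionalD K.r_distr K.m_lcomm\<close>)
  show ?thesis
    by (rule SA.additive_eqI[OF _ _ _ assms(3)])
       (use assms hg in \<open>auto intro!: ev_additive additive_comp[OF ev_additive smult_S_additive]
         simp: ev_pure[OF hg] ev_pure dual_apply S.smult_assoc1 functionalD\<close>)
qed

lemma pairing_dual_add_left: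
  assumes "h \<in> functionals" "h' \<in> functionals" "g \<in> functionals" "z \<in> carrier (tensor K A A)"
  shows "pairing (h \<oplus>\<^bsub>D\<^esub> h') g z = pairing h g z \<oplus>\<^bsub>K\<^esub> pairing h' g z"
proof -
  have hg: "h \<oplus>\<^bsub>D\<^esub> h' \<in> functionals"
    unfolding dual_algebra_simps by (rule functionalI) (use assms in \<open>auto simp: functionalD K.a_ac K.r_distr\<close>)
  show ?thesis
    by (rule AA.additive_eqI[OF _ _ _ assms(4)])
       (use assms hg in \<open>auto intro!: pairing_additive additive_plus K.abelian_group_axioms
         simp: pairing_pure[OF hg] pairing_pure dual_apply K.l_distr functionalD\<close>)
qed

lemma pairing_dual_add_right:
  assumes "h \<in> functionals" "g \<in> functionals" "g' \<in> functionals" "z \<in> carrier (tensor K A A)"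
  shows "pairing h (g \<oplus>\<^bsub>D\<^esub> g') z = pairing h g z \<oplus>\<^bsub>K\<^esub> pairing h g' z"
proof -
  have hg: "g \<oplus>\<^bsub>D\<^esub> g' \<in> functionals"
    unfolding dual_algebra_simps by (rule functionalI) (use assms in \<open>auto simp: functionalD K.a_ac K.r_distr\<close>)
  show ?thesis
    by (rule AA.additive_eqI[OF _ _ _ assms(4)])
       (use assms hg in \<open>auto intro!: pairing_additive additive_plus K.abelian_group_axioms
         simp: pairing_pure[OF _ hg] pairing_pure dual_apply K.r_distr functionalD\<close>)
qed

lemma pairing_dual_smult:
  assumes "h \<in> functionals" "g \<in> functionals" "r \<in> carrier K" "z \<in> carrier (tensor K A A)"
  shows "pairing (r \<odot>\<^bsub>D\<^esub> h) g z = r \<otimes>\<^bsub>K\<^esub> pairing h g z"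
    and "pairing h (r \<odot>\<^bsub>D\<^esub> g) z = r \<otimes>\<^bsub>K\<^esub> pairing h g z"
proof -
  have hg: "r \<odot>\<^bsub>D\<^esub> h \<in> functionals" "r \<odot>\<^bsub>D\<^esub> g \<in> functionals"
    unfolding dual_algebra_simps by (rule functionalI; use assms in \<open>auto simp: functionalD K.r_distr K.m_lcomm\<close>)+
  show "pairing (r \<odot>\<^bsub>D\<^esub> h) g z = r \<otimes>\<^bsub>K\<^esub> pairing h g z"
    by (rule AA.additive_eqI[OF _ _ _ assms(4)])
       (use assms hg in \<open>auto intro!: pairing_additive additive_comp[OF pairing_additive smult_K_additive]
         simp: pairing_pure[OF hg(1)] pairing_pure dual_apply K.m_assoc functionalD\<close>)
  show "pairing h (r \<odot>\<^bsub>D\<^esub> g) z = r \<otimes>\<^bsub>K\<^esub> pairing h g z"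
    by (rule AA.additive_eqI[OF _ _ _ assms(4)])
       (use assms hg in \<open>auto intro!: pairing_additive additive_comp[OF pairing_additive smult_K_additive]
         simp: pairing_pure[OF _ hg(2)] pairing_pure dual_apply K.m_lcomm functionalD\<close>)
qed

lemma convolution_closed: "h \<in> carrier D \<Longrightarrow> g \<in> carrier D \<Longrightarrow> h \<otimes>\<^bsub>H\<^esub> g \<in> carrier D"
  unfolding dual_hopf_simps by (intro dual_restrict conv_functional dual_functional)

lemma
  assumes h: "h \<in> carrier D" and g: "g \<in> carrier D"
  shows convolution_add_left: "h' \<in> carrier D \<Longrightarrow> (h \<oplus>\<^bsub>D\<^esub> h') \<otimes>\<^bsub>H\<^esub> g = h \<otimes>\<^bsub>H\<^esub> g \<oplus>\<^bsub>D\<^esub> h' \<otimes>\<^bsub>H\<^esub> g"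
    and convolution_add_right: "g' \<in> carrier D \<Longrightarrow> h \<otimes>\<^bsub>H\<^esub> (g \<oplus>\<^bsub>D\<^esub> g') = h \<otimes>\<^bsub>H\<^esub> g \<oplus>\<^bsub>D\<^esub> h \<otimes>\<^bsub>H\<^esub> g'"
    and convolution_smult_left: "r \<in> carrier K \<Longrightarrow> (r \<odot>\<^bsub>D\<^esub> h) \<otimes>\<^bsub>H\<^esub> g = r \<odot>\<^bsub>D\<^esub> (h \<otimes>\<^bsub>H\<^esub> g)"
    and convolution_smult_right: "r \<in> carrier K \<Longrightarrow> h \<otimes>\<^bsub>H\<^esub> (r \<odot>\<^bsub>D\<^esub> g) = r \<odot>\<^bsub>D\<^esub> (h \<otimes>\<^bsub>H\<^esub> g)"
proof -
  note f = dual_functional[OF h] dual_functional[OF g]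
  note hm = dual_hopf_simps(5)
  show "(h \<oplus>\<^bsub>D\<^esub> h') \<otimes>\<^bsub>H\<^esub> g = h \<otimes>\<^bsub>H\<^esub> g \<oplus>\<^bsub>D\<^esub> h' \<otimes>\<^bsub>H\<^esub> g" if prem: "h' \<in> carrier D"
    by (rule dual_eqI)
       (simp_all add: h g prem convolution_closed dual_add_closed dual_apply, simp add: hm f dual_functional[OF prem] pairing_dual_add_left comult_closed)
  show "h \<otimes>\<^bsub>H\<^esub> (g \<oplus>\<^bsub>D\<^esub> g') = h \<otimes>\<^bsub>H\<^esub> g \<oplus>\<^bsub>D\<^esub> h \<otimes>\<^bsub>H\<^esub> g'" if prem: "g' \<in> carrier D"
    by (rule dual_eqI)
       (simp_all add: h g prem convolution_closed dual_add_closed dual_apply, simp add: hm f dual_functional[OF prem] pairing_dual_add_right comult_closed)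
  show "(r \<odot>\<^bsub>D\<^esub> h) \<otimes>\<^bsub>H\<^esub> g = r \<odot>\<^bsub>D\<^esub> (h \<otimes>\<^bsub>H\<^esub> g)" if prem: "r \<in> carrier K"
    by (rule dual_eqI)
       (simp_all add: h g prem convolution_closed dual_smult_closed dual_apply, simp add: hm f prem pairing_dual_smult comult_closed)
  show "h \<otimes>\<^bsub>H\<^esub> (r \<odot>\<^bsub>D\<^esub> g) = r \<odot>\<^bsub>D\<^esub> (h \<otimes>\<^bsub>H\<^esub> g)" if prem: "r \<in> carrier K"
    by (rule dual_eqI)
       (simp_all add: h g prem convolution_closed dual_smult_closed dual_apply, simp add: hm f prem pairing_dual_smult comult_closed)
qed

lemmas convolution_linear = convolution_add_left convolution_add_right convolution_smult_left convolution_smult_right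

text \<open>Linearity over the invariants: for invariant \<open>r\<close> the coaction of
  \<open>r t\<close> is \<open>(r \<otimes> 1) \<rho> t\<close>, and \<open>ev h\<close> is linear
  over \<open>S\<close>.\<close>

lemma operator_End:
  assumes h: "h \<in> functionals" and s: "s \<in> carrier S"
  shows "(\<lambda>t\<in>carrier S. s \<otimes>\<^bsub>S\<^esub> act h t) \<in> carrier End_S"
proof -
  have "(\<lambda>t\<in>carrier S. s \<otimes>\<^bsub>S\<^esub> act h t) \<in> linear_maps R (regular S) (regular S)"
    by (rule linear_mapsI)
       (use h s in \<open>auto simp: act_closed additive_add[OF act_additive[OF h]] S.r_distr
          coaction_mult ev_left_mult[OF h _ coaction_closed] S.m_lcomm\<close>)
  then show ?thesis by simp
qed

lemma natural_hom_def': "N = tensor_lift (add_monoid End_S) (\<lambda>s h. \<lambda>t\<in>carrier S. s \<otimes>\<^bsub>S\<^esub> act h t)"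
  by (simp add: natural_hom_def dual_act_def)

lemma operator_balanced: "balanced K S H End_S (\<lambda>s h. \<lambda>t\<in>carrier S. s \<otimes>\<^bsub>S\<^esub> act h t)"
proof (rule balancedI)
  fix s h assume s: "s \<in> carrier S" and "h \<in> carrier H"
  then have hD: "h \<in> carrier D" and h: "h \<in> functionals" using dual_functional by (auto simp: dual_hopf_simps)
  show "(\<lambda>t\<in>carrier S. s \<otimes>\<^bsub>S\<^esub> act h t) \<in> carrier End_S" by (rule operator_End[OF h s])
  show "(\<lambda>t\<in>carrier S. (s \<oplus>\<^bsub>S\<^esub> s') \<otimes>\<^bsub>S\<^esub> act h t) =
      (\<lambda>t\<in>carrier S. s \<otimes>\<^bsub>S\<^esub> act h t) \<oplus>\<^bsub>End_S\<^esub> (\<lambda>t\<in>carrier S. s' \<otimes>\<^bsub>S\<^esub> act h t)" if "s' \<in> carrier S" for s'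
    using s that by (auto intro!: restrict_ext simp: S.l_distr act_closed[OF h])
  show "(\<lambda>t\<in>carrier S. s \<otimes>\<^bsub>S\<^esub> act (h \<oplus>\<^bsub>H\<^esub> h') t) =
      (\<lambda>t\<in>carrier S. s \<otimes>\<^bsub>S\<^esub> act h t) \<oplus>\<^bsub>End_S\<^esub> (\<lambda>t\<in>carrier S. s \<otimes>\<^bsub>S\<^esub> act h' t)" if "h' \<in> carrier H" for h'
    using s h that dual_functional[of h']
    by (auto intro!: restrict_ext simp: dual_hopf_simps ev_dual_add coaction_closed S.r_distr act_closed)
  show "(\<lambda>t\<in>carrier S. r \<odot>\<^bsub>S\<^esub> s \<otimes>\<^bsub>S\<^esub> act h t) = (\<lambda>t\<in>carrier S. s \<otimes>\<^bsub>S\<^esub> act (r \<odot>\<^bsub>H\<^esub> h) t)" if "r \<in> carrier K" for r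
    using s h that
    by (auto intro!: restrict_ext simp: dual_hopf_simps ev_dual_smult coaction_closed act_closed S.smult_assoc2 S.smult_assoc2')
qed

lemmas N_additive = SH.lift_additive[OF abelian_group_End_S operator_balanced, folded natural_hom_def']

lemma N_pure: "s \<in> carrier S \<Longrightarrow> h \<in> carrier D \<Longrightarrow> N (SH.\<tau> s h) = (\<lambda>t\<in>carrier S. s \<otimes>\<^bsub>S\<^esub> act h t)"
  using SH.lift_pure[OF abelian_group_End_S operator_balanced, of s h] by (simp add: natural_hom_def' dual_hopf_simps)

lemma N_closed: "x \<in> carrier (tensor K S H) \<Longrightarrow> N x \<in> carrier End_S"
  by (rule additive_closed[OF N_additive])

lemma End_S_D:
  assumes "f \<in> carrier End_S"
  shows "u \<in> carrier S \<Longrightarrow> f u \<in> carrier S"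
    and "u \<in> carrier S \<Longrightarrow> v \<in> carrier S \<Longrightarrow> f (u \<oplus>\<^bsub>S\<^esub> v) = f u \<oplus>\<^bsub>S\<^esub> f v"
    and "r \<in> carrier R \<Longrightarrow> u \<in> carrier S \<Longrightarrow> f (r \<otimes>\<^bsub>S\<^esub> u) = r \<otimes>\<^bsub>S\<^esub> f u"
    and "f \<in> extensional (carrier S)"
  using assms linear_mapsD[of f R "regular S" "regular S"] by simp_all

lemma N_eval_additive: "u \<in> carrier S \<Longrightarrow> additive (tensor K S H) S (\<lambda>x. N x u)"
  by (rule additiveI)
     (use End_S_D(1)[OF N_closed] in \<open>simp_all add: additive_add[OF N_additive]\<close>)

lemma skew_simps:
  "carrier Q = carrier (tensor K S H)" "ring.add Q = ring.add (tensor K S H)" "\<zero>\<^bsub>Q\<^esub> = \<zero>\<^bsub>tensor K S H\<^esub>"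
  "\<one>\<^bsub>Q\<^esub> = SH.\<tau> \<one>\<^bsub>S\<^esub> \<one>\<^bsub>H\<^esub>"
  "x \<otimes>\<^bsub>Q\<^esub> y = tensor_lift (tensor_group K S H) (\<lambda>s h. tensor_lift (tensor_group K S H) (\<lambda>t g.
      tensor_lift (tensor_group K S H) (\<lambda>h1 h2. SH.\<tau> (s \<otimes>\<^bsub>S\<^esub> act h1 t) (h2 \<otimes>\<^bsub>H\<^esub> g)) (comult H h)) y) x"
  "r \<odot>\<^bsub>Q\<^esub> x = SH.\<tau> r \<one>\<^bsub>H\<^esub> \<otimes>\<^bsub>Q\<^esub> x"
  by (simp_all add: skew_group_scheme_ring_def Let_def tensor_def dual_act_def)

end

section \<open>The smash product and its multiplicative map to operators\<close>

context dual_action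
begin

text \<open>The product of \<open>s # h\<close> and \<open>t # g\<close>, with the comultiplication
  of \<open>h\<close> expanded along the dual basis.\<close>

definition smash_pure where
  "smash_pure s h t g = finsum (tensor K S H) (\<lambda>b. SH.\<tau> (s \<otimes>\<^bsub>S\<^esub> act (e b) t) (translate h b \<otimes>\<^bsub>H\<^esub> g)) E"

lemma smash_pure_term_closed:
  "s \<in> carrier S \<Longrightarrow> h \<in> carrier D \<Longrightarrow> t \<in> carrier S \<Longrightarrow> g \<in> carrier D \<Longrightarrow> b \<in> E \<Longrightarrow>
   SH.\<tau> (s \<otimes>\<^bsub>S\<^esub> act (e b) t) (translate h b \<otimes>\<^bsub>H\<^esub> g) \<in> carrier (tensor K S H)"
  by (intro SH.pure_closed)
     (simp_all add: act_closed e_functional dual_hopf_simps(1) convolution_closed translate_closed dual_functional E_closed)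

lemma translate_linear:
  assumes "b \<in> E"
  shows "translate (h \<oplus>\<^bsub>D\<^esub> h') b = translate h b \<oplus>\<^bsub>D\<^esub> translate h' b"
    and "translate (r \<odot>\<^bsub>D\<^esub> h) b = r \<odot>\<^bsub>D\<^esub> translate h b"
  using E_closed[OF assms] unfolding translate_def dual_algebra_simps
  by (auto intro!: restrict_ext)

lemma SH_pure_smult:
  "r \<in> carrier K \<Longrightarrow> s \<in> carrier S \<Longrightarrow> h \<in> carrier D \<Longrightarrow> SH.\<tau> (r \<odot>\<^bsub>S\<^esub> s) h = SH.\<tau> s (r \<odot>\<^bsub>D\<^esub> h)"
  using SH.pure_smult[of r s h] by (simp add: dual_hopf_simps)

lemma SH_pure_add:
  "s \<in> carrier S \<Longrightarrow> h \<in> carrier D \<Longrightarrow> h' \<in> carrier D \<Longrightarrow>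
   SH.\<tau> s (h \<oplus>\<^bsub>D\<^esub> h') = SH.\<tau> s h \<oplus>\<^bsub>tensor K S H\<^esub> SH.\<tau> s h'"
  "s \<in> carrier S \<Longrightarrow> s' \<in> carrier S \<Longrightarrow> h \<in> carrier D \<Longrightarrow>
   SH.\<tau> (s \<oplus>\<^bsub>S\<^esub> s') h = SH.\<tau> s h \<oplus>\<^bsub>tensor K S H\<^esub> SH.\<tau> s' h"
  using SH.pure_add_right[of s h h'] SH.pure_add_left[of s s' h] by (simp_all add: dual_hopf_simps)

lemma smash_pure_balanced_right:
  assumes s: "s \<in> carrier S" and h: "h \<in> carrier D"
  shows "balanced K S H (tensor K S H) (smash_pure s h)"
  unfolding smash_pure_def
proof (rule balanced_sum[OF SH.abelian_group_tensor finite_E _ SH.smult_right])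
  fix b assume b: "b \<in> E"
  note eb = e_functional[OF b] and tr = translate_closed[OF dual_functional[OF h] E_closed[OF b]]
  show "balanced K S H (tensor K S H) (\<lambda>t g. SH.\<tau> (s \<otimes>\<^bsub>S\<^esub> act (e b) t) (translate h b \<otimes>\<^bsub>H\<^esub> g))"
  proof (rule balancedI)
    show "SH.\<tau> (s \<otimes>\<^bsub>S\<^esub> act (e b) t) (translate h b \<otimes>\<^bsub>H\<^esub> g) \<in> carrier (tensor K S H)"
      if "t \<in> carrier S" "g \<in> carrier H" for t g
      using smash_pure_term_closed[OF s h that(1) _ b] that(2) by (simp add: dual_hopf_simps(1))
  qed (use s in \<open>simp_all add: dual_hopf_simps(1-4) additive_add[OF act_additive[OF eb]] S.r_distr act_closed[OF eb]
         SH_pure_add convolution_closed tr convolution_linear coaction_smult ev_smult[OF eb] coaction_closed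
         S.smult_assoc2' SH_pure_smult\<close>)
qed

lemma smash_pure_balanced_left:
  assumes t: "t \<in> carrier S" and g: "g \<in> carrier D"
  shows "balanced K S H (tensor K S H) (\<lambda>s h. smash_pure s h t g)"
  unfolding smash_pure_def
proof (rule balanced_sum[OF SH.abelian_group_tensor finite_E _ SH.smult_right])
  fix b assume b: "b \<in> E"
  note eb = e_functional[OF b] and tr = translate_closed[OF dual_functional E_closed[OF b]]
  show "balanced K S H (tensor K S H) (\<lambda>s h. SH.\<tau> (s \<otimes>\<^bsub>S\<^esub> act (e b) t) (translate h b \<otimes>\<^bsub>H\<^esub> g))"
  proof (rule balancedI)
    show "SH.\<tau> (s \<otimes>\<^bsub>S\<^esub> act (e b) t) (translate h b \<otimes>\<^bsub>H\<^esub> g) \<in> carrier (tensor K S H)"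
      if "s \<in> carrier S" "h \<in> carrier H" for s h
      using smash_pure_term_closed[OF that(1) _ t g b] that(2) by (simp add: dual_hopf_simps(1))
  qed (use t g b in \<open>simp_all add: dual_hopf_simps(1-4) S.l_distr act_closed[OF eb]
         SH_pure_add convolution_closed tr convolution_linear translate_linear[OF b]
         S.smult_assoc2 SH_pure_smult\<close>)
qed

lemma comult_lift:
  assumes s: "s \<in> carrier S" and h: "h \<in> carrier D" and t: "t \<in> carrier S" and g: "g \<in> carrier D"
  shows "tensor_lift (tensor_group K S H) (\<lambda>h1 h2. SH.\<tau> (s \<otimes>\<^bsub>S\<^esub> act h1 t) (h2 \<otimes>\<^bsub>H\<^esub> g)) (comult H h) = smash_pure s h t g"
proof -
  note cl = act_closed[OF dual_functional]
  have b: "balanced K D D (tensor K S H) (\<lambda>h1 h2. SH.\<tau> (s \<otimes>\<^bsub>S\<^esub> act h1 t) (h2 \<otimes>\<^bsub>H\<^esub> g))"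
  proof (rule balancedI)
    show "SH.\<tau> (s \<otimes>\<^bsub>S\<^esub> act h1 t) (h2 \<otimes>\<^bsub>H\<^esub> g) \<in> carrier (tensor K S H)" if "h1 \<in> carrier D" "h2 \<in> carrier D" for h1 h2
      by (rule SH.pure_closed) (use s t g that in \<open>simp_all add: cl convolution_closed dual_hopf_simps(1)\<close>)
  qed (use s t g in \<open>simp_all add: cl convolution_closed convolution_linear SH_pure_add ev_dual_add ev_dual_smult
        dual_functional coaction_closed S.r_distr S.smult_assoc2' SH_pure_smult\<close>)
  note la = DD.lift_additive'[OF SH.group_facts b] and lp = DD.lift_pure'[OF SH.group_facts b]
  have tr: "translate h b \<in> carrier D" if "b \<in> E" for b
    using translate_closed[OF dual_functional[OF h] E_closed[OF that]] .
  let ?L = "tensor_lift (tensor_group K S H) (\<lambda>h1 h2. SH.\<tau> (s \<otimes>\<^bsub>S\<^esub> act h1 t) (h2 \<otimes>\<^bsub>H\<^esub> g))"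
  have "?L (comult H h) = finsum (tensor K S H) (\<lambda>b. ?L (DD.\<tau> (e b) (translate h b))) E"
    unfolding comult_dual[OF dual_functional[OF h]]
    by (rule additive_finsum[OF DD.abelian_group_tensor SH.abelian_group_tensor la finite_E])
       (rule DD.pure_closed[OF e_dual tr])
  also have "\<dots> = smash_pure s h t g"
    unfolding smash_pure_def
    by (rule SH.T.finsum_cong'[OF refl])
       (rule Pi_I, rule smash_pure_term_closed[OF s h t g], assumption, rule lp[OF e_dual tr])
  finally show ?thesis .
qed

text \<open>The product consists of three nested lifts, and each layer can be evaluated only once
  the layers inside it are known to be balanced. The innermost one equals \<open>smash_pure\<close>,
  a finite sum whose terms are visibly balanced in either pair of variables.\<close>

lemma
  shows skew_mult_additive_left: "y \<in> carrier (tensor K S H) \<Longrightarrow> additive (tensor K S H) (tensor K S H) (\<lambda>x. x \<otimes>\<^bsub>Q\<^esub> y)"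
    and skew_mult_pure_left: "s \<in> carrier S \<Longrightarrow> h \<in> carrier D \<Longrightarrow> y \<in> carrier (tensor K S H) \<Longrightarrow>
      SH.\<tau> s h \<otimes>\<^bsub>Q\<^esub> y = tensor_lift (tensor_group K S H) (\<lambda>t g. tensor_lift (tensor_group K S H)
        (\<lambda>h1 h2. SH.\<tau> (s \<otimes>\<^bsub>S\<^esub> act h1 t) (h2 \<otimes>\<^bsub>H\<^esub> g)) (comult H h)) y"
    and skew_mult_additive_right: "s \<in> carrier S \<Longrightarrow> h \<in> carrier D \<Longrightarrow>
      additive (tensor K S H) (tensor K S H) (\<lambda>y. SH.\<tau> s h \<otimes>\<^bsub>Q\<^esub> y)"
    and skew_mult_pure: "s \<in> carrier S \<Longrightarrow> h \<in> carrier D \<Longrightarrow> t \<in> carrier S \<Longrightarrow> g \<in> carrier D \<Longrightarrow>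
      SH.\<tau> s h \<otimes>\<^bsub>Q\<^esub> SH.\<tau> t g = smash_pure s h t g"
proof -
  let ?f = "\<lambda>s h t g. tensor_lift (tensor_group K S H) (\<lambda>h1 h2. SH.\<tau> (s \<otimes>\<^bsub>S\<^esub> act h1 t) (h2 \<otimes>\<^bsub>H\<^esub> g)) (comult H h)"
  have r: "balanced K S H (tensor K S H) (?f s h)" if "s \<in> carrier S" "h \<in> carrier D" for s h
    by (rule balanced_cong[OF smash_pure_balanced_right[OF that] _ SH.tensor_pair_axioms])
       (use that in \<open>simp add: comult_lift dual_hopf_simps(1)\<close>)
  have l: "balanced K S H (tensor K S H) (\<lambda>s h. ?f s h t g)" if "t \<in> carrier S" "g \<in> carrier D" for t g
    by (rule balanced_cong[OF smash_pure_balanced_left[OF that] _ SH.tensor_pair_axioms])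
       (use that in \<open>simp add: comult_lift dual_hopf_simps(1)\<close>)
  have o: "balanced K S H (tensor K S H) (\<lambda>s h. tensor_lift (tensor_group K S H) (?f s h) y)"
    if "y \<in> carrier (tensor K S H)" for y
    by (rule balanced_lift[OF SH.tensor_pair_axioms SH.tensor_pair_axioms SH.group_facts SH.abelian_group_tensor _ _ that])
       (simp_all add: r l dual_hopf_simps(1))
  show "y \<in> carrier (tensor K S H) \<Longrightarrow> additive (tensor K S H) (tensor K S H) (\<lambda>x. x \<otimes>\<^bsub>Q\<^esub> y)" for y
    unfolding skew_simps by (rule SH.lift_additive'[OF SH.group_facts o])
  show p: "s \<in> carrier S \<Longrightarrow> h \<in> carrier D \<Longrightarrow> y \<in> carrier (tensor K S H) \<Longrightarrow>
      SH.\<tau> s h \<otimes>\<^bsub>Q\<^esub> y = tensor_lift (tensor_group K S H) (?f s h) y" for s h y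
    unfolding skew_simps by (rule SH.lift_pure'[OF SH.group_facts o]) (simp_all add: dual_hopf_simps(1))
  note la = SH.lift_additive'[OF SH.group_facts r]
  show "additive (tensor K S H) (tensor K S H) (\<lambda>y. SH.\<tau> s h \<otimes>\<^bsub>Q\<^esub> y)" if "s \<in> carrier S" "h \<in> carrier D" for s h
    by (rule additiveI) (simp_all add: p that additive_closed[OF la] additive_add[OF la])
  show "SH.\<tau> s h \<otimes>\<^bsub>Q\<^esub> SH.\<tau> t g = smash_pure s h t g"
    if "s \<in> carrier S" "h \<in> carrier D" "t \<in> carrier S" "g \<in> carrier D" for s h t g
    using that SH.lift_pure'[OF SH.group_facts r[OF that(1,2)], of t g]
    by (simp add: p comult_lift dual_hopf_simps(1))
qed

lemma skew_mult_closed: "x \<in> carrier Q \<Longrightarrow> y \<in> carrier Q \<Longrightarrow> x \<otimes>\<^bsub>Q\<^esub> y \<in> carrier Q"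
  unfolding skew_simps(1) by (rule additive_closed[OF skew_mult_additive_left])

text \<open>The operator of the product is the composite of the operators: \<open>act_conv\<close>
  splits the action of the convolution with \<open>g\<close>, and \<open>act_mult\<close> collects
  the sum over the basis into the action of \<open>h\<close> on a product.\<close>

lemma N_smash_pure:
  assumes s: "s \<in> carrier S" and h: "h \<in> carrier D" and t: "t \<in> carrier S" and g: "g \<in> carrier D" and u: "u \<in> carrier S"
  shows "N (smash_pure s h t g) u = s \<otimes>\<^bsub>S\<^esub> act h (t \<otimes>\<^bsub>S\<^esub> act g u)"
proof -
  note hf = dual_functional[OF h] and gf = dual_functional[OF g]
  let ?v = "act g u"
  have v: "?v \<in> carrier S" by (rule act_closed[OF gf u])
  have tr: "translate h b \<in> carrier D" if "b \<in> E" for b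
    using translate_closed[OF hf E_closed[OF that]] .
  have cl: "act (e b) t \<otimes>\<^bsub>S\<^esub> act (translate h b) ?v \<in> carrier S" if "b \<in> E" for b
    using act_closed[OF e_functional[OF that] t] act_closed[OF dual_functional[OF tr[OF that]] v] by simp
  have "N (smash_pure s h t g) u = finsum S (\<lambda>b. N (SH.\<tau> (s \<otimes>\<^bsub>S\<^esub> act (e b) t) (translate h b \<otimes>\<^bsub>H\<^esub> g)) u) E"
    unfolding smash_pure_def
    by (rule additive_finsum[OF SH.abelian_group_tensor S.M.abelian_group_axioms N_eval_additive[OF u] finite_E])
       (rule smash_pure_term_closed[OF s h t g])
  also have "\<dots> = finsum S (\<lambda>b. s \<otimes>\<^bsub>S\<^esub> (act (e b) t \<otimes>\<^bsub>S\<^esub> act (translate h b) ?v)) E"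
  proof (rule S.finsum_cong')
    fix b assume b: "b \<in> E"
    note a = act_closed[OF e_functional[OF b] t] act_closed[OF dual_functional[OF tr[OF b]] v]
    have "act (translate h b \<otimes>\<^bsub>H\<^esub> g) u = act (translate h b) ?v"
    proof -
      have "act (translate h b \<otimes>\<^bsub>H\<^esub> g) u = ev (conv (translate h b) g) (\<rho> u)"
        unfolding dual_hopf_simps(5)
        by (rule ev_cong[symmetric, OF _ conv_functional[OF dual_functional[OF tr[OF b]] gf] coaction_closed[OF u]]) simp
      then show ?thesis using act_conv[OF dual_functional[OF tr[OF b]] gf u] by simp
    qed
    then show "N (SH.\<tau> (s \<otimes>\<^bsub>S\<^esub> act (e b) t) (translate h b \<otimes>\<^bsub>H\<^esub> g)) u = s \<otimes>\<^bsub>S\<^esub> (act (e b) t \<otimes>\<^bsub>S\<^esub> act (translate h b) ?v)"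
      using s a u by (simp add: N_pure convolution_closed tr[OF b] g S.m_assoc)
  next
    show "(\<lambda>b. s \<otimes>\<^bsub>S\<^esub> (act (e b) t \<otimes>\<^bsub>S\<^esub> act (translate h b) ?v)) \<in> E \<rightarrow> carrier S"
      by (rule Pi_I) (use cl s in simp)
  qed simp
  also have "\<dots> = s \<otimes>\<^bsub>S\<^esub> finsum S (\<lambda>b. act (e b) t \<otimes>\<^bsub>S\<^esub> act (translate h b) ?v) E"
    by (rule S.finsum_rdistr[symmetric, OF finite_E s]) (rule Pi_I, rule cl)
  also have "finsum S (\<lambda>b. act (e b) t \<otimes>\<^bsub>S\<^esub> act (translate h b) ?v) E = act h (t \<otimes>\<^bsub>S\<^esub> ?v)"
    using act_mult[OF hf coaction_closed[OF t] coaction_closed[OF v]] coaction_mult[OF t v] by simp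
  finally show ?thesis .
qed

lemma N_mult:
  assumes x: "x \<in> carrier (tensor K S H)" and y: "y \<in> carrier (tensor K S H)" and u: "u \<in> carrier S"
  shows "N (x \<otimes>\<^bsub>Q\<^esub> y) u = N x (N y u)"
proof -
  have vc: "N y u \<in> carrier S" if "y \<in> carrier (tensor K S H)" for y by (rule End_S_D(1)[OF N_closed[OF that] u])
  have 1: "N (SH.\<tau> s h \<otimes>\<^bsub>Q\<^esub> y) u = N (SH.\<tau> s h) (N y u)" if s: "s \<in> carrier S" and "h \<in> carrier H" for s h
  proof -
    have h: "h \<in> carrier D" using that by (simp add: dual_hopf_simps(1))
    have ad: "additive S S (N (SH.\<tau> s h))"
      using End_S_D[OF N_closed[of "SH.\<tau> s h"]] that by (simp add: additive_def)
    show ?thesis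
    proof (rule SH.additive_eqI[OF _ _ _ y])
      show "additive (tensor K S H) S (\<lambda>y. N (SH.\<tau> s h \<otimes>\<^bsub>Q\<^esub> y) u)"
        by (rule additive_comp[OF skew_mult_additive_right[OF s h] N_eval_additive[OF u]])
      show "additive (tensor K S H) S (\<lambda>y. N (SH.\<tau> s h) (N y u))"
        by (rule additive_comp[OF N_eval_additive[OF u] ad])
      fix t g assume tg: "t \<in> carrier S" "g \<in> carrier H"
      then show "N (SH.\<tau> s h \<otimes>\<^bsub>Q\<^esub> SH.\<tau> t g) u = N (SH.\<tau> s h) (N (SH.\<tau> t g) u)"
        using u act_closed[OF dual_functional[of g] u]
        by (simp add: skew_mult_pure[OF s h] N_smash_pure[OF s h] N_pure[OF s h] N_pure dual_hopf_simps(1))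
    qed
  qed
  show ?thesis
    by (rule SH.additive_eqI[OF _ _ _ x])
       (use 1 in \<open>auto intro!: additive_comp[OF skew_mult_additive_left[OF y] N_eval_additive[OF u]] N_eval_additive vc y\<close>)
qed

lemma N_hom:
  assumes x: "x \<in> carrier Q" and y: "y \<in> carrier Q"
  shows "N (x \<otimes>\<^bsub>Q\<^esub> y) = N x \<otimes>\<^bsub>End_S\<^esub> N y"
proof -
  note xy = x[unfolded skew_simps] y[unfolded skew_simps]
  show ?thesis
  proof (rule extensionalityI)
    show "N (x \<otimes>\<^bsub>Q\<^esub> y) \<in> extensional (carrier S)"
      by (rule End_S_D(4)[OF N_closed]) (use skew_mult_closed[OF x y] in \<open>simp add: skew_simps(1)\<close>)
  qed (simp_all add: N_mult[OF xy] compose_def)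
qed

lemma one_H_closed: "\<one>\<^bsub>H\<^esub> \<in> carrier D"
  unfolding dual_hopf_simps by (rule dual_restrict[OF counit_functional])

lemma act_one_H: "s \<in> carrier S \<Longrightarrow> act \<one>\<^bsub>H\<^esub> s = s"
  unfolding dual_hopf_simps
  using ev_cong[of "counit A" "restrict (counit A) (carrier A)" "\<rho> s"] counit_functional
  by (simp add: coaction_closed act_counit)

lemma N_one: "N \<one>\<^bsub>Q\<^esub> = \<one>\<^bsub>End_S\<^esub>"
  by (auto simp: skew_simps N_pure one_H_closed act_one_H intro!: restrict_ext)

lemma N_smult:
  assumes r: "r \<in> carrier R" and x: "x \<in> carrier Q"
  shows "N (r \<odot>\<^bsub>Q\<^esub> x) = r \<odot>\<^bsub>End_S\<^esub> N x"
proof -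
  have rS: "r \<in> carrier S" using r by simp
  have rc: "SH.\<tau> r \<one>\<^bsub>H\<^esub> \<in> carrier Q" unfolding skew_simps(1) by (rule SH.pure_closed[OF rS]) (use one_H_closed in \<open>simp add: dual_hopf_simps(1)\<close>)
  have "N (r \<odot>\<^bsub>Q\<^esub> x) = compose (carrier S) (N (SH.\<tau> r \<one>\<^bsub>H\<^esub>)) (N x)"
    unfolding skew_simps(6) using N_hom[OF rc x] by simp
  also have "\<dots> = r \<odot>\<^bsub>End_S\<^esub> N x"
    using End_S_D(1)[OF N_closed[OF x[unfolded skew_simps]]]
    unfolding N_pure[OF rS one_H_closed] compose_def
    by (simp add: act_one_H cong: restrict_cong)
  finally show ?thesis .
qed

lemma abelian_group_skew: "abelian_group Q"
  by (rule abelian_groupI)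
     (simp_all add: skew_simps(1-3) SH.T.a_ac SH.T.add.l_inv_ex[simplified])

lemma skew_algebra_if_bijective:
  assumes "bij_betw N (carrier Q) (carrier End_S)"
  shows "assoc_algebra R Q \<and> assoc_algebra R End_S \<and> N \<in> algebra_isos R Q End_S"
proof -
  have inj: "inj_on N (carrier Q)" using assms by (simp add: bij_betw_def)
  have one: "\<one>\<^bsub>Q\<^esub> \<in> carrier Q"
    unfolding skew_simps by (rule SH.pure_closed) (use one_H_closed in \<open>simp_all add: dual_hopf_simps(1)\<close>)
  have smult: "r \<odot>\<^bsub>Q\<^esub> x \<in> carrier Q" if "r \<in> carrier R" "x \<in> carrier Q" for r x
    unfolding skew_simps(6)
    by (rule skew_mult_closed[OF _ that(2)], unfold skew_simps(1), rule SH.pure_closed)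
       (use that one_H_closed in \<open>simp_all add: dual_hopf_simps(1)\<close>)
  have closed: "N x \<in> carrier End_S" if "x \<in> carrier Q" for x by (rule N_closed[OF that[unfolded skew_simps]])
  have add: "N (x \<oplus>\<^bsub>Q\<^esub> y) = N x \<oplus>\<^bsub>End_S\<^esub> N y" if "x \<in> carrier Q" "y \<in> carrier Q" for x y
    unfolding skew_simps(2) by (rule additive_add[OF N_additive that[unfolded skew_simps]])
  have "assoc_algebra R Q"
    by (rule assoc_algebra_transport[OF assoc_algebra_End_S abelian_group_skew skew_mult_closed one smult inj closed add N_hom N_one N_smult])
  moreover have "N \<in> linear_maps R Q End_S" by (rule linear_mapsI) (fact closed add N_smult)+
  moreover have "N \<in> ring_hom Q End_S" by (rule ring_hom_memI) (fact closed add N_hom N_one)+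
  ultimately show ?thesis
    using assms assoc_algebra_End_S by (simp add: algebra_isos_def ring_iso_def)
qed

end

section \<open>The orbit morphism\<close>

sublocale action \<subseteq> SS: tensor_algebra "invariants K A S \<rho>" "regular S" "regular S"
  by (rule tensor_algebra.intro[OF algebra_regular algebra_regular])

context action
begin

abbreviation "\<psi> \<equiv> orbit_comorphism K A S \<rho>"
abbreviation "C \<equiv> tensor R (regular S) (regular S)"
abbreviation "B \<equiv> tensor K S A"

text \<open>Scalars from \<open>R\<close> may cross the tensor sign precisely because
  \<open>\<rho> r = r \<otimes> 1\<close> for an invariant \<open>r\<close>.\<close>

lemma orbit_balanced: "balanced R (regular S) (regular S) B (\<lambda>s t. SA.\<tau> s \<one>\<^bsub>A\<^esub> \<otimes>\<^bsub>B\<^esub> \<rho> t)"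
proof (rule balancedI)
  show "SA.\<tau> s \<one>\<^bsub>A\<^esub> \<otimes>\<^bsub>B\<^esub> \<rho> t \<in> carrier B" if "s \<in> carrier (regular S)" "t \<in> carrier (regular S)" for s t
    using that by (simp add: coaction_closed)
  show "SA.\<tau> (s \<oplus>\<^bsub>regular S\<^esub> s') \<one>\<^bsub>A\<^esub> \<otimes>\<^bsub>B\<^esub> \<rho> t = SA.\<tau> s \<one>\<^bsub>A\<^esub> \<otimes>\<^bsub>B\<^esub> \<rho> t \<oplus>\<^bsub>B\<^esub> SA.\<tau> s' \<one>\<^bsub>A\<^esub> \<otimes>\<^bsub>B\<^esub> \<rho> t"
    if "s \<in> carrier (regular S)" "s' \<in> carrier (regular S)" "t \<in> carrier (regular S)" for s s' t
    using that by (simp add: coaction_closed SA.pure_add_left SA.T.l_distr)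
  show "SA.\<tau> s \<one>\<^bsub>A\<^esub> \<otimes>\<^bsub>B\<^esub> \<rho> (t \<oplus>\<^bsub>regular S\<^esub> t') = SA.\<tau> s \<one>\<^bsub>A\<^esub> \<otimes>\<^bsub>B\<^esub> \<rho> t \<oplus>\<^bsub>B\<^esub> SA.\<tau> s \<one>\<^bsub>A\<^esub> \<otimes>\<^bsub>B\<^esub> \<rho> t'"
    if "s \<in> carrier (regular S)" "t \<in> carrier (regular S)" "t' \<in> carrier (regular S)" for s t t'
    using that by (simp add: coaction_closed additive_add[OF coaction_additive] SA.T.r_distr)
  show "SA.\<tau> (r \<odot>\<^bsub>regular S\<^esub> s) \<one>\<^bsub>A\<^esub> \<otimes>\<^bsub>B\<^esub> \<rho> t = SA.\<tau> s \<one>\<^bsub>A\<^esub> \<otimes>\<^bsub>B\<^esub> \<rho> (r \<odot>\<^bsub>regular S\<^esub> t)"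
    if "r \<in> carrier R" "s \<in> carrier (regular S)" "t \<in> carrier (regular S)" for r s t
  proof -
    have c: "r \<in> carrier S" "s \<in> carrier S" "t \<in> carrier S" "\<rho> r = SA.\<tau> r \<one>\<^bsub>A\<^esub>" using that by auto
    have "SA.\<tau> (r \<otimes>\<^bsub>S\<^esub> s) \<one>\<^bsub>A\<^esub> = SA.\<tau> s \<one>\<^bsub>A\<^esub> \<otimes>\<^bsub>B\<^esub> SA.\<tau> r \<one>\<^bsub>A\<^esub>"
      using c by (simp add: SA.mult_pure S.m_comm)
    then show ?thesis using c by (simp add: coaction_mult coaction_closed SA.T.m_assoc)
  qed
qed

lemmas orbit_additive = SS.lift_additive'[OF SA.group_facts orbit_balanced, folded orbit_comorphism_def]

lemma orbit_pure: "s \<in> carrier S \<Longrightarrow> t \<in> carrier S \<Longrightarrow> \<psi> (SS.\<tau> s t) = SA.\<tau> s \<one>\<^bsub>A\<^esub> \<otimes>\<^bsub>B\<^esub> \<rho> t"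
  using SS.lift_pure'[OF SA.group_facts orbit_balanced, of s t] by (simp add: orbit_comorphism_def)

lemma orbit_pure_left: "s \<in> carrier S \<Longrightarrow> \<psi> (SS.\<tau> s \<one>\<^bsub>S\<^esub>) = SA.\<tau> s \<one>\<^bsub>A\<^esub>"
  by (simp add: orbit_pure coaction_one)

lemma SS_mult_pure: "s \<in> carrier S \<Longrightarrow> t \<in> carrier S \<Longrightarrow> s' \<in> carrier S \<Longrightarrow> t' \<in> carrier S \<Longrightarrow>
   SS.\<tau> s t \<otimes>\<^bsub>C\<^esub> SS.\<tau> s' t' = SS.\<tau> (s \<otimes>\<^bsub>S\<^esub> s') (t \<otimes>\<^bsub>S\<^esub> t')"
  using SS.mult_pure[of s t s' t'] by simp

lemma SS_pure_closed: "s \<in> carrier S \<Longrightarrow> t \<in> carrier S \<Longrightarrow> SS.\<tau> s t \<in> carrier C"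
  by (rule SS.pure_closed) simp_all

lemma orbit_mult:
  assumes z: "z \<in> carrier C" and w: "w \<in> carrier C"
  shows "\<psi> (z \<otimes>\<^bsub>C\<^esub> w) = \<psi> z \<otimes>\<^bsub>B\<^esub> \<psi> w"
proof -
  have mB: "additive B B (\<lambda>x. y \<otimes>\<^bsub>B\<^esub> x)" "additive B B (\<lambda>x. x \<otimes>\<^bsub>B\<^esub> y)" if "y \<in> carrier B" for y
    by (rule SA.mult_additive_right[OF that], rule SA.mult_additive_left[OF that])
  have cl: "\<psi> z \<in> carrier B" if "z \<in> carrier C" for z by (rule additive_closed[OF orbit_additive that])
  have 1: "\<psi> (SS.\<tau> s t \<otimes>\<^bsub>C\<^esub> w) = \<psi> (SS.\<tau> s t) \<otimes>\<^bsub>B\<^esub> \<psi> w" if st: "s \<in> carrier S" "t \<in> carrier S" for s t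
  proof (rule SS.additive_eqI[OF _ _ _ w])
    note c = SS_pure_closed[OF st]
    show "additive C B (\<lambda>w. \<psi> (SS.\<tau> s t \<otimes>\<^bsub>C\<^esub> w))"
      by (rule additive_comp[OF SS.mult_additive_right[OF c] orbit_additive])
    show "additive C B (\<lambda>w. \<psi> (SS.\<tau> s t) \<otimes>\<^bsub>B\<^esub> \<psi> w)"
      by (rule additive_comp[OF orbit_additive mB(1)[OF cl[OF c]]])
    fix s' t' assume "s' \<in> carrier (regular S)" "t' \<in> carrier (regular S)"
    then have c': "s' \<in> carrier S" "t' \<in> carrier S" by simp_all
    have "\<psi> (SS.\<tau> s t \<otimes>\<^bsub>C\<^esub> SS.\<tau> s' t') = (SA.\<tau> s \<one>\<^bsub>A\<^esub> \<otimes>\<^bsub>B\<^esub> SA.\<tau> s' \<one>\<^bsub>A\<^esub>) \<otimes>\<^bsub>B\<^esub> (\<rho> t \<otimes>\<^bsub>B\<^esub> \<rho> t')"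
      using st c' by (simp add: SS_mult_pure orbit_pure coaction_mult SA.mult_pure)
    also have "\<dots> = (SA.\<tau> s \<one>\<^bsub>A\<^esub> \<otimes>\<^bsub>B\<^esub> \<rho> t) \<otimes>\<^bsub>B\<^esub> (SA.\<tau> s' \<one>\<^bsub>A\<^esub> \<otimes>\<^bsub>B\<^esub> \<rho> t')"
      using st c' by (simp only: SA.T.m_ac SA.T.m_closed SA.pure_closed A.one_closed coaction_closed)
    finally show "\<psi> (SS.\<tau> s t \<otimes>\<^bsub>C\<^esub> SS.\<tau> s' t') = \<psi> (SS.\<tau> s t) \<otimes>\<^bsub>B\<^esub> \<psi> (SS.\<tau> s' t')"
      using st c' by (simp add: orbit_pure)
  qed
  show ?thesis
  proof (rule SS.additive_eqI[OF _ _ _ z])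
    show "additive C B (\<lambda>z. \<psi> (z \<otimes>\<^bsub>C\<^esub> w))"
      by (rule additive_comp[OF SS.mult_additive_left[OF w] orbit_additive])
    show "additive C B (\<lambda>z. \<psi> z \<otimes>\<^bsub>B\<^esub> \<psi> w)"
      by (rule additive_comp[OF orbit_additive mB(2)[OF cl[OF w]]])
  qed (simp add: 1)
qed

lemma orbit_ring_hom: "\<psi> \<in> ring_hom C B"
proof (rule ring_hom_memI)
  show "\<psi> \<one>\<^bsub>C\<^esub> = \<one>\<^bsub>B\<^esub>"
    unfolding SS.one_tensor SA.one_tensor by (simp add: orbit_pure_left)
qed (simp_all add: orbit_mult additive_closed[OF orbit_additive] additive_add[OF orbit_additive])

lemma left_ring_homs:
  shows SA_left: "(\<lambda>s. SA.\<tau> s \<one>\<^bsub>A\<^esub>) \<in> ring_hom S B" and SS_left: "(\<lambda>s. SS.\<tau> s \<one>\<^bsub>S\<^esub>) \<in> ring_hom S C"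
    and SS_right: "(\<lambda>s. SS.\<tau> \<one>\<^bsub>S\<^esub> s) \<in> ring_hom S C" and SS_base: "(\<lambda>r. SS.\<tau> r \<one>\<^bsub>S\<^esub>) \<in> ring_hom R C"
proof -
  show "(\<lambda>s. SA.\<tau> s \<one>\<^bsub>A\<^esub>) \<in> ring_hom S B"
    by (rule ring_hom_memI) (simp_all add: SA.mult_pure SA.pure_add_left SA.one_tensor)
  show l: "(\<lambda>s. SS.\<tau> s \<one>\<^bsub>S\<^esub>) \<in> ring_hom S C"
    by (rule ring_hom_memI)
       (use SS.pure_add_left[of _ _ "\<one>\<^bsub>S\<^esub>"] in \<open>simp_all add: SS_pure_closed SS_mult_pure SS.one_tensor\<close>)
  show "(\<lambda>s. SS.\<tau> \<one>\<^bsub>S\<^esub> s) \<in> ring_hom S C"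
    by (rule ring_hom_memI)
       (use SS.pure_add_right[of "\<one>\<^bsub>S\<^esub>"] in \<open>simp_all add: SS_pure_closed SS_mult_pure SS.one_tensor\<close>)
  show "(\<lambda>r. SS.\<tau> r \<one>\<^bsub>S\<^esub>) \<in> ring_hom R C"
    using l by (simp add: ring_hom_def)
qed

lemma pure_pow:
  assumes "s \<in> carrier S"
  shows "SA.\<tau> s \<one>\<^bsub>A\<^esub> [^]\<^bsub>B\<^esub> (k::nat) = SA.\<tau> (s [^]\<^bsub>S\<^esub> k) \<one>\<^bsub>A\<^esub>" and "SS.\<tau> s \<one>\<^bsub>S\<^esub> [^]\<^bsub>C\<^esub> k = SS.\<tau> (s [^]\<^bsub>S\<^esub> k) \<one>\<^bsub>S\<^esub>"
  by (induction k) (simp_all add: assms SA.one_tensor SS.one_tensor SA.mult_pure SS_mult_pure)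

text \<open>An invariant \<open>r\<close> satisfies \<open>r \<otimes> 1 = 1 \<otimes> r\<close> in
  \<open>C\<close>. Hence, where this element does not vanish, both projections avoid
  \<open>Z\<close> and the image in \<open>Spec R\<close> avoids the image of \<open>Z\<close>, all
  of whose points contain \<open>r\<close>. The basic open set of \<open>r\<close> thus lies inside
  the open set on which freeness is given, and likewise in \<open>Spec B\<close>.\<close>

lemma basic_open_over_invariant:
  assumes alg_closed: "algebraically_closed K" and p: "0 < (p::nat)" "[p] \<cdot>\<^bsub>K\<^esub> \<one>\<^bsub>K\<^esub> = \<zero>\<^bsub>K\<^esub>"
    and Z: "closedin (zariski S) Z"
    and stable: "\<And>Q. Q \<in> Spec B \<Longrightarrow> Spec_map S (\<lambda>s. SA.\<tau> s \<one>\<^bsub>A\<^esub>) Q \<in> Spec S - Z \<Longrightarrow> Spec_map S \<rho> Q \<in> Spec S - Z"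
    and iso: "restricts_to_iso C B \<psi> {Q \<in> Spec B. Spec_map S (\<lambda>s. SA.\<tau> s \<one>\<^bsub>A\<^esub>) Q \<in> Spec S - Z}
        {Q \<in> Spec C. Spec_map S (\<lambda>s. SS.\<tau> s \<one>\<^bsub>S\<^esub>) Q \<in> Spec S - Z \<and> Spec_map S (\<lambda>s. SS.\<tau> \<one>\<^bsub>S\<^esub> s) Q \<in> Spec S - Z \<and>
           Spec_map R (\<lambda>r. SS.\<tau> r \<one>\<^bsub>S\<^esub>) Q \<in> Spec R - Spec_map R (\<lambda>r. r) ` Z}"
    and P: "P \<in> Spec S - Z"
  obtains r where "r \<in> carrier S" "r \<notin> P"
    "\<And>b. b \<in> carrier B \<Longrightarrow> \<exists>k::nat. \<exists>c\<in>carrier C. \<psi> c = SA.\<tau> (r [^]\<^bsub>S\<^esub> k) \<one>\<^bsub>A\<^esub> \<otimes>\<^bsub>B\<^esub> b"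
    "\<And>z. z \<in> carrier C \<Longrightarrow> \<psi> z = \<zero>\<^bsub>B\<^esub> \<Longrightarrow> \<exists>k::nat. SS.\<tau> (r [^]\<^bsub>S\<^esub> k) \<one>\<^bsub>S\<^esub> \<otimes>\<^bsub>C\<^esub> z = \<zero>\<^bsub>C\<^esub>"
proof -
  obtain r where r: "r \<in> carrier R" "\<And>P'. P' \<in> Z \<Longrightarrow> r \<in> P'" "r \<notin> P"
    using invariant_outside[OF alg_closed p Z stable P] by blast
  have rS: "r \<in> carrier S" using r(1) by simp
  have r1: "SS.\<tau> \<one>\<^bsub>S\<^esub> r = SS.\<tau> r \<one>\<^bsub>S\<^esub>" using SS.pure_smult[of r "\<one>\<^bsub>S\<^esub>" "\<one>\<^bsub>S\<^esub>"] r(1) rS by simp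
  let ?f = "SS.\<tau> r \<one>\<^bsub>S\<^esub>"
  have f: "?f \<in> carrier C" by (rule SS_pure_closed[OF rS S.one_closed])
  let ?VG = "{Q \<in> Spec B. Spec_map S (\<lambda>s. SA.\<tau> s \<one>\<^bsub>A\<^esub>) Q \<in> Spec S - Z}"
  let ?VV = "{Q \<in> Spec C. Spec_map S (\<lambda>s. SS.\<tau> s \<one>\<^bsub>S\<^esub>) Q \<in> Spec S - Z \<and> Spec_map S (\<lambda>s. SS.\<tau> \<one>\<^bsub>S\<^esub> s) Q \<in> Spec S - Z \<and>
           Spec_map R (\<lambda>r. SS.\<tau> r \<one>\<^bsub>S\<^esub>) Q \<in> Spec R - Spec_map R (\<lambda>r. r) ` Z}"
  have VV: "{Q \<in> Spec C. ?f \<notin> Q} \<subseteq> ?VV"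
  proof (intro subsetI CollectI conjI DiffI)
    fix Q assume "Q \<in> {Q \<in> Spec C. ?f \<notin> Q}"
    then have Q: "Q \<in> Spec C" "?f \<notin> Q" by auto
    show "Q \<in> Spec C" by fact
    show "Spec_map S (\<lambda>s. SS.\<tau> s \<one>\<^bsub>S\<^esub>) Q \<in> Spec S"
      by (rule Spec_map_Spec[OF S.is_cring SS.cring_tensor SS_left Q(1)])
    show "Spec_map S (\<lambda>s. SS.\<tau> \<one>\<^bsub>S\<^esub> s) Q \<in> Spec S"
      by (rule Spec_map_Spec[OF S.is_cring SS.cring_tensor SS_right Q(1)])
    show "Spec_map R (\<lambda>r. SS.\<tau> r \<one>\<^bsub>S\<^esub>) Q \<in> Spec R"
      by (rule Spec_map_Spec[OF cring_invariants SS.cring_tensor SS_base Q(1)])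
    show "Spec_map S (\<lambda>s. SS.\<tau> s \<one>\<^bsub>S\<^esub>) Q \<notin> Z" "Spec_map S (\<lambda>s. SS.\<tau> \<one>\<^bsub>S\<^esub> s) Q \<notin> Z"
      using r(2) Q(2) r1 by (fastforce simp: Spec_map_def)+
    show "Spec_map R (\<lambda>r. SS.\<tau> r \<one>\<^bsub>S\<^esub>) Q \<notin> Spec_map R (\<lambda>r. r) ` Z"
    proof
      assume "Spec_map R (\<lambda>r. SS.\<tau> r \<one>\<^bsub>S\<^esub>) Q \<in> Spec_map R (\<lambda>r. r) ` Z"
      then obtain P' where P': "P' \<in> Z" "Spec_map R (\<lambda>r. SS.\<tau> r \<one>\<^bsub>S\<^esub>) Q = Spec_map R (\<lambda>r. r) P'" by blast
      have "r \<in> Spec_map R (\<lambda>r. r) P'" unfolding Spec_map_def using r(1) r(2)[OF P'(1)] by blast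
      then have "r \<in> Spec_map R (\<lambda>r. SS.\<tau> r \<one>\<^bsub>S\<^esub>) Q" using P'(2) by simp
      then show False using Q(2) by (simp add: Spec_map_def)
    qed
  qed
  have VG: "{Q \<in> Spec B. \<psi> ?f \<notin> Q} \<subseteq> ?VG"
  proof (intro subsetI CollectI conjI DiffI)
    fix Q assume "Q \<in> {Q \<in> Spec B. \<psi> ?f \<notin> Q}"
    then have Q: "Q \<in> Spec B" "SA.\<tau> r \<one>\<^bsub>A\<^esub> \<notin> Q" using orbit_pure_left[OF rS] by auto
    show "Q \<in> Spec B" by fact
    show "Spec_map S (\<lambda>s. SA.\<tau> s \<one>\<^bsub>A\<^esub>) Q \<in> Spec S"
      by (rule Spec_map_Spec[OF S.is_cring SA.cring_tensor SA_left Q(1)])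
    show "Spec_map S (\<lambda>s. SA.\<tau> s \<one>\<^bsub>A\<^esub>) Q \<notin> Z"
      using r(2) Q(2) by (fastforce simp: Spec_map_def)
  qed
  interpret L: iso_on_basic_open C B \<psi> ?VG ?VV ?f
    by (intro iso_on_basic_open.intro iso_on_basic_open_axioms.intro ring_hom_cring.intro ring_hom_cring_axioms.intro
          SS.cring_tensor SA.cring_tensor orbit_ring_hom iso f VV VG) blast
  show ?thesis
  proof (rule that[OF rS r(3)])
    show "\<exists>k::nat. \<exists>c\<in>carrier C. \<psi> c = SA.\<tau> (r [^]\<^bsub>S\<^esub> k) \<one>\<^bsub>A\<^esub> \<otimes>\<^bsub>B\<^esub> b" if b: "b \<in> carrier B" for b
    proof -
      obtain k :: nat and c where kc: "c \<in> carrier C" "\<psi> c = \<psi> (?f [^]\<^bsub>C\<^esub> k) \<otimes>\<^bsub>B\<^esub> b" using L.denominator[OF b] by blast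
      have "\<psi> (?f [^]\<^bsub>C\<^esub> k) = SA.\<tau> (r [^]\<^bsub>S\<^esub> k) \<one>\<^bsub>A\<^esub>"
        unfolding pure_pow(2)[OF rS] by (rule orbit_pure_left) (simp add: rS)
      with kc show ?thesis by auto
    qed
    show "\<exists>k::nat. SS.\<tau> (r [^]\<^bsub>S\<^esub> k) \<one>\<^bsub>S\<^esub> \<otimes>\<^bsub>C\<^esub> z = \<zero>\<^bsub>C\<^esub>" if "z \<in> carrier C" "\<psi> z = \<zero>\<^bsub>B\<^esub>" for z
      using L.kernel_torsion[OF that] unfolding pure_pow(2)[OF rS] .
  qed
qed

end

section \<open>Bijectivity of the natural homomorphism\<close>

text \<open>Here the scheme language is left behind. \<open>denominators\<close> is freeness at a
  prime outside \<open>Z\<close>, and \<open>below\<close> is height at least two for the primes in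
  \<open>Z\<close>; the latter also keeps the generic point \<open>{\<zero>}\<close> out of
  \<open>Z\<close>.\<close>

locale generically_free_action = dual_action K A S \<rho> E e
  for K :: "('k, 'c) ring_scheme" and A :: "('k, 'a) hopf" and S :: "('k, 's) module" and \<rho> E e +
  fixes Z :: "'s set set"
  assumes domain_S: "domain S"
    and denominators: "\<And>P. P \<in> Spec S - Z \<Longrightarrow> \<exists>r\<in>carrier S - P.
      (\<forall>b\<in>carrier (tensor K S A). \<exists>k::nat. \<exists>c\<in>carrier (tensor (invariants K A S \<rho>) (regular S) (regular S)).
         orbit_comorphism K A S \<rho> c = pure_tensor K S A (r [^]\<^bsub>S\<^esub> k) \<one>\<^bsub>A\<^esub> \<otimes>\<^bsub>tensor K S A\<^esub> b) \<and>
      (\<forall>z\<in>carrier (tensor (invariants K A S \<rho>) (regular S) (regular S)). orbit_comorphism K A S \<rho> z = \<zero>\<^bsub>tensor K S A\<^esub> \<longrightarrow>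
         (\<exists>k::nat. pure_tensor (invariants K A S \<rho>) (regular S) (regular S) (r [^]\<^bsub>S\<^esub> k) \<one>\<^bsub>S\<^esub>
            \<otimes>\<^bsub>tensor (invariants K A S \<rho>) (regular S) (regular S)\<^esub> z = \<zero>\<^bsub>tensor (invariants K A S \<rho>) (regular S) (regular S)\<^esub>))"
    and below: "\<And>P. P \<in> Z \<Longrightarrow> \<exists>c. primeideal c S \<and> c \<noteq> {\<zero>\<^bsub>S\<^esub>} \<and> c \<subset> P"
begin

interpretation D: domain S by (rule domain_S)

lemma cancel_power:
  assumes "r \<in> carrier S" "r \<noteq> \<zero>\<^bsub>S\<^esub>" "x \<in> carrier S" "y \<in> carrier S" "r [^]\<^bsub>S\<^esub> (k::nat) \<otimes>\<^bsub>S\<^esub> x = r [^]\<^bsub>S\<^esub> k \<otimes>\<^bsub>S\<^esub> y"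
  shows "x = y"
proof -
  have "r [^]\<^bsub>S\<^esub> k \<noteq> \<zero>\<^bsub>S\<^esub>" by (induction k) (simp_all add: assms(1,2) D.integral_iff)
  then show ?thesis using assms D.m_lcancel[of "r [^]\<^bsub>S\<^esub> k" x y] by simp
qed

text \<open>The case of the zero prime: it has no prime strictly below it and so does not belong to
  \<open>Z\<close>.\<close>

lemma generic_denominators:
  obtains r where "r \<in> carrier S" "r \<noteq> \<zero>\<^bsub>S\<^esub>"
    "\<And>b. b \<in> carrier B \<Longrightarrow> \<exists>k::nat. \<exists>c\<in>carrier C. \<psi> c = SA.\<tau> (r [^]\<^bsub>S\<^esub> k) \<one>\<^bsub>A\<^esub> \<otimes>\<^bsub>B\<^esub> b"
    "\<And>z. z \<in> carrier C \<Longrightarrow> \<psi> z = \<zero>\<^bsub>B\<^esub> \<Longrightarrow> \<exists>k::nat. SS.\<tau> (r [^]\<^bsub>S\<^esub> k) \<one>\<^bsub>S\<^esub> \<otimes>\<^bsub>C\<^esub> z = \<zero>\<^bsub>C\<^esub>"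
proof -
  have "primeideal {\<zero>\<^bsub>S\<^esub>} S" using S.domain_eq_zeroprimeideal domain_S by simp
  moreover have "{\<zero>\<^bsub>S\<^esub>} \<notin> Z"
  proof
    assume "{\<zero>\<^bsub>S\<^esub>} \<in> Z"
    then obtain c where c: "primeideal c S" "c \<noteq> {\<zero>\<^bsub>S\<^esub>}" "c \<subset> {\<zero>\<^bsub>S\<^esub>}" using below by blast
    have "\<zero>\<^bsub>S\<^esub> \<in> c" using c(1) by (simp add: primeideal.axioms(1) ideal.axioms(1) additive_subgroup.zero_closed)
    then show False using c by blast
  qed
  ultimately have "{\<zero>\<^bsub>S\<^esub>} \<in> Spec S - Z" by (simp add: Spec_def)
  from denominators[OF this] show ?thesis using that by blast
qed

section \<open>Injectivity: elements of \<open>S \<otimes> H\<close> as functionals on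
  \<open>A\<close> with values in \<open>S\<close>\<close>

definition coefficient :: "'a \<Rightarrow> ('s \<times> ('a \<Rightarrow> 'k) \<Rightarrow>\<^sub>0 int) set \<Rightarrow> 's" where
  "coefficient b = tensor_lift (add_monoid S) (\<lambda>s h. h b \<odot>\<^bsub>S\<^esub> s)"

lemma coefficient_balanced: "b \<in> carrier A \<Longrightarrow> balanced K S H S (\<lambda>s h. h b \<odot>\<^bsub>S\<^esub> s)"
proof (rule balancedI)
  assume b: "b \<in> carrier A"
  have h: "h b \<in> carrier K" if "h \<in> carrier H" for h
    using functionalD(1)[OF dual_functional[of h] b] that by (simp add: dual_hopf_simps)
  show "h b \<odot>\<^bsub>S\<^esub> s \<in> carrier S" if "s \<in> carrier S" "h \<in> carrier H" for s h using that h by simp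
  show "h b \<odot>\<^bsub>S\<^esub> (s \<oplus>\<^bsub>S\<^esub> s') = h b \<odot>\<^bsub>S\<^esub> s \<oplus>\<^bsub>S\<^esub> h b \<odot>\<^bsub>S\<^esub> s'" if "s \<in> carrier S" "s' \<in> carrier S" "h \<in> carrier H" for s s' h
    using that h by (simp add: S.smult_r_distr)
  show "(h \<oplus>\<^bsub>H\<^esub> h') b \<odot>\<^bsub>S\<^esub> s = h b \<odot>\<^bsub>S\<^esub> s \<oplus>\<^bsub>S\<^esub> h' b \<odot>\<^bsub>S\<^esub> s" if "s \<in> carrier S" "h \<in> carrier H" "h' \<in> carrier H" for s h h'
    using that h b by (simp add: dual_hopf_simps(3) dual_apply S.smult_l_distr)
  show "h b \<odot>\<^bsub>S\<^esub> (r \<odot>\<^bsub>S\<^esub> s) = (r \<odot>\<^bsub>H\<^esub> h) b \<odot>\<^bsub>S\<^esub> s" if "r \<in> carrier K" "s \<in> carrier S" "h \<in> carrier H" for r s h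
    using that h b by (simp add: dual_hopf_simps(4) dual_apply S.smult_assoc1[symmetric] K.m_comm)
qed

lemmas coefficient_additive = SH.lift_additive[OF S.M.abelian_group_axioms coefficient_balanced, folded coefficient_def]
lemmas coefficient_closed = additive_closed[OF coefficient_additive]

lemma coefficient_pure: "b \<in> carrier A \<Longrightarrow> s \<in> carrier S \<Longrightarrow> h \<in> carrier D \<Longrightarrow> coefficient b (SH.\<tau> s h) = h b \<odot>\<^bsub>S\<^esub> s"
  using SH.lift_pure[OF S.M.abelian_group_axioms coefficient_balanced, of b s h]
  by (simp add: coefficient_def dual_hopf_simps(1))

lemma SH_pure_closed: "s \<in> carrier S \<Longrightarrow> h \<in> carrier D \<Longrightarrow> SH.\<tau> s h \<in> carrier (tensor K S H)"
  by (rule SH.pure_closed) (simp_all add: dual_hopf_simps(1))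

text \<open>\<open>coefficient b x\<close> is the value at \<open>b\<close> of \<open>x\<close> as a
  functional on \<open>A\<close>. The expansion of an ordinary functional along the dual basis
  extends to values in \<open>S\<close>.\<close>

lemma SH_expansion:
  assumes x: "x \<in> carrier (tensor K S H)"
  shows "x = finsum (tensor K S H) (\<lambda>b. SH.\<tau> (coefficient b x) (e b)) E"
proof (rule SH.additive_eqI[OF additive_id _ _ x])
  have "additive (tensor K S H) (tensor K S H) (\<lambda>x. SH.\<tau> (coefficient b x) (e b))" if b: "b \<in> E" for b
    by (rule additiveI)
       (use coefficient_closed[OF E_closed[OF b]] additive_add[OF coefficient_additive[OF E_closed[OF b]]] e_dual[OF b]
        in \<open>simp_all add: SH_pure_closed SH_pure_add\<close>)
  then show "additive (tensor K S H) (tensor K S H) (\<lambda>x. finsum (tensor K S H) (\<lambda>b. SH.\<tau> (coefficient b x) (e b)) E)"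
    by (rule additive_sum[OF SH.abelian_group_tensor finite_E])
  fix s h assume s: "s \<in> carrier S" and "h \<in> carrier H"
  then have h: "h \<in> carrier D" by (simp add: dual_hopf_simps(1))
  have hb: "h b \<in> carrier K" if "b \<in> E" for b by (rule functionalD(1)[OF dual_functional[OF h] E_closed[OF that]])
  have ad: "additive D (tensor K S H) (SH.\<tau> s)"
    by (rule additiveI) (simp_all add: s SH_pure_closed SH_pure_add)
  have "SH.\<tau> s h = SH.\<tau> s (finsum D (\<lambda>b. h b \<odot>\<^bsub>D\<^esub> e b) E)" using dual_expansion[OF h] by simp
  also have "\<dots> = finsum (tensor K S H) (\<lambda>b. SH.\<tau> s (h b \<odot>\<^bsub>D\<^esub> e b)) E"
    by (rule additive_finsum[OF abelian_group_D SH.abelian_group_tensor ad finite_E])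
       (simp add: dual_smult_closed hb e_dual)
  also have "\<dots> = finsum (tensor K S H) (\<lambda>b. SH.\<tau> (coefficient b (SH.\<tau> s h)) (e b)) E"
  proof (rule SH.T.finsum_cong'[OF refl])
    show "(\<lambda>b. SH.\<tau> (coefficient b (SH.\<tau> s h)) (e b)) \<in> E \<rightarrow> carrier (tensor K S H)"
      using coefficient_closed[OF E_closed SH_pure_closed[OF s h]] e_dual by (simp add: SH_pure_closed)
    show "SH.\<tau> s (h b \<odot>\<^bsub>D\<^esub> e b) = SH.\<tau> (coefficient b (SH.\<tau> s h)) (e b)" if b: "b \<in> E" for b
      by (simp add: coefficient_pure[OF E_closed[OF b] s h] SH_pure_smult[OF hb[OF b] s e_dual[OF b]])
  qed
  finally show "SH.\<tau> s h = finsum (tensor K S H) (\<lambda>b. SH.\<tau> (coefficient b (SH.\<tau> s h)) (e b)) E" .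
qed

lemma coefficient_expansion:
  assumes x: "x \<in> carrier (tensor K S H)" and a: "a \<in> carrier A"
  shows "coefficient a x = finsum S (\<lambda>b. e b a \<odot>\<^bsub>S\<^esub> coefficient b x) E"
proof (rule SH.additive_eqI[OF coefficient_additive[OF a] _ _ x])
  show "additive (tensor K S H) S (\<lambda>x. finsum S (\<lambda>b. e b a \<odot>\<^bsub>S\<^esub> coefficient b x) E)"
    by (rule additive_sum[OF S.M.abelian_group_axioms finite_E])
       (rule additive_comp[OF coefficient_additive[OF E_closed] smult_S_additive[OF e_closed[OF _ a]]])
  fix s h assume s: "s \<in> carrier S" and "h \<in> carrier H"
  then have h: "h \<in> carrier D" by (simp add: dual_hopf_simps(1))
  note hb = functionalD(1)[OF dual_functional[OF h] E_closed]
  have ad: "additive K S (\<lambda>r. r \<odot>\<^bsub>S\<^esub> s)" by (rule additiveI) (simp_all add: s S.smult_l_distr)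
  have "h a \<odot>\<^bsub>S\<^esub> s = finsum K (\<lambda>b. e b a \<otimes>\<^bsub>K\<^esub> h b) E \<odot>\<^bsub>S\<^esub> s"
    using functional_expansion[OF dual_functional[OF h] a] by simp
  also have "\<dots> = finsum S (\<lambda>b. (e b a \<otimes>\<^bsub>K\<^esub> h b) \<odot>\<^bsub>S\<^esub> s) E"
    by (rule additive_finsum[OF K.abelian_group_axioms S.M.abelian_group_axioms ad finite_E]) (simp add: e_closed[OF _ a] hb)
  also have "\<dots> = finsum S (\<lambda>b. e b a \<odot>\<^bsub>S\<^esub> coefficient b (SH.\<tau> s h)) E"
    by (rule S.finsum_cong'[OF refl])
       (auto simp: coefficient_pure[OF E_closed s h] s hb e_closed[OF _ a] S.smult_assoc1)
  finally show "coefficient a (SH.\<tau> s h) = finsum S (\<lambda>b. e b a \<odot>\<^bsub>S\<^esub> coefficient b (SH.\<tau> s h)) E"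
    by (simp add: coefficient_pure[OF a s h])
qed

lemma N_expansion:
  assumes x: "x \<in> carrier (tensor K S H)" and t: "t \<in> carrier S"
  shows "N x t = finsum S (\<lambda>b. coefficient b x \<otimes>\<^bsub>S\<^esub> act (e b) t) E"
proof -
  have cl: "SH.\<tau> (coefficient b x) (e b) \<in> carrier (tensor K S H)" if "b \<in> E" for b
    by (rule SH_pure_closed[OF coefficient_closed[OF E_closed[OF that] x] e_dual[OF that]])
  have "N x t = N (finsum (tensor K S H) (\<lambda>b. SH.\<tau> (coefficient b x) (e b)) E) t"
    using SH_expansion[OF x] by simp
  also have "\<dots> = finsum S (\<lambda>b. N (SH.\<tau> (coefficient b x) (e b)) t) E"
    by (rule additive_finsum[OF SH.abelian_group_tensor S.M.abelian_group_axioms N_eval_additive[OF t] finite_E cl])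
  also have "\<dots> = finsum S (\<lambda>b. coefficient b x \<otimes>\<^bsub>S\<^esub> act (e b) t) E"
  proof (rule S.finsum_cong'[OF refl])
    show "(\<lambda>b. coefficient b x \<otimes>\<^bsub>S\<^esub> act (e b) t) \<in> E \<rightarrow> carrier S"
      using coefficient_closed[OF E_closed x] act_closed[OF e_functional t] by simp
    show "N (SH.\<tau> (coefficient b x) (e b)) t = coefficient b x \<otimes>\<^bsub>S\<^esub> act (e b) t" if b: "b \<in> E" for b
      by (simp add: N_pure[OF coefficient_closed[OF E_closed[OF b] x] e_dual[OF b]] t)
  qed
  finally show ?thesis .
qed

text \<open>The map \<open>\<Sum> s \<otimes> a \<mapsto> \<Sum> s x(a)\<close> on \<open>S \<otimes> A\<close> factors \<open>s \<otimes> t \<mapsto> s N(x)(t)\<close> through \<^term>\<open>\<psi>\<close>; here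
  an element \<open>x\<close> of \<open>S \<otimes> H\<close> is viewed as an \<open>S\<close>-valued functional on \<open>A\<close>.\<close>

lemma N_kernel:
  assumes x: "x \<in> carrier (tensor K S H)" and zero: "\<And>t. t \<in> carrier S \<Longrightarrow> N x t = \<zero>\<^bsub>S\<^esub>"
  shows "x = \<zero>\<^bsub>tensor K S H\<^esub>"
proof -
  define \<theta> where "\<theta> z = finsum S (\<lambda>b. coefficient b x \<otimes>\<^bsub>S\<^esub> ev (e b) z) E" for z
  have cx: "coefficient b x \<in> carrier S" if "b \<in> E" for b by (rule coefficient_closed[OF E_closed[OF that] x])
  have mS: "additive S S (\<lambda>y. s \<otimes>\<^bsub>S\<^esub> y)" if "s \<in> carrier S" for s
    by (rule additiveI) (use that in \<open>simp_all add: S.r_distr\<close>)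
  have \<theta>: "additive B S \<theta>"
    unfolding \<theta>_def by (rule additive_sum[OF S.M.abelian_group_axioms finite_E])
      (rule additive_comp[OF ev_additive[OF e_functional] mS[OF cx]])
  have \<theta>_mult: "\<theta> (SA.\<tau> s \<one>\<^bsub>A\<^esub> \<otimes>\<^bsub>B\<^esub> z) = s \<otimes>\<^bsub>S\<^esub> \<theta> z" if s: "s \<in> carrier S" and z: "z \<in> carrier B" for s z
  proof -
    have c: "coefficient b x \<otimes>\<^bsub>S\<^esub> ev (e b) z \<in> carrier S" if "b \<in> E" for b
      using cx[OF that] ev_closed[OF e_functional[OF that] z] by simp
    have "\<theta> (SA.\<tau> s \<one>\<^bsub>A\<^esub> \<otimes>\<^bsub>B\<^esub> z) = finsum S (\<lambda>b. s \<otimes>\<^bsub>S\<^esub> (coefficient b x \<otimes>\<^bsub>S\<^esub> ev (e b) z)) E"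
      unfolding \<theta>_def
      by (rule S.finsum_cong'[OF refl])
         (use s z in \<open>simp_all add: cx ev_closed[OF e_functional] ev_left_mult[OF e_functional] S.m_lcomm\<close>)
    also have "\<dots> = s \<otimes>\<^bsub>S\<^esub> \<theta> z"
      unfolding \<theta>_def by (rule S.finsum_rdistr[symmetric, OF finite_E s]) (use c in simp)
    finally show ?thesis .
  qed
  \<comment> \<open>On \<open>\<psi> (s \<otimes> t)\<close> the map \<open>\<theta>\<close> takes
    the value \<open>s\<close> times \<open>N x t\<close>, so vanishing of the operator means
    vanishing on the image of \<open>\<psi>\<close>.\<close>
  have kill: "\<theta> (\<psi> c) = \<zero>\<^bsub>S\<^esub>" if c: "c \<in> carrier C" for c
  proof (rule SS.additive_eqI[OF additive_comp[OF orbit_additive \<theta>] _ _ c])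
    show "additive C S (\<lambda>_. \<zero>\<^bsub>S\<^esub>)" by (rule additiveI) simp_all
    fix s t assume "s \<in> carrier (regular S)" "t \<in> carrier (regular S)"
    then have st: "s \<in> carrier S" "t \<in> carrier S" by simp_all
    have "\<theta> (\<rho> t) = N x t" unfolding \<theta>_def N_expansion[OF x st(2)] ..
    then show "\<theta> (\<psi> (SS.\<tau> s t)) = \<zero>\<^bsub>S\<^esub>"
      using st by (simp add: orbit_pure \<theta>_mult coaction_closed zero)
  qed
  obtain r where r: "r \<in> carrier S" "r \<noteq> \<zero>\<^bsub>S\<^esub>"
    "\<And>b. b \<in> carrier B \<Longrightarrow> \<exists>k::nat. \<exists>c\<in>carrier C. \<psi> c = SA.\<tau> (r [^]\<^bsub>S\<^esub> k) \<one>\<^bsub>A\<^esub> \<otimes>\<^bsub>B\<^esub> b"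
    using generic_denominators by metis
  \<comment> \<open>Multiplied by a power of \<open>r\<close>, the tensor
    \<open>1 \<otimes> a\<close> lies in the image of \<open>\<psi>\<close>, where
    \<open>\<theta>\<close> vanishes; and \<open>\<theta>\<close> takes \<open>1 \<otimes> a\<close>
    itself to the coefficient at \<open>a\<close>.\<close>
  have "coefficient a x = \<zero>\<^bsub>S\<^esub>" if a: "a \<in> E" for a
  proof -
    note aA = E_closed[OF a]
    have 1: "SA.\<tau> \<one>\<^bsub>S\<^esub> a \<in> carrier B" using aA by simp
    obtain k :: nat and c where kc: "c \<in> carrier C" "\<psi> c = SA.\<tau> (r [^]\<^bsub>S\<^esub> k) \<one>\<^bsub>A\<^esub> \<otimes>\<^bsub>B\<^esub> SA.\<tau> \<one>\<^bsub>S\<^esub> a"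
      using r(3)[OF 1] by blast
    have "\<theta> (SA.\<tau> \<one>\<^bsub>S\<^esub> a) = finsum S (\<lambda>b. e b a \<odot>\<^bsub>S\<^esub> coefficient b x) E"
      unfolding \<theta>_def
      by (rule S.finsum_cong'[OF refl])
         (use aA in \<open>simp_all add: cx e_closed ev_pure[OF e_functional] S.smult_assoc2'\<close>)
    also have "\<dots> = coefficient a x" by (rule coefficient_expansion[OF x aA, symmetric])
    finally have "r [^]\<^bsub>S\<^esub> k \<otimes>\<^bsub>S\<^esub> coefficient a x = r [^]\<^bsub>S\<^esub> k \<otimes>\<^bsub>S\<^esub> \<zero>\<^bsub>S\<^esub>"
      using \<theta>_mult[of "r [^]\<^bsub>S\<^esub> k", OF _ 1] kill[OF kc(1)] kc(2) r(1) by simp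
    then show ?thesis using cancel_power[OF r(1,2) cx[OF a]] by simp
  qed
  then have "finsum (tensor K S H) (\<lambda>b. SH.\<tau> (coefficient b x) (e b)) E = finsum (tensor K S H) (\<lambda>b. \<zero>\<^bsub>tensor K S H\<^esub>) E"
    by (intro SH.T.finsum_cong'[OF refl]) (use SH.pure_zero_left e_dual in \<open>simp_all add: dual_hopf_simps(1)\<close>)
  then show ?thesis using SH_expansion[OF x] by simp
qed

lemma N_inj: "inj_on N (carrier (tensor K S H))"
proof (rule inj_onI)
  interpret E: abelian_group End_S by (rule abelian_group_End_S)
  fix x y assume xy: "x \<in> carrier (tensor K S H)" "y \<in> carrier (tensor K S H)" "N x = N y"
  have d: "x \<ominus>\<^bsub>tensor K S H\<^esub> y \<in> carrier (tensor K S H)" using xy by simp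
  have "N (x \<ominus>\<^bsub>tensor K S H\<^esub> y) t = \<zero>\<^bsub>S\<^esub>" if t: "t \<in> carrier S" for t
    using additive_diff[OF SH.abelian_group_tensor S.M.abelian_group_axioms N_eval_additive[OF t] xy(1,2)] xy(3)
      End_S_D(1)[OF N_closed[OF xy(2)] t] by (simp add: S.M.r_neg S.minus_eq)
  from N_kernel[OF d this] have "\<ominus>\<^bsub>tensor K S H\<^esub> (\<ominus>\<^bsub>tensor K S H\<^esub> y) = x"
    using xy(1,2) by (intro SH.T.minus_equality) (simp_all add: SH.T.minus_eq)
  then show "x = y" using xy(2) by simp
qed

section \<open>Surjectivity\<close>

definition bilinear_extension :: "('s \<Rightarrow> 's) \<Rightarrow> ('s \<times> 's \<Rightarrow>\<^sub>0 int) set \<Rightarrow> 's" where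
  "bilinear_extension f = tensor_lift (add_monoid S) (\<lambda>s t. s \<otimes>\<^bsub>S\<^esub> f t)"

lemma bilinear_extension_balanced:
  assumes "f \<in> carrier End_S"
  shows "balanced R (regular S) (regular S) S (\<lambda>s t. s \<otimes>\<^bsub>S\<^esub> f t)"
proof (rule balancedI)
  note f = End_S_D[OF assms]
  show "s \<otimes>\<^bsub>S\<^esub> f t \<in> carrier S" if "s \<in> carrier (regular S)" "t \<in> carrier (regular S)" for s t
    using that f(1) by simp
  show "(s \<oplus>\<^bsub>regular S\<^esub> s') \<otimes>\<^bsub>S\<^esub> f t = s \<otimes>\<^bsub>S\<^esub> f t \<oplus>\<^bsub>S\<^esub> s' \<otimes>\<^bsub>S\<^esub> f t"
    if "s \<in> carrier (regular S)" "s' \<in> carrier (regular S)" "t \<in> carrier (regular S)" for s s' t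
    using that f(1) by (simp add: S.l_distr)
  show "s \<otimes>\<^bsub>S\<^esub> f (t \<oplus>\<^bsub>regular S\<^esub> t') = s \<otimes>\<^bsub>S\<^esub> f t \<oplus>\<^bsub>S\<^esub> s \<otimes>\<^bsub>S\<^esub> f t'"
    if "s \<in> carrier (regular S)" "t \<in> carrier (regular S)" "t' \<in> carrier (regular S)" for s t t'
    using that f(1,2) by (simp add: S.r_distr)
  show "(r \<odot>\<^bsub>regular S\<^esub> s) \<otimes>\<^bsub>S\<^esub> f t = s \<otimes>\<^bsub>S\<^esub> f (r \<odot>\<^bsub>regular S\<^esub> t)"
    if "r \<in> carrier R" "s \<in> carrier (regular S)" "t \<in> carrier (regular S)" for r s t
  proof -
    have c: "r \<in> carrier S" "s \<in> carrier S" "t \<in> carrier S" using that by auto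
    then show ?thesis using f(1)[OF c(3)] f(3)[OF that(1) c(3)] by (simp add: S.m_ac)
  qed
qed

lemmas bilinear_extension_additive =
  SS.lift_additive[OF S.M.abelian_group_axioms bilinear_extension_balanced, folded bilinear_extension_def]
lemmas bilinear_extension_closed = additive_closed[OF bilinear_extension_additive]

lemma bilinear_extension_pure:
  "f \<in> carrier End_S \<Longrightarrow> s \<in> carrier S \<Longrightarrow> t \<in> carrier S \<Longrightarrow> bilinear_extension f (SS.\<tau> s t) = s \<otimes>\<^bsub>S\<^esub> f t"
  using SS.lift_pure[OF S.M.abelian_group_axioms bilinear_extension_balanced, of f s t]
  by (simp add: bilinear_extension_def)

lemma bilinear_extension_mult:
  assumes f: "f \<in> carrier End_S" and s: "s \<in> carrier S" and z: "z \<in> carrier C"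
  shows "bilinear_extension f (SS.\<tau> s \<one>\<^bsub>S\<^esub> \<otimes>\<^bsub>C\<^esub> z) = s \<otimes>\<^bsub>S\<^esub> bilinear_extension f z"
proof (rule SS.additive_eqI[OF _ _ _ z])
  have mS: "additive S S (\<lambda>y. s \<otimes>\<^bsub>S\<^esub> y)" by (rule additiveI) (use s in \<open>simp_all add: S.r_distr\<close>)
  show "additive C S (\<lambda>z. bilinear_extension f (SS.\<tau> s \<one>\<^bsub>S\<^esub> \<otimes>\<^bsub>C\<^esub> z))"
    by (rule additive_comp[OF SS.mult_additive_right[OF SS_pure_closed[OF s S.one_closed]] bilinear_extension_additive[OF f]])
  show "additive C S (\<lambda>z. s \<otimes>\<^bsub>S\<^esub> bilinear_extension f z)"
    by (rule additive_comp[OF bilinear_extension_additive[OF f] mS])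
  fix s' t' assume "s' \<in> carrier (regular S)" "t' \<in> carrier (regular S)"
  then have c: "s' \<in> carrier S" "t' \<in> carrier S" by simp_all
  then show "bilinear_extension f (SS.\<tau> s \<one>\<^bsub>S\<^esub> \<otimes>\<^bsub>C\<^esub> SS.\<tau> s' t') = s \<otimes>\<^bsub>S\<^esub> bilinear_extension f (SS.\<tau> s' t')"
    using s End_S_D(1)[OF f c(2)] by (simp add: SS_mult_pure bilinear_extension_pure[OF f] S.m_assoc)
qed

text \<open>The kernel of \<^term>\<open>\<psi>\<close> is killed by a nonzero element of the domain \<^term>\<open>S\<close>.\<close>

lemma bilinear_extension_orbit_cong:
  assumes f: "f \<in> carrier End_S" and z: "z \<in> carrier C" "w \<in> carrier C" "\<psi> z = \<psi> w"
  shows "bilinear_extension f z = bilinear_extension f w"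
proof -
  note cl = bilinear_extension_closed[OF f]
  note ad = additive_diff[OF SS.abelian_group_tensor S.M.abelian_group_axioms bilinear_extension_additive[OF f] z(1,2)]
  have d: "z \<ominus>\<^bsub>C\<^esub> w \<in> carrier C" using z by simp
  have "\<psi> (z \<ominus>\<^bsub>C\<^esub> w) = \<psi> z \<ominus>\<^bsub>B\<^esub> \<psi> w"
    by (rule additive_diff[OF SS.abelian_group_tensor SA.abelian_group_tensor orbit_additive z(1,2)])
  then have "\<psi> (z \<ominus>\<^bsub>C\<^esub> w) = \<zero>\<^bsub>B\<^esub>"
    using z(3) additive_closed[OF orbit_additive z(2)] by (simp add: SA.T.minus_eq SA.T.r_neg)
  then obtain r and k :: nat where r: "r \<in> carrier S" "r \<noteq> \<zero>\<^bsub>S\<^esub>" "SS.\<tau> (r [^]\<^bsub>S\<^esub> k) \<one>\<^bsub>S\<^esub> \<otimes>\<^bsub>C\<^esub> (z \<ominus>\<^bsub>C\<^esub> w) = \<zero>\<^bsub>C\<^esub>"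
    using generic_denominators d by metis
  have "bilinear_extension f (SS.\<tau> (r [^]\<^bsub>S\<^esub> k) \<one>\<^bsub>S\<^esub> \<otimes>\<^bsub>C\<^esub> (z \<ominus>\<^bsub>C\<^esub> w)) = \<zero>\<^bsub>S\<^esub>"
    unfolding r(3) by (rule additive_zero[OF SS.abelian_group_tensor S.M.abelian_group_axioms bilinear_extension_additive[OF f]])
  then have "r [^]\<^bsub>S\<^esub> k \<otimes>\<^bsub>S\<^esub> bilinear_extension f (z \<ominus>\<^bsub>C\<^esub> w) = r [^]\<^bsub>S\<^esub> k \<otimes>\<^bsub>S\<^esub> \<zero>\<^bsub>S\<^esub>"
    using bilinear_extension_mult[OF f _ d, of "r [^]\<^bsub>S\<^esub> k"] r(1) by simp
  then have "bilinear_extension f z \<ominus>\<^bsub>S\<^esub> bilinear_extension f w = \<zero>\<^bsub>S\<^esub>"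
    using cancel_power[OF r(1,2) cl[OF d], of "\<zero>\<^bsub>S\<^esub>"] ad by simp
  then show ?thesis using cl z by simp
qed

text \<open>On the ideal of those \<open>f\<close> for which \<open>f \<otimes> b\<close> lies in the image of \<^term>\<open>\<psi>\<close>, an endomorphism
  induces a map \<open>m\<close> with \<open>f m(g) = g m(f)\<close>. No prime of height at most one contains this ideal, so \<open>m\<close> is
  the multiplication by an element.\<close>

lemma local_coefficient:
  assumes noetherian: "noetherian_domain S" and cic: "completely_integrally_closed S"
    and \<phi>: "\<phi> \<in> carrier End_S" and b: "b \<in> carrier A"
  obtains s where "s \<in> carrier S"
    "\<And>f c. f \<in> carrier S \<Longrightarrow> c \<in> carrier C \<Longrightarrow> \<psi> c = SA.\<tau> f b \<Longrightarrow> bilinear_extension \<phi> c = s \<otimes>\<^bsub>S\<^esub> f"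
proof -
  interpret ND: noetherian_domain S by (rule noetherian)
  define I where "I = {f \<in> carrier S. \<exists>c\<in>carrier C. \<psi> c = SA.\<tau> f b}"
  \<comment> \<open>The chosen preimage does not matter:
    \<open>bilinear_extension_orbit_cong\<close> makes the value depend on the image under
    \<open>\<psi>\<close> only.\<close>
  define m where "m f = bilinear_extension \<phi> (SOME c. c \<in> carrier C \<and> \<psi> c = SA.\<tau> f b)" for f
  have m: "m f = bilinear_extension \<phi> c" if c: "c \<in> carrier C" "\<psi> c = SA.\<tau> f b" for f c
  proof -
    have "(SOME c. c \<in> carrier C \<and> \<psi> c = SA.\<tau> f b) \<in> carrier C \<and> \<psi> (SOME c. c \<in> carrier C \<and> \<psi> c = SA.\<tau> f b) = SA.\<tau> f b"
      by (rule someI[of _ c]) (use c in simp)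
    then show ?thesis unfolding m_def using bilinear_extension_orbit_cong[OF \<phi> _ c(1)] c(2) by simp
  qed
  have scale: "SS.\<tau> g \<one>\<^bsub>S\<^esub> \<otimes>\<^bsub>C\<^esub> c \<in> carrier C" "\<psi> (SS.\<tau> g \<one>\<^bsub>S\<^esub> \<otimes>\<^bsub>C\<^esub> c) = SA.\<tau> (g \<otimes>\<^bsub>S\<^esub> f) b"
    if "g \<in> carrier S" "f \<in> carrier S" "c \<in> carrier C" "\<psi> c = SA.\<tau> f b" for g f c
    using that b SS_pure_closed[OF that(1) S.one_closed]
    by (simp_all add: orbit_mult orbit_pure_left SA.mult_pure)
  have I: "ideal I S"
  proof (rule S.cring_idealI)
    show "I \<subseteq> carrier S" by (auto simp: I_def)
    have "\<psi> \<zero>\<^bsub>C\<^esub> = \<zero>\<^bsub>B\<^esub>"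
      by (rule additive_zero[OF SS.abelian_group_tensor SA.abelian_group_tensor orbit_additive])
    then show "\<zero>\<^bsub>S\<^esub> \<in> I" using b unfolding I_def
      by (intro CollectI conjI bexI[of _ "\<zero>\<^bsub>C\<^esub>"]) (simp_all add: SA.pure_zero_left)
    show "f \<oplus>\<^bsub>S\<^esub> g \<in> I" if fg: "f \<in> I" "g \<in> I" for f g
    proof -
      obtain c d where h: "f \<in> carrier S" "g \<in> carrier S" "c \<in> carrier C" "d \<in> carrier C" "\<psi> c = SA.\<tau> f b" "\<psi> d = SA.\<tau> g b"
        using fg unfolding I_def by blast
      then show ?thesis using b unfolding I_def
        by (intro CollectI conjI bexI[of _ "c \<oplus>\<^bsub>C\<^esub> d"]) (simp_all add: SA.pure_add_left additive_add[OF orbit_additive])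
    qed
    show "g \<otimes>\<^bsub>S\<^esub> f \<in> I" if fg: "f \<in> I" "g \<in> carrier S" for f g
    proof -
      obtain c where h: "f \<in> carrier S" "c \<in> carrier C" "\<psi> c = SA.\<tau> f b" using fg unfolding I_def by blast
      from scale[OF fg(2) h] show ?thesis using fg(2) h(1) unfolding I_def by auto
    qed
  qed
  have power_mem: "r [^]\<^bsub>S\<^esub> k \<in> I"
    if "r \<in> carrier S" "c \<in> carrier C" "\<psi> c = SA.\<tau> (r [^]\<^bsub>S\<^esub> k) \<one>\<^bsub>A\<^esub> \<otimes>\<^bsub>B\<^esub> SA.\<tau> \<one>\<^bsub>S\<^esub> b" for r c and k :: nat
    using that b unfolding I_def by (auto simp: SA.mult_pure)
  have 1: "SA.\<tau> \<one>\<^bsub>S\<^esub> b \<in> carrier B" using b by simp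
  obtain r where r: "r \<in> carrier S" "r \<noteq> \<zero>\<^bsub>S\<^esub>"
    "\<And>b. b \<in> carrier B \<Longrightarrow> \<exists>k::nat. \<exists>c\<in>carrier C. \<psi> c = SA.\<tau> (r [^]\<^bsub>S\<^esub> k) \<one>\<^bsub>A\<^esub> \<otimes>\<^bsub>B\<^esub> b"
    using generic_denominators by metis
  obtain k :: nat and c where kc: "c \<in> carrier C" "\<psi> c = SA.\<tau> (r [^]\<^bsub>S\<^esub> k) \<one>\<^bsub>A\<^esub> \<otimes>\<^bsub>B\<^esub> SA.\<tau> \<one>\<^bsub>S\<^esub> b"
    using r(3)[OF 1] by blast
  have nz: "r [^]\<^bsub>S\<^esub> k \<noteq> \<zero>\<^bsub>S\<^esub>" using cancel_power[OF r(1,2) S.one_closed S.zero_closed, of k] r(1) D.one_not_zero by auto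
  \<comment> \<open>A prime outside \<open>Z\<close> cannot contain \<open>I\<close>: applied to
    \<open>1 \<otimes> b\<close>, the denominators at that prime put a power of an element outside
    it into \<open>I\<close>. So a prime containing \<open>I\<close> belongs to
    \<open>Z\<close>.\<close>
  have ht: "\<exists>c. primeideal c S \<and> c \<noteq> {\<zero>\<^bsub>S\<^esub>} \<and> c \<subset> P" if P: "primeideal P S" "I \<subseteq> P" for P
  proof (rule below, rule ccontr)
    assume "P \<notin> Z"
    then have "P \<in> Spec S - Z" using P(1) by (simp add: Spec_def)
    from denominators[OF this] obtain r where r: "r \<in> carrier S - P"
      "\<forall>b\<in>carrier B. \<exists>k::nat. \<exists>c\<in>carrier C. \<psi> c = SA.\<tau> (r [^]\<^bsub>S\<^esub> k) \<one>\<^bsub>A\<^esub> \<otimes>\<^bsub>B\<^esub> b" by blast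
    obtain k :: nat and c where kc: "c \<in> carrier C" "\<psi> c = SA.\<tau> (r [^]\<^bsub>S\<^esub> k) \<one>\<^bsub>A\<^esub> \<otimes>\<^bsub>B\<^esub> SA.\<tau> \<one>\<^bsub>S\<^esub> b"
      using bspec[OF r(2) 1] by blast
    have "r [^]\<^bsub>S\<^esub> k \<in> P" using power_mem[OF _ kc] r(1) P(2) by blast
    then show False using primeideal.pow_notin[OF P(1) r(1)] by blast
  qed
  have mc: "m f \<in> carrier S" if f: "f \<in> I" for f
  proof -
    obtain c where c: "c \<in> carrier C" "\<psi> c = SA.\<tau> f b" using f unfolding I_def by blast
    show ?thesis unfolding m[OF c] by (rule bilinear_extension_closed[OF \<phi> c(1)])
  qed
  have mm: "f \<otimes>\<^bsub>S\<^esub> m g = g \<otimes>\<^bsub>S\<^esub> m f" if fg: "f \<in> I" "g \<in> I" for f g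
  proof -
    obtain c d where h: "f \<in> carrier S" "g \<in> carrier S" "c \<in> carrier C" "d \<in> carrier C" "\<psi> c = SA.\<tau> f b" "\<psi> d = SA.\<tau> g b"
      using fg unfolding I_def by blast
    \<comment> \<open>The product of \<open>f\<close> with a preimage for \<open>g\<close> and the
      product of \<open>g\<close> with a preimage for \<open>f\<close> have the same image
      \<open>f g \<otimes> b\<close> under \<open>\<psi>\<close>.\<close>
    note s1 = scale[OF h(1,2,4,6)] and s2 = scale[OF h(2,1,3,5)]
    have "bilinear_extension \<phi> (SS.\<tau> f \<one>\<^bsub>S\<^esub> \<otimes>\<^bsub>C\<^esub> d) = bilinear_extension \<phi> (SS.\<tau> g \<one>\<^bsub>S\<^esub> \<otimes>\<^bsub>C\<^esub> c)"
      by (rule bilinear_extension_orbit_cong[OF \<phi> s1(1) s2(1)]) (simp add: s1(2) s2(2) S.m_comm h(1,2))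
    then show ?thesis using h m[OF h(3,5)] m[OF h(4,6)] by (simp add: bilinear_extension_mult[OF \<phi>])
  qed
  show ?thesis
  proof (rule ND.quotient_map_is_multiplication[OF cic I power_mem[OF r(1) kc] nz ht mc mm])
    fix s assume s: "s \<in> carrier S" "\<And>f. f \<in> I \<Longrightarrow> m f = s \<otimes>\<^bsub>S\<^esub> f"
    show thesis
    proof (rule that[OF s(1)])
      fix f c assume fc: "f \<in> carrier S" "c \<in> carrier C" "\<psi> c = SA.\<tau> f b"
      then have "f \<in> I" unfolding I_def by blast
      then show "bilinear_extension \<phi> c = s \<otimes>\<^bsub>S\<^esub> f" using s(2) m[OF fc(2,3)] by simp
    qed
  qed
qed

text \<open>For \<open>z = \<rho> t\<close> it says that the coaction of \<open>t\<close> is the sum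
  of the \<open>(e b \<cdot> t) \<otimes> b\<close>: the operators of the dual basis recover the
  coaction.\<close>

lemma SA_expansion:
  assumes z: "z \<in> carrier B"
  shows "z = finsum B (\<lambda>b. SA.\<tau> (ev (e b) z) b) E"
proof (rule SA.additive_eqI[OF additive_id _ _ z])
  have "additive B B (\<lambda>z. SA.\<tau> (ev (e b) z) b)" if b: "b \<in> E" for b
    by (rule additiveI)
       (simp_all add: ev_closed[OF e_functional[OF b]] E_closed[OF b] additive_add[OF ev_additive[OF e_functional[OF b]]]
          SA.pure_add_left)
  then show "additive B B (\<lambda>z. finsum B (\<lambda>b. SA.\<tau> (ev (e b) z) b) E)"
    by (rule additive_sum[OF SA.abelian_group_tensor finite_E])
  fix s a assume s: "s \<in> carrier S" and a: "a \<in> carrier A"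
  have ad: "additive A B (SA.\<tau> s)" by (rule additiveI) (simp_all add: s SA.pure_add_right)
  have "SA.\<tau> s a = SA.\<tau> s (finsum A (\<lambda>b. e b a \<odot>\<^bsub>A\<^esub> b) E)" using expansion[OF a] by simp
  also have "\<dots> = finsum B (\<lambda>b. SA.\<tau> s (e b a \<odot>\<^bsub>A\<^esub> b)) E"
    by (rule additive_finsum[OF A.M.abelian_group_axioms SA.abelian_group_tensor ad finite_E])
       (simp add: e_closed[OF _ a] E_closed)
  also have "\<dots> = finsum B (\<lambda>b. SA.\<tau> (ev (e b) (SA.\<tau> s a)) b) E"
    by (rule SA.T.finsum_cong'[OF refl])
       (simp_all add: ev_pure[OF e_functional s a] SA.pure_smult[symmetric] s e_closed[OF _ a] E_closed)
  finally show "SA.\<tau> s a = finsum B (\<lambda>b. SA.\<tau> (ev (e b) (SA.\<tau> s a)) b) E" .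
qed

text \<open>The candidate is the sum of the \<open>s b # e b\<close> with the elements
  \<open>s b\<close> of \<open>local_coefficient\<close>. Whether its operator takes
  \<open>t\<close> to \<open>\<phi> t\<close> can be tested after multiplication by a power of
  \<open>r\<close> large enough for all basis elements at once, and then both sides are values of
  \<open>bilinear_extension \<phi>\<close> at elements with the same image under
  \<open>\<psi>\<close>.\<close>

lemma N_surj:
  assumes noetherian: "noetherian_domain S" and cic: "completely_integrally_closed S" and \<phi>: "\<phi> \<in> carrier End_S"
  shows "\<exists>x\<in>carrier (tensor K S H). N x = \<phi>"
proof -
  have "\<exists>s. s \<in> carrier S \<and> (\<forall>f c. f \<in> carrier S \<longrightarrow> c \<in> carrier C \<longrightarrow> \<psi> c = SA.\<tau> f b \<longrightarrow> bilinear_extension \<phi> c = s \<otimes>\<^bsub>S\<^esub> f)"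
    if "b \<in> E" for b
    using local_coefficient[OF noetherian cic \<phi> E_closed[OF that]] by metis
  then obtain s where s: "\<And>b. b \<in> E \<Longrightarrow> s b \<in> carrier S"
    "\<And>b f c. b \<in> E \<Longrightarrow> f \<in> carrier S \<Longrightarrow> c \<in> carrier C \<Longrightarrow> \<psi> c = SA.\<tau> f b \<Longrightarrow> bilinear_extension \<phi> c = s b \<otimes>\<^bsub>S\<^esub> f"
    by metis
  define x where "x = finsum (tensor K S H) (\<lambda>b. SH.\<tau> (s b) (e b)) E"
  have xc: "SH.\<tau> (s b) (e b) \<in> carrier (tensor K S H)" if "b \<in> E" for b
    by (rule SH_pure_closed[OF s(1)[OF that] e_dual[OF that]])
  have x: "x \<in> carrier (tensor K S H)" unfolding x_def by (rule SH.T.finsum_closed) (use xc in simp)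
  obtain r where r: "r \<in> carrier S" "r \<noteq> \<zero>\<^bsub>S\<^esub>"
    "\<And>b. b \<in> carrier B \<Longrightarrow> \<exists>k::nat. \<exists>c\<in>carrier C. \<psi> c = SA.\<tau> (r [^]\<^bsub>S\<^esub> k) \<one>\<^bsub>A\<^esub> \<otimes>\<^bsub>B\<^esub> b"
    using generic_denominators by metis
  have "\<exists>k::nat. \<exists>c\<in>carrier C. \<psi> c = SA.\<tau> (r [^]\<^bsub>S\<^esub> k) b" if b: "b \<in> E" for b
    using r(3)[of "SA.\<tau> \<one>\<^bsub>S\<^esub> b"] r(1) E_closed[OF b] by (simp add: SA.mult_pure)
  then obtain k :: "'a \<Rightarrow> nat" and c where kc: "\<And>b. b \<in> E \<Longrightarrow> c b \<in> carrier C" "\<And>b. b \<in> E \<Longrightarrow> \<psi> (c b) = SA.\<tau> (r [^]\<^bsub>S\<^esub> k b) b"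
    by metis
  \<comment> \<open>The sum is a common bound for the exponents \<open>k b\<close>, also when
    \<open>E\<close> is empty.\<close>
  define M where "M = (\<Sum>b\<in>E. k b)"
  have rM: "r [^]\<^bsub>S\<^esub> M \<in> carrier S" using r(1) by simp
  define c' where "c' b = SS.\<tau> (r [^]\<^bsub>S\<^esub> (M - k b)) \<one>\<^bsub>S\<^esub> \<otimes>\<^bsub>C\<^esub> c b" for b
  have c': "c' b \<in> carrier C" "\<psi> (c' b) = SA.\<tau> (r [^]\<^bsub>S\<^esub> M) b" if b: "b \<in> E" for b
  proof -
    have p: "r [^]\<^bsub>S\<^esub> (M - k b) \<in> carrier S" "r [^]\<^bsub>S\<^esub> k b \<in> carrier S" using r(1) by simp_all
    have "k b \<le> M" unfolding M_def by (rule member_le_sum) (use b finite_E in simp_all)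
    then have "r [^]\<^bsub>S\<^esub> (M - k b) \<otimes>\<^bsub>S\<^esub> r [^]\<^bsub>S\<^esub> k b = r [^]\<^bsub>S\<^esub> M" using r(1) by (simp add: S.nat_pow_mult)
    then show "c' b \<in> carrier C" "\<psi> (c' b) = SA.\<tau> (r [^]\<^bsub>S\<^esub> M) b"
      unfolding c'_def using p kc[OF b] E_closed[OF b] SS_pure_closed[OF p(1) S.one_closed]
      by (simp_all add: orbit_mult orbit_pure_left SA.mult_pure)
  qed
  have "N x t = \<phi> t" if t: "t \<in> carrier S" for t
  proof -
    let ?a = "\<lambda>b. act (e b) t"
    have a: "?a b \<in> carrier S" if "b \<in> E" for b by (rule act_closed[OF e_functional[OF that] t])
    \<comment> \<open>By \<open>SA_expansion\<close> the sum of the \<open>?w b\<close> is mapped to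
      the power of \<open>r\<close> times \<open>\<rho> t\<close>. The pure tensor of that power
      with \<open>t\<close> has the same image, so \<open>bilinear_extension \<phi>\<close> does not
      distinguish the two.\<close>
    let ?w = "\<lambda>b. SS.\<tau> (?a b) \<one>\<^bsub>S\<^esub> \<otimes>\<^bsub>C\<^esub> c' b"
    have w: "?w b \<in> carrier C" "\<psi> (?w b) = SA.\<tau> (r [^]\<^bsub>S\<^esub> M) \<one>\<^bsub>A\<^esub> \<otimes>\<^bsub>B\<^esub> SA.\<tau> (?a b) b" if b: "b \<in> E" for b
      using c'[OF b] a[OF b] SS_pure_closed[OF a[OF b] S.one_closed] E_closed[OF b] rM
      by (simp_all add: orbit_mult orbit_pure_left SA.mult_pure S.m_comm)
    have wc: "finsum C ?w E \<in> carrier C" by (rule SS.T.finsum_closed) (use w in simp)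
    have zc: "SS.\<tau> (r [^]\<^bsub>S\<^esub> M) t \<in> carrier C" by (rule SS_pure_closed[OF rM t])
    have "\<psi> (finsum C ?w E) = finsum B (\<lambda>b. \<psi> (?w b)) E"
      by (rule additive_finsum[OF SS.abelian_group_tensor SA.abelian_group_tensor orbit_additive finite_E w(1)])
    also have "\<dots> = finsum B (\<lambda>b. SA.\<tau> (r [^]\<^bsub>S\<^esub> M) \<one>\<^bsub>A\<^esub> \<otimes>\<^bsub>B\<^esub> SA.\<tau> (?a b) b) E"
      by (rule SA.T.finsum_cong'[OF refl]) (use w(2) rM a E_closed in simp_all)
    also have "\<dots> = SA.\<tau> (r [^]\<^bsub>S\<^esub> M) \<one>\<^bsub>A\<^esub> \<otimes>\<^bsub>B\<^esub> finsum B (\<lambda>b. SA.\<tau> (?a b) b) E"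
      by (rule SA.T.finsum_rdistr[symmetric, OF finite_E]) (use rM a E_closed in simp_all)
    also have "finsum B (\<lambda>b. SA.\<tau> (?a b) b) E = \<rho> t"
      by (rule SA_expansion[OF coaction_closed[OF t], symmetric])
    also have "SA.\<tau> (r [^]\<^bsub>S\<^esub> M) \<one>\<^bsub>A\<^esub> \<otimes>\<^bsub>B\<^esub> \<rho> t = \<psi> (SS.\<tau> (r [^]\<^bsub>S\<^esub> M) t)" by (rule orbit_pure[OF rM t, symmetric])
    finally have "bilinear_extension \<phi> (finsum C ?w E) = bilinear_extension \<phi> (SS.\<tau> (r [^]\<^bsub>S\<^esub> M) t)"
      by (rule bilinear_extension_orbit_cong[OF \<phi> wc zc])
    also have "\<dots> = r [^]\<^bsub>S\<^esub> M \<otimes>\<^bsub>S\<^esub> \<phi> t" by (rule bilinear_extension_pure[OF \<phi> rM t])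
    finally have 1: "bilinear_extension \<phi> (finsum C ?w E) = r [^]\<^bsub>S\<^esub> M \<otimes>\<^bsub>S\<^esub> \<phi> t" .
    have "bilinear_extension \<phi> (finsum C ?w E) = finsum S (\<lambda>b. bilinear_extension \<phi> (?w b)) E"
      by (rule additive_finsum[OF SS.abelian_group_tensor S.M.abelian_group_axioms bilinear_extension_additive[OF \<phi>] finite_E w(1)])
    also have "\<dots> = finsum S (\<lambda>b. r [^]\<^bsub>S\<^esub> M \<otimes>\<^bsub>S\<^esub> (s b \<otimes>\<^bsub>S\<^esub> ?a b)) E"
    proof (rule S.finsum_cong'[OF refl])
      show "(\<lambda>b. r [^]\<^bsub>S\<^esub> M \<otimes>\<^bsub>S\<^esub> (s b \<otimes>\<^bsub>S\<^esub> ?a b)) \<in> E \<rightarrow> carrier S" using rM s(1) a by simp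
      show "bilinear_extension \<phi> (?w b) = r [^]\<^bsub>S\<^esub> M \<otimes>\<^bsub>S\<^esub> (s b \<otimes>\<^bsub>S\<^esub> ?a b)" if b: "b \<in> E" for b
        using rM s(1)[OF b] a[OF b] s(2)[OF b rM c'[OF b]]
        by (simp add: bilinear_extension_mult[OF \<phi> a[OF b] c'(1)[OF b]] S.m_ac)
    qed
    also have "\<dots> = r [^]\<^bsub>S\<^esub> M \<otimes>\<^bsub>S\<^esub> finsum S (\<lambda>b. s b \<otimes>\<^bsub>S\<^esub> ?a b) E"
      by (rule S.finsum_rdistr[symmetric, OF finite_E rM]) (use s(1) a in simp)
    also have "finsum S (\<lambda>b. s b \<otimes>\<^bsub>S\<^esub> ?a b) E = N x t"
    proof -
      have "N x t = finsum S (\<lambda>b. N (SH.\<tau> (s b) (e b)) t) E"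
        unfolding x_def
        by (rule additive_finsum[OF SH.abelian_group_tensor S.M.abelian_group_axioms N_eval_additive[OF t] finite_E xc])
      also have "\<dots> = finsum S (\<lambda>b. s b \<otimes>\<^bsub>S\<^esub> ?a b) E"
        by (rule S.finsum_cong'[OF refl]) (use s(1) a t in \<open>simp_all add: N_pure e_dual\<close>)
      finally show ?thesis by simp
    qed
    finally have "r [^]\<^bsub>S\<^esub> M \<otimes>\<^bsub>S\<^esub> N x t = r [^]\<^bsub>S\<^esub> M \<otimes>\<^bsub>S\<^esub> \<phi> t" using 1 by simp
    then show ?thesis
      by (rule cancel_power[OF r(1,2) End_S_D(1)[OF N_closed[OF x] t] End_S_D(1)[OF \<phi> t]])
  qed
  then have "N x = \<phi>" by (rule extensionalityI[OF End_S_D(4)[OF N_closed[OF x]] End_S_D(4)[OF \<phi>]])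
  then show ?thesis using x by blast
qed

lemma N_bijective:
  assumes "noetherian_domain S" "completely_integrally_closed S"
  shows "bij_betw N (carrier Q) (carrier End_S)"
  unfolding bij_betw_def skew_simps(1)
  using N_inj N_closed N_surj[OF assms] by blast

end

text \<open>In a chain of three primes ending at \<open>P\<close> the middle one is strictly below
  \<open>P\<close>, and it is nonzero because it strictly contains a prime, which has the element
  zero. Without such a prime every chain has length at most one.\<close>

lemma height_at_least_two:
  assumes "2 \<le> height S P"
  shows "\<exists>c. primeideal c S \<and> c \<noteq> {\<zero>\<^bsub>S\<^esub>} \<and> c \<subset> P"
proof (rule ccontr)
  assume no: "\<not> ?thesis"
  have "enat m \<le> 1" if c: "\<forall>i\<le>m. c i \<in> Spec S" "\<forall>i<m. c i \<subset> c (Suc i)" "c m = P" for m and c :: "nat \<Rightarrow> 'a set"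
  proof (rule ccontr)
    assume "\<not> enat m \<le> 1"
    then have "2 \<le> m" by (simp add: one_enat_def)
    then obtain l where m: "m = Suc (Suc l)" by (metis add_2_eq_Suc le_Suc_ex)
    have pr: "primeideal (c l) S" "primeideal (c (Suc l)) S" and sub: "c l \<subset> c (Suc l)" "c (Suc l) \<subset> P"
      using c m by (auto simp: Spec_def)
    have "\<zero>\<^bsub>S\<^esub> \<in> c l"
      using pr(1) by (simp add: primeideal.axioms(1) ideal.axioms(1) additive_subgroup.zero_closed)
    then have "c (Suc l) \<noteq> {\<zero>\<^bsub>S\<^esub>}" using sub(1) by auto
    then show False using no pr(2) sub(2) by blast
  qed
  then have "height S P \<le> 1" unfolding height_def by (auto intro!: Sup_least)
  then have "(2::enat) \<le> 1" using assms by (rule order_trans[rotated])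
  then show False by (simp add: numeral_eq_enat one_enat_def)
qed

theorem theorem1p5:
  fixes K :: "'k ring" and A :: "('k, 'a) hopf" and S :: "('k, (nat \<Rightarrow> nat) \<Rightarrow> 'k) module"
    and \<rho> :: "((nat \<Rightarrow> nat) \<Rightarrow> 'k) \<Rightarrow> (((nat \<Rightarrow> nat) \<Rightarrow> 'k) \<times> 'a \<Rightarrow>\<^sub>0 int) set"
    and R :: "((nat \<Rightarrow> nat) \<Rightarrow> 'k) ring" and p n :: nat
  assumes "algebraically_closed K"
    and "Factorial_Ring.prime p" and "[p] \<cdot>\<^bsub>K\<^esub> \<one>\<^bsub>K\<^esub> = \<zero>\<^bsub>K\<^esub>"
    and "S = power_series K n"
    and "finite_group_scheme K A"
    and "group_scheme_action K A S \<rho>"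
    and "free_in_codimension_one K A S \<rho>"
    and "R = invariants K A S \<rho>"
  shows "assoc_algebra R (skew_group_scheme_ring K A S \<rho>) \<and>
         assoc_algebra R (End_algebra R (regular S)) \<and>
         natural_hom K A S \<rho>
           \<in> algebra_isos R (skew_group_scheme_ring K A S \<rho>) (End_algebra R (regular S))"
proof -
  interpret G: action K A S \<rho> by (rule action.intro) fact
  have K: "field K" using assms(1) by (simp add: algebraically_closed_def)
  obtain rk :: "(nat \<Rightarrow> nat) \<Rightarrow> nat" where rk: "inj_on rk (exponents n)"
    "\<And>\<alpha> \<beta> \<gamma>. \<alpha> \<in> exponents n \<Longrightarrow> \<beta> \<in> exponents n \<Longrightarrow> \<gamma> \<in> exponents n \<Longrightarrow> rk \<alpha> < rk \<beta> \<Longrightarrow>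
       rk (\<lambda>i. \<alpha> i + \<gamma> i) < rk (\<lambda>i. \<beta> i + \<gamma> i)"
    using exponent_ranking[of n] by metis
  have ps: "power_series_ring K n rk"
    by (intro power_series_ring.intro power_series_ring_axioms.intro K) (use G.S.is_cring assms(4) rk in auto)
  have dom: "domain S" and noeth: "noetherian_domain S" and cic: "completely_integrally_closed S"
    using power_series_ring.domain_S[OF ps] power_series_ring.noetherian_S[OF ps] power_series_ring.cic_S[OF ps]
    by (auto simp: assms(4) noetherian_domain_def)
  obtain E e where E: "finite E" "E \<subseteq> carrier A" "\<And>b. b \<in> E \<Longrightarrow> e b \<in> linear_maps K A (regular K)"
    "\<And>a. a \<in> carrier A \<Longrightarrow> a = finsum A (\<lambda>b. e b a \<odot>\<^bsub>A\<^esub> b) E"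
    using dual_basis_exists[OF K G.A.module G.finite_dim] by blast
  \<comment> \<open>Elements of the dual algebra are extensional, so the coordinate functions are
    cut off outside \<open>A\<close>.\<close>
  define e' where "e' b = restrict (e b) (carrier A)" for b
  have e': "finsum A (\<lambda>b. e' b a \<odot>\<^bsub>A\<^esub> b) E = finsum A (\<lambda>b. e b a \<odot>\<^bsub>A\<^esub> b) E" if "a \<in> carrier A" for a
    using that by (simp add: e'_def)
  have dual: "dual_action K A S \<rho> E e'"
    by (intro dual_action.intro dual_action_axioms.intro G.action_axioms E(1,2))
       (use E(3,4) e' G.dual_restrict in \<open>auto simp: e'_def\<close>)
  obtain Z where Z: "closedin (zariski S) Z" "2 \<le> codimension S Z"
    and stable: "\<forall>Q\<in>{Q \<in> Spec (tensor K S A). Spec_map S (\<lambda>s. pure_tensor K S A s \<one>\<^bsub>A\<^esub>) Q \<in> Spec S - Z}. Spec_map S \<rho> Q \<in> Spec S - Z"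
    and iso: "restricts_to_iso G.C G.B G.\<psi> {Q \<in> Spec G.B. Spec_map S (\<lambda>s. G.SA.\<tau> s \<one>\<^bsub>A\<^esub>) Q \<in> Spec S - Z}
        {Q \<in> Spec G.C. Spec_map S (\<lambda>s. G.SS.\<tau> s \<one>\<^bsub>S\<^esub>) Q \<in> Spec S - Z \<and> Spec_map S (\<lambda>s. G.SS.\<tau> \<one>\<^bsub>S\<^esub> s) Q \<in> Spec S - Z \<and>
           Spec_map G.R (\<lambda>r. G.SS.\<tau> r \<one>\<^bsub>S\<^esub>) Q \<in> Spec G.R - Spec_map G.R (\<lambda>r. r) ` Z}"
    using assms(7) unfolding free_in_codimension_one_def Let_def by blast
  have stable': "Spec_map S \<rho> Q \<in> Spec S - Z"
    if "Q \<in> Spec G.B" "Spec_map S (\<lambda>s. G.SA.\<tau> s \<one>\<^bsub>A\<^esub>) Q \<in> Spec S - Z" for Q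
    using stable that by blast
  \<comment> \<open>The codimension is the infimum of the heights over \<open>Z\<close>, so each
    prime of \<open>Z\<close> has height at least two on its own.\<close>
  have below: "\<exists>c. primeideal c S \<and> c \<noteq> {\<zero>\<^bsub>S\<^esub>} \<and> c \<subset> P" if "P \<in> Z" for P
    using Z(2) that by (intro height_at_least_two) (auto simp: codimension_def le_INF_iff)
  have p: "0 < p" using assms(2) by (rule prime_gt_0_nat)
  have "generically_free_action K A S \<rho> E e' Z"
  proof (intro generically_free_action.intro generically_free_action_axioms.intro dual dom below)
    fix P assume P: "P \<in> Spec S - Z"
    show "\<exists>r\<in>carrier S - P.
      (\<forall>b\<in>carrier G.B. \<exists>k::nat. \<exists>c\<in>carrier G.C. G.\<psi> c = G.SA.\<tau> (r [^]\<^bsub>S\<^esub> k) \<one>\<^bsub>A\<^esub> \<otimes>\<^bsub>G.B\<^esub> b) \<and>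
      (\<forall>z\<in>carrier G.C. G.\<psi> z = \<zero>\<^bsub>G.B\<^esub> \<longrightarrow> (\<exists>k::nat. G.SS.\<tau> (r [^]\<^bsub>S\<^esub> k) \<one>\<^bsub>S\<^esub> \<otimes>\<^bsub>G.C\<^esub> z = \<zero>\<^bsub>G.C\<^esub>))"
    proof (rule G.basic_open_over_invariant[OF assms(1) p assms(3) Z(1) stable' iso P])
      fix r assume r: "r \<in> carrier S" "r \<notin> P"
        "\<And>b. b \<in> carrier G.B \<Longrightarrow> \<exists>k::nat. \<exists>c\<in>carrier G.C. G.\<psi> c = G.SA.\<tau> (r [^]\<^bsub>S\<^esub> k) \<one>\<^bsub>A\<^esub> \<otimes>\<^bsub>G.B\<^esub> b"
        "\<And>z. z \<in> carrier G.C \<Longrightarrow> G.\<psi> z = \<zero>\<^bsub>G.B\<^esub> \<Longrightarrow> \<exists>k::nat. G.SS.\<tau> (r [^]\<^bsub>S\<^esub> k) \<one>\<^bsub>S\<^esub> \<otimes>\<^bsub>G.C\<^esub> z = \<zero>\<^bsub>G.C\<^esub>"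
      show ?thesis
        by (rule bexI[of _ r]; (intro conjI ballI impI)?) (erule r(3), erule (1) r(4), use r(1,2) in blast)
    qed
  qed
  then have "bij_betw G.N (carrier G.Q) (carrier G.End_S)"
    by (rule generically_free_action.N_bijective[OF _ noeth cic])
  then show ?thesis
    unfolding assms(8) by (rule dual_action.skew_algebra_if_bijective[OF dual])
qed

end
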